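(* Suppose $p=p(n)$ with $p/n\to\gamma\in(0,\infty)$ as $n\to\infty$. For each $n$, let $\mathbf{X}_1,\dots,\mathbf{X}_n$ be independent copies of a random vector $(X_1,\dots,X_p)^\top$ whose components are mutually independent with continuous distribution functions, and let $\Phi_n=\frac12(\Xi_n+\Xi_n^\top)$, where $\Xi_n$ is the $p\times p$ Chatterjee rank correlation matrix of the sample. Then, almost surely, the empirical spectral distribution $F^{\Phi_n}$ converges weakly to the semicircle law $\mathrm{W}(1,2\sqrt{\gamma/5})$.
   Context: Chatterjee's rank correlation matrix. $[n]=\{1,\dots,n\}$. The data are $X_{ij}$, $i\in[n]$, $j\in[p]$, with $\mathbf{X}_i=(X_{i1},\dots,X_{ip})^\top$; no moment assumptions are made and the components need not be identically distributed; the data for all $n$ live on a common probability space. For $j\in[p]$ let $R_j(k)=\sum_{i=1}^n \mathbf{1}(X_{ij}\le X_{kj})$, $k\in[n]$; almost surely there are no ties and $R_j$ is a permutation of $[n]$. For $i\ne j$ set $$\Xi^{(n)}_{ij}=1-\frac{3}{n^2-1}\sum_{k=1}^{n-1}\bigl|(R_j\circ R_i^{-1})(k+1)-(R_j\circ R_i^{-1})(k)\bigr|,$$ and $\Xi^{(n)}_{ii}=1$; $\Xi_n=(\Xi_{ij}^{(n)})_{i,j\in[p]}$ (in general not symmetric). For a real symmetric $p\times p$ matrix $A$ with eigenvalues $\lambda_1(A)\ge\dots\ge\lambda_p(A)$, $F^A=\frac1p\sum_{i=1}^p\delta_{\lambda_i(A)}$. The semicircle law $\mathrm{W}(u,r)$,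 with center $u\in\mathbb{R}$ and radius $r>0$, is the probability measure with density $\frac{2}{\pi r^2}\sqrt{r^2-(x-u)^2}\,\mathbf{1}(x\in[u-r,u+r])$. *)

theory Defs
  imports "HOL-Probability.Probability" "Jordan_Normal_Form.Char_Poly"
    "Jordan_Normal_Form.Conjugate"
begin

text \<open>
  A sample of size \<open>n\<close> in dimension \<open>p\<close> is a function \<open>x\<close>, where \<open>x i j\<close> with
  \<open>i \<in> {1..n}\<close> and \<open>j \<in> {1..p}\<close> is the \<open>j\<close>-th component of the \<open>i\<close>-th observation.
\<close>

definition sample_rank :: "nat \<Rightarrow> (nat \<Rightarrow> nat \<Rightarrow> real) \<Rightarrow> nat \<Rightarrow> nat \<Rightarrow> nat" where
  "sample_rank n x j k = (\<Sum>i=1..n. if x i j \<le> x k j then 1 else 0)"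

text \<open>
  In the absence of ties in component \<open>i\<close>, \<open>sample_rank n x i\<close> is a permutation of \<open>{1..n}\<close>
  and \<open>inv_into {1..n} (sample_rank n x i)\<close> is its inverse. With ties the value below carries
  no meaning; under continuous marginals this happens with probability zero.
\<close>

definition chatterjee_xi :: "nat \<Rightarrow> (nat \<Rightarrow> nat \<Rightarrow> real) \<Rightarrow> nat \<Rightarrow> nat \<Rightarrow> real" where
  "chatterjee_xi n x i j =
    (if i = j then 1
     else let \<sigma> = sample_rank n x j \<circ> inv_into {1..n} (sample_rank n x i)
          in 1 - 3 / ((real n)\<^sup>2 - 1) * (\<Sum>k=1..n-1. \<bar>real (\<sigma> (k + 1)) - real (\<sigma> k)\<bar>))"

text \<open>
  The entries of a matrix are numbered from \<open>0\<close>, those of a sample from \<open>1\<close>.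
\<close>

definition chatterjee_matrix :: "nat \<Rightarrow> nat \<Rightarrow> (nat \<Rightarrow> nat \<Rightarrow> real) \<Rightarrow> real mat" where
  "chatterjee_matrix n p x = mat p p (\<lambda>(i, j). chatterjee_xi n x (i + 1) (j + 1))"

definition sym_chatterjee_matrix :: "nat \<Rightarrow> nat \<Rightarrow> (nat \<Rightarrow> nat \<Rightarrow> real) \<Rightarrow> real mat" where
  "sym_chatterjee_matrix n p x =
    (1 / 2) \<cdot>\<^sub>m (chatterjee_matrix n p x + transpose_mat (chatterjee_matrix n p x))"

text \<open>
  The eigenvalues of a real symmetric matrix in decreasing order, repeated according to their
  multiplicity as roots of the characteristic polynomial; \<open>eigenvalue_desc A i\<close> is
  \<open>\<lambda>\<^sub>i(A)\<close> for \<open>1 \<le> i \<le> dim_row A\<close>. Lemma \<open>length_eigenvalues_desc\<close> shows that there are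
  \<open>dim_row A\<close> of them.
\<close>

definition eigenvalues_desc :: "real mat \<Rightarrow> real list" where
  "eigenvalues_desc A = rev (sorted_list_of_multiset (proots (char_poly A)))"

definition eigenvalue_desc :: "real mat \<Rightarrow> nat \<Rightarrow> real" where
  "eigenvalue_desc A i = eigenvalues_desc A ! (i - 1)"

text \<open>
  The average of the point masses at the eigenvalues, as the image of the uniform distribution
  on \<open>{1..p}\<close>; see lemma \<open>emeasure_esd\<close>.
\<close>

definition esd :: "real mat \<Rightarrow> real measure" where
  "esd A = distr (uniform_count_measure {1..dim_row A}) borel (eigenvalue_desc A)"

definition semicircle :: "real \<Rightarrow> real \<Rightarrow> real measure" where
  "semicircle u r = density lborel
    (\<lambda>x. ennreal (2 / (pi * r\<^sup>2) * sqrt (r\<^sup>2 - (x - u)\<^sup>2) * indicator {u - r..u + r} x))"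

lemma emeasure_esd:
  assumes "S \<in> sets borel" "dim_row A > 0"
  shows "emeasure (esd A) S =
    ennreal (1 / real (dim_row A)) *
      (\<Sum>i=1..dim_row A. emeasure (return borel (eigenvalue_desc A i)) S)"
proof -
  let ?p = "dim_row A"
  let ?B = "eigenvalue_desc A -` S \<inter> {1..?p}"
  have "emeasure (esd A) S = emeasure (uniform_count_measure {1..?p}) ?B"
    unfolding esd_def using assms(1)
    by (subst emeasure_distr)
      (auto simp: space_uniform_count_measure measurable_def sets_uniform_count_measure)
  also have "\<dots> = ennreal (1 / real ?p) * ennreal (real (card ?B))"
    by (simp add: emeasure_uniform_count_measure ennreal_mult[symmetric])
  also have "ennreal (real (card ?B)) = (\<Sum>i=1..?p. emeasure (return borel (eigenvalue_desc A i)) S)"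
  proof -
    have "(\<Sum>i=1..?p. emeasure (return borel (eigenvalue_desc A i)) S) = (\<Sum>i=1..?p. indicator ?B i)"
      using assms(1) by (intro sum.cong) (auto simp: indicator_def)
    also have "\<dots> = of_nat (card ?B)"
      by (simp add: sum.If_cases indicator_def vimage_def Int_commute)
    finally show ?thesis by (simp add: ennreal_of_nat_eq_real_of_nat)
  qed
  finally show ?thesis .
qed

lemma real_eigenvalues_of_symmetric:
  fixes A :: "real mat"
  assumes A: "A \<in> carrier_mat n n" and sym: "transpose_mat A = A"
    and ev: "eigenvalue (map_mat complex_of_real A) z"
  shows "z \<in> \<real>"
proof -
  let ?A = "map_mat complex_of_real A"
  have cA: "?A \<in> carrier_mat n n" using A by simp
  obtain v where v: "v \<in> carrier_vec n" "v \<noteq> 0\<^sub>v n" "?A *\<^sub>v v = z \<cdot>\<^sub>v v"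
    using ev cA unfolding eigenvalue_def eigenvector_def by auto
  have Aij: "A $$ (j, i) = A $$ (i, j)" if "i < n" "j < n" for i j
    using that A arg_cong[OF sym, of "\<lambda>M. M $$ (i, j)"] by auto
  have row: "(\<Sum>j<n. of_real (A $$ (i, j)) * v $ j) = z * v $ i" if "i < n" for i
    using that arg_cong[OF v(3), of "\<lambda>w. w $ i"] v(1) A
    by (simp add: scalar_prod_def atLeast0LessThan)
  define q where "q = (\<Sum>i<n. \<Sum>j<n. of_real (A $$ (i, j)) * (cnj (v $ i) * v $ j))"
  define s where "s = (\<Sum>i<n. (cmod (v $ i))\<^sup>2)"
  have q1: "q = z * of_real s"
  proof -
    have "q = (\<Sum>i<n. cnj (v $ i) * (\<Sum>j<n. of_real (A $$ (i, j)) * v $ j))"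
      by (simp add: q_def sum_distrib_left algebra_simps)
    also have "\<dots> = (\<Sum>i<n. z * of_real ((cmod (v $ i))\<^sup>2))"
    proof (intro sum.cong refl)
      fix i assume "i \<in> {..<n}"
      then have "cnj (v $ i) * (\<Sum>j<n. of_real (A $$ (i, j)) * v $ j) = z * (v $ i * cnj (v $ i))"
        by (simp add: row)
      then show "cnj (v $ i) * (\<Sum>j<n. of_real (A $$ (i, j)) * v $ j) = z * of_real ((cmod (v $ i))\<^sup>2)"
        by (simp only: complex_norm_square)
    qed
    finally show ?thesis by (simp add: s_def sum_distrib_left)
  qed
  have "cnj q = (\<Sum>i<n. \<Sum>j<n. of_real (A $$ (j, i)) * (cnj (v $ j) * v $ i))"
    unfolding q_def by (auto simp: Aij algebra_simps intro!: sum.cong)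
  also have "\<dots> = q" unfolding q_def by (rule sum.swap)
  finally have "cnj z * of_real s = z * of_real s" using q1 by simp
  moreover have "s \<noteq> 0"
  proof
    assume "s = 0"
    then have "\<forall>i<n. v $ i = 0" unfolding s_def by (subst (asm) sum_nonneg_eq_0_iff) auto
    then have "v = 0\<^sub>v n" using v(1) by (intro eq_vecI) auto
    with v(2) show False by simp
  qed
  ultimately show ?thesis by (simp add: complex_eq_iff complex_is_Real_iff)
qed

lemma length_eigenvalues_desc:
  assumes A: "A \<in> carrier_mat n n" and sym: "transpose_mat A = A"
  shows "length (eigenvalues_desc A) = n"
proof -
  let ?A = "map_mat complex_of_real A"
  have cA: "?A \<in> carrier_mat n n" using A by simp
  obtain as where as: "char_poly ?A = (\<Prod>a\<leftarrow>as. [:- a, 1:])" "length as = n"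
    using char_poly_factorized[OF cA] by auto
  have re: "complex_of_real (Re a) = a" if "a \<in> set as" for a
  proof -
    have "poly (char_poly ?A) a = 0"
      using that unfolding as(1) by (auto simp: poly_prod_list prod_list_zero_iff)
    then have "a \<in> \<real>"
      using real_eigenvalues_of_symmetric[OF A sym] eigenvalue_root_char_poly[OF cA] by auto
    then show ?thesis by (simp add: of_real_Re)
  qed
  interpret h: map_poly_inj_idom_hom complex_of_real ..
  have "map_poly complex_of_real (char_poly A) = (\<Prod>a\<leftarrow>as. [:- a, 1:])"
    using as(1) of_real_hom.char_poly_hom[OF A, where ?'a = complex] by simp
  also have "\<dots> = (\<Prod>a\<leftarrow>map Re as. map_poly complex_of_real [:- a, 1:])"
    using re by (intro arg_cong[where f = prod_list]) (auto simp: o_def)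
  also have "\<dots> = map_poly complex_of_real (\<Prod>a\<leftarrow>map Re as. [:- a, 1:])"
    by (induction as) (simp_all add: h.hom_mult del: map_poly_pCons mult_pCons_left)
  finally have "char_poly A = (\<Prod>a\<leftarrow>map Re as. [:- a, 1:])"
    by simp
  moreover have "proots (\<Prod>a\<leftarrow>bs. [:- a, 1:]) = mset bs" for bs :: "real list"
  proof (induction bs)
    case (Cons b bs)
    have "(\<Prod>a\<leftarrow>bs. [:- a, 1:]) \<noteq> 0"
      by (auto simp: prod_list_zero_iff)
    then have "proots ([:- b, 1:] * (\<Prod>a\<leftarrow>bs. [:- a, 1:])) =
        proots [:- b, 1:] + proots (\<Prod>a\<leftarrow>bs. [:- a, 1:])"
      by (intro proots_mult) auto
    then show ?case
      using Cons.IH by (simp del: mult_pCons_left)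
  qed simp
  ultimately have "proots (char_poly A) = mset (map Re as)" by metis
  then show ?thesis
    using as(2) by (metis eigenvalues_desc_def length_map length_rev mset_sorted_list_of_multiset size_mset)
qed

end

theory Submission
  imports Defs "HOL-Real_Asymp.Real_Asymp" "HOL-Combinatorics.Permutations"
begin

text \<open>
  Closing the path \<open>1, \<dots>, n\<close> to a cycle changes each \<open>\<Xi>\<^sub>i\<^sub>j\<close> by \<open>O(1/n)\<close>, which is invisible to
  the limiting spectrum. After centering, \<open>\<Phi>\<^sub>n - 1\<close> then has the off-diagonal entries
  \<open>h(R\<^sub>i, R\<^sub>j)\<close>, where \<open>h\<close> is a symmetric kernel on the symmetric group and the ranks
  \<open>R\<^sub>i\<close> are independent uniform permutations. Adjacency in the cycle and distance on the line,
  doubly centered, are vectors in one irreducible representation, so Schur orthogonality gives all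
  second moments of \<open>h\<close>: the kernel is degenerate, its covariance operator has small
  Hilbert-Schmidt norm, and its variance is asymptotic to \<open>1/(5n)\<close>.

  Expanding the resolvent along one row leaves the quadratic form of the other resolvent entries in
  the row \<open>h(R\<^sub>i, \<cdot>)\<close>. It concentrates by the Poincare inequality for random transpositions,
  applied to \<open>R\<^sub>i\<close>, and the normalized resolvent trace \<open>T\<close> satisfies
  \<open>1 + (z - 1) T + (\<gamma>/5) T\<^sup>2 \<approx> 0\<close> on average. This is the equation of the semicircle
  transform, and its root in the closed upper half plane is stable. Bounded differences and
  Borel-Cantelli turn the mean into almost sure convergence for countably many \<open>z\<close>, which is
  enough for weak convergence.
\<close>

section \<open>Resolvents of real symmetric arrays\<close>

text \<open>The entries above the diagonal are not independent, and the minor in the row expansion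
  depends on every \<open>R k\<close> with \<open>k \<noteq> i\<close>. The quadratic form can
  therefore not be averaged over those permutations; the only fresh randomness is the single
  permutation \<open>R i\<close>, whose values depend on each other. This is why concentration has
  to come from a variance inequality on the symmetric group. The cycle is preferred to the path
  because it is regular: subtracting one constant off the diagonal centers all rows of its adjacency
  matrix, and the closing edge adds a single distance of at most n - 1 against a normalization of
  order n^2. The constant 1/5 is the limit of n times the product of the squared scale 9/(4 n^4),
  the inverse dimension 2/n^2, a factor 2 for the two pairings in the kernel, the squared norm n of
  the adjacency and the squared norm n^4/45 of the distance. Here 1/45 is half of 2/45 = 1/6 - 2
  (7/60) + 1/9, the variance of |U - V| after double centering for independent uniform U and
  V.\<close>

lemma Cauchy_Schwarz_cmod_sum:
  fixes f g :: "'a \<Rightarrow> complex"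
  shows "(cmod (\<Sum>i\<in>A. f i * g i))\<^sup>2 \<le> (\<Sum>i\<in>A. (cmod (f i))\<^sup>2) * (\<Sum>i\<in>A. (cmod (g i))\<^sup>2)"
proof -
  have "cmod (\<Sum>i\<in>A. f i * g i) \<le> (\<Sum>i\<in>A. cmod (f i) * cmod (g i))"
    using norm_sum[of "\<lambda>i. f i * g i" A] by (simp add: norm_mult)
  then have "(cmod (\<Sum>i\<in>A. f i * g i))\<^sup>2 \<le> (\<Sum>i\<in>A. cmod (f i) * cmod (g i))\<^sup>2"
    by (simp add: power_mono)
  also have "\<dots> \<le> (\<Sum>i\<in>A. (cmod (f i))\<^sup>2) * (\<Sum>i\<in>A. (cmod (g i))\<^sup>2)"
    by (rule Cauchy_Schwarz_ineq_sum)
  finally show ?thesis .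
qed

definition symmetric_on :: "nat set \<Rightarrow> (nat \<Rightarrow> nat \<Rightarrow> 'a) \<Rightarrow> bool" where
  "symmetric_on J A \<longleftrightarrow> (\<forall>i\<in>J. \<forall>j\<in>J. A i j = A j i)"

lemma symmetric_onD: "symmetric_on J A \<Longrightarrow> i \<in> J \<Longrightarrow> j \<in> J \<Longrightarrow> A i j = A j i"
  by (simp add: symmetric_on_def)

lemma symmetric_on_subset: "symmetric_on J A \<Longrightarrow> I \<subseteq> J \<Longrightarrow> symmetric_on I A"
  by (auto simp: symmetric_on_def)

text \<open>The quadratic form of a real symmetric array is real, so only the shift by
  \<open>z\<close> reaches the imaginary part. This identity replaces the spectral theorem in the
  bounds on resolvents.\<close>

lemma Im_shifted_form:
  fixes A :: "nat \<Rightarrow> nat \<Rightarrow> real" and x y :: "nat \<Rightarrow> complex"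
  assumes sym: "symmetric_on J A"
    and eq: "\<And>i. i \<in> J \<Longrightarrow> (\<Sum>j\<in>J. of_real (A i j) * x j) - z * x i = y i"
  shows "Im (\<Sum>i\<in>J. cnj (x i) * y i) = - Im z * (\<Sum>i\<in>J. (cmod (x i))\<^sup>2)"
proof -
  define q where "q = (\<Sum>i\<in>J. \<Sum>j\<in>J. of_real (A i j) * (cnj (x i) * x j))"
  have "cnj q = (\<Sum>i\<in>J. \<Sum>j\<in>J. of_real (A j i) * (cnj (x j) * x i))"
    unfolding q_def by (auto intro!: sum.cong simp: symmetric_onD[OF sym] mult_ac)
  also have "\<dots> = q" unfolding q_def by (rule sum.swap)
  finally have q: "Im q = 0" by (simp add: complex_eq_iff)
  have "(\<Sum>i\<in>J. cnj (x i) * y i) = (\<Sum>i\<in>J. cnj (x i) * ((\<Sum>j\<in>J. of_real (A i j) * x j) - z * x i))"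
    by (intro sum.cong) (auto simp: eq)
  also have "\<dots> = q - z * (\<Sum>i\<in>J. cnj (x i) * x i)"
    by (simp add: q_def algebra_simps sum_subtractf sum_distrib_left)
  also have "(\<Sum>i\<in>J. cnj (x i) * x i) = of_real (\<Sum>i\<in>J. (cmod (x i))\<^sup>2)"
    unfolding of_real_sum by (intro sum.cong refl) (simp only: complex_norm_square mult.commute)
  finally show ?thesis using q by simp
qed

text \<open>Cauchy-Schwarz applied to the left side of \<open>Im_shifted_form\<close> lets one
  factor of the norm of \<open>x\<close> cancel. With \<open>y = 0\<close> it also gives uniqueness
  of the resolvent.\<close>

lemma resolvent_bound:
  fixes A :: "nat \<Rightarrow> nat \<Rightarrow> real" and x y :: "nat \<Rightarrow> complex"
  assumes sym: "symmetric_on J A" and z: "Im z > 0"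
    and eq: "\<And>i. i \<in> J \<Longrightarrow> (\<Sum>j\<in>J. of_real (A i j) * x j) - z * x i = y i"
  shows "(\<Sum>i\<in>J. (cmod (x i))\<^sup>2) \<le> (\<Sum>i\<in>J. (cmod (y i))\<^sup>2) / (Im z)\<^sup>2"
proof -
  define s where "s = (\<Sum>i\<in>J. (cmod (x i))\<^sup>2)"
  define t where "t = (\<Sum>i\<in>J. (cmod (y i))\<^sup>2)"
  have s0: "s \<ge> 0" "t \<ge> 0" by (simp_all add: s_def t_def sum_nonneg)
  have "\<bar>Im (\<Sum>i\<in>J. cnj (x i) * y i)\<bar> \<le> cmod (\<Sum>i\<in>J. cnj (x i) * y i)" by (rule abs_Im_le_cmod)
  then have "\<bar>- Im z * s\<bar> \<le> cmod (\<Sum>i\<in>J. cnj (x i) * y i)"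
    by (simp only: Im_shifted_form[OF sym eq] s_def)
  then have "(Im z * s)\<^sup>2 \<le> (cmod (\<Sum>i\<in>J. cnj (x i) * y i))\<^sup>2"
    using abs_le_square_iff[of "- Im z * s" "cmod (\<Sum>i\<in>J. cnj (x i) * y i)"] by simp
  also have "\<dots> \<le> s * t"
    using Cauchy_Schwarz_cmod_sum[of "\<lambda>i. cnj (x i)" y J] by (simp add: s_def t_def)
  finally have "((Im z)\<^sup>2 * s) * s \<le> t * s" by (simp add: power2_eq_square algebra_simps)
  then have "(Im z)\<^sup>2 * s \<le> t" using s0
    by (cases "s = 0") (auto simp: mult_le_cancel_right)
  then show ?thesis using z by (simp add: field_simps s_def t_def)
qed

text \<open>Arrays over an arbitrary finite index set replace matrices, so that deleting a row is a
  change of \<open>J\<close> without renumbering.\<close>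

definition resolvent_on :: "nat set \<Rightarrow> (nat \<Rightarrow> nat \<Rightarrow> real) \<Rightarrow> complex \<Rightarrow> (nat \<Rightarrow> nat \<Rightarrow> complex) \<Rightarrow> bool" where
  "resolvent_on J A z G \<longleftrightarrow>
    (\<forall>i\<in>J. \<forall>k\<in>J. (\<Sum>j\<in>J. of_real (A i j) * G j k) - z * G i k = (if i = k then 1 else 0))"

lemma resolvent_onD:
  "resolvent_on J A z G \<Longrightarrow> i \<in> J \<Longrightarrow> k \<in> J \<Longrightarrow>
    (\<Sum>j\<in>J. of_real (A i j) * G j k) - z * G i k = (if i = k then 1 else 0)"
  by (simp add: resolvent_on_def)

lemma resolvent_on_unique:
  assumes "finite J" "symmetric_on J A" "Im z > 0" "resolvent_on J A z G" "resolvent_on J A z H"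
    and jk: "j \<in> J" "k \<in> J"
  shows "G j k = H j k"
proof -
  have "(\<Sum>i\<in>J. (cmod (G i k - H i k))\<^sup>2) \<le> (\<Sum>i\<in>J. (cmod 0)\<^sup>2) / (Im z)\<^sup>2"
  proof (rule resolvent_bound[OF assms(2,3)])
    fix i assume "i \<in> J"
    then show "(\<Sum>j\<in>J. of_real (A i j) * (G j k - H j k)) - z * (G i k - H i k) = 0"
      using resolvent_onD[OF assms(4) _ jk(2), of i] resolvent_onD[OF assms(5) _ jk(2), of i]
      by (simp add: algebra_simps sum_subtractf)
  qed
  then have "(\<Sum>i\<in>J. (cmod (G i k - H i k))\<^sup>2) = 0" by (simp add: sum_nonneg antisym)
  then show ?thesis using assms(1) jk by (subst (asm) sum_nonneg_eq_0_iff) auto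
qed

lemma resolvent_solves:
  assumes "finite J" "resolvent_on J A z G" "i \<in> J"
  shows "(\<Sum>j\<in>J. of_real (A i j) * (\<Sum>k\<in>J. G j k * x k)) - z * (\<Sum>k\<in>J. G i k * x k) = x i"
proof -
  have "(\<Sum>j\<in>J. of_real (A i j) * (\<Sum>k\<in>J. G j k * x k)) - z * (\<Sum>k\<in>J. G i k * x k)
      = (\<Sum>k\<in>J. \<Sum>j\<in>J. of_real (A i j) * (G j k * x k)) - (\<Sum>k\<in>J. z * (G i k * x k))"
    by (subst sum.swap) (simp add: sum_distrib_left)
  also have "\<dots> = (\<Sum>k\<in>J. ((\<Sum>j\<in>J. of_real (A i j) * G j k) - z * G i k) * x k)"
    by (simp add: sum_subtractf[symmetric] sum_distrib_left sum_distrib_right algebra_simps)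
  also have "\<dots> = (\<Sum>k\<in>J. (if i = k then x k else 0))"
    by (intro sum.cong refl) (simp add: resolvent_onD[OF assms(2,3)])
  also have "\<dots> = x i" using assms by (simp add: sum.delta')
  finally show ?thesis .
qed

text \<open>Block inversion with the Schur complement \<open>D\<close> as pivot, where
  \<open>w\<close> is the resolvent of the minor applied to the new row. By
  \<open>Im_shifted_form\<close> the imaginary part of \<open>D\<close> is \<open>- Im z\<close>
  times 1 plus the squared norm of \<open>w\<close>, so the pivot cannot vanish. The same formula
  serves existence by induction on \<open>J\<close> and the comparison of a trace with that of a
  minor.\<close>

lemma resolvent_insert:
  fixes A :: "nat \<Rightarrow> nat \<Rightarrow> real"
  assumes J: "finite J" "i \<notin> J" and sym: "symmetric_on (insert i J) A" and z: "Im z > 0"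
    and G: "resolvent_on J A z G" "symmetric_on J G"
  defines "w \<equiv> \<lambda>j. \<Sum>k\<in>J. G j k * of_real (A i k)"
  defines "D \<equiv> of_real (A i i) - z - (\<Sum>j\<in>J. of_real (A i j) * w j)"
  defines "G' \<equiv> \<lambda>j k. if j = i then (if k = i then 1 / D else - w k / D)
     else if k = i then - w j / D else G j k + w j * w k / D"
  shows "cmod D \<ge> Im z * (1 + (\<Sum>j\<in>J. (cmod (w j))\<^sup>2))"
    "D \<noteq> 0" "resolvent_on (insert i J) A z G'" "symmetric_on (insert i J) G'"
proof -
  have symJ: "symmetric_on J A" using sym by (rule symmetric_on_subset) auto
  have Ai: "A j i = A i j" if "j \<in> J" for j using symmetric_onD[OF sym, of j i] that by simp
  have w: "(\<Sum>j\<in>J. of_real (A l j) * w j) - z * w l = of_real (A i l)" if "l \<in> J" for l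
    using resolvent_solves[OF J(1) G(1) that, of "\<lambda>k. of_real (A i k)"] by (simp add: w_def)
  have "Im (\<Sum>j\<in>J. cnj (w j) * of_real (A i j)) = - Im z * (\<Sum>j\<in>J. (cmod (w j))\<^sup>2)"
    by (rule Im_shifted_form[OF symJ w])
  moreover have "(\<Sum>j\<in>J. of_real (A i j) * w j) = cnj (\<Sum>j\<in>J. cnj (w j) * of_real (A i j))"
    by (simp add: mult.commute)
  ultimately have "Im (\<Sum>j\<in>J. of_real (A i j) * w j) = Im z * (\<Sum>j\<in>J. (cmod (w j))\<^sup>2)"
    by (metis cnj.sel(2) minus_minus mult_minus_left)
  then have "Im D = - (Im z * (1 + (\<Sum>j\<in>J. (cmod (w j))\<^sup>2)))"
    by (simp add: D_def algebra_simps del: Im_sum)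
  then show 1: "cmod D \<ge> Im z * (1 + (\<Sum>j\<in>J. (cmod (w j))\<^sup>2))"
    using abs_Im_le_cmod[of D] by linarith
  moreover have "Im z * (1 + (\<Sum>j\<in>J. (cmod (w j))\<^sup>2)) > 0"
    using z by (intro mult_pos_pos add_pos_nonneg sum_nonneg) auto
  ultimately show D: "D \<noteq> 0" by auto
  have row: "(\<Sum>j\<in>J. of_real (A i j) * G j k) = w k" if "k \<in> J" for k
    unfolding w_def using that by (intro sum.cong) (auto simp: symmetric_onD[OF G(2)])
  have ne: "j \<noteq> i" if "j \<in> J" for j using that J by auto
  show "resolvent_on (insert i J) A z G'"
    unfolding resolvent_on_def
  proof (intro ballI)
    fix l k assume l: "l \<in> insert i J" and k: "k \<in> insert i J"
    have col_i: "(\<Sum>j\<in>J. of_real (A l j) * G' j i) = - (\<Sum>j\<in>J. of_real (A l j) * w j) / D"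
      unfolding sum_divide_distrib sum_negf[symmetric]
      by (intro sum.cong refl) (auto simp: G'_def ne)
    have col_k: "(\<Sum>j\<in>J. of_real (A l j) * G' j k) =
        (\<Sum>j\<in>J. of_real (A l j) * G j k) + (\<Sum>j\<in>J. of_real (A l j) * w j) * w k / D" if "k \<in> J"
      unfolding sum_divide_distrib sum_distrib_right sum.distrib[symmetric]
      by (intro sum.cong refl) (use that in \<open>auto simp: G'_def ne algebra_simps\<close>)
    show "(\<Sum>j\<in>insert i J. of_real (A l j) * G' j k) - z * G' l k = (if l = k then 1 else 0)"
    proof (cases "l = i"; cases "k = i")
      assume "l = i" "k = i"
      then have "(\<Sum>j\<in>insert i J. of_real (A l j) * G' j k) - z * G' l k
          = (of_real (A i i) - z - (\<Sum>j\<in>J. of_real (A i j) * w j)) / D"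
        using J col_i by (simp add: G'_def diff_divide_distrib)
      also have "\<dots> = 1" using D by (simp add: D_def[symmetric])
      finally show ?thesis using \<open>l = i\<close> \<open>k = i\<close> by simp
    next
      assume li: "l = i" "k \<noteq> i"
      then have kJ: "k \<in> J" using k by auto
      have "(\<Sum>j\<in>insert i J. of_real (A l j) * G' j k) - z * G' l k
          = w k - w k * (of_real (A i i) - z - (\<Sum>j\<in>J. of_real (A i j) * w j)) / D"
        using li J col_k[OF kJ] row[OF kJ] by (simp add: G'_def diff_divide_distrib add_divide_distrib algebra_simps)
      also have "\<dots> = 0" using D by (simp add: D_def[symmetric])
      finally show ?thesis using li by simp
    next
      assume lk: "l \<noteq> i" "k = i"
      then have lJ: "l \<in> J" using l by auto
      have "(\<Sum>j\<in>insert i J. of_real (A l j) * G' j k) - z * G' l k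
          = (of_real (A i l) - ((\<Sum>j\<in>J. of_real (A l j) * w j) - z * w l)) / D"
        using lk J col_i Ai[OF lJ] by (simp add: G'_def diff_divide_distrib add_divide_distrib algebra_simps)
      then show ?thesis using lk w[OF lJ] by simp
    next
      assume lk: "l \<noteq> i" "k \<noteq> i"
      then have lJ: "l \<in> J" and kJ: "k \<in> J" using l k by auto
      have "(\<Sum>j\<in>insert i J. of_real (A l j) * G' j k) - z * G' l k
          = ((\<Sum>j\<in>J. of_real (A l j) * G j k) - z * G l k) +
            (((\<Sum>j\<in>J. of_real (A l j) * w j) - z * w l) - of_real (A i l)) * w k / D"
        using lk J col_k[OF kJ] Ai[OF lJ] by (simp add: G'_def diff_divide_distrib add_divide_distrib algebra_simps)
      then show ?thesis using w[OF lJ] resolvent_onD[OF G(1) lJ kJ] by simp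
    qed
  qed
  show "symmetric_on (insert i J) G'"
    using G(2) by (auto simp: symmetric_on_def G'_def)
qed

lemma resolvent_ex:
  assumes "finite J" "symmetric_on J A" "Im z > 0"
  shows "\<exists>G. resolvent_on J A z G \<and> symmetric_on J G"
  using assms(1,2)
proof induction
  case empty
  show ?case by (auto simp: resolvent_on_def symmetric_on_def)
next
  case (insert i J)
  then obtain G where "resolvent_on J A z G" "symmetric_on J G"
    using symmetric_on_subset[of "insert i J" A J] by auto
  from resolvent_insert(3,4)[OF insert.hyps(1,2) insert.prems assms(3) this] show ?case by blast
qed

text \<open>The values on \<open>J\<close> do not depend on the choice, by
  \<open>resolvent_on_unique\<close>; asking for symmetry as well makes it available without a
  separate argument.\<close>

definition resolvent :: "nat set \<Rightarrow> (nat \<Rightarrow> nat \<Rightarrow> real) \<Rightarrow> complex \<Rightarrow> nat \<Rightarrow> nat \<Rightarrow> complex" where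
  "resolvent J A z = (SOME G. resolvent_on J A z G \<and> symmetric_on J G)"

definition resolvent_trace :: "nat set \<Rightarrow> (nat \<Rightarrow> nat \<Rightarrow> real) \<Rightarrow> complex \<Rightarrow> complex" where
  "resolvent_trace J A z = (\<Sum>j\<in>J. resolvent J A z j j)"

context
  fixes J :: "nat set" and A :: "nat \<Rightarrow> nat \<Rightarrow> real" and z :: complex
  assumes J: "finite J" and sym: "symmetric_on J A" and z: "Im z > 0"
begin

lemma resolvent_on_resolvent: "resolvent_on J A z (resolvent J A z)"
  and symmetric_on_resolvent: "symmetric_on J (resolvent J A z)"
  using someI_ex[OF resolvent_ex[OF J sym z]] by (auto simp: resolvent_def)

lemma resolvent_eqI:
  assumes "resolvent_on J A z H" "j \<in> J" "k \<in> J"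
  shows "resolvent J A z j k = H j k"
  by (rule resolvent_on_unique[OF J sym z resolvent_on_resolvent assms])

lemma resolvent_mult_bound:
  "(\<Sum>j\<in>J. (cmod (\<Sum>k\<in>J. resolvent J A z j k * x k))\<^sup>2) \<le> (\<Sum>k\<in>J. (cmod (x k))\<^sup>2) / (Im z)\<^sup>2"
  by (rule resolvent_bound[OF sym z resolvent_solves[OF J resolvent_on_resolvent]])

lemma resolvent_col_bound:
  assumes "k \<in> J"
  shows "(\<Sum>j\<in>J. (cmod (resolvent J A z j k))\<^sup>2) \<le> 1 / (Im z)\<^sup>2"
proof -
  have "(\<Sum>j\<in>J. (cmod (resolvent J A z j k))\<^sup>2) \<le> (\<Sum>j\<in>J. (cmod (if j = k then 1 else 0))\<^sup>2) / (Im z)\<^sup>2"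
    by (rule resolvent_bound[OF sym z resolvent_onD[OF resolvent_on_resolvent _ assms]])
  also have "(\<Sum>j\<in>J. (cmod (if j = k then 1 else 0))\<^sup>2) = (\<Sum>j\<in>J. (if j = k then 1 else 0))"
    by (intro sum.cong) auto
  also have "\<dots> = (1::real)" using J assms by simp
  finally show ?thesis .
qed

lemma resolvent_HS_bound:
  "(\<Sum>j\<in>J. \<Sum>k\<in>J. (cmod (resolvent J A z j k))\<^sup>2) \<le> real (card J) / (Im z)\<^sup>2"
proof -
  have "(\<Sum>j\<in>J. \<Sum>k\<in>J. (cmod (resolvent J A z j k))\<^sup>2) = (\<Sum>k\<in>J. \<Sum>j\<in>J. (cmod (resolvent J A z j k))\<^sup>2)"
    by (rule sum.swap)
  also have "\<dots> \<le> (\<Sum>k\<in>J. 1 / (Im z)\<^sup>2)" by (intro sum_mono resolvent_col_bound)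
  finally show ?thesis by simp
qed

lemma resolvent_entry_bound:
  assumes "j \<in> J" "k \<in> J"
  shows "cmod (resolvent J A z j k) \<le> 1 / Im z"
proof -
  have "(cmod (resolvent J A z j k))\<^sup>2 \<le> (\<Sum>j\<in>J. (cmod (resolvent J A z j k))\<^sup>2)"
    using J assms by (intro member_le_sum) auto
  also have "\<dots> \<le> (1 / Im z)\<^sup>2" using resolvent_col_bound[OF assms(2)] by (simp add: power_divide)
  finally show ?thesis using z by (simp add: power2_le_iff_abs_le abs_le_square_iff[symmetric])
qed

lemma Im_resolvent_diag:
  assumes "k \<in> J"
  shows "Im (resolvent J A z k k) \<ge> 0"
proof -
  have "Im (\<Sum>i\<in>J. cnj (resolvent J A z i k) * (if i = k then 1 else 0))
      = - Im z * (\<Sum>i\<in>J. (cmod (resolvent J A z i k))\<^sup>2)"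
    by (rule Im_shifted_form[OF sym resolvent_onD[OF resolvent_on_resolvent _ assms]])
  also have "(\<Sum>i\<in>J. cnj (resolvent J A z i k) * (if i = k then 1 else 0)) = cnj (resolvent J A z k k)"
    using J assms by (simp add: if_distrib[of "\<lambda>x. _ * x"] cong: if_cong)
  finally show ?thesis using z by (simp add: sum_nonneg)
qed

lemma Im_resolvent_trace: "Im (resolvent_trace J A z) \<ge> 0"
  by (simp add: resolvent_trace_def sum_nonneg Im_resolvent_diag)

lemma norm_resolvent_trace: "cmod (resolvent_trace J A z) \<le> real (card J) / Im z"
proof -
  have "cmod (resolvent_trace J A z) \<le> (\<Sum>j\<in>J. 1 / Im z)"
    unfolding resolvent_trace_def by (intro sum_norm_le resolvent_entry_bound)
  then show ?thesis by simp
qed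

end

lemma resolvent_cong:
  assumes "finite J" "symmetric_on J A" "Im z > 0"
    and "\<And>i j. i \<in> J \<Longrightarrow> j \<in> J \<Longrightarrow> A i j = B i j" and jk: "j \<in> J" "k \<in> J"
  shows "resolvent J A z j k = resolvent J B z j k"
proof -
  have "symmetric_on J B" using assms(2,4) by (simp add: symmetric_on_def)
  then have "resolvent_on J B z (resolvent J B z)" by (rule resolvent_on_resolvent[OF assms(1) _ assms(3)])
  then have "resolvent_on J A z (resolvent J B z)" using assms(4) by (simp add: resolvent_on_def)
  from resolvent_eqI[OF assms(1-3) this jk] show ?thesis .
qed

lemma resolvent_trace_cong:
  assumes "finite J" "symmetric_on J A" "Im z > 0"
    and "\<And>i j. i \<in> J \<Longrightarrow> j \<in> J \<Longrightarrow> A i j = B i j"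
  shows "resolvent_trace J A z = resolvent_trace J B z"
  unfolding resolvent_trace_def by (intro sum.cong refl resolvent_cong[OF assms])

text \<open>The trace difference is 1 plus the sum of the squares of \<open>w\<close>, divided by
  \<open>D\<close>. The lower bound on \<open>D\<close> contains the same sum with absolute values,
  so the quotient is bounded independently of the size and the entries of the array.\<close>

lemma
  assumes J: "finite J" "i \<notin> J" and sym: "symmetric_on (insert i J) A" and z: "Im z > 0"
  shows resolvent_schur: "resolvent (insert i J) A z i i *
      (of_real (A i i) - z - (\<Sum>j\<in>J. \<Sum>k\<in>J. of_real (A i j * A i k) * resolvent J A z j k)) = 1"
    and resolvent_trace_minor:
      "cmod (resolvent_trace (insert i J) A z - resolvent_trace J A z) \<le> 1 / Im z"
proof -
  have symJ: "symmetric_on J A" using sym by (rule symmetric_on_subset) auto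
  define G where "G = resolvent J A z"
  have G: "resolvent_on J A z G" "symmetric_on J G" unfolding G_def
    by (rule resolvent_on_resolvent[OF J(1) symJ z] symmetric_on_resolvent[OF J(1) symJ z])+
  define w where "w = (\<lambda>j. \<Sum>k\<in>J. G j k * of_real (A i k))"
  define D where "D = of_real (A i i) - z - (\<Sum>j\<in>J. of_real (A i j) * w j)"
  define G' where "G' = (\<lambda>j k. if j = i then (if k = i then 1 / D else - w k / D)
     else if k = i then - w j / D else G j k + w j * w k / D)"
  have ins: "cmod D \<ge> Im z * (1 + (\<Sum>j\<in>J. (cmod (w j))\<^sup>2))" "D \<noteq> 0" "resolvent_on (insert i J) A z G'"
    unfolding G'_def D_def w_def by (rule resolvent_insert[OF J sym z G])+
  have fin: "finite (insert i J)" using J by simp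
  have ii: "resolvent (insert i J) A z i i = 1 / D"
    by (subst resolvent_eqI[OF fin sym z ins(3)]) (auto simp: G'_def)
  have jj: "resolvent (insert i J) A z j j = G j j + w j * w j / D" if "j \<in> J" for j
    using that J by (subst resolvent_eqI[OF fin sym z ins(3)]) (auto simp: G'_def)
  have form: "(\<Sum>j\<in>J. of_real (A i j) * w j) = (\<Sum>j\<in>J. \<Sum>k\<in>J. of_real (A i j * A i k) * resolvent J A z j k)"
    by (simp add: w_def G_def sum_distrib_left mult_ac)
  show "resolvent (insert i J) A z i i *
      (of_real (A i i) - z - (\<Sum>j\<in>J. \<Sum>k\<in>J. of_real (A i j * A i k) * resolvent J A z j k)) = 1"
    unfolding form[symmetric] using ii ins(2) unfolding D_def by simp
  define W where "W = 1 + (\<Sum>j\<in>J. (cmod (w j))\<^sup>2)"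
  have W: "W > 0" unfolding W_def by (intro add_pos_nonneg sum_nonneg) auto
  have "resolvent_trace (insert i J) A z - resolvent_trace J A z = 1 / D + (\<Sum>j\<in>J. w j * w j / D)"
    using J by (simp add: resolvent_trace_def ii jj sum.distrib G_def)
  also have "\<dots> = (1 + (\<Sum>j\<in>J. w j * w j)) / D"
    by (simp add: sum_divide_distrib add_divide_distrib)
  finally have "cmod (resolvent_trace (insert i J) A z - resolvent_trace J A z)
      = cmod (1 + (\<Sum>j\<in>J. w j * w j)) / cmod D" by (simp add: norm_divide)
  also have "\<dots> \<le> W / (Im z * W)"
  proof (intro frac_le)
    have "cmod (1 + (\<Sum>j\<in>J. w j * w j)) \<le> 1 + (\<Sum>j\<in>J. cmod (w j * w j))"
      by (rule order.trans[OF norm_triangle_ineq]) (simp add: norm_sum)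
    then show "cmod (1 + (\<Sum>j\<in>J. w j * w j)) \<le> W" by (simp add: W_def norm_mult power2_eq_square)
  qed (use W z ins(1) in \<open>auto simp: W_def\<close>)
  also have "\<dots> = 1 / Im z" using W by simp
  finally show "cmod (resolvent_trace (insert i J) A z - resolvent_trace J A z) \<le> 1 / Im z" .
qed

text \<open>Both arrays have the same minor once index \<open>i\<close> is removed, and each removal
  costs \<open>1 / Im z\<close>. This supplies the constant for bounded differences.\<close>

lemma resolvent_trace_row_change:
  assumes J: "finite J" and symA: "symmetric_on J A" and symB: "symmetric_on J B" and z: "Im z > 0"
    and eq: "\<And>j k. j \<in> J \<Longrightarrow> k \<in> J \<Longrightarrow> j \<noteq> i \<Longrightarrow> k \<noteq> i \<Longrightarrow> A j k = B j k"
  shows "cmod (resolvent_trace J A z - resolvent_trace J B z) \<le> 2 / Im z"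
proof (cases "i \<in> J")
  case True
  define I where "I = J - {i}"
  have I: "J = insert i I" "i \<notin> I" "finite I" using True J by (auto simp: I_def)
  have "symmetric_on I A" using symA I(1) by (auto intro: symmetric_on_subset)
  then have "resolvent_trace I A z = resolvent_trace I B z"
    by (intro resolvent_trace_cong I z eq) (use I in auto)
  moreover have "cmod (resolvent_trace J A z - resolvent_trace I A z) \<le> 1 / Im z"
    using resolvent_trace_minor[OF I(3,2) _ z] symA I(1) by simp
  moreover have "cmod (resolvent_trace J B z - resolvent_trace I B z) \<le> 1 / Im z"
    using resolvent_trace_minor[OF I(3,2) _ z] symB I(1) by simp
  ultimately show ?thesis
    using norm_triangle_ineq4[of "resolvent_trace J A z - resolvent_trace I A z" "resolvent_trace J B z - resolvent_trace I B z"]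
    by simp
next
  case False
  then have "resolvent_trace J A z = resolvent_trace J B z"
    by (intro resolvent_trace_cong J symA z eq) auto
  then show ?thesis using z by simp
qed

text \<open>The resolvent identity writes the difference of traces as the pairing of
  \<open>A - B\<close> with a product of the two resolvents, whose squared Hilbert-Schmidt norm is
  at most \<open>card J / (Im z) ^ 4\<close>. When the size is of order n, entrywise errors of order
  1/n thus move the normalized trace by order n^(-1/2) only.\<close>

lemma resolvent_trace_HS:
  assumes J: "finite J" and symA: "symmetric_on J A" and symB: "symmetric_on J B" and z: "Im z > 0"
  shows "(cmod (resolvent_trace J A z - resolvent_trace J B z))\<^sup>2
    \<le> (\<Sum>j\<in>J. \<Sum>k\<in>J. (A j k - B j k)\<^sup>2) * real (card J) / (Im z) ^ 4"
proof -
  define G where "G = resolvent J A z"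
  define H where "H = resolvent J B z"
  note G = resolvent_on_resolvent[OF J symA z, folded G_def] symmetric_on_resolvent[OF J symA z, folded G_def]
  note H = resolvent_on_resolvent[OF J symB z, folded H_def] symmetric_on_resolvent[OF J symB z, folded H_def]
  define P where "P = (\<lambda>j k. \<Sum>i\<in>J. H k i * G i j)"
  define E where "E = (\<lambda>j k. complex_of_real (B j k - A j k))"
  have diff: "G i i - H i i = (\<Sum>j\<in>J. \<Sum>k\<in>J. G i j * E j k * H k i)" if i: "i \<in> J" for i
  proof -
    \<comment> \<open>Fact 1 evaluates the diagonal of G (B - z) H as that of G, fact 2 the diagonal
      of G (A - z) H as that of H; subtracting them gives the resolvent identity.\<close>
    have 1: "(\<Sum>j\<in>J. \<Sum>k\<in>J. G i j * of_real (B j k) * H k i) - (\<Sum>j\<in>J. z * G i j * H j i) = G i i"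
    proof -
      have "(\<Sum>j\<in>J. \<Sum>k\<in>J. G i j * of_real (B j k) * H k i) - (\<Sum>j\<in>J. z * G i j * H j i)
          = (\<Sum>j\<in>J. G i j * ((\<Sum>k\<in>J. of_real (B j k) * H k i) - z * H j i))"
        by (simp add: sum_subtractf[symmetric] sum_distrib_left algebra_simps)
      also have "\<dots> = (\<Sum>j\<in>J. (if j = i then G i j else 0))"
        by (intro sum.cong refl) (simp add: resolvent_onD[OF H(1) _ i])
      finally show ?thesis using J i by simp
    qed
    have 2: "(\<Sum>j\<in>J. \<Sum>k\<in>J. G i j * of_real (A j k) * H k i) - (\<Sum>j\<in>J. z * G i j * H j i) = H i i"
    proof -
      have "(\<Sum>j\<in>J. \<Sum>k\<in>J. G i j * of_real (A j k) * H k i) = (\<Sum>k\<in>J. \<Sum>j\<in>J. G i j * of_real (A j k) * H k i)"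
        by (rule sum.swap)
      also have "\<dots> - (\<Sum>k\<in>J. z * G i k * H k i)
          = (\<Sum>k\<in>J. ((\<Sum>j\<in>J. of_real (A k j) * G j i) - z * G k i) * H k i)"
        unfolding sum_subtractf[symmetric] left_diff_distrib
      proof (intro sum.cong refl arg_cong2[where f = "(-)"])
        fix k assume k: "k \<in> J"
        show "(\<Sum>j\<in>J. G i j * of_real (A j k) * H k i) = (\<Sum>j\<in>J. of_real (A k j) * G j i) * H k i"
          unfolding sum_distrib_right
          by (intro sum.cong refl) (simp add: symmetric_onD[OF symA _ k] symmetric_onD[OF G(2) i])
        show "z * G i k * H k i = z * G k i * H k i" using symmetric_onD[OF G(2) i k] by simp
      qed
      also have "\<dots> = (\<Sum>k\<in>J. (if k = i then H k i else 0))"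
        by (intro sum.cong refl) (simp add: resolvent_onD[OF G(1) _ i])
      finally show ?thesis using J i by simp
    qed
    have "G i i - H i i = (\<Sum>j\<in>J. \<Sum>k\<in>J. G i j * of_real (B j k) * H k i) - (\<Sum>j\<in>J. \<Sum>k\<in>J. G i j * of_real (A j k) * H k i)"
      using 1 2 by (simp add: algebra_simps)
    then show ?thesis by (simp add: E_def sum_subtractf[symmetric] algebra_simps)
  qed
  have "resolvent_trace J A z - resolvent_trace J B z = (\<Sum>i\<in>J. G i i - H i i)"
    by (simp add: resolvent_trace_def sum_subtractf G_def H_def)
  also have "\<dots> = (\<Sum>i\<in>J. \<Sum>(j,k)\<in>J\<times>J. G i j * E j k * H k i)"
    by (simp add: diff sum.cartesian_product)
  also have "\<dots> = (\<Sum>(j,k)\<in>J\<times>J. \<Sum>i\<in>J. G i j * E j k * H k i)"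
    by (subst sum.swap) (simp add: case_prod_unfold)
  also have "\<dots> = (\<Sum>jk\<in>J\<times>J. E (fst jk) (snd jk) * P (fst jk) (snd jk))"
    unfolding P_def sum_distrib_left case_prod_unfold
    by (intro sum.cong refl) (auto simp: symmetric_onD[OF G(2)] mult_ac)
  finally have "(cmod (resolvent_trace J A z - resolvent_trace J B z))\<^sup>2
     \<le> (\<Sum>jk\<in>J\<times>J. (cmod (E (fst jk) (snd jk)))\<^sup>2) * (\<Sum>jk\<in>J\<times>J. (cmod (P (fst jk) (snd jk)))\<^sup>2)"
    using Cauchy_Schwarz_cmod_sum[of "\<lambda>jk. E (fst jk) (snd jk)" "\<lambda>jk. P (fst jk) (snd jk)" "J \<times> J"] by simp
  also have "(\<Sum>jk\<in>J\<times>J. (cmod (P (fst jk) (snd jk)))\<^sup>2) = (\<Sum>j\<in>J. \<Sum>k\<in>J. (cmod (P j k))\<^sup>2)"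
    by (simp add: sum.cartesian_product case_prod_unfold)
  also have "(\<Sum>jk\<in>J\<times>J. (cmod (E (fst jk) (snd jk)))\<^sup>2) = (\<Sum>j\<in>J. \<Sum>k\<in>J. (A j k - B j k)\<^sup>2)"
    by (simp add: sum.cartesian_product case_prod_unfold E_def norm_of_real power2_commute del: of_real_diff)
  also have "(\<Sum>j\<in>J. \<Sum>k\<in>J. (cmod (P j k))\<^sup>2) \<le> (\<Sum>j\<in>J. (\<Sum>i\<in>J. (cmod (G i j))\<^sup>2) / (Im z)\<^sup>2)"
    unfolding P_def H_def by (intro sum_mono resolvent_mult_bound[OF J symB z])
  also have "\<dots> \<le> (\<Sum>j\<in>J. (1 / (Im z)\<^sup>2) / (Im z)\<^sup>2)"
    unfolding G_def by (intro sum_mono divide_right_mono resolvent_col_bound[OF J symA z]) auto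
  also have "\<dots> = real (card J) / (Im z) ^ 4" by (simp add: power4_eq_xxxx power2_eq_square)
  finally show ?thesis by (simp add: sum_nonneg mult_left_mono)
qed

section \<open>Finite averages\<close>

text \<open>Ranks take finitely many values, so all estimates up to the limit are expectations under
  uniform laws on finite sets. Measure theory enters only when the rank permutations of the sample
  are shown to be uniform. The vector-valued form covers real and complex averages alike.\<close>

definition avg :: "'a set \<Rightarrow> ('a \<Rightarrow> 'b::real_vector) \<Rightarrow> 'b" where
  "avg S f = (1 / real (card S)) *\<^sub>R (\<Sum>x\<in>S. f x)"

lemma avg_real: "avg S f = (\<Sum>x\<in>S. f x) / real (card S)" for f :: "'a \<Rightarrow> real"
  by (simp add: avg_def)

lemma avg_cong: "(\<And>x. x \<in> S \<Longrightarrow> f x = g x) \<Longrightarrow> avg S f = avg S g"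
  by (simp add: avg_def)

lemma avg_mono: "(\<And>x. x \<in> S \<Longrightarrow> f x \<le> g x) \<Longrightarrow> avg S f \<le> avg S g" for f g :: "'a \<Rightarrow> real"
  by (auto simp: avg_real intro!: divide_right_mono sum_mono)

lemma avg_nonneg: "(\<And>x. x \<in> S \<Longrightarrow> 0 \<le> f x) \<Longrightarrow> 0 \<le> avg S f" for f :: "'a \<Rightarrow> real"
  by (auto simp: avg_real intro!: divide_nonneg_nonneg sum_nonneg)

lemma avg_add: "avg S (\<lambda>x. f x + g x) = avg S f + avg S g"
  by (simp add: avg_def sum.distrib scaleR_add_right)

lemma avg_diff: "avg S (\<lambda>x. f x - g x) = avg S f - avg S g"
  by (simp add: avg_def sum_subtractf scaleR_diff_right)

lemma avg_cmult: "avg S (\<lambda>x. c * f x) = c * avg S f" for c :: "'b::real_algebra"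
  by (simp add: avg_def sum_distrib_left)

lemma avg_multc: "avg S (\<lambda>x. f x * c) = avg S f * c" for c :: "'b::real_algebra"
  by (simp add: avg_def sum_distrib_right)

lemma avg_sum: "avg S (\<lambda>x. \<Sum>i\<in>I. f i x) = (\<Sum>i\<in>I. avg S (f i))"
  unfolding avg_def by (subst sum.swap) (simp add: scaleR_sum_right)

lemma avg_swap: "avg S (\<lambda>x. avg T (f x)) = avg T (\<lambda>y. avg S (\<lambda>x. f x y))"
  unfolding avg_def by (subst scaleR_sum_right[symmetric], subst sum.swap)
    (simp add: scaleR_sum_right[symmetric] mult.commute)

lemma avg_const: "finite S \<Longrightarrow> S \<noteq> {} \<Longrightarrow> avg S (\<lambda>x. c) = c"
  by (simp add: avg_def scaleR_conv_of_real sum_constant_scaleR)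

lemma norm_avg_le: "norm (avg S f) \<le> avg S (\<lambda>x. norm (f x))" for f :: "'a \<Rightarrow> 'b::real_normed_vector"
  by (simp add: avg_def divide_right_mono norm_sum)

lemma avg_le_const: "finite S \<Longrightarrow> S \<noteq> {} \<Longrightarrow> (\<And>x. x \<in> S \<Longrightarrow> f x \<le> c) \<Longrightarrow> avg S f \<le> c" for c :: real
  using avg_mono[of S f "\<lambda>x. c"] avg_const[of S c] by simp

lemma Cauchy_Schwarz_avg: "(avg S (\<lambda>x. f x * g x))\<^sup>2 \<le> avg S (\<lambda>x. (f x)\<^sup>2) * avg S (\<lambda>x. (g x)\<^sup>2)"
  for f g :: "'a \<Rightarrow> real"
  using Cauchy_Schwarz_ineq_sum[of f g S]
  by (auto simp: avg_real power2_eq_square divide_simps)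

lemma avg_square_le: "finite S \<Longrightarrow> S \<noteq> {} \<Longrightarrow> (avg S f)\<^sup>2 \<le> avg S (\<lambda>x. (f x)\<^sup>2)" for f :: "'a \<Rightarrow> real"
  using Cauchy_Schwarz_avg[of S f "\<lambda>_. 1"] by (simp add: avg_const)

lemma avg_bij_betw: "bij_betw \<phi> T S \<Longrightarrow> avg S f = avg T (\<lambda>x. f (\<phi> x))"
  using sum.reindex_bij_betw[of \<phi> T S f] bij_betw_same_card[of \<phi> T S] by (simp add: avg_def)

lemma avg_Times: "avg (S \<times> T) (\<lambda>(x, y). f x y) = avg S (\<lambda>x. avg T (f x))"
  by (simp add: avg_def sum.cartesian_product[symmetric] card_cartesian_product scaleR_sum_right[symmetric])

text \<open>Fubini for one coordinate: drawing a tuple is drawing coordinate \<open>i\<close>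
  independently of the others. The functions in \<open>PiE J\<close> have no information at
  \<open>i\<close>, hence the update is a bijection.\<close>

lemma avg_PiE_insert:
  assumes "i \<notin> J"
  shows "avg (PiE (insert i J) (\<lambda>_. S)) f = avg (PiE J (\<lambda>_. S)) (\<lambda>R. avg S (\<lambda>Q. f (R(i := Q))))"
proof -
  have "bij_betw (\<lambda>(R, Q). R(i := Q)) (PiE J (\<lambda>_. S) \<times> S) (PiE (insert i J) (\<lambda>_. S))"
    unfolding bij_betw_def
  proof
    show "inj_on (\<lambda>(R, Q). R(i := Q)) (PiE J (\<lambda>_. S) \<times> S)"
    proof (rule inj_onI, clarsimp)
      fix R R' Q Q'
      assume R: "R \<in> PiE J (\<lambda>_. S)" "R' \<in> PiE J (\<lambda>_. S)" and eq: "R(i := Q) = R'(i := Q')"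
      have "R k = R' k" for k
        using fun_cong[OF eq, of k] PiE_arb[OF R(1), of k] PiE_arb[OF R(2), of k] assms by (cases "k = i") auto
      then show "R = R' \<and> Q = Q'" using fun_cong[OF eq, of i] by auto
    qed
    show "(\<lambda>(R, Q). R(i := Q)) ` (PiE J (\<lambda>_. S) \<times> S) = PiE (insert i J) (\<lambda>_. S)"
      unfolding PiE_insert_eq by force
  qed
  from avg_bij_betw[OF this, of f] show ?thesis
    using avg_Times[of "PiE J (\<lambda>_. S)" S "\<lambda>R Q. f (R(i := Q))"] by (simp add: case_prod_unfold)
qed

context
  fixes S :: "'a set" and J :: "nat set"
  assumes S: "finite S" "S \<noteq> {}" and J: "finite J"
begin

lemma finite_PiE_const: "finite (PiE J (\<lambda>_. S))" and PiE_const_nonempty: "PiE J (\<lambda>_. S) \<noteq> {}"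
  using S J by (auto simp: PiE_eq_empty_iff intro!: finite_PiE)

lemma avg_PiE_eval:
  assumes "j \<in> J"
  shows "avg (PiE J (\<lambda>_. S)) (\<lambda>R. \<phi> (R j)) = avg S \<phi>"
proof -
  define I where "I = J - {j}"
  have I: "J = insert j I" "j \<notin> I" "finite I" using assms J by (auto simp: I_def)
  show ?thesis
    unfolding I(1) avg_PiE_insert[OF I(2)] using I S
    by (simp add: avg_const finite_PiE PiE_eq_empty_iff)
qed

lemma avg_PiE_eval2:
  assumes "j \<in> J" "k \<in> J" "j \<noteq> k"
  shows "avg (PiE J (\<lambda>_. S)) (\<lambda>R. \<phi> (R j) (R k)) = avg S (\<lambda>r. avg S (\<phi> r))"
proof -
  define I where "I = J - {j} - {k}"
  have I: "J = insert k (insert j I)" "j \<notin> I" "k \<notin> insert j I" "finite I"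
    using assms J by (auto simp: I_def)
  show ?thesis
    unfolding I(1) avg_PiE_insert[OF I(3)] avg_PiE_insert[OF I(2)] using I S assms(3)
    by (simp add: avg_const finite_PiE PiE_eq_empty_iff)
qed

end

section \<open>Random permutations\<close>

abbreviation perms :: "'a set \<Rightarrow> ('a \<Rightarrow> 'a) set" where
  "perms S \<equiv> {p. p permutes S}"

abbreviation transposition :: "'a \<Rightarrow> 'a \<Rightarrow> 'a \<Rightarrow> 'a" where
  "transposition \<equiv> Transposition.transpose"

lemma perms_nonempty: "perms S \<noteq> {}"
  using permutes_id by blast

lemma avg_perms_compose_left: "q permutes S \<Longrightarrow> avg (perms S) (\<lambda>p. f (q \<circ> p)) = avg (perms S) f"
  using setum_permutations_compose_left[of q S f] by (simp add: avg_def)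

lemma avg_perms_compose_right: "q permutes S \<Longrightarrow> avg (perms S) (\<lambda>p. f (p \<circ> q)) = avg (perms S) f"
  using sum_permutations_compose_right[of q S f] by (simp add: avg_def)

lemma avg_perms_inverse: "avg (perms S) (\<lambda>p. f (inv_into UNIV p)) = avg (perms S) f"
  using sum_permutations_inverse[of f S] by (simp add: avg_def)

text \<open>A permutation of \<open>insert a S\<close> is uniquely
  \<open>transposition a b \<circ> p\<close> with \<open>p\<close> fixing \<open>a\<close>, and then
  \<open>b\<close> is its value at \<open>a\<close>. Thus the average conditions on that
  value.\<close>

lemma avg_perms_insert:
  assumes "finite S" "a \<notin> S"
  shows "avg (perms (insert a S)) f = avg (insert a S) (\<lambda>b. avg (perms S) (\<lambda>p. f (transposition a b \<circ> p)))"
proof -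
  have "card (perms (insert a S)) = card (insert a S) * card (perms S)"
    using assms card_permutations[of S "card S"] card_permutations[of "insert a S" "Suc (card S)"] by simp
  then have "real (card (perms (insert a S))) = real (card (insert a S)) * real (card (perms S))"
    by (simp only: of_nat_mult)
  then show ?thesis
    unfolding avg_def sum_over_permutations_insert[OF assms] scaleR_sum_right[symmetric] scaleR_scaleR by simp
qed

lemma variance_pairs:
  fixes g :: "'a \<Rightarrow> real"
  assumes "finite S" "S \<noteq> {}"
  shows "avg S (\<lambda>b. (g b)\<^sup>2) - (avg S g)\<^sup>2 = avg S (\<lambda>b. avg S (\<lambda>b'. (g b - g b')\<^sup>2)) / 2"
proof -
  have "avg S (\<lambda>b. avg S (\<lambda>b'. (g b - g b')\<^sup>2))
      = avg S (\<lambda>b. avg S (\<lambda>b'. (g b)\<^sup>2 + (g b')\<^sup>2 - 2 * g b * g b'))"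
    by (simp add: power2_diff)
  also have "\<dots> = 2 * avg S (\<lambda>b. (g b)\<^sup>2) - 2 * (avg S g * avg S g)"
    using assms by (simp add: avg_add avg_diff avg_const avg_cmult avg_multc mult.assoc)
  finally show ?thesis by (simp add: power2_eq_square)
qed

text \<open>
  Conditioning on the value at \<open>a\<close> splits the variance; averaging over \<open>a\<close> gives every
  transposition the same weight.
\<close>

lemma perms_variance_right:
  fixes f :: "('a \<Rightarrow> 'a) \<Rightarrow> real"
  assumes "finite S"
  shows "2 * real (card S) * (avg (perms S) (\<lambda>p. (f p)\<^sup>2) - (avg (perms S) f)\<^sup>2)
    \<le> (\<Sum>x\<in>S. \<Sum>y\<in>S. avg (perms S) (\<lambda>p. (f p - f (p \<circ> transposition x y))\<^sup>2))"
  using assms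
proof (induction "card S" arbitrary: S f)
  case 0
  then show ?case by simp
next
  case (Suc k)
  define N where "N = real (card S)"
  define V where "V = avg (perms S) (\<lambda>p. (f p)\<^sup>2) - (avg (perms S) f)\<^sup>2"
  define D where "D = (\<lambda>x y. avg (perms S) (\<lambda>p. (f p - f (p \<circ> transposition x y))\<^sup>2))"
  have D0: "D x y \<ge> 0" "D x x = 0" for x y by (simp_all add: D_def avg_nonneg) (simp add: avg_def)
  show ?case
  proof (cases "k = 0")
    case True
    then obtain a where "S = {a}" using Suc.hyps(2) by (metis One_nat_def card_1_singletonE)
    then have "perms S = {id}" by (auto simp: permutes_sing)
    then have "V = 0" by (simp add: V_def avg_def)
    then show ?thesis by (simp add: V_def[symmetric] sum_nonneg avg_nonneg)
  next
    case False
    have N: "N \<ge> 2" "N = real k + 1" using False Suc.hyps(2) by (auto simp: N_def)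
    \<comment> \<open>Law of total variance for the value \<open>b\<close> at \<open>a\<close>: the
      conditional variances \<open>W b\<close> are bounded by induction on \<open>S - {a}\<close>,
      the variance of the conditional means \<open>g b\<close> by the transpositions that involve
      \<open>a\<close>.\<close>
    have step: "V \<le> (\<Sum>x\<in>S - {a}. \<Sum>y\<in>S - {a}. D x y) / (2 * (N - 1)) + (\<Sum>m\<in>S. D a m) / (2 * N)"
      if a: "a \<in> S" for a
    proof -
      define T where "T = S - {a}"
      have T: "S = insert a T" "a \<notin> T" "finite T" "card T = k"
        using a Suc.hyps(2) Suc.prems by (auto simp: T_def)
      define g where "g = (\<lambda>b. avg (perms T) (\<lambda>p. f (transposition a b \<circ> p)))"
      define W where "W = (\<lambda>b. avg (perms T) (\<lambda>p. (f (transposition a b \<circ> p))\<^sup>2) - (g b)\<^sup>2)"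
      note split = avg_perms_insert[OF T(3,2), folded T(1)]
      have V: "V = avg S W + (avg S (\<lambda>b. (g b)\<^sup>2) - (avg S g)\<^sup>2)"
        unfolding V_def split W_def g_def by (simp add: avg_diff)
      have W: "2 * (N - 1) * W b \<le> (\<Sum>x\<in>T. \<Sum>y\<in>T. avg (perms T)
          (\<lambda>p. (f (transposition a b \<circ> p) - f ((transposition a b \<circ> p) \<circ> transposition x y))\<^sup>2))" for b
        using Suc.hyps(1)[OF T(4)[symmetric] T(3), of "\<lambda>p. f (transposition a b \<circ> p)"] N T(4)
        by (simp add: W_def g_def comp_assoc)
      have "2 * (N - 1) * avg S W \<le> (\<Sum>x\<in>T. \<Sum>y\<in>T. D x y)"
      proof -
        have "2 * (N - 1) * avg S W = avg S (\<lambda>b. 2 * (N - 1) * W b)" by (simp add: avg_cmult)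
        also have "\<dots> \<le> avg S (\<lambda>b. \<Sum>x\<in>T. \<Sum>y\<in>T. avg (perms T)
          (\<lambda>p. (f (transposition a b \<circ> p) - f ((transposition a b \<circ> p) \<circ> transposition x y))\<^sup>2))"
          by (intro avg_mono W)
        also have "\<dots> = (\<Sum>x\<in>T. \<Sum>y\<in>T. D x y)"
          unfolding avg_sum D_def split ..
        finally show ?thesis .
      qed
      then have 1: "avg S W \<le> (\<Sum>x\<in>T. \<Sum>y\<in>T. D x y) / (2 * (N - 1))"
        using N by (simp add: field_simps)
      \<comment> \<open>To compare \<open>g b\<close> with \<open>g b'\<close>, the value at
        \<open>a\<close> is changed by the swap of \<open>b\<close> and \<open>b'\<close> on the
        left. For points other than \<open>a\<close>, (b b')(a b) = (a b')(b b'), and the last swap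
        acts inside \<open>T\<close>, where it is averaged away.\<close>
      have swap: "g b' = avg (perms T) (\<lambda>p. f (transposition b b' \<circ> (transposition a b \<circ> p)))"
        if b: "b \<in> S" "b' \<in> S" for b b'
      proof (cases "b = b' \<or> b = a \<or> b' = a")
        case True
        then show ?thesis
          by (auto simp: g_def o_assoc transpose_commute[of b a])
      next
        case False
        have "transposition b b' \<circ> transposition a b = transposition a b' \<circ> transposition b b'"
          using False by (auto simp: fun_eq_iff Transposition.transpose_def)
        moreover have "transposition b b' permutes T"
          using False b T(1) by (intro permutes_swap_id) auto
        ultimately show ?thesis
          using avg_perms_compose_left[of "transposition b b'" T "\<lambda>p. f (transposition a b' \<circ> p)"]
          by (simp add: g_def o_assoc)
      qed
      have "(g b - g b')\<^sup>2 \<le> avg (perms T)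
          (\<lambda>p. (f (transposition a b \<circ> p) - f (transposition b b' \<circ> (transposition a b \<circ> p)))\<^sup>2)"
        if b: "b \<in> S" "b' \<in> S" for b b'
        unfolding swap[OF b] unfolding g_def avg_diff[symmetric]
        by (intro avg_square_le finite_permutations T(3) perms_nonempty)
      then have "avg S (\<lambda>b. avg S (\<lambda>b'. (g b - g b')\<^sup>2)) \<le>
          avg S (\<lambda>b. avg S (\<lambda>b'. avg (perms T)
          (\<lambda>p. (f (transposition a b \<circ> p) - f (transposition b b' \<circ> (transposition a b \<circ> p)))\<^sup>2)))"
        by (intro avg_mono) auto
      also have "\<dots> = avg S (\<lambda>b. avg (perms T) (\<lambda>p. avg S
          (\<lambda>b'. (f (transposition a b \<circ> p) - f (transposition ((transposition a b \<circ> p) a) b' \<circ> (transposition a b \<circ> p)))\<^sup>2)))"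
      proof (rule avg_cong, subst avg_swap, rule avg_cong)
        fix b p assume "p \<in> perms T"
        then have "p a = a" using T(2) by (auto intro: permutes_not_in)
        then show "avg S (\<lambda>b'. (f (transposition a b \<circ> p) - f (transposition b b' \<circ> (transposition a b \<circ> p)))\<^sup>2)
          = avg S (\<lambda>b'. (f (transposition a b \<circ> p) - f (transposition ((transposition a b \<circ> p) a) b' \<circ> (transposition a b \<circ> p)))\<^sup>2)"
          by simp
      qed
      also have "\<dots> = avg (perms S) (\<lambda>q. avg S (\<lambda>b'. (f q - f (transposition (q a) b' \<circ> q))\<^sup>2))"
        unfolding split ..
      \<comment> \<open>Swapping the values \<open>q a\<close> and \<open>b'\<close> is the same as
        swapping the positions \<open>a\<close> and \<open>m\<close> for \<open>b' = q m\<close>,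
        and \<open>m\<close> runs through \<open>S\<close> when \<open>b'\<close> does.\<close>
      also have "\<dots> = avg (perms S) (\<lambda>q. avg S (\<lambda>m. (f q - f (q \<circ> transposition a m))\<^sup>2))"
      proof (rule avg_cong)
        fix q assume q: "q \<in> perms S"
        then have "avg S (\<lambda>b'. (f q - f (transposition (q a) b' \<circ> q))\<^sup>2)
            = avg S (\<lambda>m. (f q - f (transposition (q a) (q m) \<circ> q))\<^sup>2)"
          by (intro avg_bij_betw permutes_imp_bij) simp
        moreover have "transposition (q a) (q m) \<circ> q = q \<circ> transposition a m" for m
          using permutes_inj[of q S] q by (auto simp: fun_eq_iff Transposition.transpose_def inj_eq)
        ultimately show "avg S (\<lambda>b'. (f q - f (transposition (q a) b' \<circ> q))\<^sup>2)
            = avg S (\<lambda>m. (f q - f (q \<circ> transposition a m))\<^sup>2)"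
          by (simp only:)
      qed
      also have "\<dots> = avg S (\<lambda>m. D a m)"
        by (subst avg_swap) (simp add: D_def)
      finally have "avg S (\<lambda>b. (g b)\<^sup>2) - (avg S g)\<^sup>2 \<le> avg S (\<lambda>m. D a m) / 2"
        using variance_pairs[of S g] Suc.prems a by (metis divide_right_mono empty_iff zero_le_numeral)
      then show ?thesis using 1 V by (simp add: T_def avg_real N_def field_simps)
    qed
    define \<Sigma> where "\<Sigma> = (\<Sum>x\<in>S. \<Sum>y\<in>S. D x y)"
    have \<Sigma>: "\<Sigma> \<ge> 0" by (simp add: \<Sigma>_def sum_nonneg D0)
    \<comment> \<open>A pair of distinct points survives the removal of \<open>a\<close> for exactly
      \<open>N - 2\<close> choices of \<open>a\<close>; the diagonal contributes nothing since
      \<open>D x x = 0\<close>.\<close>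
    have "(\<Sum>a\<in>S. \<Sum>x\<in>S - {a}. \<Sum>y\<in>S - {a}. D x y)
        = (\<Sum>a\<in>S. \<Sum>x\<in>S. \<Sum>y\<in>S. if x \<noteq> a \<and> y \<noteq> a then D x y else 0)"
    proof (rule sum.cong[OF refl])
      fix a
      have "(\<Sum>x\<in>S - {a}. \<Sum>y\<in>S - {a}. D x y) = (\<Sum>x\<in>S - {a}. \<Sum>y\<in>S. if x \<noteq> a \<and> y \<noteq> a then D x y else 0)"
        using Suc.prems by (intro sum.cong refl sum.mono_neutral_cong_left) auto
      also have "\<dots> = (\<Sum>x\<in>S. \<Sum>y\<in>S. if x \<noteq> a \<and> y \<noteq> a then D x y else 0)"
        using Suc.prems by (intro sum.mono_neutral_left) auto
      finally show "(\<Sum>x\<in>S - {a}. \<Sum>y\<in>S - {a}. D x y) = (\<Sum>x\<in>S. \<Sum>y\<in>S. if x \<noteq> a \<and> y \<noteq> a then D x y else 0)" .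
    qed
    also have "\<dots> = (\<Sum>x\<in>S. \<Sum>y\<in>S. \<Sum>a\<in>S. if x \<noteq> a \<and> y \<noteq> a then D x y else 0)"
      by (subst sum.swap) (intro sum.cong refl sum.swap)
    also have "\<dots> = (\<Sum>x\<in>S. \<Sum>y\<in>S. (N - 2) * D x y)"
    proof (intro sum.cong refl)
      fix x y assume xy: "x \<in> S" "y \<in> S"
      show "(\<Sum>a\<in>S. if x \<noteq> a \<and> y \<noteq> a then D x y else 0) = (N - 2) * D x y"
      proof (cases "x = y")
        case True
        then have "D x y = 0" by (simp only: D0(2))
        then show ?thesis by (auto intro!: sum.neutral)
      next
        case False
        have "(\<Sum>a\<in>S. if x \<noteq> a \<and> y \<noteq> a then D x y else 0) = (\<Sum>a\<in>S - {x, y}. D x y)"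
          using Suc.prems by (intro sum.mono_neutral_cong_right) auto
        also have "\<dots> = real (card (S - {x, y})) * D x y" by simp
        also have "real (card (S - {x, y})) = N - 2"
        proof -
          have "card (S - {x, y}) = card S - 2"
            using xy Suc.prems False by (subst card_Diff_subset) auto
          then show ?thesis using N by (simp add: N_def of_nat_diff)
        qed
        finally show ?thesis .
      qed
    qed
    finally have count: "(\<Sum>a\<in>S. \<Sum>x\<in>S - {a}. \<Sum>y\<in>S - {a}. D x y) = (N - 2) * \<Sigma>"
      by (simp add: \<Sigma>_def sum_distrib_left)
    have "N * V = (\<Sum>a\<in>S. V)" by (simp add: N_def)
    also have "\<dots> \<le> (\<Sum>a\<in>S. (\<Sum>x\<in>S - {a}. \<Sum>y\<in>S - {a}. D x y) / (2 * (N - 1)) + (\<Sum>m\<in>S. D a m) / (2 * N))"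
      by (intro sum_mono step)
    also have "\<dots> = (N - 2) * \<Sigma> / (2 * (N - 1)) + \<Sigma> / (2 * N)"
      by (simp add: sum.distrib sum_divide_distrib[symmetric] count \<Sigma>_def)
    also have "\<dots> = ((N - 2) / (N - 1) + 1 / N) * \<Sigma> / 2"
      unfolding distrib_right add_divide_distrib by (intro arg_cong2[where f = "(+)"]) (simp_all only: times_divide_eq_left times_divide_eq_right divide_divide_eq_left mult_1 mult.commute)
    \<comment> \<open>The induction reproduces its own constant because (N-2)/(N-1) + 1/N is at most
      1.\<close>
    also have "\<dots> \<le> 1 * \<Sigma> / 2"
    proof (intro divide_right_mono mult_right_mono \<Sigma>)
      have "(N - 2) / (N - 1) = 1 - 1 / (N - 1)" using N by (simp add: field_simps)
      moreover have "1 / N \<le> 1 / (N - 1)" using N by (intro frac_le) auto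
      ultimately show "(N - 2) / (N - 1) + 1 / N \<le> 1" by simp
    qed simp
    finally have "2 * N * V \<le> \<Sigma>" by simp
    then show ?thesis by (simp only: N_def V_def \<Sigma>_def D_def)
  qed
qed

text \<open>Inversion exchanges positions and values and preserves the uniform law. Swaps of values
  are the ones needed, since they act on the kernel by changing its first argument on the
  left.\<close>

lemma perms_variance_left:
  fixes f :: "('a \<Rightarrow> 'a) \<Rightarrow> real"
  assumes "finite S"
  shows "2 * real (card S) * (avg (perms S) (\<lambda>p. (f p)\<^sup>2) - (avg (perms S) f)\<^sup>2)
    \<le> (\<Sum>x\<in>S. \<Sum>y\<in>S. avg (perms S) (\<lambda>p. (f p - f (transposition x y \<circ> p))\<^sup>2))"
proof -
  have "avg (perms S) (\<lambda>p. (f (inv_into UNIV p) - f (inv_into UNIV (p \<circ> transposition x y)))\<^sup>2)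
      = avg (perms S) (\<lambda>p. (f p - f (transposition x y \<circ> p))\<^sup>2)" for x y
  proof -
    have "avg (perms S) (\<lambda>p. (f (inv_into UNIV p) - f (inv_into UNIV (p \<circ> transposition x y)))\<^sup>2)
        = avg (perms S) (\<lambda>p. (f (inv_into UNIV p) - f (transposition x y \<circ> inv_into UNIV p))\<^sup>2)"
      by (intro avg_cong) (auto simp: permutes_bij o_inv_distrib)
    then show ?thesis by (simp add: avg_perms_inverse[of S "\<lambda>p. (f p - f (transposition x y \<circ> p))\<^sup>2"])
  qed
  then show ?thesis
    using perms_variance_right[OF assms, of "\<lambda>p. f (inv_into UNIV p)"]
    by (simp add: avg_perms_inverse avg_perms_inverse[of S "\<lambda>p. (f p)\<^sup>2"])
qed

lemma perms_variance_complex: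
  fixes f :: "('a \<Rightarrow> 'a) \<Rightarrow> complex"
  assumes S: "finite S"
  shows "2 * real (card S) * avg (perms S) (\<lambda>p. (cmod (f p - avg (perms S) f))\<^sup>2)
    \<le> (\<Sum>x\<in>S. \<Sum>y\<in>S. avg (perms S) (\<lambda>p. (cmod (f p - f (transposition x y \<circ> p)))\<^sup>2))"
proof -
  have fin: "finite (perms S)" using S by (rule finite_permutations)
  have Re: "Re (avg (perms S) f) = avg (perms S) (\<lambda>p. Re (f p))" and
    Im: "Im (avg (perms S) f) = avg (perms S) (\<lambda>p. Im (f p))" by (simp_all add: avg_def)
  have var: "avg (perms S) (\<lambda>p. (g p - avg (perms S) g)\<^sup>2) = avg (perms S) (\<lambda>p. (g p)\<^sup>2) - (avg (perms S) g)\<^sup>2"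
    for g :: "('a \<Rightarrow> 'a) \<Rightarrow> real"
  proof -
    define m where "m = avg (perms S) g"
    have "avg (perms S) (\<lambda>p. (g p - m)\<^sup>2) = avg (perms S) (\<lambda>p. (g p)\<^sup>2 + m\<^sup>2 - 2 * m * g p)"
      by (simp add: power2_diff algebra_simps)
    also have "\<dots> = avg (perms S) (\<lambda>p. (g p)\<^sup>2) - m\<^sup>2"
      using fin perms_nonempty[of S]
      by (simp add: avg_add avg_diff avg_const avg_cmult flip: m_def) (simp add: power2_eq_square)
    finally show ?thesis by (simp add: m_def)
  qed
  show ?thesis
    unfolding cmod_power2 minus_complex.sel Re Im avg_add var sum.distrib distrib_left
    by (intro add_mono perms_variance_left S)
qed

section \<open>Orthogonality relations for permutation pairings\<close>

text \<open>Symmetry and zero diagonal are required at all arguments, not only in \<open>S\<close>,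
  so that they can be rewritten without membership conditions.\<close>

definition doubly_centered :: "'a set \<Rightarrow> ('a \<Rightarrow> 'a \<Rightarrow> real) \<Rightarrow> bool" where
  "doubly_centered S u \<longleftrightarrow>
    (\<forall>x y. u x y = u y x) \<and> (\<forall>x. u x x = 0) \<and> (\<forall>x\<in>S. (\<Sum>y\<in>S. u x y) = 0)"

text \<open>Halving counts every unordered pair once: with the adjacency of a cycle as one factor,
  the pairing is a sum once around the cycle.\<close>

definition pairing ::
  "'a set \<Rightarrow> ('a \<Rightarrow> 'a \<Rightarrow> real) \<Rightarrow> ('a \<Rightarrow> 'a \<Rightarrow> real) \<Rightarrow> ('a \<Rightarrow> 'a) \<Rightarrow> ('a \<Rightarrow> 'a) \<Rightarrow> real" where
  "pairing S u w p q = (\<Sum>a\<in>S. \<Sum>b\<in>S. u (p a) (p b) * w (q a) (q b)) / 2"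

lemma doubly_centeredD:
  assumes "doubly_centered S u"
  shows "u x y = u y x" "u x x = 0" "x \<in> S \<Longrightarrow> (\<Sum>y\<in>S. u x y) = 0" "x \<in> S \<Longrightarrow> (\<Sum>y\<in>S. u y x) = 0"
proof -
  show *: "u x y = u y x" for x y using assms unfolding doubly_centered_def by blast
  show "u x x = 0" using assms by (simp add: doubly_centered_def)
  show **: "x \<in> S \<Longrightarrow> (\<Sum>y\<in>S. u x y) = 0" for x using assms unfolding doubly_centered_def by blast
  show "x \<in> S \<Longrightarrow> (\<Sum>y\<in>S. u y x) = 0" using ** by (subst *)
qed

lemma sum_permutes: "p permutes S \<Longrightarrow> (\<Sum>a\<in>S. f (p a)) = (\<Sum>a\<in>S. f a)"
  by (rule sum.reindex_bij_betw[OF permutes_imp_bij])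

lemma doubly_centered_permute:
  assumes "doubly_centered S u" "p permutes S"
  shows "doubly_centered S (\<lambda>a b. u (p a) (p b))"
  unfolding doubly_centered_def
proof (intro conjI allI ballI)
  fix x assume "x \<in> S"
  then have "p x \<in> S" using assms(2) by (simp add: permutes_in_image)
  then show "(\<Sum>y\<in>S. u (p x) (p y)) = 0"
    using sum_permutes[OF assms(2), of "u (p x)"] doubly_centeredD(3)[OF assms(1)] by simp
qed (use doubly_centeredD[OF assms(1)] in auto)

lemma permutes_ex_two_points:
  assumes "a \<in> S" "b \<in> S" "a' \<in> S" "b' \<in> S" "a \<noteq> b" "a' \<noteq> b'"
  shows "\<exists>p. p permutes S \<and> p a = a' \<and> p b = b'"
proof (intro exI conjI)
  let ?t = "transposition a a'"
  have tb: "?t b \<in> S" "?t b \<noteq> a'" using assms by (auto simp: Transposition.transpose_def)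
  show "transposition (?t b) b' \<circ> ?t permutes S"
    using assms tb by (intro permutes_compose permutes_swap_id)
  show "(transposition (?t b) b' \<circ> ?t) a = a'" "(transposition (?t b) b' \<circ> ?t) b = b'"
    using assms tb by simp_all
qed

lemma sum_remove_points:
  fixes f :: "'a \<Rightarrow> real"
  assumes "finite S" "A \<subseteq> S" "\<And>c. c \<in> S - A \<Longrightarrow> f c = k"
  shows "(\<Sum>c\<in>S. f c) = (\<Sum>c\<in>A. f c) + (real (card S) - real (card A)) * k"
proof -
  have "(\<Sum>c\<in>S. f c) = (\<Sum>c\<in>S - A. f c) + (\<Sum>c\<in>A. f c)"
    using assms by (intro sum.subset_diff)
  also have "(\<Sum>c\<in>S - A. f c) = real (card (S - A)) * k" using assms(3) by simp
  also have "real (card (S - A)) = real (card S) - real (card A)"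
    using assms by (simp add: card_Diff_subset finite_subset of_nat_diff card_mono)
  finally show ?thesis by simp
qed

text \<open>
  Doubly centered symmetric matrices with zero diagonal form the irreducible representation of
  the symmetric group attached to the partition \<open>(n-2,2)\<close>, of dimension \<open>n(n-3)/2\<close>;
  this is Schur orthogonality for its matrix coefficients.
\<close>

lemma pairing_orthogonality:
  assumes S: "finite S" "card S \<ge> 4"
    and u: "doubly_centered S u" and v: "doubly_centered S v"
    and w: "doubly_centered S w" and y: "doubly_centered S y"
    and p: "p permutes S" and q: "q permutes S"
  shows "avg (perms S) (\<lambda>r. pairing S u v p r * pairing S w y q r)
    = 2 / (real (card S) * (real (card S) - 3)) * pairing S v y id id * pairing S u w p q"
proof -
  define n where "n = real (card S)"
  have n: "n \<ge> 4" using S by (simp add: n_def)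
  define U where "U = (\<lambda>a b. u (p a) (p b))"
  define W where "W = (\<lambda>a b. w (q a) (q b))"
  have U: "doubly_centered S U" and W: "doubly_centered S W"
    unfolding U_def W_def using doubly_centered_permute[OF u p] doubly_centered_permute[OF w q] by auto
  \<comment> \<open>Invariance under a common permutation of the points leaves three values:
    \<open>t2\<close> if the pairs coincide, \<open>t1\<close> if they share one point,
    \<open>t0\<close> if they are disjoint. A repeated point inside a pair gives 0.\<close>
  define T where "T = (\<lambda>a b c d. avg (perms S) (\<lambda>r. v (r a) (r b) * y (r c) (r d)))"
  have inv: "T (t a) (t b) (t c) (t d) = T a b c d" if "t permutes S" for t a b c d
    using avg_perms_compose_right[OF that, of "\<lambda>r. v (r a) (r b) * y (r c) (r d)"] by (simp add: T_def)
  have sym: "T a b d c = T a b c d" "T b a c d = T a b c d" for a b c d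
    unfolding T_def by (simp_all add: doubly_centeredD(1)[OF v, of "_ b"] doubly_centeredD(1)[OF y, of "_ d"])
  have row: "(\<Sum>c\<in>S. T a b c d) = 0" if "d \<in> S" for a b d
  proof -
    have "(\<Sum>c\<in>S. T a b c d) = avg (perms S) (\<lambda>r. v (r a) (r b) * (\<Sum>c\<in>S. y (r c) (r d)))"
      by (simp add: T_def avg_sum[symmetric] sum_distrib_left)
    also have "\<dots> = avg (perms S) (\<lambda>r. 0)"
    proof (intro avg_cong)
      fix r assume r: "r \<in> perms S"
      then have "(\<Sum>c\<in>S. y (r c) (r d)) = 0"
        using doubly_centeredD(4)[OF doubly_centered_permute[OF y, of r] that] by simp
      then show "v (r a) (r b) * (\<Sum>c\<in>S. y (r c) (r d)) = 0" by simp
    qed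
    finally show ?thesis by (simp add: avg_def)
  qed
  have diag0: "T a a c d = 0" "T a b c c = 0" for a b c d
    by (simp_all add: T_def doubly_centeredD(2)[OF v] doubly_centeredD(2)[OF y] avg_def)
  define t2 where "t2 = 2 * pairing S v y id id / (n * (n - 1))"
  have t2: "T a b a b = t2" if ab: "a \<in> S" "b \<in> S" "a \<noteq> b" for a b
  proof -
    have same: "T a' b' a' b' = T a b a b" if "a' \<in> S" "b' \<in> S" "a' \<noteq> b'" for a' b'
      using permutes_ex_two_points[OF ab(1,2) that(1,2) ab(3) that(3)] inv by metis
    have "(\<Sum>a'\<in>S. \<Sum>b'\<in>S. T a' b' a' b') = (\<Sum>a'\<in>S. (n - 1) * T a b a b)"
    proof (intro sum.cong refl)
      fix a' assume a': "a' \<in> S"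
      have "(\<Sum>b'\<in>S. T a' b' a' b') = (\<Sum>b'\<in>{a'}. T a' b' a' b') + (n - real (card {a'})) * T a b a b"
        unfolding n_def using a' same S by (intro sum_remove_points) auto
      then show "(\<Sum>b'\<in>S. T a' b' a' b') = (n - 1) * T a b a b" by (simp add: diag0)
    qed
    also have "\<dots> = n * (n - 1) * T a b a b" by (simp add: n_def)
    also have "(\<Sum>a'\<in>S. \<Sum>b'\<in>S. T a' b' a' b')
        = avg (perms S) (\<lambda>r. \<Sum>a'\<in>S. \<Sum>b'\<in>S. v (r a') (r b') * y (r a') (r b'))"
      by (simp add: T_def avg_sum)
    also have "\<dots> = avg (perms S) (\<lambda>r. 2 * pairing S v y id id)"
    proof (intro avg_cong)
      fix r assume "r \<in> perms S"
      then have r: "r permutes S" by simp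
      have "(\<Sum>a'\<in>S. \<Sum>b'\<in>S. v (r a') (r b') * y (r a') (r b')) = (\<Sum>a'\<in>S. \<Sum>b'\<in>S. v (r a') b' * y (r a') b')"
        by (intro sum.cong refl sum_permutes[OF r])
      also have "\<dots> = (\<Sum>a'\<in>S. \<Sum>b'\<in>S. v a' b' * y a' b')"
        by (rule sum_permutes[OF r, of "\<lambda>x. \<Sum>b'\<in>S. v x b' * y x b'"])
      finally show "(\<Sum>a'\<in>S. \<Sum>b'\<in>S. v (r a') (r b') * y (r a') (r b')) = 2 * pairing S v y id id"
        by (simp add: pairing_def)
    qed
    also have "\<dots> = 2 * pairing S v y id id"
      using S by (intro avg_const finite_permutations perms_nonempty)
    finally show ?thesis using n by (simp add: t2_def field_simps)
  qed
  \<comment> \<open>Sums over \<open>c\<close> vanish. For a second pair \<open>c, a\<close> this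
    reads t2 + (n-2) t1 = 0, and for \<open>c, d\<close> with \<open>d\<close> outside the first
    pair it reads 2 t1 + (n-3) t0 = 0.\<close>
  define t1 where "t1 = - t2 / (n - 2)"
  define t0 where "t0 = - 2 * t1 / (n - 3)"
  have t1: "T a b a c = t1" if abc: "a \<in> S" "b \<in> S" "a \<noteq> b" "c \<in> S" "c \<noteq> a" "c \<noteq> b" for a b c
  proof -
    have same: "T a b c' a = T a b c a" if "c' \<in> S - {a, b}" for c'
      using inv[of "transposition c c'" a b c a] permutes_swap_id[of c S c'] abc that
      by (auto simp: Transposition.transpose_def)
    have "(\<Sum>c\<in>S. T a b c a) = (\<Sum>c\<in>{a, b}. T a b c a) + (n - real (card {a, b})) * T a b c a"
      unfolding n_def by (rule sum_remove_points[OF S(1) _ same]) (use abc in auto)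
    then have "T a b a b + (n - 2) * T a b a c = 0"
      using row[OF abc(1), of a b] abc(3) by (simp add: diag0 sym(1)[of a b a])
    then show ?thesis using n t2[OF abc(1-3)] by (simp add: t1_def field_simps)
  qed
  have t0: "T a b c d = t0" if abc: "a \<in> S" "b \<in> S" "a \<noteq> b" "c \<in> S" "c \<noteq> a" "c \<noteq> b"
      and d: "d \<in> S" "d \<noteq> a" "d \<noteq> b" "c \<noteq> d" for a b c d
  proof -
    have same: "T a b c' d = T a b c d" if "c' \<in> S - {a, b, d}" for c'
      using inv[of "transposition c c'" a b c d] permutes_swap_id[of c S c'] abc d that
      by (auto simp: Transposition.transpose_def)
    have "(\<Sum>c\<in>S. T a b c d) = (\<Sum>c\<in>{a, b, d}. T a b c d) + (n - real (card {a, b, d})) * T a b c d"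
      unfolding n_def by (rule sum_remove_points[OF S(1) _ same]) (use abc d in auto)
    moreover have "T a b b d = t1" using t1[of b a d] abc d sym(2)[of b a] by simp
    ultimately have "2 * t1 + (n - 3) * T a b c d = 0"
      using row[OF d(1), of a b] abc d t1[of a b d] by (simp add: diag0)
    then show ?thesis using n by (simp add: t0_def field_simps)
  qed
  define \<delta> where "\<delta> = (\<lambda>x z::'a. if x = z then 1 else (0::real))"
  define \<kappa> where "\<kappa> = t2 - 2 * t1 + t0"
  \<comment> \<open>Terms with at most one delta are annihilated when summed against the doubly
    centered \<open>W\<close>, so that only the coefficient \<kappa> survives.\<close>
  have T: "T a b c d = \<kappa> * (\<delta> c a * \<delta> d b + \<delta> c b * \<delta> d a) + (t1 - t0) * (\<delta> c a + \<delta> c b + \<delta> d a + \<delta> d b) + t0"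
    if "a \<in> S" "b \<in> S" "a \<noteq> b" "c \<in> S" "d \<in> S" "c \<noteq> d" for a b c d
  proof -
    consider "c = a" "d = b" | "c = b" "d = a" | "c = a" "d \<noteq> b" | "c = b" "d \<noteq> a"
      | "d = a" "c \<noteq> b" | "d = b" "c \<noteq> a" | "c \<noteq> a" "c \<noteq> b" "d \<noteq> a" "d \<noteq> b" by blast
    then show ?thesis
    proof cases
      case 1 then show ?thesis using that t2[of a b] by (simp add: \<delta>_def \<kappa>_def)
    next
      case 2 then show ?thesis using that t2[of a b] sym(1)[of a b a b] by (simp add: \<delta>_def \<kappa>_def)
    next
      case 3 then show ?thesis using that t1[of a b d] by (simp add: \<delta>_def)
    next
      case 4 then show ?thesis using that t1[of b a d] sym(2)[of b a b d] by (simp add: \<delta>_def)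
    next
      case 5 then show ?thesis using that t1[of a b c] sym(1)[of a b a c] by (simp add: \<delta>_def)
    next
      case 6 then show ?thesis using that t1[of b a c] sym(1)[of a b b c] sym(2)[of b a b c] by (simp add: \<delta>_def)
    next
      case 7 then show ?thesis using that t0[of a b c d] by (simp add: \<delta>_def)
    qed
  qed
  have inner: "(\<Sum>c\<in>S. \<Sum>d\<in>S. W c d * T a b c d) = 2 * \<kappa> * W a b" if ab: "a \<in> S" "b \<in> S" "a \<noteq> b" for a b
  proof -
    have "(\<Sum>c\<in>S. \<Sum>d\<in>S. W c d * T a b c d) = (\<Sum>c\<in>S. \<Sum>d\<in>S. W c d *
        (\<kappa> * (\<delta> c a * \<delta> d b + \<delta> c b * \<delta> d a) + (t1 - t0) * (\<delta> c a + \<delta> c b + \<delta> d a + \<delta> d b) + t0))"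
    proof (intro sum.cong refl)
      fix c d assume cd: "c \<in> S" "d \<in> S"
      then show "W c d * T a b c d = W c d *
        (\<kappa> * (\<delta> c a * \<delta> d b + \<delta> c b * \<delta> d a) + (t1 - t0) * (\<delta> c a + \<delta> c b + \<delta> d a + \<delta> d b) + t0)"
        using T[OF ab cd] doubly_centeredD(2)[OF W] by (cases "c = d") simp_all
    qed
    also have "\<dots> = \<kappa> * (W a b + W b a) + (t1 - t0) * ((\<Sum>d\<in>S. W a d) + (\<Sum>d\<in>S. W b d) + (\<Sum>c\<in>S. W c a) + (\<Sum>c\<in>S. W c b))
        + t0 * (\<Sum>c\<in>S. \<Sum>d\<in>S. W c d)"
    proof -
      have d1: "(\<Sum>c\<in>S. \<Sum>d\<in>S. W c d * (\<delta> c e * \<delta> d f)) = W e f" if "e \<in> S" "f \<in> S" for e f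
      proof -
        have "(\<Sum>c\<in>S. \<Sum>d\<in>S. W c d * (\<delta> c e * \<delta> d f))
            = (\<Sum>c\<in>S. \<Sum>d\<in>S. if d = f then if c = e then W c d else 0 else 0)"
          by (intro sum.cong refl) (simp add: \<delta>_def)
        then show ?thesis using S that by simp
      qed
      have d3: "(\<Sum>c\<in>S. \<Sum>d\<in>S. W c d * \<delta> d e) = (\<Sum>c\<in>S. W c e)" if "e \<in> S" for e
      proof -
        have "(\<Sum>c\<in>S. \<Sum>d\<in>S. W c d * \<delta> d e) = (\<Sum>c\<in>S. \<Sum>d\<in>S. if d = e then W c d else 0)"
          by (intro sum.cong refl) (simp add: \<delta>_def)
        then show ?thesis using S that by simp
      qed
      have d2: "(\<Sum>c\<in>S. \<Sum>d\<in>S. W c d * \<delta> c e) = (\<Sum>d\<in>S. W e d)" if "e \<in> S" for e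
      proof -
        have "(\<Sum>c\<in>S. \<Sum>d\<in>S. W c d * \<delta> c e) = (\<Sum>d\<in>S. \<Sum>c\<in>S. W c d * \<delta> c e)"
          by (rule sum.swap)
        also have "\<dots> = (\<Sum>d\<in>S. \<Sum>c\<in>S. if c = e then W c d else 0)"
          by (intro sum.cong refl) (simp add: \<delta>_def)
        finally show ?thesis using S that by simp
      qed
      have "(\<Sum>c\<in>S. \<Sum>d\<in>S. W c d *
        (\<kappa> * (\<delta> c a * \<delta> d b + \<delta> c b * \<delta> d a) + (t1 - t0) * (\<delta> c a + \<delta> c b + \<delta> d a + \<delta> d b) + t0))
       = (\<Sum>c\<in>S. \<Sum>d\<in>S. \<kappa> * (W c d * (\<delta> c a * \<delta> d b)) + \<kappa> * (W c d * (\<delta> c b * \<delta> d a))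
        + (t1 - t0) * (W c d * \<delta> c a) + (t1 - t0) * (W c d * \<delta> c b) + (t1 - t0) * (W c d * \<delta> d a)
        + (t1 - t0) * (W c d * \<delta> d b) + t0 * W c d)"
        by (intro sum.cong refl) (simp only: distrib_left mult_ac add_ac)
      then show ?thesis using ab
        by (simp only: sum.distrib sum_distrib_left[symmetric] d1 d2 d3) (simp add: algebra_simps)
    qed
    also have "\<dots> = 2 * \<kappa> * W a b"
      using ab doubly_centeredD(1)[OF W, of b a] by (simp add: doubly_centeredD(3,4)[OF W])
    finally show ?thesis .
  qed
  have "avg (perms S) (\<lambda>r. pairing S u v p r * pairing S w y q r)
     = avg (perms S) (\<lambda>r. \<Sum>a\<in>S. \<Sum>b\<in>S. \<Sum>c\<in>S. \<Sum>d\<in>S. (U a b * W c d / 4) * (v (r a) (r b) * y (r c) (r d)))"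
  proof (intro avg_cong)
    fix r
    have "pairing S u v p r * pairing S w y q r =
        (\<Sum>a\<in>S. \<Sum>b\<in>S. U a b * v (r a) (r b)) * (\<Sum>c\<in>S. \<Sum>d\<in>S. W c d * y (r c) (r d)) / 4"
      by (simp add: pairing_def U_def W_def)
    also have "\<dots> = (\<Sum>a\<in>S. \<Sum>b\<in>S. \<Sum>c\<in>S. \<Sum>d\<in>S. U a b * v (r a) (r b) * (W c d * y (r c) (r d)) / 4)"
      unfolding sum_distrib_right unfolding sum_distrib_left sum_divide_distrib ..
    also have "\<dots> = (\<Sum>a\<in>S. \<Sum>b\<in>S. \<Sum>c\<in>S. \<Sum>d\<in>S. (U a b * W c d / 4) * (v (r a) (r b) * y (r c) (r d)))"
      by (intro sum.cong refl) simp
    finally show "pairing S u v p r * pairing S w y q r =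
      (\<Sum>a\<in>S. \<Sum>b\<in>S. \<Sum>c\<in>S. \<Sum>d\<in>S. (U a b * W c d / 4) * (v (r a) (r b) * y (r c) (r d)))" .
  qed
  also have "\<dots> = (\<Sum>a\<in>S. \<Sum>b\<in>S. \<Sum>c\<in>S. \<Sum>d\<in>S. (U a b * W c d / 4) * T a b c d)"
    by (simp only: avg_sum avg_cmult T_def)
  also have "\<dots> = (\<Sum>a\<in>S. \<Sum>b\<in>S. U a b / 4 * (\<Sum>c\<in>S. \<Sum>d\<in>S. W c d * T a b c d))"
    unfolding sum_distrib_left by (intro sum.cong refl) simp
  also have "\<dots> = (\<Sum>a\<in>S. \<Sum>b\<in>S. U a b / 4 * (2 * \<kappa> * W a b))"
  proof (intro sum.cong refl)
    fix a b assume "a \<in> S" "b \<in> S"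
    then show "U a b / 4 * (\<Sum>c\<in>S. \<Sum>d\<in>S. W c d * T a b c d) = U a b / 4 * (2 * \<kappa> * W a b)"
      using inner[of a b] doubly_centeredD(2)[OF U] by (cases "a = b") simp_all
  qed
  also have "\<dots> = \<kappa> * pairing S u w p q"
    unfolding pairing_def U_def W_def sum_divide_distrib sum_distrib_left
    by (intro sum.cong refl) simp
  \<comment> \<open>The recurrences give \<kappa> (n-3) = t2 (n-1), which turns the factor
    2/(n(n-1)) inside \<open>t2\<close> into the inverse 2/(n(n-3)) of the dimension.\<close>
  also have "\<kappa> = 2 / (n * (n - 3)) * pairing S v y id id"
  proof -
    have e: "t1 * (n - 2) = - t2" "t0 * (n - 3) = - 2 * t1" using n by (simp_all add: t0_def t1_def)
    have "\<kappa> * ((n - 2) * (n - 3)) = t2 * ((n - 2) * (n - 3)) - 2 * (t1 * (n - 2)) * (n - 3) + t0 * (n - 3) * (n - 2)"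
      by (simp add: \<kappa>_def algebra_simps)
    also have "\<dots> = t2 * ((n - 2) * (n - 3)) + 2 * t2 * (n - 3) - 2 * (t1 * (n - 2))"
      unfolding e by (simp add: e)
    also have "\<dots> = t2 * ((n - 1) * (n - 2))" unfolding e by (simp add: algebra_simps)
    finally have "\<kappa> * ((n - 2) * (n - 3)) = t2 * ((n - 1) * (n - 2))" .
    then have "\<kappa> * (n - 3) = t2 * (n - 1)" using n by simp
    moreover have "t2 * (n * (n - 1)) = 2 * pairing S v y id id" using n by (simp add: t2_def)
    moreover have "\<kappa> * (n * (n - 3)) = n * (\<kappa> * (n - 3))" "n * (t2 * (n - 1)) = t2 * (n * (n - 1))" by simp_all
    ultimately have "\<kappa> * (n * (n - 3)) = 2 * pairing S v y id id" by (simp only:)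
    then show ?thesis using n by (simp add: field_simps)
  qed
  finally show ?thesis by (simp add: n_def)
qed

section \<open>Matrices built from degenerate kernels\<close>

definition kernel_matrix :: "('s \<Rightarrow> 's \<Rightarrow> real) \<Rightarrow> (nat \<Rightarrow> 's) \<Rightarrow> nat \<Rightarrow> nat \<Rightarrow> real" where
  "kernel_matrix h R j k = (if j = k then 0 else h (R j) (R k))"

text \<open>
  The maps \<open>act i\<close> stand for the transpositions of the symmetric group. The assumption
  \<open>h_gram\<close> bounds the Hilbert-Schmidt norm of the Gram matrix of the increments of \<open>h\<close>
  under these maps, which controls the Dirichlet form of a quadratic form in \<open>h\<close>.
\<close>

locale degenerate_kernel =
  fixes S :: "'s set" and h :: "'s \<Rightarrow> 's \<Rightarrow> real" and I :: "'i set" and act :: "'i \<Rightarrow> 's \<Rightarrow> 's"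
    and H v \<kappa> c \<delta> \<theta> :: real
  assumes S: "finite S" "S \<noteq> {}"
    and I: "finite I"
    and h_sym: "h q r = h r q"
    and h_bound: "q \<in> S \<Longrightarrow> r \<in> S \<Longrightarrow> \<bar>h q r\<bar> \<le> H"
    and h_var: "r \<in> S \<Longrightarrow> avg S (\<lambda>q. h q r * h q r) = v"
    and h_cov: "avg S (\<lambda>r. avg S (\<lambda>r'. (avg S (\<lambda>q. h q r * h q r'))\<^sup>2)) \<le> \<kappa>"
    and c0: "c \<ge> 0"
    and poincare: "\<And>f :: 's \<Rightarrow> complex. avg S (\<lambda>q. (cmod (f q - avg S f))\<^sup>2)
      \<le> c * (\<Sum>i\<in>I. avg S (\<lambda>q. (cmod (f q - f (act i q)))\<^sup>2))"
    and h_lip: "i \<in> I \<Longrightarrow> q \<in> S \<Longrightarrow> r \<in> S \<Longrightarrow> \<bar>h (act i q) r - h q r\<bar> \<le> \<delta>"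
    and h_gram: "q \<in> S \<Longrightarrow> (\<Sum>i\<in>I. \<Sum>k\<in>I.
      (avg S (\<lambda>r. (h (act i q) r - h q r) * (h (act k q) r - h q r)))\<^sup>2) \<le> \<theta>"
begin

lemma h_bound_sq: "q \<in> S \<Longrightarrow> r \<in> S \<Longrightarrow> (h q r)\<^sup>2 \<le> H\<^sup>2"
  using h_bound[of q r] by (metis abs_ge_zero power2_abs power_mono)

lemma h_var': "q \<in> S \<Longrightarrow> avg S (\<lambda>r. (h q r)\<^sup>2) = v"
  using h_var[of q] by (simp add: power2_eq_square h_sym[of q])

lemma v_nonneg: "v \<ge> 0"
  using S h_var' by (metis all_not_in_conv avg_nonneg zero_le_power2)

lemma symmetric_kernel_matrix: "symmetric_on J (kernel_matrix h R)"
  by (auto simp: symmetric_on_def kernel_matrix_def h_sym)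

text \<open>The quadratic form in the Schur complement, with the deleted permutation as a separate
  variable \<open>q\<close>: for fixed \<open>R\<close> the resolvent is constant and only
  \<open>q\<close> is random.\<close>

definition quad :: "nat set \<Rightarrow> complex \<Rightarrow> (nat \<Rightarrow> 's) \<Rightarrow> 's \<Rightarrow> complex" where
  "quad J z R q = (\<Sum>j\<in>J. \<Sum>k\<in>J. of_real (h q (R j) * h q (R k)) * resolvent J (kernel_matrix h R) z j k)"

text \<open>Distinct \<open>R j\<close> and \<open>R k\<close> are independent, so only the terms
  with \<open>j = k\<close> exceed \<open>v\<^sup>2\<close>, and for these the supremum bound
  \<open>H\<close> suffices.\<close>

lemma fourth_moment_row:
  fixes J :: "nat set"
  assumes J: "finite J" and q: "q \<in> S"
  shows "avg (PiE J (\<lambda>_. S)) (\<lambda>R. (\<Sum>j\<in>J. (h q (R j))\<^sup>2)\<^sup>2) \<le> (real (card J))\<^sup>2 * v\<^sup>2 + real (card J) * (H\<^sup>2 * v)"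
proof -
  have "avg (PiE J (\<lambda>_. S)) (\<lambda>R. (\<Sum>j\<in>J. (h q (R j))\<^sup>2)\<^sup>2)
      = (\<Sum>j\<in>J. \<Sum>k\<in>J. avg (PiE J (\<lambda>_. S)) (\<lambda>R. (h q (R j))\<^sup>2 * (h q (R k))\<^sup>2))"
    unfolding power2_eq_square[of "sum _ _"] sum_product avg_sum ..
  also have "\<dots> \<le> (\<Sum>j\<in>J. \<Sum>k\<in>J. v\<^sup>2 + (if j = k then H\<^sup>2 * v else 0))"
  proof (intro sum_mono)
    fix j k assume jk: "j \<in> J" "k \<in> J"
    show "avg (PiE J (\<lambda>_. S)) (\<lambda>R. (h q (R j))\<^sup>2 * (h q (R k))\<^sup>2) \<le> v\<^sup>2 + (if j = k then H\<^sup>2 * v else 0)"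
    proof (cases "j = k")
      case True
      have "avg (PiE J (\<lambda>_. S)) (\<lambda>R. (h q (R j))\<^sup>2 * (h q (R k))\<^sup>2) = avg S (\<lambda>r. (h q r)\<^sup>2 * (h q r)\<^sup>2)"
        using avg_PiE_eval[OF S J jk(2), of "\<lambda>r. (h q r)\<^sup>2 * (h q r)\<^sup>2"] True by simp
      also have "\<dots> \<le> avg S (\<lambda>r. H\<^sup>2 * (h q r)\<^sup>2)"
        using q by (intro avg_mono mult_right_mono h_bound_sq) auto
      also have "\<dots> = H\<^sup>2 * v" by (simp add: avg_cmult h_var' q)
      finally show ?thesis using True by (simp add: add_increasing)
    next
      case False
      have "avg (PiE J (\<lambda>_. S)) (\<lambda>R. (h q (R j))\<^sup>2 * (h q (R k))\<^sup>2) = avg S (\<lambda>r. avg S (\<lambda>r'. (h q r)\<^sup>2 * (h q r')\<^sup>2))"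
        by (rule avg_PiE_eval2[OF S J jk False])
      also have "\<dots> = v * v" by (simp add: avg_cmult avg_multc h_var' q)
      finally show ?thesis using False by (simp add: power2_eq_square)
    qed
  qed
  also have "\<dots> = (real (card J))\<^sup>2 * v\<^sup>2 + real (card J) * (H\<^sup>2 * v)"
    using J by (simp add: sum.distrib power2_eq_square algebra_simps)
  finally show ?thesis .
qed

text \<open>Gram matrix, over all moves in \<open>I\<close>, of the increments of one row. Its form
  at a vector \<open>w\<close> is the linear part of the Dirichlet form of
  \<open>quad\<close>.\<close>

definition gram :: "(nat \<Rightarrow> 's) \<Rightarrow> 's \<Rightarrow> nat \<Rightarrow> nat \<Rightarrow> real" where
  "gram R q j k = (\<Sum>i\<in>I. (h (act i q) (R j) - h q (R j)) * (h (act i q) (R k) - h q (R k)))"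

text \<open>A Gram matrix indexed by ranks and the one indexed by moves have the same
  Hilbert-Schmidt norm. Averaging an entry with \<open>j \<noteq> k\<close> over two independent
  arguments passes to moves, where \<open>h_gram\<close> applies; the diagonal is bounded entrywise
  by \<open>\<delta>\<close>.\<close>

lemma gram_HS:
  assumes J: "finite J" and q: "q \<in> S"
  shows "avg (PiE J (\<lambda>_. S)) (\<lambda>R. \<Sum>j\<in>J. \<Sum>k\<in>J. (gram R q j k)\<^sup>2)
    \<le> (real (card J))\<^sup>2 * \<theta> + real (card J) * ((real (card I))\<^sup>2 * \<delta> ^ 4)"
proof -
  define D where "D = (\<lambda>i r. h (act i q) r - h q r)"
  have \<theta>: "\<theta> \<ge> 0" by (rule order.trans[OF _ h_gram[OF q]]) (simp add: sum_nonneg)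
  have "avg (PiE J (\<lambda>_. S)) (\<lambda>R. \<Sum>j\<in>J. \<Sum>k\<in>J. (gram R q j k)\<^sup>2)
      = (\<Sum>j\<in>J. \<Sum>k\<in>J. avg (PiE J (\<lambda>_. S)) (\<lambda>R. (\<Sum>i\<in>I. D i (R j) * D i (R k))\<^sup>2))"
    unfolding avg_sum gram_def D_def ..
  also have "\<dots> \<le> (\<Sum>j\<in>J. \<Sum>k\<in>J. \<theta> + (if j = k then (real (card I))\<^sup>2 * \<delta> ^ 4 else 0))"
  proof (intro sum_mono)
    fix j k assume jk: "j \<in> J" "k \<in> J"
    show "avg (PiE J (\<lambda>_. S)) (\<lambda>R. (\<Sum>i\<in>I. D i (R j) * D i (R k))\<^sup>2)
        \<le> \<theta> + (if j = k then (real (card I))\<^sup>2 * \<delta> ^ 4 else 0)"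
    proof (cases "j = k")
      case True
      have "avg (PiE J (\<lambda>_. S)) (\<lambda>R. (\<Sum>i\<in>I. D i (R j) * D i (R k))\<^sup>2)
          = avg S (\<lambda>r. (\<Sum>i\<in>I. D i r * D i r)\<^sup>2)"
        using avg_PiE_eval[OF S J jk(2), of "\<lambda>r. (\<Sum>i\<in>I. D i r * D i r)\<^sup>2"] True by simp
      also have "\<dots> \<le> (real (card I) * \<delta>\<^sup>2)\<^sup>2"
      proof (intro avg_le_const[OF S] power_mono sum_nonneg)
        fix r assume r: "r \<in> S"
        have "(\<Sum>i\<in>I. D i r * D i r) \<le> (\<Sum>i\<in>I. \<delta>\<^sup>2)"
        proof (intro sum_mono)
          fix i assume "i \<in> I"
          then have "\<bar>D i r\<bar> \<le> \<delta>" using h_lip q r by (simp add: D_def)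
          then show "D i r * D i r \<le> \<delta>\<^sup>2"
            by (metis abs_ge_zero power2_abs power2_eq_square power_mono)
        qed
        then show "(\<Sum>i\<in>I. D i r * D i r) \<le> real (card I) * \<delta>\<^sup>2" by simp
      qed simp
      also have "\<dots> = (real (card I))\<^sup>2 * \<delta> ^ 4" by (simp add: power_mult_distrib flip: power_mult)
      finally show ?thesis using True \<theta> by simp
    next
      case False
      have "avg (PiE J (\<lambda>_. S)) (\<lambda>R. (\<Sum>i\<in>I. D i (R j) * D i (R k))\<^sup>2)
          = avg S (\<lambda>r. avg S (\<lambda>r'. (\<Sum>i\<in>I. D i r * D i r')\<^sup>2))"
        by (rule avg_PiE_eval2[OF S J jk False])
      also have "\<dots> = avg S (\<lambda>r. avg S (\<lambda>r'. \<Sum>i\<in>I. \<Sum>k\<in>I. (D i r * D k r) * (D i r' * D k r')))"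
        unfolding power2_eq_square sum_product by (intro avg_cong sum.cong refl) (simp add: mult_ac)
      also have "\<dots> = (\<Sum>i\<in>I. \<Sum>k\<in>I. (avg S (\<lambda>r. D i r * D k r))\<^sup>2)"
        by (simp add: avg_sum avg_cmult avg_multc power2_eq_square)
      also have "\<dots> \<le> \<theta>" using h_gram[OF q] by (simp add: D_def)
      finally show ?thesis using False by simp
    qed
  qed
  also have "\<dots> = (real (card J))\<^sup>2 * \<theta> + real (card J) * ((real (card I))\<^sup>2 * \<delta> ^ 4)"
    using J by (simp add: sum.distrib power2_eq_square algebra_simps)
  finally show ?thesis .
qed

text \<open>A move replaces the row a by a + d and changes the form by 2 d.w + d.Gd with w = Ga. The
  part quadratic in d is bounded move by move. The linear part must be summed over all moves at
  once: for the Chatterjee kernel, bounding each d.w by the norms of d and w gives order n in total,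
  which the Poincare factor 1/(2n) does not make small, whereas the Gram matrix gives order sqrt n
  on average.\<close>

lemma quad_increment:
  assumes J: "finite J" and z: "Im z > 0" and R: "R \<in> PiE J (\<lambda>_. S)" and q: "q \<in> S" and t: "t > 0"
  defines "\<eta> \<equiv> Im z"
  shows "(\<Sum>i\<in>I. (cmod (quad J z R q - quad J z R (act i q)))\<^sup>2)
    \<le> 4 * (t * (\<Sum>j\<in>J. (h q (R j))\<^sup>2)\<^sup>2 / \<eta> ^ 4 + (\<Sum>j\<in>J. \<Sum>k\<in>J. (gram R q j k)\<^sup>2) / t)
      + 2 * real (card I) * ((real (card J))\<^sup>2 * \<delta> ^ 4) / \<eta>\<^sup>2"
proof -
  define G where "G = resolvent J (kernel_matrix h R) z"
  note sym = symmetric_kernel_matrix[of J R]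
  have G: "symmetric_on J G" unfolding G_def by (rule symmetric_on_resolvent[OF J sym z])
  define a where "a = (\<lambda>j. complex_of_real (h q (R j)))"
  define d where "d = (\<lambda>i j. complex_of_real (h (act i q) (R j) - h q (R j)))"
  define w where "w = (\<lambda>j. \<Sum>k\<in>J. G j k * a k)"
  have incr: "quad J z R (act i q) - quad J z R q = 2 * (\<Sum>j\<in>J. d i j * w j) + (\<Sum>j\<in>J. d i j * (\<Sum>k\<in>J. G j k * d i k))"
    for i
  proof -
    have "quad J z R (act i q) - quad J z R q
      = (\<Sum>j\<in>J. \<Sum>k\<in>J. ((a j + d i j) * (a k + d i k) - a j * a k) * G j k)"
      unfolding quad_def G_def[symmetric] sum_subtractf[symmetric]
      by (intro sum.cong refl) (simp add: a_def d_def algebra_simps)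
    also have "\<dots> = (\<Sum>j\<in>J. \<Sum>k\<in>J. d i j * (G j k * a k)) + (\<Sum>j\<in>J. \<Sum>k\<in>J. d i k * (G j k * a j))
       + (\<Sum>j\<in>J. \<Sum>k\<in>J. d i j * (G j k * d i k))"
      unfolding sum.distrib[symmetric] by (intro sum.cong refl) (simp add: algebra_simps)
    also have "(\<Sum>j\<in>J. \<Sum>k\<in>J. d i k * (G j k * a j)) = (\<Sum>k\<in>J. \<Sum>j\<in>J. d i k * (G j k * a j))"
      by (rule sum.swap)
    also have "\<dots> = (\<Sum>k\<in>J. \<Sum>j\<in>J. d i k * (G k j * a j))"
      by (intro sum.cong refl) (simp add: symmetric_onD[OF G])
    finally show ?thesis by (simp add: w_def sum_distrib_left)
  qed
  have second: "(cmod (\<Sum>j\<in>J. d i j * (\<Sum>k\<in>J. G j k * d i k)))\<^sup>2 \<le> (real (card J))\<^sup>2 * \<delta> ^ 4 / \<eta>\<^sup>2" if i: "i \<in> I" for i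
  proof -
    have "(\<Sum>j\<in>J. (cmod (d i j))\<^sup>2) \<le> (\<Sum>j\<in>J. \<delta>\<^sup>2)"
    proof (intro sum_mono power_mono)
      fix j assume "j \<in> J"
      then have "R j \<in> S" using R by (auto simp: PiE_iff)
      then show "cmod (d i j) \<le> \<delta>" unfolding d_def norm_of_real by (rule h_lip[OF i q])
    qed simp
    then have dd: "(\<Sum>j\<in>J. (cmod (d i j))\<^sup>2) \<le> real (card J) * \<delta>\<^sup>2" by simp
    have "(cmod (\<Sum>j\<in>J. d i j * (\<Sum>k\<in>J. G j k * d i k)))\<^sup>2
        \<le> (\<Sum>j\<in>J. (cmod (d i j))\<^sup>2) * (\<Sum>j\<in>J. (cmod (\<Sum>k\<in>J. G j k * d i k))\<^sup>2)"
      by (rule Cauchy_Schwarz_cmod_sum)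
    also have "\<dots> \<le> (\<Sum>j\<in>J. (cmod (d i j))\<^sup>2) * ((\<Sum>j\<in>J. (cmod (d i j))\<^sup>2) / \<eta>\<^sup>2)"
      unfolding G_def \<eta>_def by (intro mult_left_mono resolvent_mult_bound[OF J sym z] sum_nonneg) auto
    also have "\<dots> = (\<Sum>j\<in>J. (cmod (d i j))\<^sup>2)\<^sup>2 / \<eta>\<^sup>2" by (simp add: power2_eq_square)
    also have "\<dots> \<le> (real (card J) * \<delta>\<^sup>2)\<^sup>2 / \<eta>\<^sup>2"
      by (intro divide_right_mono power_mono dd sum_nonneg) auto
    also have "\<dots> = (real (card J))\<^sup>2 * \<delta> ^ 4 / \<eta>\<^sup>2" by (simp add: power_mult_distrib flip: power_mult)
    finally show ?thesis .
  qed
  define Y where "Y = (\<Sum>i\<in>I. (cmod (\<Sum>j\<in>J. d i j * w j))\<^sup>2)"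
  define x where "x = (\<Sum>j\<in>J. (h q (R j))\<^sup>2)\<^sup>2 / \<eta> ^ 4"
  define y where "y = (\<Sum>j\<in>J. \<Sum>k\<in>J. (gram R q j k)\<^sup>2)"
  have "x \<ge> 0" by (simp add: x_def)
  have "y \<ge> 0" by (simp add: y_def sum_nonneg)
  \<comment> \<open>Expanding the squares and summing over the moves first gives the form of
    \<open>gram\<close> at \<open>w\<close>, to which Cauchy-Schwarz over pairs of indices
    applies.\<close>
  have "complex_of_real Y = (\<Sum>i\<in>I. (\<Sum>j\<in>J. d i j * w j) * cnj (\<Sum>j\<in>J. d i j * w j))"
    unfolding Y_def of_real_sum by (intro sum.cong refl) (simp only: complex_norm_square)
  also have "\<dots> = (\<Sum>i\<in>I. \<Sum>j\<in>J. \<Sum>k\<in>J. of_real ((h (act i q) (R j) - h q (R j)) * (h (act i q) (R k) - h q (R k))) * (w j * cnj (w k)))"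
    unfolding cnj_sum sum_product by (intro sum.cong refl) (simp add: d_def)
  also have "\<dots> = (\<Sum>j\<in>J. \<Sum>k\<in>J. \<Sum>i\<in>I. of_real ((h (act i q) (R j) - h q (R j)) * (h (act i q) (R k) - h q (R k))) * (w j * cnj (w k)))"
    by (subst sum.swap) (intro sum.cong refl sum.swap)
  also have "\<dots> = (\<Sum>j\<in>J. \<Sum>k\<in>J. of_real (gram R q j k) * (w j * cnj (w k)))"
    unfolding gram_def of_real_sum sum_distrib_right ..
  also have "\<dots> = (\<Sum>jk\<in>J \<times> J. of_real (gram R q (fst jk) (snd jk)) * (w (fst jk) * cnj (w (snd jk))))"
    by (simp add: sum.cartesian_product case_prod_unfold)
  finally have "(cmod (complex_of_real Y))\<^sup>2 \<le> (\<Sum>jk\<in>J \<times> J. (cmod (complex_of_real (gram R q (fst jk) (snd jk))))\<^sup>2) *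
      (\<Sum>jk\<in>J \<times> J. (cmod (w (fst jk) * cnj (w (snd jk))))\<^sup>2)"
    by (simp only: Cauchy_Schwarz_cmod_sum)
  also have "(\<Sum>jk\<in>J \<times> J. (cmod (complex_of_real (gram R q (fst jk) (snd jk))))\<^sup>2) = y"
    by (simp add: y_def sum.cartesian_product case_prod_unfold)
  also have "(\<Sum>jk\<in>J \<times> J. (cmod (w (fst jk) * cnj (w (snd jk))))\<^sup>2) = (\<Sum>j\<in>J. (cmod (w j))\<^sup>2)\<^sup>2"
    by (simp add: norm_mult power_mult_distrib sum.cartesian_product case_prod_unfold power2_eq_square[of "sum _ _"] sum_product)
  finally have "Y\<^sup>2 \<le> y * (\<Sum>j\<in>J. (cmod (w j))\<^sup>2)\<^sup>2" by simp
  also have "(\<Sum>j\<in>J. (cmod (w j))\<^sup>2)\<^sup>2 \<le> ((\<Sum>j\<in>J. (cmod (a j))\<^sup>2) / \<eta>\<^sup>2)\<^sup>2"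
    unfolding w_def G_def \<eta>_def by (intro power_mono resolvent_mult_bound[OF J sym z] sum_nonneg) auto
  also have "\<dots> = x" by (simp add: x_def a_def power_divide flip: power_mult)
  finally have Y2: "Y\<^sup>2 \<le> y * x" using \<open>y \<ge> 0\<close> by (simp add: mult_left_mono)
  \<comment> \<open>The bound by the square root of \<open>x * y\<close> is made linear because
    \<open>x\<close> and \<open>y\<close> are averaged over \<open>R\<close> separately.\<close>
  have Y: "Y \<le> (t * x + y / t) / 2"
  proof (rule power2_le_imp_le)
    have "((t * x + y / t) / 2)\<^sup>2 - y * x = ((t * x - y / t) / 2)\<^sup>2"
      using t by (simp add: power2_eq_square field_simps)
    then show "Y\<^sup>2 \<le> ((t * x + y / t) / 2)\<^sup>2" using Y2 by (smt (verit) zero_le_power2)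
    show "0 \<le> (t * x + y / t) / 2" using t \<open>x \<ge> 0\<close> \<open>y \<ge> 0\<close> by simp
  qed
  have "(\<Sum>i\<in>I. (cmod (quad J z R q - quad J z R (act i q)))\<^sup>2)
     \<le> (\<Sum>i\<in>I. 8 * (cmod (\<Sum>j\<in>J. d i j * w j))\<^sup>2 + 2 * ((real (card J))\<^sup>2 * \<delta> ^ 4 / \<eta>\<^sup>2))"
  proof (intro sum_mono)
    fix i assume i: "i \<in> I"
    define A where "A = cmod (\<Sum>j\<in>J. d i j * w j)"
    define B where "B = cmod (\<Sum>j\<in>J. d i j * (\<Sum>k\<in>J. G j k * d i k))"
    have "cmod (quad J z R q - quad J z R (act i q)) = cmod (quad J z R (act i q) - quad J z R q)"
      by (rule norm_minus_commute)
    also have "\<dots> \<le> 2 * A + B"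
      unfolding incr A_def B_def by (rule order.trans[OF norm_triangle_ineq]) (simp add: norm_mult)
    finally have "(cmod (quad J z R q - quad J z R (act i q)))\<^sup>2 \<le> (2 * A + B)\<^sup>2" by (simp add: power_mono)
    also have "\<dots> \<le> 8 * A\<^sup>2 + 2 * B\<^sup>2"
      using zero_le_power2[of "2 * A - B"] by (simp add: power2_eq_square algebra_simps)
    finally show "(cmod (quad J z R q - quad J z R (act i q)))\<^sup>2
      \<le> 8 * (cmod (\<Sum>j\<in>J. d i j * w j))\<^sup>2 + 2 * ((real (card J))\<^sup>2 * \<delta> ^ 4 / \<eta>\<^sup>2)"
      using second[OF i] unfolding A_def B_def by linarith
  qed
  also have "\<dots> = 8 * Y + 2 * real (card I) * ((real (card J))\<^sup>2 * \<delta> ^ 4) / \<eta>\<^sup>2"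
    by (simp add: sum.distrib Y_def sum_distrib_left)
  also have "\<dots> \<le> 4 * (t * x + y / t) + 2 * real (card I) * ((real (card J))\<^sup>2 * \<delta> ^ 4) / \<eta>\<^sup>2"
    using Y by simp
  finally show ?thesis by (simp add: x_def y_def)
qed

text \<open>The summand with factor \<open>c\<close> bounds the fluctuation of \<open>quad\<close>
  around its mean over \<open>q\<close>; the summand with \<open>\<kappa>\<close> bounds the
  distance of that mean from \<open>v\<close> times the trace. Both carry a factor 2 from squaring a
  sum.\<close>

definition error_bound :: "real \<Rightarrow> nat \<Rightarrow> real \<Rightarrow> real" where
  "error_bound \<eta> p t = 2 * c * (4 * (t * ((real p)\<^sup>2 * v\<^sup>2 + real p * (H\<^sup>2 * v)) / \<eta> ^ 4
      + ((real p)\<^sup>2 * \<theta> + real p * ((real (card I))\<^sup>2 * \<delta> ^ 4)) / t)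
      + 2 * real (card I) * ((real p)\<^sup>2 * \<delta> ^ 4) / \<eta>\<^sup>2) + 2 * ((real p) ^ 3 * \<kappa> / \<eta>\<^sup>2)"

text \<open>
  The free parameter \<open>t\<close> comes from an arithmetic-geometric mean step; later it is \<open>sqrt n\<close>.
\<close>

lemma quad_concentration:
  assumes J: "finite J" and z: "Im z > 0" and t: "t > 0"
  shows "avg (PiE J (\<lambda>_. S)) (\<lambda>R. avg S (\<lambda>q.
      (cmod (quad J z R q - of_real v * resolvent_trace J (kernel_matrix h R) z))\<^sup>2))
    \<le> error_bound (Im z) (card J) t"
proof -
  define \<eta> where "\<eta> = Im z"
  define P where "P = PiE J (\<lambda>_. S)"
  define p where "p = real (card J)"
  note P = finite_PiE_const[OF S J, folded P_def] PiE_const_nonempty[OF S J, folded P_def]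
  define G where "G = (\<lambda>R. resolvent J (kernel_matrix h R) z)"
  define cov where "cov = (\<lambda>r r'. avg S (\<lambda>q. h q r * h q r'))"
  have mean: "avg S (quad J z R) = (\<Sum>j\<in>J. \<Sum>k\<in>J. of_real (cov (R j) (R k)) * G R j k)" for R
  proof -
    have "of_real (cov r r') = avg S (\<lambda>q. complex_of_real (h q r * h q r'))" for r r'
      by (simp add: cov_def avg_def scaleR_conv_of_real)
    then show ?thesis unfolding quad_def[abs_def] avg_sum avg_multc G_def by simp
  qed
  \<comment> \<open>Split at the mean over \<open>q\<close>: \<open>n1\<close> is a variance in
    \<open>q\<close> for fixed \<open>R\<close>, left to the Poincare inequality, and
    \<open>n2\<close> is the squared bias of that mean.\<close>
  define n1 where "n1 = (\<lambda>R. avg S (\<lambda>q. (cmod (quad J z R q - avg S (quad J z R)))\<^sup>2))"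
  define n2 where "n2 = (\<lambda>R. (cmod (avg S (quad J z R) - of_real v * resolvent_trace J (kernel_matrix h R) z))\<^sup>2)"
  define B where "B = (\<lambda>R q. 4 * (t * (\<Sum>j\<in>J. (h q (R j))\<^sup>2)\<^sup>2 / \<eta> ^ 4 + (\<Sum>j\<in>J. \<Sum>k\<in>J. (gram R q j k)\<^sup>2) / t)
      + 2 * real (card I) * (p\<^sup>2 * \<delta> ^ 4) / \<eta>\<^sup>2)"
  have "avg P n1 \<le> avg P (\<lambda>R. c * avg S (\<lambda>q. B R q))"
  proof (intro avg_mono)
    fix R assume R: "R \<in> P"
    have "n1 R \<le> c * (\<Sum>i\<in>I. avg S (\<lambda>q. (cmod (quad J z R q - quad J z R (act i q)))\<^sup>2))"
      unfolding n1_def by (rule poincare)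
    also have "\<dots> = c * avg S (\<lambda>q. \<Sum>i\<in>I. (cmod (quad J z R q - quad J z R (act i q)))\<^sup>2)"
      by (simp only: avg_sum)
    also have "\<dots> \<le> c * avg S (\<lambda>q. B R q)"
      unfolding B_def p_def \<eta>_def using R
      by (intro mult_left_mono avg_mono quad_increment J z t c0) (auto simp: P_def)
    finally show "n1 R \<le> c * avg S (\<lambda>q. B R q)" .
  qed
  also have "\<dots> = c * avg S (\<lambda>q. avg P (\<lambda>R. B R q))"
    by (subst avg_cmult, subst avg_swap) simp
  also have "\<dots> \<le> c * (4 * (t * (p\<^sup>2 * v\<^sup>2 + p * (H\<^sup>2 * v)) / \<eta> ^ 4 + (p\<^sup>2 * \<theta> + p * ((real (card I))\<^sup>2 * \<delta> ^ 4)) / t)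
      + 2 * real (card I) * (p\<^sup>2 * \<delta> ^ 4) / \<eta>\<^sup>2)"
  proof (intro mult_left_mono c0 avg_le_const[OF S])
    fix q assume q: "q \<in> S"
    have "avg P (\<lambda>R. B R q) = 4 * (t * avg P (\<lambda>R. (\<Sum>j\<in>J. (h q (R j))\<^sup>2)\<^sup>2) / \<eta> ^ 4 +
        avg P (\<lambda>R. \<Sum>j\<in>J. \<Sum>k\<in>J. (gram R q j k)\<^sup>2) / t) + 2 * real (card I) * (p\<^sup>2 * \<delta> ^ 4) / \<eta>\<^sup>2"
      unfolding B_def by (simp only: avg_add avg_cmult divide_inverse avg_multc avg_const[OF P])
    also have "\<dots> \<le> 4 * (t * (p\<^sup>2 * v\<^sup>2 + p * (H\<^sup>2 * v)) / \<eta> ^ 4 + (p\<^sup>2 * \<theta> + p * ((real (card I))\<^sup>2 * \<delta> ^ 4)) / t)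
      + 2 * real (card I) * (p\<^sup>2 * \<delta> ^ 4) / \<eta>\<^sup>2"
      unfolding P_def p_def using t
      by (intro add_mono mult_left_mono divide_right_mono fourth_moment_row[OF J q] gram_HS[OF J q] order.refl) auto
    finally show "avg P (\<lambda>R. B R q) \<le> \<dots>" .
  qed
  finally have n1: "avg P n1 \<le> c * (4 * (t * (p\<^sup>2 * v\<^sup>2 + p * (H\<^sup>2 * v)) / \<eta> ^ 4 + (p\<^sup>2 * \<theta> + p * ((real (card I))\<^sup>2 * \<delta> ^ 4)) / t)
      + 2 * real (card I) * (p\<^sup>2 * \<delta> ^ 4) / \<eta>\<^sup>2)" .
  \<comment> \<open>By \<open>h_var\<close> the diagonal of the covariances is exactly
    \<open>v\<close> and reproduces \<open>v\<close> times the trace. The rest is a pairing of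
    off-diagonal covariances with the resolvent; for \<open>j \<noteq> k\<close> the two ranks are
    independent, so \<open>h_cov\<close> controls the average square.\<close>
  have "avg P n2 \<le> avg P (\<lambda>R. (\<Sum>j\<in>J. \<Sum>k\<in>J. if j = k then 0 else (cov (R j) (R k))\<^sup>2) * (p / \<eta>\<^sup>2))"
  proof (intro avg_mono)
    fix R assume R: "R \<in> P"
    have diag: "cov (R j) (R j) = v" if "j \<in> J" for j
      using h_var[of "R j"] R that by (auto simp: cov_def P_def)
    define E where "E = (\<lambda>j k. complex_of_real (if j = k then 0 else cov (R j) (R k)))"
    have "avg S (quad J z R) - of_real v * resolvent_trace J (kernel_matrix h R) z = (\<Sum>j\<in>J. \<Sum>k\<in>J. E j k * G R j k)"
    proof -
      have "of_real v * resolvent_trace J (kernel_matrix h R) z = (\<Sum>j\<in>J. \<Sum>k\<in>J. if k = j then of_real v * G R j k else 0)"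
        using J by (simp add: resolvent_trace_def G_def sum_distrib_left)
      then show ?thesis unfolding mean
        by (simp only: sum_subtractf[symmetric]) (intro sum.cong refl, auto simp: E_def diag)
    qed
    also have "\<dots> = (\<Sum>jk\<in>J \<times> J. E (fst jk) (snd jk) * G R (fst jk) (snd jk))"
      by (simp add: sum.cartesian_product case_prod_unfold)
    finally have "n2 R \<le> (\<Sum>jk\<in>J \<times> J. (cmod (E (fst jk) (snd jk)))\<^sup>2) * (\<Sum>jk\<in>J \<times> J. (cmod (G R (fst jk) (snd jk)))\<^sup>2)"
      unfolding n2_def by (simp only: Cauchy_Schwarz_cmod_sum)
    also have "\<dots> = (\<Sum>j\<in>J. \<Sum>k\<in>J. (cmod (E j k))\<^sup>2) * (\<Sum>j\<in>J. \<Sum>k\<in>J. (cmod (G R j k))\<^sup>2)"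
      by (simp add: sum.cartesian_product case_prod_unfold)
    also have "\<dots> \<le> (\<Sum>j\<in>J. \<Sum>k\<in>J. (cmod (E j k))\<^sup>2) * (p / \<eta>\<^sup>2)"
      unfolding G_def p_def \<eta>_def
      by (intro mult_left_mono resolvent_HS_bound[OF J symmetric_kernel_matrix z] sum_nonneg) auto
    also have "(\<Sum>j\<in>J. \<Sum>k\<in>J. (cmod (E j k))\<^sup>2) = (\<Sum>j\<in>J. \<Sum>k\<in>J. if j = k then 0 else (cov (R j) (R k))\<^sup>2)"
      by (intro sum.cong refl) (auto simp: E_def)
    finally show "n2 R \<le> (\<Sum>j\<in>J. \<Sum>k\<in>J. if j = k then 0 else (cov (R j) (R k))\<^sup>2) * (p / \<eta>\<^sup>2)" .
  qed
  also have "\<dots> = (\<Sum>j\<in>J. \<Sum>k\<in>J. avg P (\<lambda>R. if j = k then 0 else (cov (R j) (R k))\<^sup>2)) * (p / \<eta>\<^sup>2)"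
    by (simp only: avg_multc avg_sum)
  also have "\<dots> \<le> (\<Sum>j\<in>J. \<Sum>k\<in>J. \<kappa>) * (p / \<eta>\<^sup>2)"
  proof (intro mult_right_mono sum_mono)
    fix j k assume jk: "j \<in> J" "k \<in> J"
    have "\<kappa> \<ge> 0" by (rule order.trans[OF _ h_cov]) (intro avg_nonneg, simp)
    then show "avg P (\<lambda>R. if j = k then 0 else (cov (R j) (R k))\<^sup>2) \<le> \<kappa>"
      using avg_PiE_eval2[OF S J jk, of "\<lambda>r r'. (cov r r')\<^sup>2"] h_cov
      by (cases "j = k") (simp_all add: avg_const[OF P, unfolded P_def] P_def cov_def)
  qed (simp add: p_def)
  also have "\<dots> = p ^ 3 * \<kappa> / \<eta>\<^sup>2" by (simp add: p_def power3_eq_cube)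
  finally have n2: "avg P n2 \<le> p ^ 3 * \<kappa> / \<eta>\<^sup>2" .
  have "avg P (\<lambda>R. avg S (\<lambda>q. (cmod (quad J z R q - of_real v * resolvent_trace J (kernel_matrix h R) z))\<^sup>2))
     \<le> avg P (\<lambda>R. 2 * n1 R + 2 * n2 R)"
  proof (intro avg_mono)
    fix R
    have "avg S (\<lambda>q. (cmod (quad J z R q - of_real v * resolvent_trace J (kernel_matrix h R) z))\<^sup>2)
       \<le> avg S (\<lambda>q. 2 * (cmod (quad J z R q - avg S (quad J z R)))\<^sup>2 + 2 * n2 R)"
    proof (intro avg_mono)
      fix q
      define A where "A = cmod (quad J z R q - avg S (quad J z R))"
      define B where "B = cmod (avg S (quad J z R) - of_real v * resolvent_trace J (kernel_matrix h R) z)"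
      have "cmod (quad J z R q - of_real v * resolvent_trace J (kernel_matrix h R) z) \<le> A + B"
        unfolding A_def B_def by (rule order.trans[OF _ norm_triangle_ineq]) simp
      then have "(cmod (quad J z R q - of_real v * resolvent_trace J (kernel_matrix h R) z))\<^sup>2 \<le> (A + B)\<^sup>2"
        by (simp add: power_mono)
      also have "\<dots> \<le> 2 * A\<^sup>2 + 2 * B\<^sup>2"
        using zero_le_power2[of "A - B"] by (simp add: power2_eq_square algebra_simps)
      finally show "(cmod (quad J z R q - of_real v * resolvent_trace J (kernel_matrix h R) z))\<^sup>2
          \<le> 2 * (cmod (quad J z R q - avg S (quad J z R)))\<^sup>2 + 2 * n2 R"
        by (simp add: A_def B_def n2_def)
    qed
    then show "avg S (\<lambda>q. (cmod (quad J z R q - of_real v * resolvent_trace J (kernel_matrix h R) z))\<^sup>2)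
       \<le> 2 * n1 R + 2 * n2 R" by (simp add: avg_add avg_cmult n1_def avg_const[OF S])
  qed
  also have "\<dots> = 2 * avg P n1 + 2 * avg P n2" by (simp only: avg_add avg_cmult)
  also have "\<dots> \<le> error_bound \<eta> (card J) t"
    using n1 n2 unfolding error_bound_def p_def by linarith
  finally show ?thesis by (simp add: P_def \<eta>_def)
qed

lemma error_bound_mono:
  assumes "p \<le> p'" "\<eta> > 0" "t > 0" "\<theta> \<ge> 0" "\<kappa> \<ge> 0"
  shows "error_bound \<eta> p t \<le> error_bound \<eta> p' t"
  unfolding error_bound_def using assms v_nonneg c0
  by (intro add_mono mult_left_mono divide_right_mono mult_right_mono power_mono order.refl
      mult_nonneg_nonneg add_nonneg_nonneg) auto

text \<open>In the Schur formula of each diagonal entry the quadratic form is replaced by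
  \<open>v\<close> times the full trace. This costs the concentration error and
  \<open>v / Im z\<close> for passing from the minor to the full array, times the bound
  \<open>1 / Im z\<close> on the entry. Averaging over the rows closes the equation in
  \<open>m R\<close>.\<close>

lemma resolvent_trace_equation:
  assumes p: "p \<ge> 1" and z: "Im z > 0" and t: "t > 0" and pos: "\<theta> \<ge> 0" "\<kappa> \<ge> 0"
  defines "m \<equiv> \<lambda>R. resolvent_trace {..<p} (kernel_matrix h R) z / of_nat p"
  shows "avg (PiE {..<p} (\<lambda>_. S)) (\<lambda>R. cmod (1 + z * m R + of_real (v * real p) * (m R)\<^sup>2))
    \<le> (sqrt (error_bound (Im z) p t) + v / Im z) / Im z"
proof -
  define \<eta> where "\<eta> = Im z"
  have \<eta>: "\<eta> > 0" using z by (simp add: \<eta>_def)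
  define P where "P = PiE {..<p} (\<lambda>_. S)"
  note P = finite_PiE_const[OF S finite_lessThan, of p, folded P_def]
    PiE_const_nonempty[OF S finite_lessThan, of p, folded P_def]
  define X where "X = (\<lambda>i R. quad ({..<p} - {i}) z R (R i))"
  define tr where "tr = (\<lambda>R. resolvent_trace {..<p} (kernel_matrix h R) z)"
  define tr' where "tr' = (\<lambda>i R. resolvent_trace ({..<p} - {i}) (kernel_matrix h R) z)"
  define g where "g = (\<lambda>i R. resolvent {..<p} (kernel_matrix h R) z i i)"
  have each: "cmod (1 + z * g i R + of_real v * tr R * g i R) \<le> (cmod (X i R - of_real v * tr' i R) + v / \<eta>) / \<eta>"
    if i: "i < p" and R: "R \<in> P" for i R
  proof -
    have J: "finite ({..<p} - {i})" "i \<notin> {..<p} - {i}" "insert i ({..<p} - {i}) = {..<p}" using i by auto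
    note schur = resolvent_schur[OF J(1,2) symmetric_kernel_matrix[where R = R] z, unfolded J(3)]
    have "(\<Sum>j\<in>{..<p} - {i}. \<Sum>k\<in>{..<p} - {i}. of_real (kernel_matrix h R i j * kernel_matrix h R i k)
        * resolvent ({..<p} - {i}) (kernel_matrix h R) z j k) = X i R"
      unfolding X_def quad_def by (intro sum.cong refl) (auto simp: kernel_matrix_def)
    then have "g i R * (- z - X i R) = 1" using schur by (simp add: g_def kernel_matrix_def)
    then have "1 + z * g i R + of_real v * tr R * g i R = g i R * (- z - X i R) + z * g i R + of_real v * tr R * g i R"
      by (simp only:)
    also have "\<dots> = g i R * (of_real v * (tr R - tr' i R) - (X i R - of_real v * tr' i R))"
      by (simp add: algebra_simps)
    finally have "1 + z * g i R + of_real v * tr R * g i R = g i R * (of_real v * (tr R - tr' i R) - (X i R - of_real v * tr' i R))" .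
    then have "cmod (1 + z * g i R + of_real v * tr R * g i R)
        = cmod (g i R) * cmod (of_real v * (tr R - tr' i R) - (X i R - of_real v * tr' i R))"
      by (simp add: norm_mult)
    also have "\<dots> \<le> (1 / \<eta>) * (cmod (X i R - of_real v * tr' i R) + v / \<eta>)"
    proof (intro mult_mono)
      show "cmod (g i R) \<le> 1 / \<eta>" unfolding g_def \<eta>_def using i
        by (intro resolvent_entry_bound symmetric_kernel_matrix z) auto
      have "cmod (tr R - tr' i R) \<le> 1 / \<eta>" unfolding tr_def tr'_def \<eta>_def
        using resolvent_trace_minor[OF J(1,2) symmetric_kernel_matrix[where R = R] z] J(3) by simp
      then have "cmod (of_real v * (tr R - tr' i R)) \<le> v * (1 / \<eta>)"
        using v_nonneg by (simp add: norm_mult mult_left_mono del: times_divide_eq_right)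
      then show "cmod (of_real v * (tr R - tr' i R) - (X i R - of_real v * tr' i R))
          \<le> cmod (X i R - of_real v * tr' i R) + v / \<eta>"
        using norm_triangle_ineq4[of "of_real v * (tr R - tr' i R)" "X i R - of_real v * tr' i R"] by simp
    qed (use \<eta> in auto)
    finally show ?thesis by simp
  qed
  have avg_i: "avg P (\<lambda>R. cmod (X i R - of_real v * tr' i R)) \<le> sqrt (error_bound \<eta> p t)" if i: "i < p" for i
  proof -
    have J: "finite ({..<p} - {i})" "i \<notin> {..<p} - {i}" "insert i ({..<p} - {i}) = {..<p}" using i by auto
    \<comment> \<open>The minor does not involve \<open>R i\<close>, so this coordinate can be split
      off and averaged as the independent argument \<open>q\<close>.\<close>
    have upd: "X i (R(i := q)) = quad ({..<p} - {i}) z R q"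
      "tr' i (R(i := q)) = resolvent_trace ({..<p} - {i}) (kernel_matrix h R) z" for R q
    proof -
      have km: "kernel_matrix h (R(i := q)) j k = kernel_matrix h R j k" if "j \<in> {..<p} - {i}" "k \<in> {..<p} - {i}" for j k
        using that by (auto simp: kernel_matrix_def)
      show "X i (R(i := q)) = quad ({..<p} - {i}) z R q"
        unfolding X_def quad_def
        by (intro sum.cong refl arg_cong2[where f = "(*)"] resolvent_cong[OF J(1) symmetric_kernel_matrix z km]) auto
      show "tr' i (R(i := q)) = resolvent_trace ({..<p} - {i}) (kernel_matrix h R) z"
        unfolding tr'_def by (intro resolvent_trace_cong[OF J(1) symmetric_kernel_matrix z km])
    qed
    have "(avg P (\<lambda>R. cmod (X i R - of_real v * tr' i R)))\<^sup>2 \<le> avg P (\<lambda>R. (cmod (X i R - of_real v * tr' i R))\<^sup>2)"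
      by (rule avg_square_le[OF P])
    also have "\<dots> = avg (PiE ({..<p} - {i}) (\<lambda>_. S)) (\<lambda>R. avg S (\<lambda>q.
      (cmod (quad ({..<p} - {i}) z R q - of_real v * resolvent_trace ({..<p} - {i}) (kernel_matrix h R) z))\<^sup>2))"
      unfolding P_def using avg_PiE_insert[OF J(2), of S "\<lambda>R. (cmod (X i R - of_real v * tr' i R))\<^sup>2"]
      by (simp only: J(3) upd)
    also have "\<dots> \<le> error_bound \<eta> (card ({..<p} - {i})) t"
      unfolding \<eta>_def by (rule quad_concentration[OF J(1) z t])
    also have "\<dots> \<le> error_bound \<eta> p t"
      by (intro error_bound_mono \<eta> t pos) (use i in auto)
    finally show ?thesis by (rule real_le_rsqrt)
  qed
  have "avg P (\<lambda>R. cmod (1 + z * m R + of_real (v * real p) * (m R)\<^sup>2))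
     \<le> avg P (\<lambda>R. (\<Sum>i<p. (cmod (X i R - of_real v * tr' i R) + v / \<eta>) / \<eta>) / real p)"
  proof (intro avg_mono)
    fix R assume R: "R \<in> P"
    have "(\<Sum>i<p. 1 + z * g i R + of_real v * tr R * g i R) = of_nat p + z * tr R + of_real v * tr R * tr R"
      by (simp add: sum.distrib sum_distrib_left[symmetric] g_def tr_def resolvent_trace_def)
    also have "\<dots> = of_nat p * (1 + z * m R + of_real (v * real p) * (m R)\<^sup>2)"
      using p by (simp add: m_def tr_def power2_eq_square field_simps)
    finally have "real p * cmod (1 + z * m R + of_real (v * real p) * (m R)\<^sup>2)
        = cmod (\<Sum>i<p. 1 + z * g i R + of_real v * tr R * g i R)"
      by (simp add: norm_mult)
    also have "\<dots> \<le> (\<Sum>i<p. (cmod (X i R - of_real v * tr' i R) + v / \<eta>) / \<eta>)"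
      by (intro sum_norm_le each R) auto
    finally show "cmod (1 + z * m R + of_real (v * real p) * (m R)\<^sup>2)
        \<le> (\<Sum>i<p. (cmod (X i R - of_real v * tr' i R) + v / \<eta>) / \<eta>) / real p"
      using p by (simp add: field_simps)
  qed
  also have "\<dots> = (\<Sum>i<p. (avg P (\<lambda>R. cmod (X i R - of_real v * tr' i R)) + v / \<eta>) / \<eta>) / real p"
    by (simp only: divide_inverse avg_multc avg_sum avg_add avg_const[OF P])
  also have "\<dots> \<le> (\<Sum>i<p. (sqrt (error_bound \<eta> p t) + v / \<eta>) / \<eta>) / real p"
    using \<eta> by (intro divide_right_mono sum_mono add_mono avg_i order.refl) auto
  also have "\<dots> = (sqrt (error_bound \<eta> p t) + v / \<eta>) / \<eta>" using p by simp
  finally show ?thesis by (simp add: P_def \<eta>_def)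
qed

end

section \<open>The variance of a pairing\<close>

lemma pairing_commute: "pairing S u w p q = pairing S w u q p"
  by (simp add: pairing_def mult.commute)

lemma pairing_compose: "r permutes S \<Longrightarrow> pairing S u w (p \<circ> r) (q \<circ> r) = pairing S u w p q"
  unfolding pairing_def comp_def
  using sum_permutes[of r S "\<lambda>a. \<Sum>b\<in>S. u (p a) (p b) * w (q a) (q b)"]
    sum_permutes[of r S "\<lambda>b. u (p (r a)) (p b) * w (q (r a)) (q b)" for a] by simp

lemma pairing_same: "p permutes S \<Longrightarrow> pairing S u w p p = pairing S u w id id"
  using pairing_compose[of p S u w id id] by simp

lemma pairing_left_diff: "pairing S (\<lambda>x y. u x y - u' x y) w p q = pairing S u w p q - pairing S u' w p q"
  by (simp add: pairing_def left_diff_distrib sum_subtractf diff_divide_distrib)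

lemma pairing_self_nonneg: "pairing S u u p p \<ge> 0"
  by (simp add: pairing_def sum_nonneg)

lemma pairing_Cauchy_Schwarz: "(pairing S u w p q)\<^sup>2 \<le> pairing S u u p p * pairing S w w q q"
proof -
  have "(\<Sum>(a, b)\<in>S \<times> S. u (p a) (p b) * w (q a) (q b))\<^sup>2
    \<le> (\<Sum>(a, b)\<in>S \<times> S. (u (p a) (p b))\<^sup>2) * (\<Sum>(a, b)\<in>S \<times> S. (w (q a) (q b))\<^sup>2)"
    using Cauchy_Schwarz_ineq_sum[of "\<lambda>(a, b). u (p a) (p b)" "\<lambda>(a, b). w (q a) (q b)" "S \<times> S"]
    by (simp add: case_prod_unfold)
  then show ?thesis
    by (simp add: pairing_def sum.cartesian_product[symmetric] power2_eq_square)
qed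

lemma doubly_centered_diff:
  "doubly_centered S u \<Longrightarrow> doubly_centered S w \<Longrightarrow> doubly_centered S (\<lambda>x y. u x y - w x y)"
  unfolding doubly_centered_def by (auto simp: sum_subtractf)

section \<open>Increments of a pairing under a transposition\<close>

definition swap_diff :: "'a \<times> 'a \<Rightarrow> ('a \<Rightarrow> 'a \<Rightarrow> real) \<Rightarrow> 'a \<Rightarrow> 'a \<Rightarrow> real" where
  "swap_diff i u a b = u (transposition (fst i) (snd i) a) (transposition (fst i) (snd i) b) - u a b"

lemma doubly_centered_swap_diff:
  assumes "doubly_centered S u" "i \<in> S \<times> S"
  shows "doubly_centered S (swap_diff i u)"
  unfolding swap_diff_def[abs_def] using assms
  by (intro doubly_centered_diff doubly_centered_permute[OF assms(1) permutes_swap_id]) auto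

text \<open>Support of \<open>swap_diff i u\<close>: the rows and columns of the two swapped points,
  hence of order n among the n^2 entries. The bounds below gain a factor n from this.\<close>

definition touches :: "'a \<times> 'a \<Rightarrow> 'a \<Rightarrow> 'a \<Rightarrow> real" where
  "touches i a b = (if a \<in> {fst i, snd i} \<or> b \<in> {fst i, snd i} then 1 else 0)"

lemma swap_diff_touches: "swap_diff i u a b = touches i a b * swap_diff i u a b"
  by (auto simp: swap_diff_def touches_def Transposition.transpose_def)

lemma touches_swap:
  "touches i (transposition (fst i) (snd i) a) (transposition (fst i) (snd i) b) = touches i a b"
  by (auto simp: touches_def Transposition.transpose_def)

lemma touches_nonneg: "0 \<le> touches i a b" by (simp add: touches_def)

lemma touches_sq: "(touches i a b)\<^sup>2 = touches i a b" by (simp add: touches_def)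

lemma sum_touches_le:
  assumes S: "finite S" and i: "i \<in> S \<times> S" and f: "\<And>a b. f a b \<ge> 0" "\<And>a b. f a b = f b a"
  shows "(\<Sum>a\<in>S. \<Sum>b\<in>S. touches i a b * f a b) \<le> 2 * ((\<Sum>b\<in>S. f (fst i) b) + (\<Sum>b\<in>S. f (snd i) b))"
proof -
  define x where "x = fst i"
  define y where "y = snd i"
  have xy: "x \<in> S" "y \<in> S" using i by (auto simp: x_def y_def)
  have "(\<Sum>a\<in>S. \<Sum>b\<in>S. touches i a b * f a b) \<le>
      (\<Sum>a\<in>S. \<Sum>b\<in>S. (if a = x then f a b else 0) + (if a = y then f a b else 0) +
        (if b = x then f a b else 0) + (if b = y then f a b else 0))"
    using f(1) by (intro sum_mono) (auto simp: touches_def x_def y_def)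
  also have "\<dots> = (\<Sum>b\<in>S. \<Sum>a\<in>S. if a = x then f a b else 0) + (\<Sum>b\<in>S. \<Sum>a\<in>S. if a = y then f a b else 0)
      + (\<Sum>a\<in>S. \<Sum>b\<in>S. if b = x then f a b else 0) + (\<Sum>a\<in>S. \<Sum>b\<in>S. if b = y then f a b else 0)"
    unfolding sum.distrib by (subst (1 2) sum.swap) simp
  also have "\<dots> = 2 * ((\<Sum>b\<in>S. f x b) + (\<Sum>b\<in>S. f y b))"
    using S xy f(2)[of _ x] f(2)[of _ y] by simp
  finally show ?thesis by (simp add: x_def y_def)
qed

lemma sum_touches_swap:
  assumes i: "i \<in> S \<times> S"
  defines "\<tau> \<equiv> transposition (fst i) (snd i)"
  shows "(\<Sum>a\<in>S. \<Sum>b\<in>S. touches i a b * f (\<tau> a) (\<tau> b)) = (\<Sum>a\<in>S. \<Sum>b\<in>S. touches i a b * f a b)"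
proof -
  have \<tau>: "\<tau> permutes S" unfolding \<tau>_def using i by (intro permutes_swap_id) auto
  have "(\<Sum>a\<in>S. \<Sum>b\<in>S. touches i a b * f (\<tau> a) (\<tau> b)) = (\<Sum>a\<in>S. \<Sum>b\<in>S. touches i (\<tau> a) (\<tau> b) * f (\<tau> a) (\<tau> b))"
    unfolding \<tau>_def touches_swap ..
  also have "\<dots> = (\<Sum>a\<in>S. \<Sum>b\<in>S. touches i (\<tau> a) b * f (\<tau> a) b)"
    by (intro sum.cong refl sum_permutes[OF \<tau>, of "\<lambda>b. touches i (\<tau> a) b * f (\<tau> a) b" for a])
  also have "\<dots> = (\<Sum>a\<in>S. \<Sum>b\<in>S. touches i a b * f a b)"
    by (rule sum_permutes[OF \<tau>, of "\<lambda>a. \<Sum>b\<in>S. touches i a b * f a b"])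
  finally show ?thesis .
qed

context
  fixes S :: "'a set" and N :: real
  assumes S: "finite S" and N: "N = real (card S)"
begin

text \<open>The swap maps the touched rows and columns among themselves, so both terms of the
  difference involve the same entries of \<open>u\<close>, and these are covered by four row or
  column norms.\<close>

lemma swap_diff_norm:
  assumes u: "doubly_centered S u" and i: "i \<in> S \<times> S" and M: "\<And>x. x \<in> S \<Longrightarrow> (\<Sum>y\<in>S. (u x y)\<^sup>2) \<le> M"
  shows "pairing S (swap_diff i u) (swap_diff i u) id id \<le> 8 * M"
proof -
  let ?t = "transposition (fst i) (snd i)"
  have "2 * pairing S (swap_diff i u) (swap_diff i u) id id = (\<Sum>a\<in>S. \<Sum>b\<in>S. (swap_diff i u a b)\<^sup>2)"
    by (simp add: pairing_def power2_eq_square)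
  also have "\<dots> \<le> (\<Sum>a\<in>S. \<Sum>b\<in>S. touches i a b * (2 * (u (?t a) (?t b))\<^sup>2) + touches i a b * (2 * (u a b)\<^sup>2))"
  proof (intro sum_mono)
    fix a b
    have "(swap_diff i u a b)\<^sup>2 = touches i a b * (swap_diff i u a b)\<^sup>2"
      by (subst swap_diff_touches) (simp add: power_mult_distrib touches_sq)
    also have "\<dots> \<le> touches i a b * (2 * (u (?t a) (?t b))\<^sup>2 + 2 * (u a b)\<^sup>2)"
    proof (intro mult_left_mono touches_nonneg)
      have "(x - y)\<^sup>2 \<le> 2 * x\<^sup>2 + 2 * y\<^sup>2" for x y :: real
        using zero_le_power2[of "x + y"] by (simp add: power2_eq_square algebra_simps)
      then show "(swap_diff i u a b)\<^sup>2 \<le> 2 * (u (?t a) (?t b))\<^sup>2 + 2 * (u a b)\<^sup>2" by (simp add: swap_diff_def)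
    qed
    finally show "(swap_diff i u a b)\<^sup>2 \<le> touches i a b * (2 * (u (?t a) (?t b))\<^sup>2) + touches i a b * (2 * (u a b)\<^sup>2)"
      by (simp add: distrib_left)
  qed
  also have "\<dots> = 4 * (\<Sum>a\<in>S. \<Sum>b\<in>S. touches i a b * (u a b)\<^sup>2)"
    using sum_touches_swap[OF i, of "\<lambda>a b. 2 * (u a b)\<^sup>2"] by (simp add: sum.distrib sum_distrib_left mult_ac)
  also have "\<dots> \<le> 4 * (2 * ((\<Sum>b\<in>S. (u (fst i) b)\<^sup>2) + (\<Sum>b\<in>S. (u (snd i) b)\<^sup>2)))"
    using doubly_centeredD(1)[OF u] by (intro mult_left_mono sum_touches_le S i) auto
  also have "\<dots> \<le> 4 * (2 * (M + M))" using i by (intro mult_left_mono add_mono M) auto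
  finally show ?thesis by simp
qed

text \<open>Cauchy-Schwarz is applied after restricting \<open>f\<close> to the entries touched by
  \<open>i\<close>. In the sum over all swaps each row of \<open>f\<close> is then counted
  \<open>2 * N\<close> times instead of \<open>N\<^sup>2\<close> times, which is the gain needed for
  \<open>h_gram\<close>.\<close>

lemma sum_pairing_swap_diff:
  assumes u: "doubly_centered S u" and M: "\<And>x. x \<in> S \<Longrightarrow> (\<Sum>y\<in>S. (u x y)\<^sup>2) \<le> M"
    and f: "doubly_centered S f"
  shows "(\<Sum>i\<in>S \<times> S. (pairing S (swap_diff i u) f id id)\<^sup>2) \<le> 32 * N * M * pairing S f f id id"
proof -
  have each: "(pairing S (swap_diff i u) f id id)\<^sup>2 \<le> 8 * M * ((\<Sum>b\<in>S. (f (fst i) b)\<^sup>2) + (\<Sum>b\<in>S. (f (snd i) b)\<^sup>2))"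
    if i: "i \<in> S \<times> S" for i
  proof -
    define g where "g = (\<lambda>a b. touches i a b * f a b)"
    have "pairing S (swap_diff i u) f id id = pairing S (swap_diff i u) g id id"
      unfolding pairing_def g_def
      by (intro arg_cong2[where f = "(/)"] sum.cong refl, subst swap_diff_touches) (simp add: mult_ac)
    then have "(pairing S (swap_diff i u) f id id)\<^sup>2 \<le> pairing S (swap_diff i u) (swap_diff i u) id id * pairing S g g id id"
      using pairing_Cauchy_Schwarz[of S "swap_diff i u" g id id] by simp
    also have "\<dots> \<le> (8 * M) * pairing S g g id id"
      using u i M by (intro mult_right_mono swap_diff_norm pairing_self_nonneg)
    also have "\<dots> \<le> (8 * M) * ((\<Sum>b\<in>S. (f (fst i) b)\<^sup>2) + (\<Sum>b\<in>S. (f (snd i) b)\<^sup>2))"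
    proof (intro mult_left_mono)
      have "2 * pairing S g g id id = (\<Sum>a\<in>S. \<Sum>b\<in>S. touches i a b * (f a b)\<^sup>2)"
        by (simp add: pairing_def g_def power2_eq_square[symmetric] power_mult_distrib touches_sq)
      also have "\<dots> \<le> 2 * ((\<Sum>b\<in>S. (f (fst i) b)\<^sup>2) + (\<Sum>b\<in>S. (f (snd i) b)\<^sup>2))"
        using doubly_centeredD(1)[OF f] by (intro sum_touches_le S i) auto
      finally show "pairing S g g id id \<le> (\<Sum>b\<in>S. (f (fst i) b)\<^sup>2) + (\<Sum>b\<in>S. (f (snd i) b)\<^sup>2)" by simp
      show "0 \<le> 8 * M" using order.trans[OF sum_nonneg M[of "fst i"]] i by auto
    qed
    finally show ?thesis .
  qed
  have "(\<Sum>i\<in>S \<times> S. (pairing S (swap_diff i u) f id id)\<^sup>2)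
      \<le> (\<Sum>i\<in>S \<times> S. 8 * M * ((\<Sum>b\<in>S. (f (fst i) b)\<^sup>2) + (\<Sum>b\<in>S. (f (snd i) b)\<^sup>2)))"
    by (intro sum_mono each)
  also have "\<dots> = (\<Sum>x\<in>S. \<Sum>y\<in>S. 8 * M * ((\<Sum>b\<in>S. (f x b)\<^sup>2) + (\<Sum>b\<in>S. (f y b)\<^sup>2)))"
    by (simp add: sum.cartesian_product case_prod_unfold)
  also have "\<dots> = 8 * M * (2 * N * (\<Sum>x\<in>S. \<Sum>b\<in>S. (f x b)\<^sup>2))"
    by (simp add: sum_distrib_left[symmetric] sum.distrib N)
  also have "(\<Sum>x\<in>S. \<Sum>b\<in>S. (f x b)\<^sup>2) = 2 * pairing S f f id id"
    by (simp add: pairing_def power2_eq_square)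
  finally show ?thesis by (simp add: mult_ac id_def)
qed

lemma sum_pairing_swap_diff2:
  assumes u: "doubly_centered S u" and Mu: "\<And>x. x \<in> S \<Longrightarrow> (\<Sum>y\<in>S. (u x y)\<^sup>2) \<le> Mu"
    and w: "doubly_centered S w" and Mw: "\<And>x. x \<in> S \<Longrightarrow> (\<Sum>y\<in>S. (w x y)\<^sup>2) \<le> Mw"
    and M0: "Mu \<ge> 0"
  shows "(\<Sum>i\<in>S \<times> S. \<Sum>k\<in>S \<times> S. (pairing S (swap_diff i u) (swap_diff k w) id id)\<^sup>2) \<le> 256 * N ^ 3 * Mu * Mw"
proof -
  have "(\<Sum>i\<in>S \<times> S. \<Sum>k\<in>S \<times> S. (pairing S (swap_diff i u) (swap_diff k w) id id)\<^sup>2)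
      = (\<Sum>k\<in>S \<times> S. \<Sum>i\<in>S \<times> S. (pairing S (swap_diff i u) (swap_diff k w) id id)\<^sup>2)"
    by (rule sum.swap)
  also have "\<dots> \<le> (\<Sum>k\<in>S \<times> S. 32 * N * Mu * pairing S (swap_diff k w) (swap_diff k w) id id)"
    by (intro sum_mono sum_pairing_swap_diff u Mu doubly_centered_swap_diff w)
  also have "\<dots> \<le> (\<Sum>k\<in>S \<times> S. 32 * N * Mu * (8 * Mw))"
    using M0 by (intro sum_mono mult_left_mono swap_diff_norm w Mw) (auto simp: N)
  also have "\<dots> = 256 * N ^ 3 * Mu * Mw"
    by (simp add: card_cartesian_product N power3_eq_cube)
  finally show ?thesis .
qed

lemma pairing_bound:
  assumes L: "\<And>x. x \<in> S \<Longrightarrow> (\<Sum>y\<in>S. \<bar>u x y\<bar>) \<le> L" and W: "\<And>x y. x \<in> S \<Longrightarrow> y \<in> S \<Longrightarrow> \<bar>w x y\<bar> \<le> W"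
    and p: "p permutes S" and q: "q permutes S"
  shows "\<bar>pairing S u w p q\<bar> \<le> N * L * W / 2"
proof -
  have inS: "p x \<in> S" "q x \<in> S" if "x \<in> S" for x using p q that by (simp_all add: permutes_in_image)
  have "2 * \<bar>pairing S u w p q\<bar> \<le> (\<Sum>a\<in>S. \<Sum>b\<in>S. \<bar>u (p a) (p b) * w (q a) (q b)\<bar>)"
    by (simp add: pairing_def) (intro order.trans[OF sum_abs] sum_mono sum_abs)
  also have "\<dots> \<le> (\<Sum>a\<in>S. \<Sum>b\<in>S. \<bar>u (p a) (p b)\<bar> * W)"
    unfolding abs_mult by (intro sum_mono mult_left_mono W) (auto simp: inS)
  also have "\<dots> = (\<Sum>a\<in>S. \<Sum>b\<in>S. \<bar>u (p a) b\<bar>) * W"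
    using sum_permutes[OF p, of "\<lambda>b. \<bar>u (p a) b\<bar>" for a] by (simp add: sum_distrib_right[symmetric])
  also have "\<dots> \<le> (\<Sum>a\<in>S. L) * W"
  proof (cases "S = {}")
    case False
    then obtain x where "x \<in> S" by auto
    then have "W \<ge> 0" using W[of x x] by linarith
    then show ?thesis by (intro mult_right_mono sum_mono L) (auto simp: inS)
  qed simp
  finally show ?thesis by (simp add: N)
qed

lemma pairing_swap_diff_bound:
  assumes u: "\<And>x y. u x y = u y x" and L: "\<And>x. x \<in> S \<Longrightarrow> (\<Sum>y\<in>S. \<bar>u x y\<bar>) \<le> L"
    and W: "\<And>x y. x \<in> S \<Longrightarrow> y \<in> S \<Longrightarrow> \<bar>w x y\<bar> \<le> W"
    and p: "p permutes S" and q: "q permutes S" and i: "i \<in> S \<times> S"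
  shows "\<bar>pairing S (swap_diff i u) w p q\<bar> \<le> 4 * L * W"
proof -
  let ?t = "transposition (fst i) (snd i)"
  have inS: "p x \<in> S" "q x \<in> S" if "x \<in> S" for x using p q that by (simp_all add: permutes_in_image)
  have W0: "W \<ge> 0" using W[of "fst i" "fst i"] i by (auto intro: order.trans[OF abs_ge_zero])
  have "2 * \<bar>pairing S (swap_diff i u) w p q\<bar> \<le> (\<Sum>a\<in>S. \<Sum>b\<in>S. \<bar>swap_diff i u (p a) (p b) * w (q a) (q b)\<bar>)"
    by (simp add: pairing_def) (intro order.trans[OF sum_abs] sum_mono sum_abs)
  also have "\<dots> \<le> (\<Sum>a\<in>S. \<Sum>b\<in>S. \<bar>swap_diff i u (p a) (p b)\<bar> * W)"
    unfolding abs_mult by (intro sum_mono mult_left_mono W) (auto simp: inS)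
  also have "\<dots> = (\<Sum>a\<in>S. \<Sum>b\<in>S. \<bar>swap_diff i u (p a) b\<bar>) * W"
    using sum_permutes[OF p, of "\<lambda>b. \<bar>swap_diff i u (p a) b\<bar>" for a] by (simp add: sum_distrib_right[symmetric])
  also have "(\<Sum>a\<in>S. \<Sum>b\<in>S. \<bar>swap_diff i u (p a) b\<bar>) = (\<Sum>a\<in>S. \<Sum>b\<in>S. \<bar>swap_diff i u a b\<bar>)"
    by (rule sum_permutes[OF p, of "\<lambda>a. \<Sum>b\<in>S. \<bar>swap_diff i u a b\<bar>"])
  also have "\<dots> \<le> (\<Sum>a\<in>S. \<Sum>b\<in>S. touches i a b * \<bar>u (?t a) (?t b)\<bar> + touches i a b * \<bar>u a b\<bar>)"
  proof (intro sum_mono)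
    fix a b
    have "\<bar>swap_diff i u a b\<bar> = touches i a b * \<bar>swap_diff i u a b\<bar>"
      by (subst swap_diff_touches) (simp add: abs_mult touches_def)
    also have "\<dots> \<le> touches i a b * (\<bar>u (?t a) (?t b)\<bar> + \<bar>u a b\<bar>)"
      by (intro mult_left_mono touches_nonneg) (simp add: swap_diff_def)
    finally show "\<bar>swap_diff i u a b\<bar> \<le> touches i a b * \<bar>u (?t a) (?t b)\<bar> + touches i a b * \<bar>u a b\<bar>"
      by (simp add: distrib_left)
  qed
  also have "\<dots> = 2 * (\<Sum>a\<in>S. \<Sum>b\<in>S. touches i a b * \<bar>u a b\<bar>)"
    using sum_touches_swap[OF i, of "\<lambda>a b. \<bar>u a b\<bar>"] by (simp add: sum.distrib)
  also have "\<dots> \<le> 2 * (2 * ((\<Sum>b\<in>S. \<bar>u (fst i) b\<bar>) + (\<Sum>b\<in>S. \<bar>u (snd i) b\<bar>)))"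
    using u by (intro mult_left_mono sum_touches_le S i) auto
  also have "\<dots> \<le> 2 * (2 * (L + L))" using i by (intro mult_left_mono add_mono L) auto
  finally show ?thesis using W0 by (simp add: mult_right_mono)
qed

text \<open>Counterpart of \<open>pairing_swap_diff_bound\<close> in which the swapped factor is
  only bounded entrywise and the other factor has small rows. The kernel needs both, since either of
  adjacency and distance may be the swapped one. Moving the pairing to \<open>id\<close> in the
  first argument makes the touched entries explicit.\<close>

lemma pairing_swap_diff_bound':
  assumes u: "\<And>x y. x \<in> S \<Longrightarrow> y \<in> S \<Longrightarrow> \<bar>u x y\<bar> \<le> W"
    and w: "\<And>x y. w x y = w y x" "\<And>x. x \<in> S \<Longrightarrow> (\<Sum>y\<in>S. \<bar>w x y\<bar>) \<le> L"
    and p: "p permutes S" and q: "q permutes S" and i: "i \<in> S \<times> S"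
  shows "\<bar>pairing S (swap_diff i u) w p q\<bar> \<le> 4 * L * W"
proof -
  let ?t = "transposition (fst i) (snd i)"
  have t: "?t permutes S" using i by (intro permutes_swap_id) auto
  define r where "r = q \<circ> inv_into UNIV p"
  have r: "r permutes S" unfolding r_def by (intro permutes_compose permutes_inv p q)
  have "inv_into UNIV p permutes S" using p by (rule permutes_inv)
  then have "pairing S (swap_diff i u) w p q = pairing S (swap_diff i u) w id r"
    using pairing_compose[of "inv_into UNIV p" S "swap_diff i u" w p q] permutes_inv_o(1)[OF p] by (simp add: r_def)
  also have "2 * \<bar>\<dots>\<bar> \<le> (\<Sum>a\<in>S. \<Sum>b\<in>S. \<bar>swap_diff i u a b * w (r a) (r b)\<bar>)"
    by (simp add: pairing_def) (intro order.trans[OF sum_abs] sum_mono sum_abs)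
  also have "\<dots> \<le> (\<Sum>a\<in>S. \<Sum>b\<in>S. 2 * W * (touches i a b * \<bar>w (r a) (r b)\<bar>))"
  proof (intro sum_mono)
    fix a b assume ab: "a \<in> S" "b \<in> S"
    have "\<bar>swap_diff i u a b\<bar> \<le> \<bar>u (?t a) (?t b)\<bar> + \<bar>u a b\<bar>" by (simp add: swap_diff_def)
    also have "\<dots> \<le> W + W" using ab t by (intro add_mono u) (auto simp: permutes_in_image)
    finally have le: "\<bar>swap_diff i u a b\<bar> \<le> 2 * W" by simp
    have "\<bar>swap_diff i u a b * w (r a) (r b)\<bar> = \<bar>swap_diff i u a b\<bar> * (touches i a b * \<bar>w (r a) (r b)\<bar>)"
      by (subst swap_diff_touches) (simp add: abs_mult touches_def)
    also have "\<dots> \<le> 2 * W * (touches i a b * \<bar>w (r a) (r b)\<bar>)"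
      by (intro mult_right_mono le mult_nonneg_nonneg touches_nonneg) simp
    finally show "\<bar>swap_diff i u a b * w (r a) (r b)\<bar> \<le> 2 * W * (touches i a b * \<bar>w (r a) (r b)\<bar>)" .
  qed
  also have "\<dots> = 2 * W * (\<Sum>a\<in>S. \<Sum>b\<in>S. touches i a b * \<bar>w (r a) (r b)\<bar>)"
    by (simp add: sum_distrib_left)
  also have "\<dots> \<le> 2 * W * (2 * ((\<Sum>b\<in>S. \<bar>w (r (fst i)) (r b)\<bar>) + (\<Sum>b\<in>S. \<bar>w (r (snd i)) (r b)\<bar>)))"
    using w(1) order.trans[OF abs_ge_zero u[of "fst i" "fst i"]] i
    by (intro mult_left_mono sum_touches_le S i) auto
  also have "\<dots> = 2 * W * (2 * ((\<Sum>b\<in>S. \<bar>w (r (fst i)) b\<bar>) + (\<Sum>b\<in>S. \<bar>w (r (snd i)) b\<bar>)))"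
    using sum_permutes[OF r, of "\<lambda>b. \<bar>w (r x) b\<bar>" for x] by simp
  also have "\<dots> \<le> 2 * W * (2 * (L + L))"
    using i r order.trans[OF abs_ge_zero u[of "fst i" "fst i"]]
    by (intro mult_left_mono add_mono w(2)) (auto simp: permutes_in_image)
  finally show ?thesis by (simp add: mult_ac)
qed

end

section \<open>Cyclic adjacency and distances\<close>

definition cyclic_next :: "nat \<Rightarrow> nat \<Rightarrow> nat" where
  "cyclic_next n x = (if x = n then 1 else Suc x)"

definition cyclic_prev :: "nat \<Rightarrow> nat \<Rightarrow> nat" where
  "cyclic_prev n x = (if x = 1 then n else x - 1)"

definition cyclic_adjacency :: "nat \<Rightarrow> nat \<Rightarrow> nat \<Rightarrow> real" where
  "cyclic_adjacency n x y =
    (if x = y then 0 else of_bool (y = cyclic_next n x) + of_bool (x = cyclic_next n y))"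

text \<open>Every point has degree 2, spread evenly over the n - 1 off-diagonal entries of its
  row.\<close>

definition centered_adjacency :: "nat \<Rightarrow> nat \<Rightarrow> nat \<Rightarrow> real" where
  "centered_adjacency n x y = (if x = y then 0 else cyclic_adjacency n x y - 2 / (real n - 1))"

definition distance_sum :: "nat \<Rightarrow> nat \<Rightarrow> real" where
  "distance_sum n x = (\<Sum>y=1..n. \<bar>real x - real y\<bar>)"

text \<open>Double centering that keeps the diagonal at zero: a sum of a function of
  \<open>x\<close> and a function of \<open>y\<close> is subtracted off the diagonal only. Vanishing
  row sums without the diagonal force the denominators n - 2 and (n - 1)(n - 2).\<close>

definition centered_distance :: "nat \<Rightarrow> nat \<Rightarrow> nat \<Rightarrow> real" where
  "centered_distance n x y = (if x = y then 0 else
    \<bar>real x - real y\<bar> - distance_sum n x / (real n - 2) - distance_sum n y / (real n - 2)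
      + (\<Sum>z=1..n. distance_sum n z) / ((real n - 1) * (real n - 2)))"

context
  fixes n :: nat
  assumes n: "n \<ge> 4"
begin

lemma cyclic_next_in: "x \<in> {1..n} \<Longrightarrow> cyclic_next n x \<in> {1..n}"
  and cyclic_prev_in: "x \<in> {1..n} \<Longrightarrow> cyclic_prev n x \<in> {1..n}"
  and eq_cyclic_next: "x \<in> {1..n} \<Longrightarrow> y \<in> {1..n} \<Longrightarrow> x = cyclic_next n y \<longleftrightarrow> y = cyclic_prev n x"
  and cyclic_next_neq: "x \<noteq> cyclic_next n x"
  using n by (auto simp: cyclic_next_def cyclic_prev_def)

lemma cyclic_adjacency_eq:
  "cyclic_adjacency n x y = of_bool (y = cyclic_next n x) + of_bool (x = cyclic_next n y)"
  using cyclic_next_neq by (auto simp: cyclic_adjacency_def)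

lemma cyclic_adjacency_range: "cyclic_adjacency n x y \<in> {0, 1}"
  using n by (auto simp: cyclic_adjacency_def cyclic_next_def split: if_splits)

lemma cyclic_adjacency_diag: "cyclic_adjacency n x x = 0"
  by (simp add: cyclic_adjacency_def)

lemma cyclic_adjacency_row: "x \<in> {1..n} \<Longrightarrow> (\<Sum>y=1..n. cyclic_adjacency n x y) = 2"
proof -
  assume x: "x \<in> {1..n}"
  have "(\<Sum>y=1..n. cyclic_adjacency n x y) =
      (\<Sum>y=1..n. (if y = cyclic_next n x then 1 else 0) + (if y = cyclic_prev n x then 1 else 0))"
    using x by (intro sum.cong refl) (simp add: cyclic_adjacency_eq eq_cyclic_next of_bool_def)
  also have "\<dots> = 2" using cyclic_next_in[OF x] cyclic_prev_in[OF x] by (simp add: sum.distrib)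
  finally show ?thesis .
qed

lemma sum_offdiag:
  assumes "x \<in> {1..n}"
  shows "(\<Sum>y=1..n. if x = y then 0 else f y) = (\<Sum>y=1..n. f y) - (f x :: real)"
proof -
  have "(\<Sum>y=1..n. if x = y then 0 else f y) = (\<Sum>y=1..n. f y - (if y = x then f y else 0))"
    by (intro sum.cong refl) auto
  then show ?thesis using assms by (simp add: sum_subtractf)
qed

lemma doubly_centered_adjacency: "doubly_centered {1..n} (centered_adjacency n)"
  unfolding doubly_centered_def
proof (intro conjI allI ballI)
  fix x assume x: "x \<in> {1..n}"
  show "(\<Sum>y=1..n. centered_adjacency n x y) = 0"
    unfolding centered_adjacency_def sum_offdiag[OF x] sum_subtractf cyclic_adjacency_row[OF x] cyclic_adjacency_diag
    using n by (simp add: field_simps)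
qed (auto simp: centered_adjacency_def cyclic_adjacency_def)

lemma doubly_centered_distance: "doubly_centered {1..n} (centered_distance n)"
  unfolding doubly_centered_def
proof (intro conjI allI ballI)
  fix x assume x: "x \<in> {1..n}"
  define T where "T = (\<Sum>z=1..n. distance_sum n z)"
  have "(\<Sum>y=1..n. centered_distance n x y) =
    (\<Sum>y=1..n. \<bar>real x - real y\<bar> - distance_sum n x / (real n - 2) - distance_sum n y / (real n - 2)
      + T / ((real n - 1) * (real n - 2))) - (- 2 * distance_sum n x / (real n - 2)
      + T / ((real n - 1) * (real n - 2)))"
    unfolding centered_distance_def sum_offdiag[OF x] by (simp add: T_def)
  also have "(\<Sum>y=1..n. \<bar>real x - real y\<bar> - distance_sum n x / (real n - 2) - distance_sum n y / (real n - 2)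
      + T / ((real n - 1) * (real n - 2)))
    = distance_sum n x - real n * (distance_sum n x / (real n - 2)) - T / (real n - 2)
      + real n * (T / ((real n - 1) * (real n - 2)))"
    by (simp add: sum.distrib sum_subtractf distance_sum_def[of n x] T_def sum_divide_distrib)
  also have "\<dots> - (- 2 * distance_sum n x / (real n - 2) + T / ((real n - 1) * (real n - 2))) = 0"
    using n by (simp add: divide_simps) (simp add: algebra_simps)
  finally show "(\<Sum>y=1..n. centered_distance n x y) = 0" .
qed (auto simp: centered_distance_def abs_minus_commute)

lemma abs_centered_adjacency_le: "\<bar>centered_adjacency n x y\<bar> \<le> 1"
  and centered_adjacency_row: "x \<in> {1..n} \<Longrightarrow> (\<Sum>y=1..n. \<bar>centered_adjacency n x y\<bar>) \<le> 4"
  and centered_adjacency_row2: "x \<in> {1..n} \<Longrightarrow> (\<Sum>y=1..n. (centered_adjacency n x y)\<^sup>2) \<le> 4"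
proof -
  have e: "2 / (real n - 1) \<le> 1" "2 / (real n - 1) \<ge> 0" using n by (simp_all add: field_simps)
  show le: "\<bar>centered_adjacency n x y\<bar> \<le> 1" for x y
    using cyclic_adjacency_range[of x y] e by (auto simp: centered_adjacency_def)
  show row: "(\<Sum>y=1..n. \<bar>centered_adjacency n x y\<bar>) \<le> 4" if x: "x \<in> {1..n}"
  proof -
    have "(\<Sum>y=1..n. \<bar>centered_adjacency n x y\<bar>) \<le> (\<Sum>y=1..n. if x = y then 0 else cyclic_adjacency n x y + 2 / (real n - 1))"
    proof (intro sum_mono)
      fix y show "\<bar>centered_adjacency n x y\<bar> \<le> (if x = y then 0 else cyclic_adjacency n x y + 2 / (real n - 1))"
        using cyclic_adjacency_range[of x y] e by (auto simp: centered_adjacency_def)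
    qed
    also have "\<dots> = 4" unfolding sum_offdiag[OF x] sum.distrib cyclic_adjacency_row[OF x] cyclic_adjacency_diag
      using n by (simp add: divide_simps)
    finally show ?thesis .
  qed
  show "(\<Sum>y=1..n. (centered_adjacency n x y)\<^sup>2) \<le> 4" if x: "x \<in> {1..n}"
  proof (rule order.trans[OF sum_mono row[OF x]])
    fix y show "(centered_adjacency n x y)\<^sup>2 \<le> \<bar>centered_adjacency n x y\<bar>"
      using le[of x y] by (metis abs_ge_zero abs_le_square_iff abs_power2 mult_left_le power2_abs power2_eq_square)
  qed
qed

section \<open>Power sums, and norms of the centered adjacency and distance\<close>

lemma distance_sum_eq:
  assumes x: "x \<in> {1..n}"
  shows "distance_sum n x = (real x)\<^sup>2 - (real n + 1) * real x + real n * (real n + 1) / 2"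
proof -
  have "x \<le> n" using x by simp
  then show ?thesis
  proof (induction n rule: dec_induct)
    case base
    have "distance_sum x x = (\<Sum>y=1..x. real x - real y)"
      unfolding distance_sum_def by (intro sum.cong refl) auto
    also have "\<dots> = real x * real x - real x * (real x + 1) / 2"
    proof -
      have "(\<Sum>y=1..m. real y) = real m * (real m + 1) / 2" for m
        by (induction m) (auto simp: field_simps)
      then show ?thesis by (simp add: sum_subtractf)
    qed
    finally show ?case by (simp add: power2_eq_square field_simps)
  next
    case (step m)
    have "distance_sum (Suc m) x = distance_sum m x + (real m + 1 - real x)"
      using step.hyps by (simp add: distance_sum_def)
    then show ?case using step.IH by (simp add: power2_eq_square field_simps)
  qed
qed

lemma sum_distance_sum: "(\<Sum>x=1..n. distance_sum n x) = real n * ((real n)\<^sup>2 - 1) / 3"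
proof -
  have s1: "(\<Sum>x=1..m. real x) = real m * (real m + 1) / 2" for m
    by (induction m) (auto simp: field_simps)
  have s2: "(\<Sum>x=1..m. (real x)\<^sup>2) = real m * (real m + 1) * (2 * real m + 1) / 6" for m
    by (induction m) (auto simp: field_simps power2_eq_square)
  have "(\<Sum>x=1..n. distance_sum n x) = (\<Sum>x=1..n. (real x)\<^sup>2 - (real n + 1) * real x + real n * (real n + 1) / 2)"
    by (intro sum.cong refl distance_sum_eq)
  also have "\<dots> = (\<Sum>x=1..n. (real x)\<^sup>2) - (real n + 1) * (\<Sum>x=1..n. real x) + real n * (real n * (real n + 1) / 2)"
    by (simp add: sum.distrib sum_subtractf sum_distrib_left)
  also have "\<dots> = real n * ((real n)\<^sup>2 - 1) / 3"
    unfolding s1 s2 by (simp add: field_simps power2_eq_square)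
  finally show ?thesis .
qed

lemma sum_distance_sum_sq: "(\<Sum>x=1..n. (distance_sum n x)\<^sup>2) =
    (real n + 1) * ((real n + 1) ^ 4 - 1) / 30 - real n * (real n + 1)\<^sup>2 * ((real n + 1)\<^sup>2 - 1) / 6
      + real n ^ 3 * (real n + 1)\<^sup>2 / 4"
proof -
  have s1: "(\<Sum>x=1..m. real x) = real m * (real m + 1) / 2" for m
    by (induction m) (auto simp: field_simps)
  have s2: "(\<Sum>x=1..m. (real x)\<^sup>2) = real m * (real m + 1) * (2 * real m + 1) / 6" for m
    by (induction m) (auto simp: field_simps power2_eq_square)
  have s3: "(\<Sum>x=1..m. (real x) ^ 3) = (real m)\<^sup>2 * (real m + 1)\<^sup>2 / 4" for m
    by (induction m) (auto simp: field_simps power2_eq_square power3_eq_cube)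
  have s4: "(\<Sum>x=1..m. (real x) ^ 4) = real m * (real m + 1) * (2 * real m + 1) * (3 * (real m)\<^sup>2 + 3 * real m - 1) / 30" for m
    by (induction m) (auto simp: field_simps power2_eq_square power4_eq_xxxx)
  define m where "m = real n + 1"
  define b where "b = real n * (real n + 1) / 2"
  have "(\<Sum>x=1..n. (distance_sum n x)\<^sup>2) = (\<Sum>x=1..n. (real x) ^ 4 - 2 * m * (real x) ^ 3 + (m\<^sup>2 + 2 * b) * (real x)\<^sup>2 - 2 * m * b * real x + b\<^sup>2)"
  proof (intro sum.cong refl)
    fix x assume x: "x \<in> {1..n}"
    show "(distance_sum n x)\<^sup>2 = (real x) ^ 4 - 2 * m * (real x) ^ 3 + (m\<^sup>2 + 2 * b) * (real x)\<^sup>2 - 2 * m * b * real x + b\<^sup>2"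
    proof -
      have "distance_sum n x = (real x)\<^sup>2 - m * real x + b" by (simp add: distance_sum_eq[OF x] b_def m_def)
      show ?thesis unfolding \<open>distance_sum n x = _\<close>
        by (simp add: power2_eq_square power3_eq_cube power4_eq_xxxx algebra_simps)
    qed
  qed
  also have "\<dots> = (\<Sum>x=1..n. (real x) ^ 4) - 2 * m * (\<Sum>x=1..n. (real x) ^ 3) + (m\<^sup>2 + 2 * b) * (\<Sum>x=1..n. (real x)\<^sup>2)
      - 2 * m * b * (\<Sum>x=1..n. real x) + real n * b\<^sup>2"
    by (simp add: sum.distrib sum_subtractf sum_distrib_left)
  also have "\<dots> = (real n + 1) * ((real n + 1) ^ 4 - 1) / 30 - real n * (real n + 1)\<^sup>2 * ((real n + 1)\<^sup>2 - 1) / 6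
      + real n ^ 3 * (real n + 1)\<^sup>2 / 4"
    unfolding s1 s2 s3 s4 m_def b_def
    by (simp add: field_simps power2_eq_square power3_eq_cube power4_eq_xxxx)
  finally show ?thesis .
qed

lemma abs_centered_distance_le:
  assumes "x \<in> {1..n}" "y \<in> {1..n}"
  shows "\<bar>centered_distance n x y\<bar> \<le> 9 * real n"
proof -
  have ds: "0 \<le> distance_sum n z" "distance_sum n z / (real n - 2) \<le> 2 * real n" if "z \<in> {1..n}" for z
  proof -
    show "0 \<le> distance_sum n z" by (simp add: distance_sum_def sum_nonneg)
    have "distance_sum n z \<le> (\<Sum>y=1..n. real n)"
      unfolding distance_sum_def using that by (intro sum_mono) auto
    also have "\<dots> \<le> 2 * real n * (real n - 2)" using n by (simp add: algebra_simps)
    finally show "distance_sum n z / (real n - 2) \<le> 2 * real n" using n by (simp add: field_simps)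
  qed
  define T where "T = (\<Sum>z=1..n. distance_sum n z)"
  have "T \<ge> 0" unfolding T_def by (intro sum_nonneg ds(1))
  have "T \<le> (\<Sum>z=1..n. 2 * real n * (real n - 2))"
    unfolding T_def using ds(2) n by (intro sum_mono) (auto simp: field_simps)
  then have "T / ((real n - 1) * (real n - 2)) \<le> real n * (2 * real n * (real n - 2)) / ((real n - 1) * (real n - 2))"
    using n by (intro divide_right_mono) auto
  also have "\<dots> = 2 * (real n)\<^sup>2 / (real n - 1)" using n by (simp add: power2_eq_square)
  also have "\<dots> \<le> 4 * real n" using n by (simp add: field_simps power2_eq_square)
  finally have T: "0 \<le> T / ((real n - 1) * (real n - 2))" "T / ((real n - 1) * (real n - 2)) \<le> 4 * real n"
    using n \<open>T \<ge> 0\<close> by auto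
  have "0 \<le> distance_sum n x / (real n - 2)" "0 \<le> distance_sum n y / (real n - 2)"
    using ds(1) assms n by auto
  moreover have "\<bar>real x - real y\<bar> \<le> real n" using assms by auto
  ultimately show ?thesis
    using T ds(2)[OF assms(1)] ds(2)[OF assms(2)] unfolding centered_distance_def T_def[symmetric] by auto
qed

lemma centered_distance_row2:
  assumes "x \<in> {1..n}"
  shows "(\<Sum>y=1..n. (centered_distance n x y)\<^sup>2) \<le> 81 * real n ^ 3"
proof -
  have "(\<Sum>y=1..n. (centered_distance n x y)\<^sup>2) \<le> (\<Sum>y=1..n. (9 * real n)\<^sup>2)"
  proof (intro sum_mono)
    fix y assume "y \<in> {1..n}"
    then show "(centered_distance n x y)\<^sup>2 \<le> (9 * real n)\<^sup>2"
      using abs_centered_distance_le[OF assms, of y] abs_le_square_iff[of "centered_distance n x y" "9 * real n"] by simp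
  qed
  then show ?thesis by (simp add: power2_eq_square power3_eq_cube)
qed

abbreviation (input) "ip u w \<equiv> pairing {1..n} u w id id"

text \<open>Centering is a projection, so one of the two factors may be left uncentered; the
  remaining product is \<open>1 - c\<close> times the adjacency itself.\<close>

lemma adjacency_norm: "ip (centered_adjacency n) (centered_adjacency n) = real n - 2 * real n / (real n - 1)"
proof -
  define c where "c = 2 / (real n - 1)"
  have "2 * ip (centered_adjacency n) (centered_adjacency n)
      = (\<Sum>x=1..n. \<Sum>y=1..n. centered_adjacency n x y * cyclic_adjacency n x y
          - c * centered_adjacency n x y)"
    unfolding pairing_def by (simp, intro sum.cong refl) (auto simp: centered_adjacency_def c_def[symmetric] algebra_simps)
  also have "\<dots> = (\<Sum>x=1..n. \<Sum>y=1..n. centered_adjacency n x y * cyclic_adjacency n x y)"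
    using doubly_centeredD(3)[OF doubly_centered_adjacency]
    by (simp add: sum_subtractf sum_distrib_left[symmetric])
  also have "\<dots> = (\<Sum>x=1..n. \<Sum>y=1..n. (1 - c) * cyclic_adjacency n x y)"
  proof (intro sum.cong refl)
    fix x y
    show "centered_adjacency n x y * cyclic_adjacency n x y = (1 - c) * cyclic_adjacency n x y"
      using cyclic_adjacency_range[of x y]
      by (cases "x = y") (auto simp: centered_adjacency_def cyclic_adjacency_diag c_def)
  qed
  also have "\<dots> = (1 - c) * (2 * real n)"
    by (simp add: sum_distrib_left[symmetric] cyclic_adjacency_row del: One_nat_def)
  finally have "ip (centered_adjacency n) (centered_adjacency n) = real n - real n * c"
    by (simp add: algebra_simps)
  then show ?thesis by (simp add: c_def)
qed

text \<open>By the same projection argument twice the norm is the sum of squared distances, minus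
  2/(n-2) times the sum of squared row sums, plus T^2/((n-1)(n-2)) for the total T. Power sums are
  inserted; only the leading term n^4/45 matters in the limit.\<close>

lemma distance_norm: "ip (centered_distance n) (centered_distance n) =
  ((real n)\<^sup>2 * ((real n)\<^sup>2 - 1) / 6
    - 2 * ((real n + 1) * ((real n + 1) ^ 4 - 1) / 30 - real n * (real n + 1)\<^sup>2 * ((real n + 1)\<^sup>2 - 1) / 6
      + real n ^ 3 * (real n + 1)\<^sup>2 / 4) / (real n - 2)
    + (real n * ((real n)\<^sup>2 - 1) / 3)\<^sup>2 / ((real n - 1) * (real n - 2))) / 2"
proof -
  define T where "T = (\<Sum>z=1..n. distance_sum n z)"
  define g where "g = (\<lambda>x. distance_sum n x / (real n - 2))"
  define c where "c = T / ((real n - 1) * (real n - 2))"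
  define A where "A = (\<lambda>x y. \<bar>real x - real y\<bar>)"
  let ?d = "centered_distance n"
  note D = doubly_centeredD[OF doubly_centered_distance]
  have d: "?d x y = (if x = y then 0 else A x y - g x - g y + c)" for x y
    by (simp add: centered_distance_def g_def c_def A_def T_def)
  have "2 * ip ?d ?d = (\<Sum>x=1..n. \<Sum>y=1..n. ?d x y * A x y - g x * ?d x y - ?d x y * g y + c * ?d x y)"
    unfolding pairing_def by (simp, intro sum.cong refl) (auto simp: d algebra_simps)
  also have "\<dots> = (\<Sum>x=1..n. \<Sum>y=1..n. ?d x y * A x y)"
  proof -
    have "(\<Sum>x=1..n. \<Sum>y=1..n. ?d x y * g y) = (\<Sum>y=1..n. \<Sum>x=1..n. ?d x y * g y)" by (rule sum.swap)
    also have "\<dots> = 0" by (simp add: sum_distrib_right[symmetric] D(4) del: One_nat_def)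
    finally show ?thesis
      by (simp add: sum_subtractf sum.distrib sum_distrib_left[symmetric] D(3) del: One_nat_def)
  qed
  also have "\<dots> = (\<Sum>x=1..n. \<Sum>y=1..n. A x y * A x y - g x * A x y - A x y * g y + c * A x y)"
    by (intro sum.cong refl) (auto simp: d A_def algebra_simps)
  also have "\<dots> = (\<Sum>x=1..n. \<Sum>y=1..n. A x y * A x y) - (\<Sum>x=1..n. g x * distance_sum n x)
      - (\<Sum>x=1..n. distance_sum n x * g x) + c * T"
  proof -
    have r: "(\<Sum>y=1..n. A x y) = distance_sum n x" for x by (simp add: A_def distance_sum_def)
    have "(\<Sum>x=1..n. \<Sum>y=1..n. A x y * g y) = (\<Sum>y=1..n. \<Sum>x=1..n. A y x * g y)"
      by (subst sum.swap) (simp add: A_def abs_minus_commute)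
    also have "\<dots> = (\<Sum>y=1..n. distance_sum n y * g y)" by (simp add: sum_distrib_right[symmetric] r del: One_nat_def)
    finally show ?thesis
      by (simp add: sum_subtractf sum.distrib sum_distrib_left[symmetric] r T_def del: One_nat_def)
  qed
  also have "(\<Sum>x=1..n. \<Sum>y=1..n. A x y * A x y) = (real n)\<^sup>2 * ((real n)\<^sup>2 - 1) / 6"
  proof -
    have s1: "(\<Sum>x=1..m. real x) = real m * (real m + 1) / 2" for m
      by (induction m) (auto simp: field_simps)
    have s2: "(\<Sum>x=1..m. real x * real x) = real m * (real m + 1) * (2 * real m + 1) / 6" for m
      by (induction m) (auto simp: field_simps)
    have "(\<Sum>x=1..n. \<Sum>y=1..n. A x y * A x y) = (\<Sum>x=1..n. \<Sum>y=1..n. real x * real x + real y * real y - 2 * (real x * real y))"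
      by (intro sum.cong refl) (auto simp: A_def abs_if algebra_simps)
    also have "\<dots> = 2 * real n * (\<Sum>x=1..n. real x * real x) - 2 * ((\<Sum>x=1..n. real x) * (\<Sum>x=1..n. real x))"
      by (simp add: sum_subtractf sum.distrib sum_distrib_left[symmetric] sum_product)
    also have "\<dots> = (real n)\<^sup>2 * ((real n)\<^sup>2 - 1) / 6" unfolding s1 s2 by (simp add: field_simps power2_eq_square)
    finally show ?thesis .
  qed
  also have "(\<Sum>x=1..n. g x * distance_sum n x) = (\<Sum>x=1..n. (distance_sum n x)\<^sup>2) / (real n - 2)"
    by (simp add: g_def sum_divide_distrib power2_eq_square)
  also have "(\<Sum>x=1..n. distance_sum n x * g x) = (\<Sum>x=1..n. (distance_sum n x)\<^sup>2) / (real n - 2)"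
    by (simp add: g_def sum_divide_distrib power2_eq_square)
  also have "c * T = T\<^sup>2 / ((real n - 1) * (real n - 2))" by (simp add: c_def power2_eq_square)
  finally show ?thesis
    unfolding sum_distance_sum[symmetric] sum_distance_sum_sq[symmetric] T_def[symmetric] by (simp add: id_def)
qed

end

section \<open>The Chatterjee kernel\<close>

text \<open>For \<open>p = R\<^sub>i\<close> and \<open>q = R\<^sub>j\<close> the first pairing
  belongs to the entry (i, j) of the Chatterjee matrix, the second to (j, i). Each enters with
  -3/(n^2 - 1), halved by the symmetrization.\<close>

definition chatterjee_kernel :: "nat \<Rightarrow> (nat \<Rightarrow> nat) \<Rightarrow> (nat \<Rightarrow> nat) \<Rightarrow> real" where
  "chatterjee_kernel n p q = - (3 / (2 * ((real n)\<^sup>2 - 1))) *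
    (pairing {1..n} (centered_adjacency n) (centered_distance n) p q +
     pairing {1..n} (centered_distance n) (centered_adjacency n) p q)"

definition kernel_scale :: "nat \<Rightarrow> real" where
  "kernel_scale n = 3 / (2 * ((real n)\<^sup>2 - 1))"

text \<open>
  In the names below, \<open>e\<close> is the centered cyclic adjacency and \<open>d\<close> the centered distance;
  \<open>kernel_kappa\<close> and \<open>kernel_theta\<close> serve as the bounds \<open>h_cov\<close> and \<open>h_gram\<close>.
\<close>

definition orth_const :: "nat \<Rightarrow> real" where
  "orth_const n = 2 / (real n * (real n - 3))"

definition norm_ee :: "nat \<Rightarrow> real" where
  "norm_ee n = pairing {1..n} (centered_adjacency n) (centered_adjacency n) id id"

definition norm_dd :: "nat \<Rightarrow> real" where
  "norm_dd n = pairing {1..n} (centered_distance n) (centered_distance n) id id"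

definition norm_ed :: "nat \<Rightarrow> real" where
  "norm_ed n = pairing {1..n} (centered_adjacency n) (centered_distance n) id id"

text \<open>Expanding the square of the two pairings, orthogonality gives two products
  \<open>norm_ee n * norm_dd n\<close> and two squares of \<open>norm_ed n\<close>.\<close>

definition kernel_var :: "nat \<Rightarrow> real" where
  "kernel_var n = (kernel_scale n)\<^sup>2 * orth_const n * (2 * norm_ee n * norm_dd n + 2 * (norm_ed n)\<^sup>2)"

definition kernel_kappa :: "nat \<Rightarrow> real" where
  "kernel_kappa n = 16 * kernel_scale n ^ 4 * orth_const n ^ 3 * (norm_ee n * norm_dd n)\<^sup>2"

definition kernel_theta :: "nat \<Rightarrow> real" where
  "kernel_theta n = 1024 * kernel_scale n ^ 4 * (orth_const n)\<^sup>2 * real n ^ 3 *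
    (norm_ee n * (81 * real n ^ 3) + norm_dd n * 4)\<^sup>2"

lemma sum4_sq_le: "(a + b + c + d)\<^sup>2 \<le> 4 * (a\<^sup>2 + b\<^sup>2 + c\<^sup>2 + d\<^sup>2)" for a b c d :: real
  using zero_le_power2[of "a - b"] zero_le_power2[of "a - c"] zero_le_power2[of "a - d"]
    zero_le_power2[of "b - c"] zero_le_power2[of "b - d"] zero_le_power2[of "c - d"]
  by (simp add: power2_eq_square algebra_simps)

context
  fixes n :: nat
  assumes n: "n \<ge> 4"
begin

lemma kernel_scale_bounds: "0 \<le> kernel_scale n" "kernel_scale n \<le> 2 / (real n)\<^sup>2"
proof -
  have "4 * 4 \<le> real n * real n" using n by (intro mult_mono) auto
  then have *: "(real n)\<^sup>2 \<ge> 16" by (simp add: power2_eq_square)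
  then show "0 \<le> kernel_scale n" by (simp add: kernel_scale_def)
  show "kernel_scale n \<le> 2 / (real n)\<^sup>2" using * by (simp add: kernel_scale_def divide_simps)
qed

lemma orth_const_bounds: "0 \<le> orth_const n" "orth_const n \<le> 8 / (real n)\<^sup>2"
proof -
  show "0 \<le> orth_const n" using n by (simp add: orth_const_def)
  have "real n * real n \<le> real n * (4 * (real n - 3))" using n by (intro mult_left_mono) auto
  then show "orth_const n \<le> 8 / (real n)\<^sup>2" using n by (simp add: orth_const_def field_simps power2_eq_square)
qed

lemma norm_ee_bounds: "0 \<le> norm_ee n" "norm_ee n \<le> real n"
  unfolding norm_ee_def using pairing_self_nonneg n by (blast, simp only: adjacency_norm, simp)

lemma norm_dd_bounds: "0 \<le> norm_dd n" "norm_dd n \<le> 41 * real n ^ 4"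
proof -
  show "0 \<le> norm_dd n" unfolding norm_dd_def by (rule pairing_self_nonneg)
  have "2 * norm_dd n = (\<Sum>x=1..n. \<Sum>y=1..n. (centered_distance n x y)\<^sup>2)"
    by (simp add: norm_dd_def pairing_def power2_eq_square)
  also have "\<dots> \<le> (\<Sum>x=1..n. 81 * real n ^ 3)" by (intro sum_mono centered_distance_row2[OF n])
  also have "\<dots> = 81 * real n ^ 4" by (simp add: power4_eq_xxxx power3_eq_cube)
  finally show "norm_dd n \<le> 41 * real n ^ 4" using zero_le_power[of "real n" 4] by linarith
qed

lemma norm_ed_sq_le: "(norm_ed n)\<^sup>2 \<le> norm_ee n * norm_dd n"
  unfolding norm_ed_def norm_ee_def norm_dd_def by (rule pairing_Cauchy_Schwarz)

lemma abs_norm_ed_le: "\<bar>norm_ed n\<bar> \<le> 18 * (real n)\<^sup>2"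
  using pairing_bound[of "{1..n}" "real n" "centered_adjacency n" 4 "centered_distance n" "9 * real n" id id]
    centered_adjacency_row[OF n] abs_centered_distance_le[OF n]
  by (simp add: norm_ed_def permutes_id power2_eq_square del: One_nat_def)

text \<open>The functions \<open>u\<close>, \<open>u'\<close>, \<open>w\<close>, \<open>w'\<close>
  stand for the adjacency and the distance themselves or for their swap differences, so that one
  statement covers both the covariance and the Gram matrix.\<close>

lemma kernel_covariance:
  assumes u: "doubly_centered {1..n} u" "doubly_centered {1..n} u'"
    and w: "doubly_centered {1..n} w" "doubly_centered {1..n} w'"
    and p: "p permutes {1..n}" and q: "q permutes {1..n}"
  defines "e \<equiv> centered_adjacency n" and "d \<equiv> centered_distance n"
  shows "avg (perms {1..n}) (\<lambda>r. (pairing {1..n} u e p r + pairing {1..n} u' d p r) *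
      (pairing {1..n} w e q r + pairing {1..n} w' d q r))
    = orth_const n * (norm_ee n * pairing {1..n} u w p q + norm_ed n * pairing {1..n} u w' p q +
      norm_ed n * pairing {1..n} u' w p q + norm_dd n * pairing {1..n} u' w' p q)"
proof -
  have e: "doubly_centered {1..n} e" and d: "doubly_centered {1..n} d"
    unfolding e_def d_def by (rule doubly_centered_adjacency[OF n] doubly_centered_distance[OF n])+
  have orth: "avg (perms {1..n}) (\<lambda>r. pairing {1..n} f v p r * pairing {1..n} g y q r)
    = orth_const n * pairing {1..n} v y id id * pairing {1..n} f g p q"
    if "doubly_centered {1..n} f" "doubly_centered {1..n} v" "doubly_centered {1..n} g" "doubly_centered {1..n} y"
    for f v g y
    using pairing_orthogonality[OF _ _ that p q] n by (simp add: orth_const_def)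
  have "avg (perms {1..n}) (\<lambda>r. (pairing {1..n} u e p r + pairing {1..n} u' d p r) *
      (pairing {1..n} w e q r + pairing {1..n} w' d q r))
    = avg (perms {1..n}) (\<lambda>r. pairing {1..n} u e p r * pairing {1..n} w e q r)
      + avg (perms {1..n}) (\<lambda>r. pairing {1..n} u e p r * pairing {1..n} w' d q r)
      + avg (perms {1..n}) (\<lambda>r. pairing {1..n} u' d p r * pairing {1..n} w e q r)
      + avg (perms {1..n}) (\<lambda>r. pairing {1..n} u' d p r * pairing {1..n} w' d q r)"
    unfolding avg_add[symmetric] by (simp add: algebra_simps)
  also have "\<dots> = orth_const n * (norm_ee n * pairing {1..n} u w p q + norm_ed n * pairing {1..n} u w' p q +
      norm_ed n * pairing {1..n} u' w p q + norm_dd n * pairing {1..n} u' w' p q)"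
    unfolding orth[OF u(1) e w(1) e] orth[OF u(1) e w(2) d] orth[OF u(2) d w(1) e] orth[OF u(2) d w(2) d]
      norm_ee_def norm_ed_def norm_dd_def e_def[symmetric] d_def[symmetric] pairing_commute[of _ d e]
    by (simp add: algebra_simps)
  finally show ?thesis .
qed

text \<open>The numerals are products of the bound 4 on row sums of the adjacency and
  \<open>9 * real n\<close> on entries of the distance: 36 comes from two pairings bounded by n * 4
  * 9n / 2, and 288 from two increments bounded by 4 * 4 * 9n. The Poincare constant is that of the
  swaps of values.\<close>

lemma kernel_degenerate: "degenerate_kernel (perms {1..n}) (chatterjee_kernel n) ({1..n} \<times> {1..n})
    (\<lambda>i q. transposition (fst i) (snd i) \<circ> q) (36 * (real n)\<^sup>2 * kernel_scale n) (kernel_var n) (kernel_kappa n)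
    (1 / (2 * real n)) (288 * real n * kernel_scale n) (kernel_theta n)"
proof
  define V where "V = {1..n}"
  define e where "e = centered_adjacency n"
  define d where "d = centered_distance n"
  define \<alpha> where "\<alpha> = kernel_scale n"
  define \<beta> where "\<beta> = orth_const n"
  define N where "N = real n"
  have e: "doubly_centered V e" and d: "doubly_centered V d"
    unfolding e_def d_def V_def by (rule doubly_centered_adjacency[OF n] doubly_centered_distance[OF n])+
  have V: "finite V" "N = real (card V)" by (simp_all add: V_def N_def)
  have ker: "chatterjee_kernel n p q = - \<alpha> * (pairing V e d p q + pairing V d e p q)" for p q
    by (simp add: chatterjee_kernel_def \<alpha>_def kernel_scale_def e_def d_def V_def)
  have ker': "chatterjee_kernel n p q = - \<alpha> * (pairing V d e q p + pairing V e d q p)" for p q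
    unfolding ker by (simp add: pairing_commute[of V e d] pairing_def mult.commute)
  have \<alpha>: "\<alpha> \<ge> 0" unfolding \<alpha>_def by (rule kernel_scale_bounds)
  have \<beta>: "\<beta> \<ge> 0" unfolding \<beta>_def by (rule orth_const_bounds)
  have eL: "(\<Sum>y\<in>V. \<bar>e x y\<bar>) \<le> 4" if "x \<in> V" for x
    using that centered_adjacency_row[OF n] by (simp add: e_def V_def)
  have e2: "(\<Sum>y\<in>V. (e x y)\<^sup>2) \<le> 4" if "x \<in> V" for x
    using that centered_adjacency_row2[OF n] by (simp add: e_def V_def)
  have dW: "\<bar>d x y\<bar> \<le> 9 * N" if "x \<in> V" "y \<in> V" for x y
    using that abs_centered_distance_le[OF n] by (simp add: d_def V_def N_def)
  have d2: "(\<Sum>y\<in>V. (d x y)\<^sup>2) \<le> 81 * N ^ 3" if "x \<in> V" for x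
    using that centered_distance_row2[OF n] by (simp add: d_def V_def N_def)
  have cov: "avg (perms V) (\<lambda>r. (pairing V u e p r + pairing V u' d p r) * (pairing V w e q r + pairing V w' d q r))
    = \<beta> * (norm_ee n * pairing V u w p q + norm_ed n * pairing V u w' p q + norm_ed n * pairing V u' w p q + norm_dd n * pairing V u' w' p q)"
    if "doubly_centered V u" "doubly_centered V u'" "doubly_centered V w" "doubly_centered V w'" "p permutes V" "q permutes V"
    for u u' w w' p q
    using kernel_covariance that unfolding V_def e_def d_def \<beta>_def by blast
  \<comment> \<open>Averaging out \<open>q\<close> leaves again a combination of pairings in
    \<open>r\<close> and \<open>r'\<close>, so orthogonality can be used a second time for the mean
    square required by \<open>h_cov\<close>.\<close>
  have h2: "avg (perms V) (\<lambda>q. chatterjee_kernel n q r * chatterjee_kernel n q r') = \<alpha>\<^sup>2 * \<beta> *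
      (norm_ee n * pairing V d d r r' + norm_ed n * pairing V d e r r' + norm_ed n * pairing V e d r r' + norm_dd n * pairing V e e r r')"
    if r: "r permutes V" "r' permutes V" for r r'
  proof -
    have "avg (perms V) (\<lambda>q. chatterjee_kernel n q r * chatterjee_kernel n q r')
      = avg (perms V) (\<lambda>q. \<alpha>\<^sup>2 * ((pairing V d e r q + pairing V e d r q) * (pairing V d e r' q + pairing V e d r' q)))"
      unfolding ker' by (simp add: power2_eq_square algebra_simps)
    then show ?thesis unfolding avg_cmult cov[OF d e d e r] by simp
  qed
  show "finite (perms {1..n})" by (intro finite_permutations) simp
  show "perms {1..n} \<noteq> {}" by (rule perms_nonempty)
  show "finite ({1..n} \<times> {1..n})" by simp
  show "chatterjee_kernel n q r = chatterjee_kernel n r q" for q r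
    unfolding ker'[of q r] ker[of r q] by simp
  show "\<bar>chatterjee_kernel n q r\<bar> \<le> 36 * (real n)\<^sup>2 * kernel_scale n"
    if "q \<in> perms {1..n}" "r \<in> perms {1..n}" for q r
  proof -
    have qr: "q permutes V" "r permutes V" using that by (simp_all add: V_def)
    have "\<bar>pairing V e d q r + pairing V e d r q\<bar> \<le> N * 4 * (9 * N) / 2 + N * 4 * (9 * N) / 2"
      by (intro order.trans[OF abs_triangle_ineq] add_mono pairing_bound V eL dW qr)
    moreover have "pairing V d e q r = pairing V e d r q" by (simp add: pairing_def mult.commute)
    ultimately have "\<bar>pairing V e d q r + pairing V d e q r\<bar> \<le> 36 * N\<^sup>2" by (simp add: power2_eq_square)
    then have "\<alpha> * \<bar>pairing V e d q r + pairing V d e q r\<bar> \<le> \<alpha> * (36 * N\<^sup>2)" by (intro mult_left_mono \<alpha>)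
    then show ?thesis unfolding ker by (simp add: abs_mult \<alpha> N_def mult_ac) (simp add: \<alpha>_def mult_ac)
  qed
  show "avg (perms {1..n}) (\<lambda>q. chatterjee_kernel n q r * chatterjee_kernel n q r) = kernel_var n"
    if "r \<in> perms {1..n}" for r
  proof -
    have r: "r permutes V" using that by (simp add: V_def)
    show ?thesis
      using h2[OF r r] unfolding pairing_same[OF r] pairing_commute[of V d e]
      by (simp add: kernel_var_def \<alpha>_def \<beta>_def norm_ee_def norm_dd_def norm_ed_def e_def d_def V_def
          power2_eq_square algebra_simps)
  qed
  show "avg (perms {1..n}) (\<lambda>r. avg (perms {1..n}) (\<lambda>r'. (avg (perms {1..n})
      (\<lambda>q. chatterjee_kernel n q r * chatterjee_kernel n q r'))\<^sup>2)) \<le> kernel_kappa n"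
    unfolding V_def[symmetric]
  proof (rule avg_le_const[OF finite_permutations[OF V(1)] perms_nonempty])
    fix r assume "r \<in> perms V"
    then have r: "r permutes V" by simp
    have sq: "avg (perms V) (\<lambda>r'. (pairing V u w r r')\<^sup>2) = \<beta> * pairing V w w id id * pairing V u u id id"
      if "doubly_centered V u" "doubly_centered V w" for u w
      using pairing_orthogonality[OF V(1) _ that(1,2,1,2) r r] n pairing_same[OF r]
      by (simp add: power2_eq_square \<beta>_def orth_const_def V_def del: One_nat_def)
    have "avg (perms V) (\<lambda>r'. (avg (perms V) (\<lambda>q. chatterjee_kernel n q r * chatterjee_kernel n q r'))\<^sup>2)
      \<le> avg (perms V) (\<lambda>r'. (\<alpha>\<^sup>2 * \<beta>)\<^sup>2 * (4 * ((norm_ee n)\<^sup>2 * (pairing V d d r r')\<^sup>2 + (norm_ed n)\<^sup>2 * (pairing V d e r r')\<^sup>2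
         + (norm_ed n)\<^sup>2 * (pairing V e d r r')\<^sup>2 + (norm_dd n)\<^sup>2 * (pairing V e e r r')\<^sup>2)))"
    proof (intro avg_mono)
      fix r' assume "r' \<in> perms V"
      then have r': "r' permutes V" by simp
      show "(avg (perms V) (\<lambda>q. chatterjee_kernel n q r * chatterjee_kernel n q r'))\<^sup>2 \<le> (\<alpha>\<^sup>2 * \<beta>)\<^sup>2 *
        (4 * ((norm_ee n)\<^sup>2 * (pairing V d d r r')\<^sup>2 + (norm_ed n)\<^sup>2 * (pairing V d e r r')\<^sup>2
         + (norm_ed n)\<^sup>2 * (pairing V e d r r')\<^sup>2 + (norm_dd n)\<^sup>2 * (pairing V e e r r')\<^sup>2))"
        unfolding h2[OF r r'] power_mult_distrib[of "\<alpha>\<^sup>2 * \<beta>"]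
        by (intro mult_left_mono order.trans[OF sum4_sq_le]) (simp_all add: power_mult_distrib)
    qed
    also have "\<dots> = (\<alpha>\<^sup>2 * \<beta>)\<^sup>2 * (4 * \<beta> * ((norm_ee n)\<^sup>2 * (norm_dd n)\<^sup>2 + 2 * ((norm_ed n)\<^sup>2 * (norm_ee n * norm_dd n))
         + (norm_dd n)\<^sup>2 * (norm_ee n)\<^sup>2))"
      unfolding avg_cmult avg_add sq[OF d d] sq[OF d e] sq[OF e d] sq[OF e e]
      by (simp add: norm_ee_def norm_dd_def V_def d_def e_def power2_eq_square algebra_simps)
    also have "\<dots> \<le> (\<alpha>\<^sup>2 * \<beta>)\<^sup>2 * (4 * \<beta> * ((norm_ee n)\<^sup>2 * (norm_dd n)\<^sup>2 + 2 * ((norm_ee n * norm_dd n) * (norm_ee n * norm_dd n))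
         + (norm_dd n)\<^sup>2 * (norm_ee n)\<^sup>2))"
      using \<beta> norm_ee_bounds norm_dd_bounds
      by (intro mult_left_mono add_mono mult_right_mono norm_ed_sq_le order.refl mult_nonneg_nonneg) auto
    also have "\<dots> = kernel_kappa n"
      by (simp add: kernel_kappa_def \<alpha>_def \<beta>_def power2_eq_square power3_eq_cube power4_eq_xxxx)
    finally show "avg (perms V) (\<lambda>r'. (avg (perms V) (\<lambda>q. chatterjee_kernel n q r * chatterjee_kernel n q r'))\<^sup>2) \<le> kernel_kappa n" .
  qed
  show "0 \<le> 1 / (2 * real n)" by simp
  show "avg (perms {1..n}) (\<lambda>q. (cmod (f q - avg (perms {1..n}) f))\<^sup>2) \<le> 1 / (2 * real n) *
      (\<Sum>i\<in>{1..n} \<times> {1..n}. avg (perms {1..n}) (\<lambda>q. (cmod (f q - f (transposition (fst i) (snd i) \<circ> q)))\<^sup>2))"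
    for f :: "(nat \<Rightarrow> nat) \<Rightarrow> complex"
  proof -
    have "2 * real n * avg (perms {1..n}) (\<lambda>q. (cmod (f q - avg (perms {1..n}) f))\<^sup>2) \<le>
      (\<Sum>i\<in>{1..n} \<times> {1..n}. avg (perms {1..n}) (\<lambda>q. (cmod (f q - f (transposition (fst i) (snd i) \<circ> q)))\<^sup>2))"
      using perms_variance_complex[of "{1..n}" f] by (simp add: sum.cartesian_product case_prod_unfold)
    then show ?thesis using n by (simp add: field_simps)
  qed
  have incr: "chatterjee_kernel n (transposition (fst i) (snd i) \<circ> q) r - chatterjee_kernel n q r
      = - \<alpha> * (pairing V (swap_diff i d) e q r + pairing V (swap_diff i e) d q r)" for i q r
    unfolding ker swap_diff_def[abs_def] pairing_left_diff by (simp add: pairing_def algebra_simps)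
  show "\<bar>chatterjee_kernel n (transposition (fst i) (snd i) \<circ> q) r - chatterjee_kernel n q r\<bar> \<le> 288 * real n * kernel_scale n"
    if "i \<in> {1..n} \<times> {1..n}" "q \<in> perms {1..n}" "r \<in> perms {1..n}" for i q r
  proof -
    have iqr: "i \<in> V \<times> V" "q permutes V" "r permutes V" using that by (simp_all add: V_def)
    have "\<bar>pairing V (swap_diff i d) e q r\<bar> \<le> 4 * 4 * (9 * N)"
      by (rule pairing_swap_diff_bound'[OF V dW doubly_centeredD(1)[OF e] eL iqr(2,3,1)])
    moreover have "\<bar>pairing V (swap_diff i e) d q r\<bar> \<le> 4 * 4 * (9 * N)"
      by (rule pairing_swap_diff_bound[OF V doubly_centeredD(1)[OF e] eL dW iqr(2,3,1)])
    ultimately have "\<bar>pairing V (swap_diff i d) e q r + pairing V (swap_diff i e) d q r\<bar> \<le> 288 * N"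
      by linarith
    then have "\<alpha> * \<bar>pairing V (swap_diff i d) e q r + pairing V (swap_diff i e) d q r\<bar> \<le> \<alpha> * (288 * N)"
      by (intro mult_left_mono \<alpha>)
    then show ?thesis unfolding incr by (simp add: abs_mult \<alpha> N_def mult_ac) (simp add: \<alpha>_def mult_ac)
  qed
  show "(\<Sum>i\<in>{1..n} \<times> {1..n}. \<Sum>k\<in>{1..n} \<times> {1..n}. (avg (perms {1..n}) (\<lambda>r.
      (chatterjee_kernel n (transposition (fst i) (snd i) \<circ> q) r - chatterjee_kernel n q r) *
      (chatterjee_kernel n (transposition (fst k) (snd k) \<circ> q) r - chatterjee_kernel n q r)))\<^sup>2) \<le> kernel_theta n"
    if "q \<in> perms {1..n}" for q
  proof -
    have q: "q permutes V" using that by (simp add: V_def)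
    \<comment> \<open>Orthogonality turns every Gram entry into pairings of swap differences at
      \<open>q\<close>, and pairings with equal arguments do not depend on \<open>q\<close>.\<close>
    let ?G = "\<lambda>u w i k. pairing V (swap_diff i u) (swap_diff k w) id id"
    have "(\<Sum>i\<in>V \<times> V. \<Sum>k\<in>V \<times> V. (avg (perms V) (\<lambda>r.
        (- \<alpha> * (pairing V (swap_diff i d) e q r + pairing V (swap_diff i e) d q r)) *
        (- \<alpha> * (pairing V (swap_diff k d) e q r + pairing V (swap_diff k e) d q r))))\<^sup>2)
      \<le> (\<Sum>i\<in>V \<times> V. \<Sum>k\<in>V \<times> V. (\<alpha>\<^sup>2 * \<beta>)\<^sup>2 * (4 * ((norm_ee n)\<^sup>2 * (?G d d i k)\<^sup>2 + (norm_ed n)\<^sup>2 * (?G d e i k)\<^sup>2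
         + (norm_ed n)\<^sup>2 * (?G e d i k)\<^sup>2 + (norm_dd n)\<^sup>2 * (?G e e i k)\<^sup>2)))"
    proof (intro sum_mono)
      fix i k assume ik: "i \<in> V \<times> V" "k \<in> V \<times> V"
      have "avg (perms V) (\<lambda>r.
        (- \<alpha> * (pairing V (swap_diff i d) e q r + pairing V (swap_diff i e) d q r)) *
        (- \<alpha> * (pairing V (swap_diff k d) e q r + pairing V (swap_diff k e) d q r)))
        = avg (perms V) (\<lambda>r. \<alpha>\<^sup>2 *
        ((pairing V (swap_diff i d) e q r + pairing V (swap_diff i e) d q r) *
        (pairing V (swap_diff k d) e q r + pairing V (swap_diff k e) d q r)))"
        by (simp add: power2_eq_square mult_ac)
      also have "\<dots> = \<alpha>\<^sup>2 * \<beta> * (norm_ee n * ?G d d i k + norm_ed n * ?G d e i k + norm_ed n * ?G e d i k + norm_dd n * ?G e e i k)"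
        unfolding avg_cmult
        using cov[OF doubly_centered_swap_diff[OF d ik(1)] doubly_centered_swap_diff[OF e ik(1)]
            doubly_centered_swap_diff[OF d ik(2)] doubly_centered_swap_diff[OF e ik(2)] q q]
        by (simp add: pairing_same[OF q])
      finally show "(avg (perms V) (\<lambda>r.
        (- \<alpha> * (pairing V (swap_diff i d) e q r + pairing V (swap_diff i e) d q r)) *
        (- \<alpha> * (pairing V (swap_diff k d) e q r + pairing V (swap_diff k e) d q r))))\<^sup>2
        \<le> (\<alpha>\<^sup>2 * \<beta>)\<^sup>2 * (4 * ((norm_ee n)\<^sup>2 * (?G d d i k)\<^sup>2 + (norm_ed n)\<^sup>2 * (?G d e i k)\<^sup>2
         + (norm_ed n)\<^sup>2 * (?G e d i k)\<^sup>2 + (norm_dd n)\<^sup>2 * (?G e e i k)\<^sup>2))"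
        unfolding power_mult_distrib[of "\<alpha>\<^sup>2 * \<beta>"]
        by (simp only: power_mult_distrib[of "\<alpha>\<^sup>2 * \<beta>"])
          (intro mult_left_mono order.trans[OF sum4_sq_le], simp_all add: power_mult_distrib)
    qed
    also have "\<dots> = (\<alpha>\<^sup>2 * \<beta>)\<^sup>2 * (4 * ((norm_ee n)\<^sup>2 * (\<Sum>i\<in>V \<times> V. \<Sum>k\<in>V \<times> V. (?G d d i k)\<^sup>2)
        + (norm_ed n)\<^sup>2 * (\<Sum>i\<in>V \<times> V. \<Sum>k\<in>V \<times> V. (?G d e i k)\<^sup>2)
        + (norm_ed n)\<^sup>2 * (\<Sum>i\<in>V \<times> V. \<Sum>k\<in>V \<times> V. (?G e d i k)\<^sup>2)
        + (norm_dd n)\<^sup>2 * (\<Sum>i\<in>V \<times> V. \<Sum>k\<in>V \<times> V. (?G e e i k)\<^sup>2)))"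
      by (simp only: sum_distrib_left[symmetric] sum.distrib)
    also have "\<dots> \<le> (\<alpha>\<^sup>2 * \<beta>)\<^sup>2 * (4 * ((norm_ee n)\<^sup>2 * (256 * N ^ 3 * (81 * N ^ 3) * (81 * N ^ 3))
        + (norm_ee n * norm_dd n) * (256 * N ^ 3 * (81 * N ^ 3) * 4)
        + (norm_ee n * norm_dd n) * (256 * N ^ 3 * 4 * (81 * N ^ 3))
        + (norm_dd n)\<^sup>2 * (256 * N ^ 3 * 4 * 4)))"
      using norm_ee_bounds norm_dd_bounds
      by (intro mult_left_mono add_mono mult_mono norm_ed_sq_le sum_pairing_swap_diff2[OF V] e d e2 d2 order.refl
          sum_nonneg mult_nonneg_nonneg) (auto simp: N_def)
    also have "\<dots> = kernel_theta n"
      unfolding kernel_theta_def \<alpha>_def[symmetric] \<beta>_def[symmetric] N_def[symmetric]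
      by (simp add: power2_eq_square power3_eq_cube power4_eq_xxxx algebra_simps)
    finally show ?thesis unfolding V_def[symmetric] by (simp only: incr)
  qed
qed

end

section \<open>The approximate quadratic equation\<close>

definition kernel_trace :: "nat \<Rightarrow> nat \<Rightarrow> complex \<Rightarrow> (nat \<Rightarrow> nat \<Rightarrow> nat) \<Rightarrow> complex" where
  "kernel_trace n p z R = resolvent_trace {..<p} (kernel_matrix (chatterjee_kernel n) R) z / of_nat p"

lemma mult_bounds:
  fixes a b c d :: real
  shows "0 \<le> a \<Longrightarrow> a \<le> b \<Longrightarrow> 0 \<le> c \<Longrightarrow> c \<le> d \<Longrightarrow> a * c \<le> b * d"
  by (intro mult_mono) auto

context
  fixes n :: nat
  assumes n: "n \<ge> 4"
begin

lemma norm_product_bound: "norm_ee n * norm_dd n \<le> 41 * real n ^ 5"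
  using mult_bounds[OF norm_ee_bounds[OF n] norm_dd_bounds[OF n]] by (simp add: eval_nat_numeral mult_ac)

lemma kernel_scale_pow: "kernel_scale n ^ k \<le> (2 / (real n)\<^sup>2) ^ k"
  by (intro power_mono kernel_scale_bounds n)

lemma orth_const_pow: "orth_const n ^ k \<le> (8 / (real n)\<^sup>2) ^ k"
  by (intro power_mono orth_const_bounds n)

lemma scale_orth_bound: "kernel_scale n ^ j * orth_const n ^ k \<le> 2 ^ j * 8 ^ k / real n ^ (2 * j + 2 * k)"
proof -
  have "kernel_scale n ^ j * orth_const n ^ k \<le> (2 / (real n)\<^sup>2) ^ j * (8 / (real n)\<^sup>2) ^ k"
    using kernel_scale_bounds[OF n] orth_const_bounds[OF n]
    by (intro mult_mono kernel_scale_pow orth_const_pow) auto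
  then show ?thesis by (simp add: power_divide power_add flip: power_mult)
qed

text \<open>The scale and \<open>orth_const\<close> are of order n^(-2), and the squared norms of
  order n and n^4. The numerals here and below are products of the crude constants 2, 8, 41 and 81
  in those bounds; for instance 5248 = 4 * 8 * 4 * 41.\<close>

lemma kernel_var_bounds: "0 \<le> kernel_var n" "kernel_var n \<le> 5248 / real n"
proof -
  note b = kernel_scale_bounds[OF n] orth_const_bounds[OF n] norm_ee_bounds[OF n] norm_dd_bounds[OF n]
  show "0 \<le> kernel_var n" using b by (simp add: kernel_var_def)
  have "kernel_var n \<le> ((kernel_scale n)\<^sup>2 * orth_const n) * (4 * (norm_ee n * norm_dd n))"
    unfolding kernel_var_def using norm_ed_sq_le[OF n] b by (intro mult_left_mono) (auto simp: mult_ac)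
  also have "\<dots> \<le> (2\<^sup>2 * 8 ^ 1 / real n ^ (2 * 2 + 2 * 1)) * (4 * (41 * real n ^ 5))"
    by (rule mult_bounds) (use b scale_orth_bound[of 2 1] norm_product_bound in \<open>auto simp: mult_ac\<close>)
  also have "\<dots> = 5248 / real n" using n by (simp add: field_simps eval_nat_numeral)
  finally show "kernel_var n \<le> 5248 / real n" .
qed

lemma kernel_kappa_bounds: "0 \<le> kernel_kappa n" "kernel_kappa n \<le> 220332032 / real n ^ 4"
proof -
  note b = kernel_scale_bounds[OF n] orth_const_bounds[OF n] norm_ee_bounds[OF n] norm_dd_bounds[OF n]
  show "0 \<le> kernel_kappa n" using b by (simp add: kernel_kappa_def)
  have "(norm_ee n * norm_dd n)\<^sup>2 \<le> (41 * real n ^ 5)\<^sup>2"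
    using b by (intro power_mono norm_product_bound) auto
  then have "(kernel_scale n ^ 4 * orth_const n ^ 3) * (norm_ee n * norm_dd n)\<^sup>2
      \<le> (2 ^ 4 * 8 ^ 3 / real n ^ (2 * 4 + 2 * 3)) * (41 * real n ^ 5)\<^sup>2"
    using b scale_orth_bound[of 4 3] by (intro mult_mono) auto
  also have "\<dots> = 13770752 / real n ^ 4" using n by (simp add: field_simps eval_nat_numeral)
  finally show "kernel_kappa n \<le> 220332032 / real n ^ 4" by (simp add: kernel_kappa_def mult_ac)
qed

text \<open>Order 1/n suffices: in \<open>error_bound\<close> it is multiplied by p^2 and the
  Poincare factor 1/(2n) and divided by \<open>t\<close>, which leaves n^(-1/2).\<close>

lemma kernel_theta_bounds: "0 \<le> kernel_theta n" "kernel_theta n \<le> 62941798400 / real n"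
proof -
  note b = kernel_scale_bounds[OF n] orth_const_bounds[OF n] norm_ee_bounds[OF n] norm_dd_bounds[OF n]
  show "0 \<le> kernel_theta n" using b by (simp add: kernel_theta_def)
  have "norm_ee n * (81 * real n ^ 3) + norm_dd n * 4 \<le> real n * (81 * real n ^ 3) + 41 * real n ^ 4 * 4"
    using b by (intro add_mono mult_right_mono) auto
  also have "\<dots> = 245 * real n ^ 4" by (simp add: eval_nat_numeral)
  finally have "(norm_ee n * (81 * real n ^ 3) + norm_dd n * 4)\<^sup>2 \<le> (245 * real n ^ 4)\<^sup>2"
    using b by (intro power_mono) auto
  then have "(kernel_scale n ^ 4 * (orth_const n)\<^sup>2) * (norm_ee n * (81 * real n ^ 3) + norm_dd n * 4)\<^sup>2
      \<le> (2 ^ 4 * 8 ^ 2 / real n ^ (2 * 4 + 2 * 2)) * (245 * real n ^ 4)\<^sup>2"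
    using b scale_orth_bound[of 4 2] by (intro mult_mono) auto
  also have "\<dots> = 61465600 / real n ^ 4" using n by (simp add: field_simps eval_nat_numeral)
  finally have "1024 * real n ^ 3 * ((kernel_scale n ^ 4 * (orth_const n)\<^sup>2) * (norm_ee n * (81 * real n ^ 3) + norm_dd n * 4)\<^sup>2)
      \<le> 1024 * real n ^ 3 * (61465600 / real n ^ 4)"
    by (intro mult_left_mono) auto
  also have "\<dots> \<le> 62941798400 / real n" using n by (simp add: field_simps eval_nat_numeral)
  finally show "kernel_theta n \<le> 62941798400 / real n" by (simp add: kernel_theta_def mult_ac)
qed

text \<open>The number \<Gamma> bounds p/n. The choice \<open>t = sqrt n\<close> balances a bounded
  quantity times \<open>t\<close> against one of order n divided by \<open>t\<close>; after the
  Poincare factor the argument of the outer root is of order n^(-1/2), and the error of order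
  n^(-1/4). The constants 72 and 576 are 36 and 288 times the factor 2 in the bound on the
  scale.\<close>

lemma kernel_trace_equation:
  assumes p: "p \<ge> 1" "real p \<le> \<Gamma> * real n" and z: "Im z > 0"
  defines "\<eta> \<equiv> Im z"
  shows "avg (PiE {..<p} (\<lambda>_. perms {1..n})) (\<lambda>R. cmod (1 + z * kernel_trace n p z R +
      of_real (kernel_var n * real p) * (kernel_trace n p z R)\<^sup>2))
    \<le> (sqrt ((4 * (sqrt (real n) * (\<Gamma>\<^sup>2 * 5248\<^sup>2 + \<Gamma> * (72\<^sup>2 * 5248)) / \<eta> ^ 4
        + (\<Gamma>\<^sup>2 * 62941798400 + \<Gamma> * 576 ^ 4) * sqrt (real n)) + 2 * \<Gamma>\<^sup>2 * 576 ^ 4 / \<eta>\<^sup>2) / real n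
        + 2 * (\<Gamma> ^ 3 * 220332032 / \<eta>\<^sup>2) / real n)
      + 5248 / real n / \<eta>) / \<eta>"
proof -
  interpret degenerate_kernel "perms {1..n}" "chatterjee_kernel n" "{1..n} \<times> {1..n}"
    "\<lambda>i q. transposition (fst i) (snd i) \<circ> q" "36 * (real n)\<^sup>2 * kernel_scale n" "kernel_var n" "kernel_kappa n"
    "1 / (2 * real n)" "288 * real n * kernel_scale n" "kernel_theta n"
    by (rule kernel_degenerate[OF n])
  define P where "P = real p"
  define N where "N = real n"
  define t where "t = sqrt N"
  define H where "H = 36 * (real n)\<^sup>2 * kernel_scale n"
  define \<delta> where "\<delta> = 288 * real n * kernel_scale n"
  define v where "v = kernel_var n"
  have N: "N \<ge> 4" and P: "P \<ge> 0" "P \<le> \<Gamma> * N" using n p by (simp_all add: N_def P_def)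
  have \<Gamma>: "\<Gamma> \<ge> 0" using P N by (simp add: zero_le_mult_iff order.trans[OF P(1)] P_def) (smt (verit) P(1) P(2) mult_less_0_iff)
  have t: "t > 0" "t * t = N" using N by (simp_all add: t_def)
  have \<eta>: "\<eta> > 0" using z by (simp add: \<eta>_def)
  have H: "0 \<le> H" "H \<le> 72"
  proof -
    show "0 \<le> H" using kernel_scale_bounds[OF n] by (simp add: H_def)
    have "H \<le> 36 * (real n)\<^sup>2 * (2 / (real n)\<^sup>2)" unfolding H_def
      by (intro mult_left_mono kernel_scale_bounds[OF n]) auto
    then show "H \<le> 72" using n by simp
  qed
  have \<delta>: "0 \<le> \<delta>" "\<delta> \<le> 576 / N"
  proof -
    show "0 \<le> \<delta>" using kernel_scale_bounds[OF n] by (simp add: \<delta>_def)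
    have "\<delta> \<le> 288 * real n * (2 / (real n)\<^sup>2)" unfolding \<delta>_def
      by (intro mult_left_mono kernel_scale_bounds[OF n]) auto
    then show "\<delta> \<le> 576 / N" using n by (simp add: N_def power2_eq_square)
  qed
  have v: "0 \<le> v" "v \<le> 5248 / N" using kernel_var_bounds by (simp_all add: v_def N_def)
  have PN: "P\<^sup>2 \<le> \<Gamma>\<^sup>2 * N\<^sup>2" "P ^ 3 \<le> \<Gamma> ^ 3 * N ^ 3"
    using power_mono[OF P(2,1), of 2] power_mono[OF P(2,1), of 3] by (simp_all add: power_mult_distrib)
  have \<delta>4: "\<delta> ^ 4 \<le> 576 ^ 4 / N ^ 4" using power_mono[OF \<delta>(2,1), of 4] by (simp add: power_divide)
  have b1: "P\<^sup>2 * v\<^sup>2 + P * (H\<^sup>2 * v) \<le> \<Gamma>\<^sup>2 * 5248\<^sup>2 + \<Gamma> * (72\<^sup>2 * 5248)"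
  proof (intro add_mono)
    have "P\<^sup>2 * v\<^sup>2 \<le> (\<Gamma>\<^sup>2 * N\<^sup>2) * (5248 / N)\<^sup>2" using v PN by (intro mult_mono power_mono) auto
    also have "\<dots> = \<Gamma>\<^sup>2 * 5248\<^sup>2" using N by (simp add: power_divide)
    finally show "P\<^sup>2 * v\<^sup>2 \<le> \<Gamma>\<^sup>2 * 5248\<^sup>2" .
    have "P * (H\<^sup>2 * v) \<le> (\<Gamma> * N) * (72\<^sup>2 * (5248 / N))" using v P H \<Gamma> N by (intro mult_mono power_mono) auto
    also have "\<dots> = \<Gamma> * (72\<^sup>2 * 5248)" using N by simp
    finally show "P * (H\<^sup>2 * v) \<le> \<Gamma> * (72\<^sup>2 * 5248)" .
  qed
  have b2: "P\<^sup>2 * kernel_theta n + P * (N ^ 4 * \<delta> ^ 4) \<le> (\<Gamma>\<^sup>2 * 62941798400 + \<Gamma> * 576 ^ 4) * N"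
  proof -
    have "P\<^sup>2 * kernel_theta n \<le> (\<Gamma>\<^sup>2 * N\<^sup>2) * (62941798400 / N)"
      using PN kernel_theta_bounds by (intro mult_mono) (auto simp: N_def)
    also have "\<dots> = \<Gamma>\<^sup>2 * 62941798400 * N" using N by (simp add: power2_eq_square)
    finally have 1: "P\<^sup>2 * kernel_theta n \<le> \<Gamma>\<^sup>2 * 62941798400 * N" .
    have "P * (N ^ 4 * \<delta> ^ 4) \<le> (\<Gamma> * N) * (N ^ 4 * (576 ^ 4 / N ^ 4))"
      using P \<delta>4 \<Gamma> N \<delta> by (intro mult_mono) auto
    also have "\<dots> = \<Gamma> * 576 ^ 4 * N" using N by simp
    finally show ?thesis using 1 by (simp add: distrib_right)
  qed
  have b3: "2 * N\<^sup>2 * (P\<^sup>2 * \<delta> ^ 4) \<le> 2 * \<Gamma>\<^sup>2 * 576 ^ 4"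
  proof -
    have "2 * N\<^sup>2 * (P\<^sup>2 * \<delta> ^ 4) \<le> 2 * N\<^sup>2 * ((\<Gamma>\<^sup>2 * N\<^sup>2) * (576 ^ 4 / N ^ 4))"
      using PN \<delta>4 \<delta> by (intro mult_left_mono mult_mono) auto
    also have "\<dots> = 2 * \<Gamma>\<^sup>2 * 576 ^ 4" using N by (simp add: power2_eq_square power4_eq_xxxx)
    finally show ?thesis .
  qed
  have b4: "P ^ 3 * kernel_kappa n \<le> \<Gamma> ^ 3 * 220332032 / N"
  proof -
    have "P ^ 3 * kernel_kappa n \<le> (\<Gamma> ^ 3 * N ^ 3) * (220332032 / N ^ 4)"
      using PN kernel_kappa_bounds \<Gamma> N by (intro mult_mono) (auto simp: N_def)
    also have "\<dots> = \<Gamma> ^ 3 * 220332032 / N" using N by (simp add: power3_eq_cube power4_eq_xxxx)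
    finally show ?thesis .
  qed
  have c4: "(real (card ({1..n} \<times> {1..n})))\<^sup>2 = N ^ 4" "real (card ({1..n} \<times> {1..n})) = N\<^sup>2"
    by (simp_all add: card_cartesian_product N_def power2_eq_square power4_eq_xxxx)
  have "error_bound \<eta> p t = 2 * (1 / (2 * N)) * (4 * (t * (P\<^sup>2 * v\<^sup>2 + P * (H\<^sup>2 * v)) / \<eta> ^ 4
      + (P\<^sup>2 * kernel_theta n + P * (N ^ 4 * \<delta> ^ 4)) / t) + 2 * N\<^sup>2 * (P\<^sup>2 * \<delta> ^ 4) / \<eta>\<^sup>2) + 2 * (P ^ 3 * kernel_kappa n / \<eta>\<^sup>2)"
    unfolding error_bound_def c4(1) unfolding c4(2) v_def H_def \<delta>_def P_def N_def by (rule refl)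
  also have "\<dots> \<le> 2 * (1 / (2 * N)) * (4 * (t * (\<Gamma>\<^sup>2 * 5248\<^sup>2 + \<Gamma> * (72\<^sup>2 * 5248)) / \<eta> ^ 4
      + ((\<Gamma>\<^sup>2 * 62941798400 + \<Gamma> * 576 ^ 4) * N) / t) + (2 * \<Gamma>\<^sup>2 * 576 ^ 4) / \<eta>\<^sup>2) + 2 * ((\<Gamma> ^ 3 * 220332032 / N) / \<eta>\<^sup>2)"
    using N t \<eta> by (intro add_mono mult_left_mono divide_right_mono b1 b2 b3 b4) auto
  also have "\<dots> = (4 * (t * (\<Gamma>\<^sup>2 * 5248\<^sup>2 + \<Gamma> * (72\<^sup>2 * 5248)) / \<eta> ^ 4
      + (\<Gamma>\<^sup>2 * 62941798400 + \<Gamma> * 576 ^ 4) * t) + 2 * \<Gamma>\<^sup>2 * 576 ^ 4 / \<eta>\<^sup>2) / N + 2 * (\<Gamma> ^ 3 * 220332032 / \<eta>\<^sup>2) / N"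
  proof -
    have "((\<Gamma>\<^sup>2 * 62941798400 + \<Gamma> * 576 ^ 4) * N) / t = (\<Gamma>\<^sup>2 * 62941798400 + \<Gamma> * 576 ^ 4) * t"
      unfolding t(2)[symmetric] using t(1) by simp
    then show ?thesis by (simp only:) simp
  qed
  finally have eb: "error_bound \<eta> p t \<le> (4 * (t * (\<Gamma>\<^sup>2 * 5248\<^sup>2 + \<Gamma> * (72\<^sup>2 * 5248)) / \<eta> ^ 4
      + (\<Gamma>\<^sup>2 * 62941798400 + \<Gamma> * 576 ^ 4) * t) + 2 * \<Gamma>\<^sup>2 * 576 ^ 4 / \<eta>\<^sup>2) / N + 2 * (\<Gamma> ^ 3 * 220332032 / \<eta>\<^sup>2) / N" .
  have "avg (PiE {..<p} (\<lambda>_. perms {1..n})) (\<lambda>R. cmod (1 + z * kernel_trace n p z R +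
      of_real (kernel_var n * real p) * (kernel_trace n p z R)\<^sup>2))
    \<le> (sqrt (error_bound (Im z) p t) + kernel_var n / Im z) / Im z"
    unfolding kernel_trace_def
    by (rule resolvent_trace_equation[OF p(1) z t(1) kernel_theta_bounds(1) kernel_kappa_bounds(1)])
  also have "\<dots> \<le> (sqrt ((4 * (t * (\<Gamma>\<^sup>2 * 5248\<^sup>2 + \<Gamma> * (72\<^sup>2 * 5248)) / \<eta> ^ 4
      + (\<Gamma>\<^sup>2 * 62941798400 + \<Gamma> * 576 ^ 4) * t) + 2 * \<Gamma>\<^sup>2 * 576 ^ 4 / \<eta>\<^sup>2) / N + 2 * (\<Gamma> ^ 3 * 220332032 / \<eta>\<^sup>2) / N)
      + 5248 / N / \<eta>) / \<eta>"
    using \<eta> v eb unfolding \<eta>_def v_def by (intro add_mono divide_right_mono real_sqrt_le_mono) auto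
  finally show ?thesis by (simp only: t_def N_def)
qed

end

lemma kernel_trace_mean_error_tendsto:
  fixes \<Gamma> \<eta> :: real
  shows "(\<lambda>n. (sqrt ((4 * (sqrt (real n) * (\<Gamma>\<^sup>2 * 5248\<^sup>2 + \<Gamma> * (72\<^sup>2 * 5248)) / \<eta> ^ 4
        + (\<Gamma>\<^sup>2 * 62941798400 + \<Gamma> * 576 ^ 4) * sqrt (real n)) + 2 * \<Gamma>\<^sup>2 * 576 ^ 4 / \<eta>\<^sup>2) / real n
        + 2 * (\<Gamma> ^ 3 * 220332032 / \<eta>\<^sup>2) / real n)
      + 5248 / real n / \<eta>) / \<eta>) \<longlonglongrightarrow> 0"
proof -
  define A where "A = (\<Gamma>\<^sup>2 * 5248\<^sup>2 + \<Gamma> * (72\<^sup>2 * 5248)) / \<eta> ^ 4"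
  define B where "B = \<Gamma>\<^sup>2 * 62941798400 + \<Gamma> * 576 ^ 4"
  define C where "C = 2 * \<Gamma>\<^sup>2 * 576 ^ 4 / \<eta>\<^sup>2"
  define D where "D = 2 * (\<Gamma> ^ 3 * 220332032 / \<eta>\<^sup>2)"
  have t1: "(\<lambda>n. sqrt (real n) / real n) \<longlonglongrightarrow> 0" by real_asymp
  have t2: "(\<lambda>n. 1 / real n) \<longlonglongrightarrow> 0" by real_asymp
  have lim: "(\<lambda>n. (sqrt (4 * A * (sqrt (real n) / real n) + 4 * B * (sqrt (real n) / real n) + C * (1 / real n) + D * (1 / real n))
      + 5248 / \<eta> * (1 / real n)) / \<eta>) \<longlonglongrightarrow> (sqrt (4 * A * 0 + 4 * B * 0 + C * 0 + D * 0) + 5248 / \<eta> * 0) / \<eta>"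
    unfolding divide_inverse[of _ \<eta>] by (intro tendsto_intros t1 t2)
  have eq: "(sqrt ((4 * (sqrt (real n) * (\<Gamma>\<^sup>2 * 5248\<^sup>2 + \<Gamma> * (72\<^sup>2 * 5248)) / \<eta> ^ 4
        + (\<Gamma>\<^sup>2 * 62941798400 + \<Gamma> * 576 ^ 4) * sqrt (real n)) + 2 * \<Gamma>\<^sup>2 * 576 ^ 4 / \<eta>\<^sup>2) / real n
        + 2 * (\<Gamma> ^ 3 * 220332032 / \<eta>\<^sup>2) / real n) + 5248 / real n / \<eta>) / \<eta>
    = (sqrt (4 * A * (sqrt (real n) / real n) + 4 * B * (sqrt (real n) / real n) + C * (1 / real n) + D * (1 / real n))
      + 5248 / \<eta> * (1 / real n)) / \<eta>" for n
  proof -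
    have "sqrt (real n) * (\<Gamma>\<^sup>2 * 5248\<^sup>2 + \<Gamma> * (72\<^sup>2 * 5248)) / \<eta> ^ 4 = sqrt (real n) * A" by (simp add: A_def)
    then show ?thesis
      unfolding B_def[symmetric] C_def[symmetric] D_def[symmetric]
      by (simp only:) (simp add: add_divide_distrib distrib_left mult_ac)
  qed
  show ?thesis unfolding eq using lim by simp
qed

text \<open>Only the product of the two norms survives: \<open>norm_ed n\<close> is of order n^2, so
  its square contributes order 1/n to n times the variance. The function \<open>g\<close> is the
  exact remaining term.\<close>

lemma kernel_var_tendsto: "(\<lambda>n. real n * kernel_var n) \<longlonglongrightarrow> 1 / 5"
proof -
  define g where "g = (\<lambda>n::real. n * ((3 / (2 * (n\<^sup>2 - 1)))\<^sup>2 * (2 / (n * (n - 3))) * (2 * (n - 2 * n / (n - 1)) *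
    ((n\<^sup>2 * (n\<^sup>2 - 1) / 6
    - 2 * ((n + 1) * ((n + 1) ^ 4 - 1) / 30 - n * (n + 1)\<^sup>2 * ((n + 1)\<^sup>2 - 1) / 6
      + n ^ 3 * (n + 1)\<^sup>2 / 4) / (n - 2)
    + (n * (n\<^sup>2 - 1) / 3)\<^sup>2 / ((n - 1) * (n - 2))) / 2))))"
  \<comment> \<open>The limit is written as the expansion yields it; it equals 9/4 times 4/45, where
    4/45 is 2 * 2 times the coefficient 1/45 of \<open>distance_norm\<close>.\<close>
  have "(\<lambda>n. g (real n)) \<longlonglongrightarrow> (3 / 2)\<^sup>2 * (2 * (1 / 3)\<^sup>2 - 2 / 15)" unfolding g_def by real_asymp
  then have g: "(\<lambda>n. g (real n)) \<longlonglongrightarrow> 1 / 5" by (simp add: power2_eq_square)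
  have "(\<lambda>n. real n * kernel_var n - g (real n)) \<longlonglongrightarrow> 0"
  proof (rule Lim_null_comparison)
    show "\<forall>\<^sub>F n in sequentially. norm (real n * kernel_var n - g (real n)) \<le> 20736 / real n"
      using eventually_ge_at_top[of 4]
    proof eventually_elim
      fix n :: nat assume n: "n \<ge> 4"
      have "real n * kernel_var n - g (real n) = real n * (((kernel_scale n)\<^sup>2 * orth_const n) * (2 * (norm_ed n)\<^sup>2))"
        unfolding kernel_var_def g_def norm_ee_def norm_dd_def adjacency_norm[OF n] distance_norm[OF n]
          kernel_scale_def orth_const_def
        by (simp add: distrib_left)
      moreover have "0 \<le> real n * (((kernel_scale n)\<^sup>2 * orth_const n) * (2 * (norm_ed n)\<^sup>2))"
        using kernel_scale_bounds[OF n] orth_const_bounds[OF n] by simp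
      moreover have "real n * (((kernel_scale n)\<^sup>2 * orth_const n) * (2 * (norm_ed n)\<^sup>2))
        \<le> real n * ((2\<^sup>2 * 8 ^ 1 / real n ^ (2 * 2 + 2 * 1)) * (2 * (18 * (real n)\<^sup>2)\<^sup>2))"
      proof -
        have "(norm_ed n)\<^sup>2 \<le> (18 * (real n)\<^sup>2)\<^sup>2"
          using abs_norm_ed_le[OF n] abs_le_square_iff[of "norm_ed n" "18 * (real n)\<^sup>2"] by simp
        then show ?thesis
          using scale_orth_bound[OF n, of 2 1] kernel_scale_bounds[OF n] orth_const_bounds[OF n]
          by (intro mult_left_mono mult_mono) auto
      qed
      moreover have "real n * ((2\<^sup>2 * 8 ^ 1 / real n ^ (2 * 2 + 2 * 1)) * (2 * (18 * (real n)\<^sup>2)\<^sup>2)) = 20736 / real n"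
        using n by (simp add: field_simps eval_nat_numeral)
      ultimately show "norm (real n * kernel_var n - g (real n)) \<le> 20736 / real n" by simp
    qed
    show "(\<lambda>n. 20736 / real n) \<longlonglongrightarrow> 0" by real_asymp
  qed
  from tendsto_add[OF this g] show ?thesis by simp
qed

section \<open>Concentration of functions of independent coordinates\<close>

text \<open>One martingale step: the term linear in \<open>Y\<close> vanishes on average, and the
  cubic term is absorbed through 2zy being at most z^2 + y^2.\<close>

lemma avg_fourth_moment_step:
  fixes z c :: real and Y :: "'a \<Rightarrow> real"
  assumes S: "finite S" "S \<noteq> {}" and Y: "\<And>q. q \<in> S \<Longrightarrow> \<bar>Y q\<bar> \<le> c" "avg S Y = 0" and c: "c \<ge> 0"
  shows "avg S (\<lambda>q. (z + Y q)\<^sup>2) \<le> z\<^sup>2 + c\<^sup>2"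
    and "avg S (\<lambda>q. (z + Y q) ^ 4) \<le> z ^ 4 + 8 * c\<^sup>2 * z\<^sup>2 + 3 * c ^ 4"
proof -
  have Y2: "(Y q)\<^sup>2 \<le> c\<^sup>2" if "q \<in> S" for q
    using power_mono[OF Y(1)[OF that], of 2] by simp
  have "avg S (\<lambda>q. (z + Y q)\<^sup>2) = avg S (\<lambda>q. z\<^sup>2 + 2 * z * Y q + (Y q)\<^sup>2)"
    by (simp add: power2_sum mult_ac add_ac)
  also have "\<dots> = z\<^sup>2 + avg S (\<lambda>q. (Y q)\<^sup>2)" by (simp add: avg_add avg_cmult avg_const S Y)
  also have "\<dots> \<le> z\<^sup>2 + c\<^sup>2" using Y2 by (intro add_left_mono avg_le_const S)
  finally show "avg S (\<lambda>q. (z + Y q)\<^sup>2) \<le> z\<^sup>2 + c\<^sup>2" .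
  have "avg S (\<lambda>q. (z + Y q) ^ 4) \<le> avg S (\<lambda>q. z ^ 4 + 8 * c\<^sup>2 * z\<^sup>2 + 3 * c ^ 4 + 4 * z ^ 3 * Y q)"
  proof (intro avg_mono)
    fix q assume q: "q \<in> S"
    define y where "y = Y q"
    have y2: "y\<^sup>2 \<le> c\<^sup>2" using Y2[OF q] by (simp add: y_def)
    have "(z + y) ^ 4 = z ^ 4 + 4 * z ^ 3 * y + 6 * z\<^sup>2 * y\<^sup>2 + 4 * z * y * y\<^sup>2 + y\<^sup>2 * y\<^sup>2"
      by (simp add: eval_nat_numeral algebra_simps)
    also have "4 * z * y * y\<^sup>2 \<le> (2 * z\<^sup>2 + 2 * y\<^sup>2) * y\<^sup>2"
      using zero_le_power2[of "z - y"] by (intro mult_right_mono) (simp_all add: power2_eq_square algebra_simps)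
    also have "z ^ 4 + 4 * z ^ 3 * y + 6 * z\<^sup>2 * y\<^sup>2 + (2 * z\<^sup>2 + 2 * y\<^sup>2) * y\<^sup>2 + y\<^sup>2 * y\<^sup>2
        = z ^ 4 + 4 * z ^ 3 * y + 8 * z\<^sup>2 * y\<^sup>2 + 3 * (y\<^sup>2 * y\<^sup>2)" by (simp add: algebra_simps)
    also have "\<dots> \<le> z ^ 4 + 4 * z ^ 3 * y + 8 * z\<^sup>2 * c\<^sup>2 + 3 * (c\<^sup>2 * c\<^sup>2)"
      using mult_left_mono[OF y2, of "z\<^sup>2"] mult_mono[OF y2 y2] by simp
    finally show "(z + Y q) ^ 4 \<le> z ^ 4 + 8 * c\<^sup>2 * z\<^sup>2 + 3 * c ^ 4 + 4 * z ^ 3 * Y q"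
      by (simp add: y_def eval_nat_numeral algebra_simps)
  qed
  also have "\<dots> = z ^ 4 + 8 * c\<^sup>2 * z\<^sup>2 + 3 * c ^ 4"
    by (simp add: avg_add avg_cmult avg_const S Y)
  finally show "avg S (\<lambda>q. (z + Y q) ^ 4) \<le> z ^ 4 + 8 * c\<^sup>2 * z\<^sup>2 + 3 * c ^ 4" .
qed

text \<open>Averaging out coordinate \<open>i\<close> gives a function of the remaining coordinates
  with the same bounded differences, so the coordinates are removed one by one. The constant closes
  because 4m^2 + 8m + 3 is at most 4(m+1)^2. The fourth moment is needed since the second one gives
  tails of order 1/n, which are not summable.\<close>

lemma bounded_differences_moments:
  fixes f :: "(nat \<Rightarrow> 's) \<Rightarrow> real"
  assumes S: "finite S" "S \<noteq> {}" and J: "finite J" and c: "c \<ge> 0"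
    and diff: "\<And>i R q q'. i \<in> J \<Longrightarrow> R \<in> PiE J (\<lambda>_. S) \<Longrightarrow> q \<in> S \<Longrightarrow> q' \<in> S \<Longrightarrow> \<bar>f (R(i := q)) - f (R(i := q'))\<bar> \<le> c"
  defines "P \<equiv> PiE J (\<lambda>_. S)"
  shows "avg P (\<lambda>R. (f R - avg P f)\<^sup>2) \<le> real (card J) * c\<^sup>2"
    and "avg P (\<lambda>R. (f R - avg P f) ^ 4) \<le> 4 * (real (card J))\<^sup>2 * c ^ 4"
  using J diff unfolding P_def
proof (induction J arbitrary: f)
  case empty
  {
    case 1 then show ?case by (simp add: avg_def)
  next
    case 2 then show ?case by (simp add: avg_def)
  }
next
  case (insert i J)
  define P where "P = PiE J (\<lambda>_. S)"
  note Pfin = finite_PiE_const[OF S insert.hyps(1), folded P_def] PiE_const_nonempty[OF S insert.hyps(1), folded P_def]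
  have "(avg (PiE (insert i J) (\<lambda>_. S)) (\<lambda>R. (f R - avg (PiE (insert i J) (\<lambda>_. S)) f)\<^sup>2) \<le> real (card (insert i J)) * c\<^sup>2) \<and>
    (avg (PiE (insert i J) (\<lambda>_. S)) (\<lambda>R. (f R - avg (PiE (insert i J) (\<lambda>_. S)) f) ^ 4) \<le> 4 * (real (card (insert i J)))\<^sup>2 * c ^ 4)"
    if d: "\<And>k R q q'. k \<in> insert i J \<Longrightarrow> R \<in> PiE (insert i J) (\<lambda>_. S) \<Longrightarrow> q \<in> S \<Longrightarrow> q' \<in> S \<Longrightarrow>
      \<bar>f (R(k := q)) - f (R(k := q'))\<bar> \<le> c" for f
  proof -
    define g where "g = (\<lambda>R. avg S (\<lambda>q. f (R(i := q))))"
    define m where "m = avg (PiE (insert i J) (\<lambda>_. S)) f"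
    have m: "m = avg P g" unfolding m_def g_def P_def by (rule avg_PiE_insert[OF insert.hyps(2)])
    have ext: "R(i := q) \<in> PiE (insert i J) (\<lambda>_. S)" if "R \<in> P" "q \<in> S" for R q
      using that unfolding P_def by (intro PiE_fun_upd)
    have gd: "\<bar>g (R(k := q)) - g (R(k := q'))\<bar> \<le> c" if "k \<in> J" "R \<in> P" "q \<in> S" "q' \<in> S" for k R q q'
    proof -
      have ki: "k \<noteq> i" using that insert.hyps by auto
      have "\<bar>g (R(k := q)) - g (R(k := q'))\<bar> = \<bar>avg S (\<lambda>x. f (R(i := x, k := q)) - f (R(i := x, k := q')))\<bar>"
        using ki by (simp add: g_def avg_diff fun_upd_twist)
      also have "\<dots> \<le> avg S (\<lambda>x. \<bar>f (R(i := x, k := q)) - f (R(i := x, k := q'))\<bar>)"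
        using norm_avg_le[of S "\<lambda>x. f (R(i := x, k := q)) - f (R(i := x, k := q'))"] by simp
      also have "\<dots> \<le> c" by (intro avg_le_const S d ext that) (use that in auto)
      finally show ?thesis .
    qed
    have Y: "\<bar>f (R(i := q)) - g R\<bar> \<le> c" if "R \<in> P" "q \<in> S" for R q
    proof -
      have "\<bar>f (R(i := q)) - g R\<bar> = \<bar>avg S (\<lambda>x. f (R(i := q)) - f (R(i := x)))\<bar>"
        by (simp add: avg_diff avg_const[OF S] g_def)
      also have "\<dots> \<le> avg S (\<lambda>x. \<bar>f (R(i := q)) - f (R(i := x))\<bar>)"
        using norm_avg_le[of S "\<lambda>x. f (R(i := q)) - f (R(i := x))"] by simp
      also have "\<dots> \<le> c"
      proof (intro avg_le_const S)
        fix x assume "x \<in> S"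
        then show "\<bar>f (R(i := q)) - f (R(i := x))\<bar> \<le> c"
          using d[of i "R(i := q)" q x] ext[OF that] that by simp
      qed
      finally show ?thesis .
    qed
    have Y0: "avg S (\<lambda>q. f (R(i := q)) - g R) = 0" for R by (simp add: avg_diff avg_const[OF S] g_def)
    have IH: "avg P (\<lambda>R. (g R - m)\<^sup>2) \<le> real (card J) * c\<^sup>2" "avg P (\<lambda>R. (g R - m) ^ 4) \<le> 4 * (real (card J))\<^sup>2 * c ^ 4"
      unfolding m P_def by (rule insert.IH(1)[of g, OF gd[unfolded P_def]] insert.IH(2)[of g, OF gd[unfolded P_def]]; assumption)+
    have "avg (PiE (insert i J) (\<lambda>_. S)) (\<lambda>R. (f R - m)\<^sup>2) = avg P (\<lambda>R. avg S (\<lambda>q. ((g R - m) + (f (R(i := q)) - g R))\<^sup>2))"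
      unfolding avg_PiE_insert[OF insert.hyps(2)] P_def by simp
    also have "\<dots> \<le> avg P (\<lambda>R. (g R - m)\<^sup>2 + c\<^sup>2)"
      by (intro avg_mono avg_fourth_moment_step(1)[OF S _ Y0 c] Y)
    also have "\<dots> \<le> real (card J) * c\<^sup>2 + c\<^sup>2" using IH by (simp add: avg_add avg_const[OF Pfin])
    finally have 1: "avg (PiE (insert i J) (\<lambda>_. S)) (\<lambda>R. (f R - m)\<^sup>2) \<le> real (card (insert i J)) * c\<^sup>2"
      using insert.hyps by (simp add: algebra_simps)
    have "avg (PiE (insert i J) (\<lambda>_. S)) (\<lambda>R. (f R - m) ^ 4) = avg P (\<lambda>R. avg S (\<lambda>q. ((g R - m) + (f (R(i := q)) - g R)) ^ 4))"
      unfolding avg_PiE_insert[OF insert.hyps(2)] P_def by simp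
    also have "\<dots> \<le> avg P (\<lambda>R. (g R - m) ^ 4 + 8 * c\<^sup>2 * (g R - m)\<^sup>2 + 3 * c ^ 4)"
      by (intro avg_mono avg_fourth_moment_step(2)[OF S _ Y0 c] Y)
    also have "\<dots> = avg P (\<lambda>R. (g R - m) ^ 4) + 8 * c\<^sup>2 * avg P (\<lambda>R. (g R - m)\<^sup>2) + 3 * c ^ 4"
      by (simp add: avg_add avg_cmult avg_const[OF Pfin])
    also have "\<dots> \<le> 4 * (real (card J))\<^sup>2 * c ^ 4 + 8 * c\<^sup>2 * (real (card J) * c\<^sup>2) + 3 * c ^ 4"
      by (intro add_mono IH mult_left_mono) auto
    also have "\<dots> = (4 * (real (card J))\<^sup>2 + 8 * real (card J) + 3) * c ^ 4"
      by (simp add: eval_nat_numeral algebra_simps)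
    also have "\<dots> \<le> (4 * (real (card (insert i J)))\<^sup>2) * c ^ 4"
      using insert.hyps by (intro mult_right_mono) (auto simp: power2_eq_square algebra_simps)
    finally show ?thesis using 1 unfolding m_def by simp
  qed
  note both = this
  {
    case 1
    show ?case by (rule conjunct1[OF both]) (rule 1)
  next
    case 2
    show ?case by (rule conjunct2[OF both]) (rule 2)
  }
qed

lemma bounded_differences_fourth_moment:
  fixes f :: "(nat \<Rightarrow> 's) \<Rightarrow> complex"
  assumes S: "finite S" "S \<noteq> {}" and J: "finite J" and c: "c \<ge> 0"
    and diff: "\<And>i R q q'. i \<in> J \<Longrightarrow> R \<in> PiE J (\<lambda>_. S) \<Longrightarrow> q \<in> S \<Longrightarrow> q' \<in> S \<Longrightarrow>
      cmod (f (R(i := q)) - f (R(i := q'))) \<le> c"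
  defines "P \<equiv> PiE J (\<lambda>_. S)"
  shows "avg P (\<lambda>R. cmod (f R - avg P f) ^ 4) \<le> 16 * (real (card J))\<^sup>2 * c ^ 4"
proof -
  have Re: "Re (avg P f) = avg P (\<lambda>R. Re (f R))" and Im: "Im (avg P f) = avg P (\<lambda>R. Im (f R))"
    by (simp_all add: avg_def)
  have "avg P (\<lambda>R. cmod (f R - avg P f) ^ 4)
      \<le> avg P (\<lambda>R. 2 * (Re (f R) - avg P (\<lambda>R. Re (f R))) ^ 4 + 2 * (Im (f R) - avg P (\<lambda>R. Im (f R))) ^ 4)"
  proof (intro avg_mono)
    fix R
    define x where "x = Re (f R - avg P f)"
    define y where "y = Im (f R - avg P f)"
    have "cmod (f R - avg P f) ^ 4 = ((cmod (f R - avg P f))\<^sup>2)\<^sup>2" by (simp flip: power_mult)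
    also have "\<dots> = (x\<^sup>2 + y\<^sup>2)\<^sup>2" by (simp add: cmod_power2 x_def y_def)
    also have "\<dots> \<le> 2 * x ^ 4 + 2 * y ^ 4"
      using zero_le_power2[of "x\<^sup>2 - y\<^sup>2"] by (simp add: eval_nat_numeral algebra_simps)
    finally show "cmod (f R - avg P f) ^ 4
        \<le> 2 * (Re (f R) - avg P (\<lambda>R. Re (f R))) ^ 4 + 2 * (Im (f R) - avg P (\<lambda>R. Im (f R))) ^ 4"
      by (simp add: x_def y_def Re Im)
  qed
  also have "\<dots> \<le> 2 * (4 * (real (card J))\<^sup>2 * c ^ 4) + 2 * (4 * (real (card J))\<^sup>2 * c ^ 4)"
    unfolding avg_add avg_cmult P_def
  proof (intro add_mono mult_left_mono bounded_differences_moments(2) S J c)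
    fix i R q q' assume *: "i \<in> J" "R \<in> PiE J (\<lambda>_. S)" "q \<in> S" "q' \<in> S"
    show "\<bar>Re (f (R(i := q))) - Re (f (R(i := q')))\<bar> \<le> c" "\<bar>Im (f (R(i := q))) - Im (f (R(i := q')))\<bar> \<le> c"
      using order.trans[OF abs_Re_le_cmod diff[OF *]] order.trans[OF abs_Im_le_cmod diff[OF *]] by simp_all
  qed auto
  finally show ?thesis by (simp add: mult_ac)
qed

section \<open>Weak convergence from Stieltjes transforms\<close>

abbreviation cauchy_fun :: "complex \<Rightarrow> real \<Rightarrow> complex" where
  "cauchy_fun z x \<equiv> 1 / (of_real x - z)"

lemma norm_cauchy_fun_le:
  assumes "Im z \<noteq> 0"
  shows "cmod (cauchy_fun z x) \<le> 1 / \<bar>Im z\<bar>"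
proof -
  have "\<bar>Im z\<bar> \<le> cmod (of_real x - z)" using abs_Im_le_cmod[of "of_real x - z"] by simp
  then show ?thesis using assms by (simp add: norm_divide frac_le)
qed

lemma cauchy_fun_nonzero: "Im z \<noteq> 0 \<Longrightarrow> of_real x - z \<noteq> 0"
  by (auto simp: complex_eq_iff)

lemma cauchy_fun_diff:
  "Im z \<noteq> 0 \<Longrightarrow> Im w \<noteq> 0 \<Longrightarrow> cauchy_fun z x - cauchy_fun w x = (z - w) * (cauchy_fun z x * cauchy_fun w x)"
  using cauchy_fun_nonzero[of z x] cauchy_fun_nonzero[of w x] by (simp add: field_simps)

lemma borel_measurable_cauchy_fun [measurable]: "cauchy_fun z \<in> borel_measurable borel"
  by measurable

locale cauchy_convergence =
  fixes \<mu> :: "nat \<Rightarrow> real measure" and \<nu> :: "real measure"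
  assumes \<mu>: "real_distribution (\<mu> n)" and \<nu>: "real_distribution \<nu>"
    and conv_rational: "Re z \<in> \<rat> \<Longrightarrow> Im z \<in> \<rat> \<Longrightarrow> Im z > 0 \<Longrightarrow> (\<lambda>n. LINT x|\<mu> n. cauchy_fun z x) \<longlonglongrightarrow> (LINT x|\<nu>. cauchy_fun z x)"
begin

text \<open>The class of test functions along which integrals converge. It is enlarged step by step:
  kernels at rational points, all kernels, their products, polynomials in one kernel and its
  conjugate, and finally continuous functions of compact support. Boundedness is part of it so that
  integrals against any probability law exist.\<close>

definition good :: "(real \<Rightarrow> complex) \<Rightarrow> bool" where
  "good f \<longleftrightarrow> f \<in> borel_measurable borel \<and> (\<exists>B. \<forall>x. cmod (f x) \<le> B) \<and>
    (\<lambda>n. LINT x|\<mu> n. f x) \<longlonglongrightarrow> (LINT x|\<nu>. f x)"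

lemma integrable_bounded:
  assumes "real_distribution M" "f \<in> borel_measurable borel" "\<And>x. cmod (f x) \<le> B"
  shows "integrable M f"
proof -
  interpret real_distribution M by fact
  show ?thesis by (rule integrable_const_bound[of _ B]) (use assms in auto)
qed

lemma good_integrable:
  assumes "good f"
  shows "integrable (\<mu> n) f" "integrable \<nu> f"
proof -
  obtain B where f: "f \<in> borel_measurable borel" "\<And>x. cmod (f x) \<le> B" using assms by (auto simp: good_def)
  show "integrable (\<mu> n) f" "integrable \<nu> f"
    by (rule integrable_bounded[OF \<mu> f] integrable_bounded[OF \<nu> f])+
qed

lemma good_const: "good (\<lambda>x. c)"
proof -
  have "(LINT x|M. c) = c" if "real_distribution M" for M
  proof -
    interpret real_distribution M by fact
    show ?thesis by (simp add: prob_space[simplified])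
  qed
  then show ?thesis using \<mu> \<nu> by (auto simp: good_def)
qed

lemma good_add:
  assumes f: "good f" and g: "good g"
  shows "good (\<lambda>x. f x + g x)"
proof -
  obtain B C where "\<forall>x. cmod (f x) \<le> B" "\<forall>x. cmod (g x) \<le> C" using f g by (auto simp: good_def)
  then have "\<forall>x. cmod (f x + g x) \<le> B + C" by (meson add_mono norm_triangle_le)
  moreover have "(\<lambda>n. (LINT x|\<mu> n. f x) + (LINT x|\<mu> n. g x)) \<longlonglongrightarrow> (LINT x|\<nu>. f x) + (LINT x|\<nu>. g x)"
    using f g by (intro tendsto_add) (auto simp: good_def)
  ultimately show ?thesis using f g good_integrable[OF f] good_integrable[OF g]
    by (auto simp: good_def)
qed

lemma good_cmult:
  assumes f: "good f"
  shows "good (\<lambda>x. c * f x)"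
proof -
  obtain B where "\<forall>x. cmod (f x) \<le> B" using f by (auto simp: good_def)
  then have "\<forall>x. cmod (c * f x) \<le> cmod c * B" by (simp add: norm_mult mult_left_mono)
  moreover have "(\<lambda>n. c * (LINT x|\<mu> n. f x)) \<longlonglongrightarrow> c * (LINT x|\<nu>. f x)"
    using f by (intro tendsto_mult_left) (auto simp: good_def)
  ultimately show ?thesis using f by (auto simp: good_def)
qed

lemma integral_uniform_diff:
  assumes "real_distribution M" "integrable M f" "integrable M g" "\<And>x. cmod (f x - g x) \<le> e"
  shows "cmod ((LINT x|M. f x) - (LINT x|M. g x)) \<le> e"
proof -
  interpret real_distribution M by fact
  have "cmod ((LINT x|M. f x) - (LINT x|M. g x)) = cmod (LINT x|M. f x - g x)"
    using assms by simp
  also have "\<dots> \<le> (LINT x|M. cmod (f x - g x))" by (rule integral_norm_bound)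
  also have "\<dots> \<le> (LINT x|M. e)" using assms by (intro integral_mono) auto
  finally show ?thesis by (simp add: prob_space[simplified])
qed

lemma good_uniform_limit:
  assumes f: "f \<in> borel_measurable borel" "\<And>x. cmod (f x) \<le> B"
    and appr: "\<And>e. e > 0 \<Longrightarrow> \<exists>g. good g \<and> (\<forall>x. cmod (f x - g x) \<le> e)"
  shows "good f"
proof -
  have "(\<lambda>n. LINT x|\<mu> n. f x) \<longlonglongrightarrow> (LINT x|\<nu>. f x)"
  proof (rule LIMSEQ_I)
    fix r :: real assume r: "r > 0"
    then obtain g where g: "good g" "\<And>x. cmod (f x - g x) \<le> r / 4" using appr[of "r / 4"] by auto
    have "(\<lambda>n. LINT x|\<mu> n. g x) \<longlonglongrightarrow> (LINT x|\<nu>. g x)" using g by (simp add: good_def)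
    from LIMSEQ_D[OF this, of "r / 4"] r obtain n0
      where n0: "\<And>n. n \<ge> n0 \<Longrightarrow> cmod ((LINT x|\<mu> n. g x) - (LINT x|\<nu>. g x)) < r / 4" by auto
    show "\<exists>no. \<forall>n\<ge>no. cmod ((LINT x|\<mu> n. f x) - (LINT x|\<nu>. f x)) < r"
    proof (intro exI allI impI)
      fix n assume "n \<ge> n0"
      have 1: "cmod ((LINT x|\<mu> n. f x) - (LINT x|\<mu> n. g x)) \<le> r / 4"
        by (rule integral_uniform_diff[OF \<mu> integrable_bounded[OF \<mu> f] good_integrable(1)[OF g(1)] g(2)])
      have 2: "cmod ((LINT x|\<nu>. f x) - (LINT x|\<nu>. g x)) \<le> r / 4"
        by (rule integral_uniform_diff[OF \<nu> integrable_bounded[OF \<nu> f] good_integrable(2)[OF g(1)] g(2)])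
      have "(LINT x|\<mu> n. f x) - (LINT x|\<nu>. f x) = ((LINT x|\<mu> n. f x) - (LINT x|\<mu> n. g x)) +
          ((LINT x|\<mu> n. g x) - (LINT x|\<nu>. g x)) - ((LINT x|\<nu>. f x) - (LINT x|\<nu>. g x))" by simp
      then have "cmod ((LINT x|\<mu> n. f x) - (LINT x|\<nu>. f x)) \<le> cmod ((LINT x|\<mu> n. f x) - (LINT x|\<mu> n. g x)) +
          cmod ((LINT x|\<mu> n. g x) - (LINT x|\<nu>. g x)) + cmod ((LINT x|\<nu>. f x) - (LINT x|\<nu>. g x))"
        by (metis (no_types, lifting) add_mono_thms_linordered_semiring(3) norm_triangle_ineq norm_triangle_ineq4 order.trans)
      then show "cmod ((LINT x|\<mu> n. f x) - (LINT x|\<nu>. f x)) < r"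
        using 1 2 n0[OF \<open>n \<ge> n0\<close>] r by linarith
    qed
  qed
  then show ?thesis using f by (auto simp: good_def)
qed

lemma good_cnj: "good f \<Longrightarrow> good (\<lambda>x. cnj (f x))"
  unfolding good_def integral_cnj
  by (auto intro!: tendsto_cnj borel_measurable_continuous_on[of cnj] continuous_intros)

text \<open>The kernel is Lipschitz in its pole, uniformly on the line, so density of the rational
  points suffices; conjugation reaches the lower half plane.\<close>

lemma good_cauchy_fun:
  assumes z: "Im z \<noteq> 0"
  shows "good (cauchy_fun z)"
proof -
  have upper: "good (cauchy_fun w)" if w: "Im w > 0" for w
  proof (rule good_uniform_limit[OF borel_measurable_cauchy_fun norm_cauchy_fun_le])
    show "Im w \<noteq> 0" using w by simp
    fix e :: real assume e: "e > 0"
    \<comment> \<open>The poles differ by at most \<open>2 * d\<close>, and both kernels are at most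
      \<open>1 / Im w\<close> because \<open>v\<close> is chosen above \<open>w\<close>; the product
      is \<open>e\<close>.\<close>
    define d where "d = e * (Im w)\<^sup>2 / 2"
    have d: "d > 0" using e w by (simp add: d_def)
    obtain a where a: "a \<in> \<rat>" "Re w < a" "a < Re w + d" using Rats_dense_in_real[of "Re w" "Re w + d"] d by auto
    obtain b where b: "b \<in> \<rat>" "Im w < b" "b < Im w + d" using Rats_dense_in_real[of "Im w" "Im w + d"] d by auto
    define v where "v = Complex a b"
    have v: "Im v > Im w" using b by (simp add: v_def)
    have "good (cauchy_fun v)"
      unfolding good_def using conv_rational[of v] norm_cauchy_fun_le[of v] a b w by (auto simp: v_def)
    moreover have "cmod (cauchy_fun w x - cauchy_fun v x) \<le> e" for x
    proof -
      have "cmod (w - v) \<le> \<bar>Re w - a\<bar> + \<bar>Im w - b\<bar>" using cmod_le[of "w - v"] by (simp add: v_def)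
      then have wv: "cmod (w - v) \<le> 2 * d" using a b by simp
      have c: "cmod (cauchy_fun w x) \<le> 1 / Im w" using norm_cauchy_fun_le[of w x] w by simp
      have "cmod (cauchy_fun v x) \<le> 1 / Im v" using norm_cauchy_fun_le[of v x] v w by simp
      also have "\<dots> \<le> 1 / Im w" using v w by (intro frac_le) auto
      finally have "cmod (cauchy_fun w x) * cmod (cauchy_fun v x) \<le> 1 / Im w * (1 / Im w)"
        using c w by (intro mult_mono) auto
      then have "cmod (w - v) * (cmod (cauchy_fun w x) * cmod (cauchy_fun v x)) \<le> 2 * d * (1 / Im w * (1 / Im w))"
        by (rule mult_mono[OF wv]) (use d in auto)
      also have "\<dots> = e" using w by (simp add: d_def power2_eq_square)
      finally show ?thesis using cauchy_fun_diff[of w v x] v w by (simp only: norm_mult)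
    qed
    ultimately show "\<exists>g. good g \<and> (\<forall>x. cmod (cauchy_fun w x - g x) \<le> e)" by auto
  qed
  show ?thesis
  proof (cases "Im z > 0")
    case False
    then have "good (\<lambda>x. cnj (cauchy_fun (cnj z) x))" using z by (intro good_cnj upper) simp
    then show ?thesis by simp
  qed (rule upper)
qed

definition prods :: "complex list \<Rightarrow> real \<Rightarrow> complex" where
  "prods zs x = (\<Prod>z\<leftarrow>zs. cauchy_fun z x)"

lemma prods_bounded: "(\<And>z. z \<in> set zs \<Longrightarrow> Im z \<noteq> 0) \<Longrightarrow> \<exists>B\<ge>0. \<forall>x. cmod (prods zs x) \<le> B"
proof (induction zs)
  case Nil
  show ?case by (intro exI[of _ 1]) (simp add: prods_def)
next
  case (Cons z zs)
  then obtain B where B: "B \<ge> 0" "\<And>x. cmod (prods zs x) \<le> B" by auto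
  have "cmod (prods (z # zs) x) \<le> (1 / \<bar>Im z\<bar>) * B" for x
    using norm_cauchy_fun_le[of z x] Cons.prems B
    by (simp add: prods_def norm_mult del: times_divide_eq_left) (intro mult_mono, auto)
  then show ?case using B(1) by (intro exI[of _ "(1 / \<bar>Im z\<bar>) * B"]) auto
qed

lemma prods_measurable: "prods zs \<in> borel_measurable borel"
  by (induction zs) (auto simp: prods_def[abs_def])

text \<open>Partial fractions reduce the number of factors; equal poles are separated by a small shift.\<close>

lemma good_prods: "(\<And>z. z \<in> set zs \<Longrightarrow> Im z \<noteq> 0) \<Longrightarrow> good (prods zs)"
proof (induction "length zs" arbitrary: zs)
  case 0
  then show ?case using good_const[of 1] by (simp add: prods_def[abs_def])
next
  case (Suc k)
  show ?case
  proof (cases zs)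
    case Nil
    then show ?thesis using Suc by simp
  next
    case (Cons z ws)
    show ?thesis
    proof (cases ws)
      case Nil
      have "good (cauchy_fun z)" using Suc.prems Cons by (intro good_cauchy_fun) auto
      then show ?thesis using Cons Nil by (simp add: prods_def[abs_def])
    next
      case (Cons w rest)
      have zw: "Im z \<noteq> 0" "Im w \<noteq> 0" and rest: "\<And>y. y \<in> set rest \<Longrightarrow> Im y \<noteq> 0"
        using Suc.prems Cons \<open>zs = z # ws\<close> by auto
      have distinct: "good (prods (z # w' # rest))" if "w' \<noteq> z" "Im w' \<noteq> 0" for w'
      proof -
        have "good (prods (z # rest))" "good (prods (w' # rest))"
          using Suc.hyps(1)[of "z # rest"] Suc.hyps(1)[of "w' # rest"] Suc.hyps(2) Cons \<open>zs = z # ws\<close> zw rest that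
          by auto
        then have "good (\<lambda>x. 1 / (z - w') * prods (z # rest) x + (- (1 / (z - w'))) * prods (w' # rest) x)"
          by (intro good_add good_cmult)
        also have "(\<lambda>x. 1 / (z - w') * prods (z # rest) x + (- (1 / (z - w'))) * prods (w' # rest) x) = prods (z # w' # rest)"
        proof
          fix x
          have "1 / (z - w') * prods (z # rest) x + (- (1 / (z - w'))) * prods (w' # rest) x
              = 1 / (z - w') * (cauchy_fun z x - cauchy_fun w' x) * prods rest x"
            by (simp add: prods_def algebra_simps)
          also have "\<dots> = prods (z # w' # rest) x"
            unfolding cauchy_fun_diff[OF zw(1) that(2)] using that by (simp add: prods_def)
          finally show "1 / (z - w') * prods (z # rest) x + (- (1 / (z - w'))) * prods (w' # rest) x = prods (z # w' # rest) x" .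
        qed
        finally show ?thesis .
      qed
      show ?thesis
      proof (cases "w = z")
        case False
        then show ?thesis using distinct[of w] zw Cons \<open>zs = z # ws\<close> by simp
      next
        case True
        obtain B where B: "B \<ge> 0" "\<And>x. cmod (prods (z # rest) x) \<le> B"
          using prods_bounded[of "z # rest"] zw rest by auto
        obtain C where C: "\<And>x. cmod (prods zs x) \<le> C" using prods_bounded[OF Suc.prems] by auto
        show ?thesis
        proof (rule good_uniform_limit[OF prods_measurable C])
          fix e :: real assume e: "e > 0"
          define \<eta> where "\<eta> = \<bar>Im z\<bar>"
          have \<eta>: "\<eta> > 0" using zw by (simp add: \<eta>_def)
          \<comment> \<open>A real shift leaves the distance \<eta> of the pole from the line
            unchanged, so the error is at most t B / \<eta>^2. The 1 added to \<open>B\<close>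
            excludes a zero denominator.\<close>
          define t where "t = e * \<eta>\<^sup>2 / (B + 1)"
          have t: "t > 0" using e \<eta> B by (simp add: t_def)
          define w' where "w' = z + of_real t"
          have w': "w' \<noteq> z" "Im w' = Im z" using t by (auto simp: w'_def)
          have "cmod (prods zs x - prods (z # w' # rest) x) \<le> e" for x
          proof -
            have "prods zs x - prods (z # w' # rest) x = (cauchy_fun z x - cauchy_fun w' x) * prods (z # rest) x"
            proof -
              have "a * (a * s) - a * (b * s) = (a - b) * (a * s)" for a b s :: complex by (simp add: algebra_simps)
              moreover have "prods (y # l) x = cauchy_fun y x * prods l x" for y l by (simp add: prods_def)
              ultimately show ?thesis using True Cons \<open>zs = z # ws\<close> by metis
            qed
            also have "cauchy_fun z x - cauchy_fun w' x = (z - w') * (cauchy_fun z x * cauchy_fun w' x)"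
              using zw w' by (intro cauchy_fun_diff) auto
            finally have eq: "prods zs x - prods (z # w' # rest) x
                = (z - w') * (cauchy_fun z x * cauchy_fun w' x) * prods (z # rest) x" .
            have "cmod (z - w') = t" using t by (simp add: w'_def)
            then have "cmod (prods zs x - prods (z # w' # rest) x)
                = t * (cmod (cauchy_fun z x) * cmod (cauchy_fun w' x)) * cmod (prods (z # rest) x)"
              unfolding eq by (simp only: norm_mult)
            also have "\<dots> \<le> t * ((1 / \<eta>) * (1 / \<eta>)) * B"
              using norm_cauchy_fun_le[of z x] norm_cauchy_fun_le[of w' x] zw w' B t
              unfolding \<eta>_def by (intro mult_mono mult_left_mono) auto
            also have "\<dots> = e * (B / (B + 1))" using \<eta> by (simp add: t_def power2_eq_square)
            also have "\<dots> \<le> e * 1" using e B by (intro mult_left_mono) auto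
            finally show ?thesis by simp
          qed
          then show "\<exists>g. good g \<and> (\<forall>x. cmod (prods zs x - g x) \<le> e)"
            using distinct[of w'] w' zw by auto
        qed
      qed
    qed
  qed
qed

text \<open>The real coordinates of the kernel at \<open>\<i>\<close> are combinations of the
  kernels at \<open>\<i>\<close> and \<open>- \<i>\<close>, because conjugation moves the pole.
  Polynomials in them are therefore combinations of \<open>prods\<close>.\<close>

lemma good_real_polynomial:
  assumes "real_polynomial_function g"
  shows "good (\<lambda>x. of_real (g (cauchy_fun \<i> x)))"
proof -
  \<comment> \<open>Goodness is not known to be preserved under products, so the induction over
    polynomials runs with functions that stay good after multiplication by any product of
    kernels.\<close>
  define M where "M = {h :: real \<Rightarrow> complex. \<forall>zs. (\<forall>z\<in>set zs. Im z \<noteq> 0) \<longrightarrow> good (\<lambda>x. h x * prods zs x)}"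
  have M_add: "(\<lambda>x. h x + k x) \<in> M" if "h \<in> M" "k \<in> M" for h k
    using that good_add unfolding M_def by (auto simp: distrib_right)
  have M_cmult: "(\<lambda>x. c * h x) \<in> M" if "h \<in> M" for h c
    using that good_cmult[of _ c] unfolding M_def by (auto simp: mult.assoc)
  have M_cauchy: "(\<lambda>x. cauchy_fun z x * h x) \<in> M" if "h \<in> M" "Im z \<noteq> 0" for h z
    unfolding M_def
  proof (intro CollectI allI impI)
    fix zs assume zs: "\<forall>z\<in>set zs. Im z \<noteq> 0"
    then have "good (\<lambda>x. h x * prods (z # zs) x)" using that unfolding M_def by auto
    then show "good (\<lambda>x. cauchy_fun z x * h x * prods zs x)" by (simp add: prods_def mult_ac)
  qed
  have "\<forall>h\<in>M. (\<lambda>x. of_real (g (cauchy_fun \<i> x)) * h x) \<in> M"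
    using assms
  proof induction
    case (linear f)
    interpret bounded_linear f by fact
    show ?case
    proof
      fix h assume h: "h \<in> M"
      define a where "a = complex_of_real (f 1)"
      define b where "b = complex_of_real (f \<i>)"
      have cnj: "cnj (cauchy_fun \<i> x) = cauchy_fun (- \<i>) x" for x by simp
      have f: "complex_of_real (f w) = (a / 2 + b / (2 * \<i>)) * w + (a / 2 - b / (2 * \<i>)) * cnj w" for w
      proof -
        have "w = Re w *\<^sub>R 1 + Im w *\<^sub>R \<i>" by (simp add: complex_eq_iff)
        then have "f w = Re w * f 1 + Im w * f \<i>" using add scaleR by (metis real_scaleR_def)
        then have "complex_of_real (f w) = of_real (Re w) * a + of_real (Im w) * b" by (simp add: a_def b_def)
        moreover have "complex_of_real (Re w) = (w + cnj w) / 2" by (simp add: complex_eq_iff)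
        moreover have "complex_of_real (Im w) = (w - cnj w) / (2 * \<i>)" by (simp add: complex_eq_iff)
        ultimately show ?thesis by (simp only:) (simp add: field_simps)
      qed
      have "(\<lambda>x. (a / 2 + b / (2 * \<i>)) * (cauchy_fun \<i> x * h x) + (a / 2 - b / (2 * \<i>)) * (cauchy_fun (- \<i>) x * h x)) \<in> M"
        using h by (intro M_add M_cmult M_cauchy) auto
      also have "(\<lambda>x. (a / 2 + b / (2 * \<i>)) * (cauchy_fun \<i> x * h x) + (a / 2 - b / (2 * \<i>)) * (cauchy_fun (- \<i>) x * h x))
          = (\<lambda>x. of_real (f (cauchy_fun \<i> x)) * h x)"
        unfolding f cnj by (simp only: distrib_right mult.assoc)
      finally show "(\<lambda>x. of_real (f (cauchy_fun \<i> x)) * h x) \<in> M" .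
    qed
  next
    case (const c)
    then show ?case using M_cmult by simp
  next
    case (add f g)
    then show ?case using M_add by (simp add: distrib_right)
  next
    case (mult f g)
    then show ?case by (simp add: mult.assoc)
  qed
  moreover have "(\<lambda>x. 1) \<in> M" using good_prods unfolding M_def by (auto simp: eta_contract_eq)
  ultimately have "(\<lambda>x. of_real (g (cauchy_fun \<i> x)) * 1) \<in> M" by (rule bspec)
  then have "\<forall>zs. (\<forall>z\<in>set zs. Im z \<noteq> 0) \<longrightarrow> good (\<lambda>x. of_real (g (cauchy_fun \<i> x)) * 1 * prods zs x)"
    unfolding M_def by blast
  from this[rule_format, of "[]"] show ?thesis by (simp add: prods_def)
qed

lemma cauchy_fun_sphere: "cauchy_fun \<i> x \<in> sphere (\<i> / 2) (1 / 2)"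
proof -
  have "cauchy_fun \<i> x - \<i> / 2 = ((of_real x + \<i>) / (of_real x - \<i>)) * (- \<i> / 2)"
    using cauchy_fun_nonzero[of \<i> x] by (simp add: field_simps)
  moreover have "cmod (of_real x + \<i>) = cmod (of_real x - \<i>)" by (simp add: cmod_def)
  ultimately have "cmod (cauchy_fun \<i> x - \<i> / 2) = cmod (of_real x - \<i>) / cmod (of_real x - \<i>) * cmod (- \<i> / 2)"
    by (simp only: norm_mult norm_divide)
  then have "cmod (cauchy_fun \<i> x - \<i> / 2) = 1 / 2"
    using cauchy_fun_nonzero[of \<i> x] by (simp add: norm_divide)
  then show ?thesis by (simp add: dist_norm norm_minus_commute)
qed

text \<open>
  The Cayley-type map \<open>x \<mapsto> 1 / (x - \<i>)\<close> carries the line onto a circle with one point removed;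
  polynomials in its real coordinates are sums of products of Cauchy kernels, and these are dense
  by Stone-Weierstrass.
\<close>

lemma good_compact_support:
  fixes f :: "real \<Rightarrow> real"
  assumes f: "continuous_on UNIV f" and supp: "\<And>x. \<bar>x\<bar> \<ge> L \<Longrightarrow> f x = 0"
  shows "good (\<lambda>x. of_real (f x))"
proof -
  define K where "K = sphere (\<i> / 2) (1 / 2 :: real)"
  \<comment> \<open>The test function carried to the circle, extended by 0 to the point 0 that
    corresponds to infinity. The radius \<open>r\<close> is the modulus of the kernel at
    \<open>\<bar>x\<bar> = L\<close>, so \<open>F\<close> vanishes on the arc within
    \<open>r\<close> of 0 and is continuous on each of two closed arcs.\<close>
  define F where "F = (\<lambda>w. if w = 0 then 0 else f (Re (1 / w)))"
  define r where "r = 1 / sqrt (L\<^sup>2 + 1)"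
  have r: "r > 0" by (simp add: r_def add_nonneg_pos)
  have Ff: "F (cauchy_fun \<i> x) = f x" for x
    using cauchy_fun_nonzero[of \<i> x] by (simp add: F_def)
  have small: "F w = 0" if w: "w \<in> K" "cmod w \<le> r" for w
  proof (cases "w = 0")
    case True then show ?thesis by (simp add: F_def)
  next
    case False
    \<comment> \<open>Inversion maps the circle without 0 to the line with imaginary part -1, and
      \<open>Re y\<close> is the preimage on the real line.\<close>
    define y where "y = 1 / w"
    have y: "y \<noteq> 0" "w = 1 / y" using False by (auto simp: y_def)
    have "cmod (w - \<i> / 2) = 1 / 2" using w by (simp add: K_def dist_norm norm_minus_commute)
    moreover have "w - \<i> / 2 = (1 - \<i> * y / 2) / y" using y by (simp add: field_simps)
    ultimately have "cmod (1 - \<i> * y / 2) = cmod y / 2" using y by (simp add: norm_divide field_simps)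
    then have "(cmod (1 - \<i> * y / 2))\<^sup>2 = (cmod y / 2)\<^sup>2" by (simp only:)
    then have "(cmod (1 - \<i> * y / 2))\<^sup>2 = (cmod y)\<^sup>2 / 4" by (simp only: power_divide) simp
    then have "Im y = - 1" unfolding cmod_power2 by (simp add: power2_eq_square field_simps)
    moreover have "1 / r \<le> cmod y"
      using w(2) False r by (simp add: y_def norm_divide frac_le)
    ultimately have "(sqrt (L\<^sup>2 + 1))\<^sup>2 \<le> (Re y)\<^sup>2 + 1"
      using power_mono[of "1 / r" "cmod y" 2] r by (simp add: r_def cmod_power2)
    then have "L\<^sup>2 \<le> (Re y)\<^sup>2" by simp
    then have "\<bar>Re y\<bar> \<ge> L" using abs_le_square_iff[of L "Re y"] by linarith
    then show ?thesis using supp False by (simp add: F_def y_def)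
  qed
  have "continuous_on (K \<inter> {w. cmod w \<ge> r}) F"
  proof -
    have "continuous_on (K \<inter> {w. cmod w \<ge> r}) (\<lambda>w. f (Re (1 / w)))"
      using r by (intro continuous_on_compose2[OF f] continuous_intros) auto
    then show ?thesis
      by (rule continuous_on_eq) (use r in \<open>auto simp: F_def\<close>)
  qed
  moreover have "continuous_on (K \<inter> {w. cmod w \<le> r}) F"
    by (rule continuous_on_eq[of _ "\<lambda>_. 0"]) (use small in auto)
  moreover have "closed (K \<inter> {w. cmod w \<ge> r})" "closed (K \<inter> {w. cmod w \<le> r})"
    unfolding K_def by (intro closed_Int closed_Collect_le continuous_intros closed_sphere)+
  moreover have "K = (K \<inter> {w. cmod w \<ge> r}) \<union> (K \<inter> {w. cmod w \<le> r})" by auto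
  ultimately have F: "continuous_on K F" by (metis continuous_on_closed_Un)
  have K: "compact K" by (simp add: K_def)
  have meas: "(\<lambda>x. complex_of_real (f x)) \<in> borel_measurable borel"
    using borel_measurable_continuous_onI[OF f] by measurable
  have "compact (F ` K)" by (intro compact_continuous_image F K)
  then obtain B where B: "\<And>w. w \<in> K \<Longrightarrow> \<bar>F w\<bar> \<le> B"
    using compact_imp_bounded[of "F ` K"] by (auto simp: bounded_iff)
  have bnd: "cmod (of_real (f x)) \<le> B" for x
    using B[OF cauchy_fun_sphere[of x, folded K_def]] by (simp add: Ff)
  show ?thesis
  proof (rule good_uniform_limit[OF meas bnd])
    fix e :: real assume "e > 0"
    from Stone_Weierstrass_real_polynomial_function[OF K F this]
    obtain g where g: "real_polynomial_function g" "\<And>w. w \<in> K \<Longrightarrow> \<bar>F w - g w\<bar> < e" by auto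
    have "cmod (of_real (f x) - of_real (g (cauchy_fun \<i> x))) \<le> e" for x
      using g(2)[OF cauchy_fun_sphere[of x, folded K_def]] unfolding Ff of_real_diff[symmetric] norm_of_real by simp
    then show "\<exists>k. good k \<and> (\<forall>x. cmod (of_real (f x) - k x) \<le> e)"
      using good_real_polynomial[OF g(1)] by blast
  qed
qed

lemma compact_support_conv:
  fixes f :: "real \<Rightarrow> real"
  assumes f: "continuous_on UNIV f" and supp: "\<And>x. \<bar>x\<bar> \<ge> L \<Longrightarrow> f x = 0"
  shows "(\<lambda>n. LINT x|\<mu> n. f x) \<longlonglongrightarrow> (LINT x|\<nu>. f x)"
proof -
  have "(\<lambda>n. complex_of_real (LINT x|\<mu> n. f x)) \<longlonglongrightarrow> complex_of_real (LINT x|\<nu>. f x)"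
    using good_compact_support[OF assms] unfolding good_def integral_complex_of_real by blast
  then show ?thesis by (simp add: tendsto_of_real_iff)
qed

section \<open>From compactly supported test functions to weak convergence\<close>

definition plateau :: "real \<Rightarrow> real \<Rightarrow> real" where
  "plateau L x = cts_step L (L + 1) x * cts_step L (L + 1) (- x)"

lemma plateau_props:
  "0 \<le> plateau L x" "plateau L x \<le> 1" "\<bar>x\<bar> \<ge> L + 1 \<Longrightarrow> plateau L x = 0" "\<bar>x\<bar> \<le> L \<Longrightarrow> plateau L x = 1"
proof -
  have c: "0 \<le> cts_step L (L + 1) y" "cts_step L (L + 1) y \<le> 1" for y by (auto simp: cts_step_def)
  show "0 \<le> plateau L x" "plateau L x \<le> 1" using c by (auto simp: plateau_def mult_le_one)
  show "\<bar>x\<bar> \<ge> L + 1 \<Longrightarrow> plateau L x = 0" "\<bar>x\<bar> \<le> L \<Longrightarrow> plateau L x = 1"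
    by (auto simp: plateau_def cts_step_def)
qed

lemma continuous_cts_step: "a < b \<Longrightarrow> continuous_on UNIV (cts_step a b)"
  by (intro uniformly_continuous_imp_continuous cts_step_uniformly_continuous)

lemma continuous_plateau: "continuous_on UNIV (plateau L)"
proof -
  have "continuous_on UNIV (\<lambda>x. cts_step L (L + 1) (- x))"
    by (intro continuous_on_compose2[OF continuous_cts_step[of L "L + 1"]] continuous_intros) auto
  then show ?thesis unfolding plateau_def[abs_def]
    by (intro continuous_on_mult continuous_cts_step) auto
qed

lemma integrable_plateau: "real_distribution M \<Longrightarrow> integrable M (plateau L)"
proof -
  assume "real_distribution M"
  then interpret real_distribution M .
  show ?thesis
    using borel_measurable_continuous_onI[OF continuous_plateau[of L]] plateau_props[of L]
    by (intro integrable_const_bound[of _ 1]) auto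
qed

lemma plateau_mass: "(\<lambda>k. LINT x|\<nu>. plateau (real k) x) \<longlonglongrightarrow> 1"
proof -
  interpret real_distribution \<nu> by (rule \<nu>)
  have "(\<lambda>k. LINT x|\<nu>. plateau (real k) x) \<longlonglongrightarrow> (LINT x|\<nu>. 1)"
  proof (rule integral_dominated_convergence[where w = "\<lambda>_. 1"])
    show "AE x in \<nu>. (\<lambda>k. plateau (real k) x) \<longlonglongrightarrow> 1"
    proof (rule AE_I2)
      fix x
      have "\<forall>\<^sub>F k in sequentially. plateau (real k) x = 1"
        using eventually_ge_at_top[of "nat \<lceil>\<bar>x\<bar>\<rceil>"]
        by eventually_elim (intro plateau_props(4), linarith)
      then show "(\<lambda>k. plateau (real k) x) \<longlonglongrightarrow> 1" by (simp add: tendsto_eventually)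
    qed
    show "plateau (real k) \<in> borel_measurable \<nu>" for k using integrable_plateau[OF \<nu>] by auto
  qed (use plateau_props in auto)
  then show ?thesis by (simp add: prob_space[simplified])
qed

text \<open>This takes the place of a tightness argument: the error of truncation is the mass missed
  by \<open>plateau\<close>, and since \<open>plateau\<close> has compact support this mass
  converges along the sequence to its value under the limit law.\<close>

lemma cut_off:
  assumes M: "real_distribution M" and xy: "x < y"
  shows "\<bar>(LINT t|M. cts_step x y t) - (LINT t|M. cts_step x y t * plateau L t)\<bar> \<le> 1 - (LINT t|M. plateau L t)"
proof -
  interpret real_distribution M by fact
  have c: "0 \<le> cts_step x y t" "cts_step x y t \<le> 1" for t using xy by (auto simp: cts_step_def)
  have i1: "integrable M (cts_step x y)" by (rule integrable_cts_step[OF xy])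
  have i2: "integrable M (\<lambda>t. cts_step x y t * plateau L t)"
    using integrable_plateau[OF M, of L] i1 c plateau_props[of L]
    by (intro integrable_const_bound[of _ 1]) (auto simp: mult_le_one)
  have "\<bar>(LINT t|M. cts_step x y t) - (LINT t|M. cts_step x y t * plateau L t)\<bar>
      = \<bar>LINT t|M. cts_step x y t * (1 - plateau L t)\<bar>"
    using i1 i2 by (simp add: right_diff_distrib)
  also have "\<dots> \<le> (LINT t|M. \<bar>cts_step x y t * (1 - plateau L t)\<bar>)" by (rule integral_abs_bound)
  also have "\<dots> \<le> (LINT t|M. 1 - plateau L t)"
  proof (intro integral_mono)
    show "integrable M (\<lambda>t. \<bar>cts_step x y t * (1 - plateau L t)\<bar>)"
      using i1 i2 by (simp add: right_diff_distrib)
    show "integrable M (\<lambda>t. 1 - plateau L t)" using integrable_plateau[OF M] by simp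
    show "\<bar>cts_step x y t * (1 - plateau L t)\<bar> \<le> 1 - plateau L t" for t
      using c[of t] plateau_props[of L t] by (simp add: abs_mult mult_left_le_one_le)
  qed
  also have "\<dots> = 1 - (LINT t|M. plateau L t)" using integrable_plateau[OF M] by (simp add: prob_space[simplified])
  finally show ?thesis .
qed

theorem weak_convergence: "weak_conv_m \<mu> \<nu>"
proof (rule integral_cts_step_conv_imp_weak_conv[OF \<mu> \<nu>])
  fix x y :: real assume xy: "x < y"
  show "(\<lambda>n. integral\<^sup>L (\<mu> n) (cts_step x y)) \<longlonglongrightarrow> integral\<^sup>L \<nu> (cts_step x y)"
  proof (rule LIMSEQ_I)
    fix r :: real assume r: "r > 0"
    from LIMSEQ_D[OF plateau_mass, of "r / 5"] r obtain k0 where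
      k0: "\<And>k. k \<ge> k0 \<Longrightarrow> \<bar>(LINT x|\<nu>. plateau (real k) x) - 1\<bar> < r / 5" by auto
    define L where "L = real k0"
    have L: "1 - (LINT x|\<nu>. plateau L x) < r / 5" using k0[of k0] unfolding L_def by linarith
    have "(\<lambda>n. LINT x|\<mu> n. plateau L x) \<longlonglongrightarrow> (LINT x|\<nu>. plateau L x)"
      by (rule compact_support_conv[OF continuous_plateau plateau_props(3)])
    from LIMSEQ_D[OF this, of "r / 5"] r obtain n1 where
      n1: "\<And>n. n \<ge> n1 \<Longrightarrow> \<bar>(LINT x|\<mu> n. plateau L x) - (LINT x|\<nu>. plateau L x)\<bar> < r / 5" by auto
    have "(\<lambda>n. LINT t|\<mu> n. cts_step x y t * plateau L t) \<longlonglongrightarrow> (LINT t|\<nu>. cts_step x y t * plateau L t)"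
      using plateau_props(3)[of L]
      by (intro compact_support_conv[of _ "L + 1"] continuous_on_mult continuous_plateau continuous_cts_step xy) auto
    from LIMSEQ_D[OF this, of "r / 5"] r obtain n2 where
      n2: "\<And>n. n \<ge> n2 \<Longrightarrow> \<bar>(LINT t|\<mu> n. cts_step x y t * plateau L t) - (LINT t|\<nu>. cts_step x y t * plateau L t)\<bar> < r / 5"
      by auto
    show "\<exists>no. \<forall>n\<ge>no. norm (integral\<^sup>L (\<mu> n) (cts_step x y) - integral\<^sup>L \<nu> (cts_step x y)) < r"
    proof (intro exI allI impI)
      fix n assume n: "n \<ge> max n1 n2"
      show "norm (integral\<^sup>L (\<mu> n) (cts_step x y) - integral\<^sup>L \<nu> (cts_step x y)) < r"
        using cut_off[OF \<mu> xy, of n L] cut_off[OF \<nu> xy, of L] n1[of n] n2[of n] n L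
        unfolding real_norm_def max.bounded_iff by linarith
    qed
  qed
qed

end

section \<open>The Stieltjes transform of the semicircle law\<close>

text \<open>Generating function of the Chebyshev polynomials of the second kind, multiplied by
  \<open>sin \<theta>\<close> and truncated with its exact remainder; the induction step is the
  addition formula for sines.\<close>

lemma sin_series_identity:
  fixes q :: complex
  shows "(1 - 2 * q * of_real (cos \<theta>) + q\<^sup>2) * (\<Sum>k<K. q ^ k * of_real (sin (real (Suc k) * \<theta>)))
    = of_real (sin \<theta>) - q ^ K * of_real (sin (real (Suc K) * \<theta>)) + q ^ Suc K * of_real (sin (real K * \<theta>))"
proof (induction K)
  case 0
  show ?case by simp
next
  case (Suc K)
  have s: "of_real (sin (real (Suc (Suc K)) * \<theta>)) + of_real (sin (real K * \<theta>))
      = 2 * of_real (cos \<theta>) * complex_of_real (sin (real (Suc K) * \<theta>))"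
  proof -
    have "real (Suc (Suc K)) * \<theta> = real (Suc K) * \<theta> + \<theta>" "real K * \<theta> = real (Suc K) * \<theta> - \<theta>"
      by (simp_all add: algebra_simps)
    then have "sin (real (Suc (Suc K)) * \<theta>) + sin (real K * \<theta>) = 2 * cos \<theta> * sin (real (Suc K) * \<theta>)"
      by (simp only: sin_add sin_diff) (simp del: of_nat_Suc)
    then have "complex_of_real (sin (real (Suc (Suc K)) * \<theta>) + sin (real K * \<theta>)) = of_real (2 * cos \<theta> * sin (real (Suc K) * \<theta>))"
      by (simp only:)
    then show ?thesis by (simp only: of_real_add of_real_mult of_real_numeral)
  qed
  have "(1 - 2 * q * of_real (cos \<theta>) + q\<^sup>2) * (\<Sum>k<Suc K. q ^ k * of_real (sin (real (Suc k) * \<theta>)))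
    = of_real (sin \<theta>) - q ^ K * of_real (sin (real (Suc K) * \<theta>)) + q ^ Suc K * of_real (sin (real K * \<theta>))
      + (1 - 2 * q * of_real (cos \<theta>) + q\<^sup>2) * (q ^ K * of_real (sin (real (Suc K) * \<theta>)))"
    unfolding sum.lessThan_Suc distrib_left Suc.IH ..
  also have "\<dots> = of_real (sin \<theta>) - q ^ Suc K * (2 * of_real (cos \<theta>) * of_real (sin (real (Suc K) * \<theta>)) - of_real (sin (real K * \<theta>)))
      + q ^ Suc (Suc K) * of_real (sin (real (Suc K) * \<theta>))"
    by (simp add: algebra_simps power2_eq_square del: of_nat_Suc)
  also have "2 * of_real (cos \<theta>) * complex_of_real (sin (real (Suc K) * \<theta>)) - of_real (sin (real K * \<theta>))
      = of_real (sin (real (Suc (Suc K)) * \<theta>))"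
    unfolding s[symmetric] by simp
  finally show ?case .
qed

text \<open>The denominator is the product of \<open>1 - q * cis \<theta>\<close> and
  \<open>1 - q * cis (- \<theta>)\<close>.\<close>

lemma norm_poisson_denominator:
  fixes q :: complex
  assumes "cmod q < 1"
  shows "(1 - cmod q)\<^sup>2 \<le> cmod (1 - 2 * q * of_real (cos \<theta>) + q\<^sup>2)"
proof -
  have fact: "1 - 2 * q * of_real (cos \<theta>) + q\<^sup>2 = (1 - q * cis \<theta>) * (1 - q * cis (- \<theta>))"
  proof -
    have a: "cis \<theta> * cis (- \<theta>) = 1" by (simp add: cis_mult)
    have b: "cis \<theta> + cis (- \<theta>) = 2 * of_real (cos \<theta>)" by (simp add: complex_eq_iff)
    have "(1 - q * a) * (1 - q * b) = 1 - q * (a + b) + q\<^sup>2 * (a * b)" for a b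
      by (simp add: algebra_simps power2_eq_square)
    from this[of "cis \<theta>" "cis (- \<theta>)"] show ?thesis unfolding a b by simp
  qed
  have "1 - cmod q \<le> cmod (1 - q * cis t)" for t
    using norm_triangle_ineq2[of 1 "q * cis t"] by (simp add: norm_mult)
  then have "(1 - cmod q) * (1 - cmod q) \<le> cmod (1 - q * cis \<theta>) * cmod (1 - q * cis (- \<theta>))"
    using assms by (intro mult_mono) auto
  then show ?thesis unfolding fact norm_mult by (simp add: power2_eq_square)
qed

lemma integral_sin_sin:
  "((\<lambda>\<theta>. sin \<theta> * sin (real (Suc k) * \<theta>)) has_integral (if k = 0 then pi / 2 else 0)) {0..pi}"
proof (cases "k = 0")
  case True
  have "((\<lambda>\<theta>. sin \<theta> * sin \<theta>) has_integral (pi - sin pi * cos pi) / 2 - (0 - sin 0 * cos 0) / 2) {0..pi}"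
  proof (rule fundamental_theorem_of_calculus)
    fix x :: real
    have "((\<lambda>\<theta>. (\<theta> - sin \<theta> * cos \<theta>) / 2) has_real_derivative (1 - (sin x * - sin x + cos x * cos x)) / 2) (at x within {0..pi})"
      by (auto intro!: derivative_eq_intros)
    moreover have "(1 - (sin x * - sin x + cos x * cos x)) / 2 = sin x * sin x"
      using sin_cos_squared_add[of x] by (simp add: power2_eq_square field_simps)
    ultimately show "((\<lambda>\<theta>. (\<theta> - sin \<theta> * cos \<theta>) / 2) has_vector_derivative sin x * sin x) (at x within {0..pi})"
      by (simp only: has_real_derivative_iff_has_vector_derivative)
  qed simp
  then show ?thesis using True by simp
next
  case False
  define a where "a = real k"
  have a: "a > 0" using False by (simp add: a_def)
  define F where "F = (\<lambda>\<theta>. (sin (a * \<theta>) / a - sin ((a + 2) * \<theta>) / (a + 2)) / 2)"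
  have "((\<lambda>\<theta>. sin \<theta> * sin (real (Suc k) * \<theta>)) has_integral F pi - F 0) {0..pi}"
  proof (rule fundamental_theorem_of_calculus)
    fix x :: real
    have "(F has_real_derivative (cos (a * x) - cos ((a + 2) * x)) / 2) (at x within {0..pi})"
      unfolding F_def using a by (auto intro!: derivative_eq_intros)
    moreover have "(cos (a * x) - cos ((a + 2) * x)) / 2 = sin x * sin (real (Suc k) * x)"
    proof -
      have "a * x = real (Suc k) * x - x" "(a + 2) * x = real (Suc k) * x + x"
        by (simp_all add: a_def algebra_simps)
      then show ?thesis by (simp only: cos_add cos_diff) simp
    qed
    ultimately show "(F has_vector_derivative sin x * sin (real (Suc k) * x)) (at x within {0..pi})"
      by (simp add: has_real_derivative_iff_has_vector_derivative)
  qed simp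
  moreover have "F pi = 0"
  proof -
    have "sin (a * pi) = 0" unfolding a_def by (simp add: sin_npi)
    moreover have "sin ((a + 2) * pi) = 0" using sin_npi[of "k + 2"] by (simp add: a_def add.commute)
    ultimately show ?thesis by (simp add: F_def)
  qed
  ultimately show ?thesis using False by (simp add: F_def)
qed

text \<open>In the truncated series only the term \<open>k = 0\<close> has a nonzero integral
  against \<open>sin \<theta>\<close>, by orthogonality of sines. The remainder is of order
  \<open>cmod q ^ Suc K\<close> uniformly in \<theta>, so no exchange of an infinite sum and an
  integral occurs.\<close>

lemma poisson_integral:
  fixes q :: complex
  assumes q: "cmod q < 1"
  shows "integral {0..pi} (\<lambda>\<theta>. of_real ((sin \<theta>)\<^sup>2) / (1 - 2 * q * of_real (cos \<theta>) + q\<^sup>2)) = of_real (pi / 2)"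
proof -
  define D where "D = (\<lambda>\<theta>. 1 - 2 * q * of_real (cos \<theta>) + q\<^sup>2)"
  define c where "c = (1 - cmod q)\<^sup>2"
  have c: "c > 0" using q by (simp add: c_def)
  have Dc: "c \<le> cmod (D \<theta>)" for \<theta> unfolding c_def D_def by (rule norm_poisson_denominator[OF q])
  then have D0: "D \<theta> \<noteq> 0" for \<theta> using c by (metis norm_zero not_le)
  define f where "f = (\<lambda>\<theta>. of_real ((sin \<theta>)\<^sup>2) / D \<theta>)"
  have cont: "continuous_on {0..pi} f"
    unfolding f_def by (intro continuous_intros) (use D0 in \<open>auto simp: D_def intro!: continuous_intros\<close>)
  define S where "S = (\<lambda>K \<theta>. \<Sum>k<K. q ^ k * of_real (sin \<theta> * sin (real (Suc k) * \<theta>)))"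
  have S: "(S (Suc K) has_integral of_real (pi / 2)) {0..pi}" for K
  proof -
    have "(S (Suc K) has_integral (\<Sum>k<Suc K. q ^ k * of_real (if k = 0 then pi / 2 else 0))) {0..pi}"
      unfolding S_def
      by (intro has_integral_sum has_integral_mult_right has_integral_of_real integral_sin_sin) auto
    also have "(\<Sum>k<Suc K. q ^ k * of_real (if k = 0 then pi / 2 else 0)) = of_real (pi / 2)"
      unfolding sum.lessThan_Suc_shift by simp
    finally show ?thesis .
  qed
  have bound: "cmod (integral {0..pi} f - of_real (pi / 2)) \<le> (2 * cmod q ^ Suc K / c) * pi" for K
  proof -
    have err: "cmod (f \<theta> - S (Suc K) \<theta>) \<le> 2 * cmod q ^ Suc K / c" for \<theta>
    proof -
      have "D \<theta> * S (Suc K) \<theta> = of_real (sin \<theta>) * (D \<theta> * (\<Sum>k<Suc K. q ^ k * of_real (sin (real (Suc k) * \<theta>))))"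
        unfolding S_def by (simp only: sum_distrib_left of_real_mult mult_ac)
      also have "\<dots> = of_real (sin \<theta>) * (of_real (sin \<theta>) - q ^ Suc K * of_real (sin (real (Suc (Suc K)) * \<theta>)) + q ^ Suc (Suc K) * of_real (sin (real (Suc K) * \<theta>)))"
        unfolding D_def sin_series_identity ..
      finally have "f \<theta> - S (Suc K) \<theta> = of_real (sin \<theta>) * (q ^ Suc K * (of_real (sin (real (Suc (Suc K)) * \<theta>)) - q * of_real (sin (real (Suc K) * \<theta>)))) / D \<theta>"
        using D0[of \<theta>] by (simp add: f_def field_simps power2_eq_square del: of_nat_Suc)
      then have "cmod (f \<theta> - S (Suc K) \<theta>) = \<bar>sin \<theta>\<bar> * (cmod q ^ Suc K * cmod (of_real (sin (real (Suc (Suc K)) * \<theta>)) - q * of_real (sin (real (Suc K) * \<theta>)))) / cmod (D \<theta>)"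
        by (simp add: norm_mult norm_divide norm_power del: of_nat_Suc power_Suc)
      also have "\<dots> \<le> 1 * (cmod q ^ Suc K * (1 + 1 * 1)) / c"
      proof (intro frac_le mult_mono mult_left_mono Dc c)
        show "cmod (of_real (sin (real (Suc (Suc K)) * \<theta>)) - q * of_real (sin (real (Suc K) * \<theta>))) \<le> 1 + 1 * 1"
          using q by (intro order.trans[OF norm_triangle_ineq4] add_mono)
            (auto simp: norm_mult simp del: of_nat_Suc intro!: mult_le_one)
      qed auto
      finally show ?thesis by (simp add: mult.commute)
    qed
    have "(f has_integral integral {0..pi} f) {0..pi}"
      using cont by (intro integrable_integral integrable_continuous_interval)
    from has_integral_diff[OF this S[of K]]
    have "cmod (integral {0..pi} f - of_real (pi / 2)) \<le> (2 * cmod q ^ Suc K / c) * measure lborel {0..pi}"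
      using err c by (intro has_integral_bound_real[where S = "{}" and f = "\<lambda>x. f x - S (Suc K) x"]) auto
    then show ?thesis by simp
  qed
  have "(\<lambda>K. (2 * cmod q ^ Suc K / c) * pi) \<longlonglongrightarrow> (2 * 0 / c) * pi"
    using c q by (intro tendsto_intros LIMSEQ_Suc[OF LIMSEQ_power_zero]) auto
  then have "cmod (integral {0..pi} f - of_real (pi / 2)) \<le> 0"
    using bound by (intro LIMSEQ_le_const[of _ 0]) auto
  then show ?thesis by (simp add: f_def D_def)
qed

context
  fixes u r :: real
  assumes r: "r > 0"
begin

text \<open>The substitution is increasing on \<open>{0..pi}\<close> and absorbs the square root:
  the root and the derivative each contribute \<open>r * sin \<theta>\<close>, which leaves the
  smooth weight \<open>2 / pi * (sin \<theta>)\<^sup>2\<close>.\<close>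

lemma integral_semicircle:
  fixes h :: "real \<Rightarrow> 'b::euclidean_space"
  assumes h: "continuous_on UNIV h"
  shows "(LINT x|semicircle u r. h x) = integral {0..pi} (\<lambda>\<theta>. (2 / pi * (sin \<theta>)\<^sup>2) *\<^sub>R h (u - r * cos \<theta>))"
proof -
  define f where "f = (\<lambda>x. (2 / (pi * r\<^sup>2) * sqrt (r\<^sup>2 - (x - u)\<^sup>2)) *\<^sub>R h x)"
  define g where "g = (\<lambda>\<theta>. u - r * cos \<theta>)"
  have hm: "h \<in> borel_measurable lborel" using borel_measurable_continuous_onI[OF h] by simp
  have "(LINT x|semicircle u r. h x) = (LINT x|lborel. (2 / (pi * r\<^sup>2) * sqrt (r\<^sup>2 - (x - u)\<^sup>2) * indicator {u - r..u + r} x) *\<^sub>R h x)"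
    unfolding semicircle_def
  proof (intro integral_density hm)
    have "0 \<le> 2 / (pi * r\<^sup>2) * sqrt (r\<^sup>2 - (x - u)\<^sup>2) * indicat_real {u - r..u + r} x" for x
    proof (cases "x \<in> {u - r..u + r}")
      case True
      then have "\<bar>x - u\<bar> \<le> \<bar>r\<bar>" using r by auto
      then have "(x - u)\<^sup>2 \<le> r\<^sup>2" by (simp add: abs_le_square_iff)
      then show ?thesis by simp
    qed simp
    then show "AE x in lborel. 0 \<le> 2 / (pi * r\<^sup>2) * sqrt (r\<^sup>2 - (x - u)\<^sup>2) * indicat_real {u - r..u + r} x" by simp
  qed measurable
  also have "\<dots> = (LBINT x : {u - r..u + r}. f x)"
    unfolding set_lebesgue_integral_def f_def by (intro Bochner_Integration.integral_cong refl) (simp add: mult_ac)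
  also have "\<dots> = (LBINT x = g 0..g pi. f x)"
    using r by (subst interval_integral_Icc) (auto simp: g_def)
  also have "\<dots> = (LBINT \<theta> = ereal 0..ereal pi. (r * sin \<theta>) *\<^sub>R f (g \<theta>))"
  proof (rule interval_integral_substitution_finite[symmetric])
    show "(g has_real_derivative r * sin x) (at x within {0..pi})" for x
      unfolding g_def by (auto intro!: derivative_eq_intros)
    show "continuous_on (g ` {0..pi}) f"
      unfolding f_def by (intro continuous_intros continuous_on_subset[OF h]) auto
    show "continuous_on {0..pi} (\<lambda>x. r * sin x)" by (intro continuous_intros)
  qed simp
  also have "\<dots> = integral {0..pi} (\<lambda>\<theta>. (r * sin \<theta>) *\<^sub>R f (g \<theta>))"
  proof (rule interval_integral_eq_integral)
    have "continuous_on {0..pi} (\<lambda>\<theta>. (r * sin \<theta>) *\<^sub>R f (g \<theta>))"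
      unfolding f_def g_def by (intro continuous_intros continuous_on_compose2[OF h]) auto
    then show "set_integrable lborel {0..pi} (\<lambda>\<theta>. (r * sin \<theta>) *\<^sub>R f (g \<theta>))"
      by (rule borel_integrable_atLeastAtMost')
  qed simp
  also have "\<dots> = integral {0..pi} (\<lambda>\<theta>. (2 / pi * (sin \<theta>)\<^sup>2) *\<^sub>R h (u - r * cos \<theta>))"
  proof (rule integral_cong)
    fix \<theta> assume "\<theta> \<in> {0..pi}"
    then have "sin \<theta> \<ge> 0" by (simp add: sin_ge_zero)
    have "r\<^sup>2 - (g \<theta> - u)\<^sup>2 = (r * sin \<theta>)\<^sup>2"
      by (simp add: g_def power_mult_distrib sin_squared_eq right_diff_distrib)
    then have "sqrt (r\<^sup>2 - (g \<theta> - u)\<^sup>2) = r * sin \<theta>" using r \<open>sin \<theta> \<ge> 0\<close> by simp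
    then show "(r * sin \<theta>) *\<^sub>R f (g \<theta>) = (2 / pi * (sin \<theta>)\<^sup>2) *\<^sub>R h (u - r * cos \<theta>)"
      using r by (simp add: f_def g_def power2_eq_square)
  qed
  finally show ?thesis .
qed

lemma real_distribution_semicircle: "real_distribution (semicircle u r)"
proof -
  have "integral {0..pi} (\<lambda>\<theta>. (2 / pi * (sin \<theta>)\<^sup>2) *\<^sub>R (1::real)) = 1"
  proof -
    have int: "((\<lambda>\<theta>. 2 / pi * (sin \<theta> * sin (real (Suc 0) * \<theta>))) has_integral 2 / pi * (pi / 2)) {0..pi}"
      using integral_sin_sin[of 0] by (intro has_integral_mult_right) simp
    have eq: "(\<lambda>\<theta>. (2 / pi * (sin \<theta>)\<^sup>2) *\<^sub>R (1::real)) = (\<lambda>\<theta>. 2 / pi * (sin \<theta> * sin (real (Suc 0) * \<theta>)))"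
      by (auto simp: power2_eq_square)
    show ?thesis unfolding eq integral_unique[OF int] by simp
  qed
  then have 1: "(LINT x|semicircle u r. 1::real) = 1"
    using integral_semicircle[of "\<lambda>_. 1::real"] by simp
  then have "measure (semicircle u r) (space (semicircle u r)) = 1" by simp
  then have "emeasure (semicircle u r) (space (semicircle u r)) = 1"
    by (metis emeasure_eq_ennreal_measure ennreal_1 measure_zero_top zero_neq_one)
  then have "prob_space (semicircle u r)" by (rule prob_spaceI)
  then show ?thesis
    unfolding real_distribution_def real_distribution_axioms_def by (simp add: semicircle_def)
qed

text \<open>
  Substituting \<open>x = u - r cos \<theta>\<close> and writing \<open>2 (z - u) / r = - (q + 1 / q)\<close> with
  \<open>cmod q < 1\<close> turns the transform into the integral in \<open>poisson_integral\<close>.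
\<close>

lemma semicircle_stieltjes:
  assumes z: "Im z > 0"
  defines "m \<equiv> (LINT x|semicircle u r. 1 / (of_real x - z))"
  shows "1 + (z - of_real u) * m + of_real (r\<^sup>2 / 4) * m\<^sup>2 = 0"
    and "Im m \<ge> 0"
proof -
  interpret real_distribution "semicircle u r" by (rule real_distribution_semicircle)
  have nz: "of_real x - z \<noteq> 0" for x using z by (auto simp: complex_eq_iff)
  have cont: "continuous_on UNIV (\<lambda>x. 1 / (complex_of_real x - z))"
    by (intro continuous_intros) (use nz in auto)
  have "integrable (semicircle u r) (\<lambda>x. 1 / (complex_of_real x - z))"
  proof (rule integrable_const_bound[of _ "1 / Im z"])
    have "cmod (1 / (complex_of_real x - z)) \<le> 1 / Im z" for x
      using abs_Im_le_cmod[of "complex_of_real x - z"] z by (simp add: norm_divide frac_le)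
    then show "AE x in semicircle u r. cmod (1 / (complex_of_real x - z)) \<le> 1 / Im z" by simp
    show "(\<lambda>x. 1 / (complex_of_real x - z)) \<in> borel_measurable (semicircle u r)"
      using borel_measurable_continuous_onI[OF cont] by simp
  qed
  then have "Im m = (LINT x|semicircle u r. Im (1 / (complex_of_real x - z)))"
    unfolding m_def by simp
  also have "\<dots> \<ge> 0"
    using z by (intro integral_nonneg_AE AE_I2) (simp add: Im_divide)
  finally show "Im m \<ge> 0" .
  define w where "w = - 2 * (z - of_real u) / of_real r"
  have w: "Im w \<noteq> 0" using z r by (simp add: w_def)
  \<comment> \<open>The two roots of q^2 - w q + 1 have product 1. A root on the unit circle would
    make \<open>w\<close> the sum of a number and its conjugate, hence real; so exactly one root
    lies inside the disc.\<close>
  obtain q where q: "q \<noteq> 0" "cmod q < 1" "q\<^sup>2 + 1 = w * q"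
  proof -
    define s where "s = csqrt (w\<^sup>2 - 4)"
    define q1 where "q1 = (w + s) / 2"
    define q2 where "q2 = (w - s) / 2"
    have s: "s\<^sup>2 = w\<^sup>2 - 4" by (simp add: s_def)
    have "q1 * q2 = (w\<^sup>2 - s\<^sup>2) / 4" by (simp add: q1_def q2_def power2_eq_square algebra_simps)
    then have prod: "q1 * q2 = 1" by (simp add: s)
    have sum: "q1 + q2 = w" by (simp add: q1_def q2_def field_simps)
    have "(q1 + q2) * q1 = q1\<^sup>2 + q1 * q2" "(q1 + q2) * q2 = q2\<^sup>2 + q1 * q2"
      by (simp_all add: power2_eq_square algebra_simps)
    then have root: "q1\<^sup>2 + 1 = w * q1" "q2\<^sup>2 + 1 = w * q2" unfolding sum prod by simp_all
    have unit: "cmod y \<noteq> 1" if "y\<^sup>2 + 1 = w * y" for y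
    proof
      assume y: "cmod y = 1"
      then have "y * cnj y = 1" using complex_norm_square[of y] by simp
      moreover have "w * (y * cnj y) = (y\<^sup>2 + 1) * cnj y" by (simp only: that mult.assoc)
      moreover have "(y\<^sup>2 + 1) * cnj y = y * (y * cnj y) + cnj y" by (simp add: power2_eq_square algebra_simps)
      ultimately have "w = y + cnj y" by simp
      then show False using w by (simp add: complex_add_cnj)
    qed
    have nz: "q1 \<noteq> 0" "q2 \<noteq> 0" using prod by auto
    have "cmod q1 * cmod q2 = 1" using prod by (metis norm_mult norm_one)
    then have "cmod q1 < 1 \<or> cmod q2 < 1"
      using unit[OF root(1)] unit[OF root(2)] by (smt (verit) mult_less_cancel_right1 norm_ge_zero mult_le_cancel_right1)
    then show ?thesis using that[of q1] that[of q2] nz root by blast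
  qed
  have "m = integral {0..pi} (\<lambda>\<theta>. (2 / pi * (sin \<theta>)\<^sup>2) *\<^sub>R (1 / (complex_of_real (u - r * cos \<theta>) - z)))"
    unfolding m_def by (rule integral_semicircle[OF cont])
  also have "\<dots> = integral {0..pi} (\<lambda>\<theta>. of_real (4 / (pi * r)) * q * (of_real ((sin \<theta>)\<^sup>2) / (1 - 2 * q * of_real (cos \<theta>) + q\<^sup>2)))"
  proof (rule integral_cong)
    fix \<theta>
    have D0: "1 - 2 * q * of_real (cos \<theta>) + q\<^sup>2 \<noteq> 0"
      using norm_poisson_denominator[OF q(2), of \<theta>] zero_less_power[of "1 - cmod q" 2] q(2) by auto
    have zq: "(z - of_real u) * 2 * q = - of_real r * (q\<^sup>2 + 1)"
      unfolding q(3) w_def using r by (simp add: field_simps)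
    have "(complex_of_real (u - r * cos \<theta>) - z) * (2 * q) = of_real r * (1 - 2 * q * of_real (cos \<theta>) + q\<^sup>2)"
      using zq by (simp add: algebra_simps)
    then have "1 / (complex_of_real (u - r * cos \<theta>) - z) = 2 * q / (of_real r * (1 - 2 * q * of_real (cos \<theta>) + q\<^sup>2))"
      using nz[of "u - r * cos \<theta>"] D0 r by (subst frac_eq_eq) (auto simp: mult_ac)
    then show "(2 / pi * (sin \<theta>)\<^sup>2) *\<^sub>R (1 / (complex_of_real (u - r * cos \<theta>) - z)) =
        of_real (4 / (pi * r)) * q * (of_real ((sin \<theta>)\<^sup>2) / (1 - 2 * q * of_real (cos \<theta>) + q\<^sup>2))"
      by (simp only:) (simp add: scaleR_conv_of_real mult_ac)
  qed
  also have "\<dots> = of_real (4 / (pi * r)) * q * of_real (pi / 2)"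
    by (simp only: integral_mult_right poisson_integral[OF q(2)])
  also have "\<dots> = 2 * q / of_real r" using r by simp
  finally have m: "m = 2 * q / of_real r" .
  have "(z - of_real u) = - of_real r * w / 2" using r by (simp add: w_def)
  then have "1 + (z - of_real u) * m + of_real (r\<^sup>2 / 4) * m\<^sup>2 = 1 - w * q + q\<^sup>2"
    using r by (simp add: m power2_eq_square)
  then show "1 + (z - of_real u) * m + of_real (r\<^sup>2 / 4) * m\<^sup>2 = 0" using q(3) by (metis add.commute diff_add_eq diff_self)
qed

end

section \<open>The joint law of the rank permutations\<close>

text \<open>Fixing all points outside \<open>{1..n}\<close> turns the ranks into a bijection of the
  whole type, as \<open>permutes\<close> demands.\<close>

definition rank_perm :: "nat \<Rightarrow> (nat \<Rightarrow> nat \<Rightarrow> real) \<Rightarrow> nat \<Rightarrow> nat \<Rightarrow> nat" where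
  "rank_perm n x j k = (if k \<in> {1..n} then sample_rank n x j k else k)"

lemma sample_rank_card: "sample_rank n x j k = card {i \<in> {1..n}. x i j \<le> x k j}"
  unfolding sample_rank_def by (simp add: sum.If_cases Int_def)

lemma rank_perm_permutes:
  assumes "inj_on (\<lambda>i. x i j) {1..n}"
  shows "rank_perm n x j permutes {1..n}"
proof -
  have rng: "sample_rank n x j k \<in> {1..n}" if k: "k \<in> {1..n}" for k
  proof -
    have "card {i \<in> {1..n}. x i j \<le> x k j} \<le> card {1..n}" by (intro card_mono) auto
    moreover have "card {i \<in> {1..n}. x i j \<le> x k j} > 0" using k by (subst card_gt_0_iff) auto
    ultimately show ?thesis by (simp add: sample_rank_card)
  qed
  have inj: "inj_on (sample_rank n x j) {1..n}"
  proof (rule inj_onI)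
    fix k l assume kl: "k \<in> {1..n}" "l \<in> {1..n}" "sample_rank n x j k = sample_rank n x j l"
    have lt: "sample_rank n x j a < sample_rank n x j b" if "a \<in> {1..n}" "b \<in> {1..n}" "x a j < x b j" for a b
      unfolding sample_rank_card
    proof (intro psubset_card_mono psubsetI notI)
      show "{i \<in> {1..n}. x i j \<le> x a j} \<subseteq> {i \<in> {1..n}. x i j \<le> x b j}" using that by auto
      assume "{i \<in> {1..n}. x i j \<le> x a j} = {i \<in> {1..n}. x i j \<le> x b j}"
      moreover have "b \<in> {i \<in> {1..n}. x i j \<le> x b j}" using that by simp
      ultimately have "b \<in> {i \<in> {1..n}. x i j \<le> x a j}" by (simp only:)
      then show False using that by simp
    qed simp
    have "x k j = x l j" using lt[OF kl(1,2)] lt[OF kl(2,1)] kl(3) by (cases "x k j" "x l j" rule: linorder_cases) auto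
    from inj_onD[OF assms this kl(1,2)] show "k = l" .
  qed
  have "bij_betw (sample_rank n x j) {1..n} {1..n}"
    unfolding bij_betw_def by (intro conjI inj endo_inj_surj image_subsetI rng) simp
  then have "bij_betw (rank_perm n x j) {1..n} {1..n}"
    by (subst bij_betw_cong[of _ _ "sample_rank n x j"]) (auto simp: rank_perm_def)
  then show ?thesis by (rule bij_imp_permutes) (auto simp: rank_perm_def)
qed

lemma sample_rank_permute:
  assumes "\<pi> permutes {1..n}" "k \<in> {1..n}"
  shows "sample_rank n (\<lambda>i j. x (\<pi> i) j) j k = sample_rank n x j (\<pi> k)"
  unfolding sample_rank_def
  using sum.reindex_bij_betw[OF permutes_imp_bij[OF assms(1)], of "\<lambda>i. if x i j \<le> x (\<pi> k) j then 1 else (0::nat)"] by simp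

locale ranked_sample = prob_space M
  for M :: "'a measure" +
  fixes n p :: nat and X :: "nat \<Rightarrow> nat \<Rightarrow> 'a \<Rightarrow> real" and N :: "'b measure" and Y :: "nat \<Rightarrow> 'b \<Rightarrow> real"
  assumes n: "n \<ge> 1"
    and population: "prob_space N"
    and components: "prob_space.indep_vars N (\<lambda>_. borel) Y {1..p}"
    and continuous: "\<And>j. j \<in> {1..p} \<Longrightarrow> continuous_on UNIV (cdf (distr N borel (Y j)))"
    and rows: "indep_vars (\<lambda>_. PiM {1..p} (\<lambda>_. borel)) (\<lambda>i \<omega>. \<lambda>j\<in>{1..p}. X i j \<omega>) {1..n}"
    and copies: "\<And>i. i \<in> {1..n} \<Longrightarrow> distr M (PiM {1..p} (\<lambda>_. borel)) (\<lambda>\<omega>. \<lambda>j\<in>{1..p}. X i j \<omega>) =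
        distr N (PiM {1..p} (\<lambda>_. borel)) (\<lambda>\<omega>. \<lambda>j\<in>{1..p}. Y j \<omega>)"
begin

text \<open>
  The value outside \<open>{1..p}\<close> only makes \<open>marginal j\<close> a probability measure for every \<open>j\<close>.
\<close>

definition marginal :: "nat \<Rightarrow> real measure" where
  "marginal j = (if j \<in> {1..p} then distr N borel (Y j) else return borel 0)"

lemma Y_measurable: "j \<in> {1..p} \<Longrightarrow> Y j \<in> borel_measurable N"
  using components unfolding prob_space.indep_vars_def[OF population] by auto

lemma marginal_prob: "prob_space (marginal j)" and marginal_sets [simp]: "sets (marginal j) = sets borel"
  using Y_measurable by (auto simp: marginal_def prob_space_return intro!: prob_space.prob_space_distr[OF population])

lemma X_measurable:
  assumes "i \<in> {1..n}" "j \<in> {1..p}"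
  shows "X i j \<in> borel_measurable M"
proof -
  have "(\<lambda>\<omega>. \<lambda>j\<in>{1..p}. X i j \<omega>) \<in> measurable M (PiM {1..p} (\<lambda>_. borel))"
    using rows assms unfolding indep_vars_def by auto
  from measurable_component_singleton[OF assms(2)] this
  have "(\<lambda>\<omega>. (\<lambda>j\<in>{1..p}. X i j \<omega>) j) \<in> borel_measurable M"
    by (rule measurable_compose[rotated])
  then show ?thesis using assms by simp
qed

lemma row_emeasure:
  assumes i: "i \<in> {1..n}" and A: "\<And>j. j \<in> {1..p} \<Longrightarrow> A j \<in> sets borel"
  shows "emeasure M {\<omega> \<in> space M. \<forall>j\<in>{1..p}. X i j \<omega> \<in> A j} = (\<Prod>j\<in>{1..p}. emeasure (marginal j) (A j))"
proof -
  interpret N: prob_space N by (rule population)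
  let ?P = "PiM {1..p} (\<lambda>_. borel :: real measure)"
  have S: "PiE {1..p} A \<in> sets ?P" using A by (intro sets_PiM_I_finite) auto
  have mX: "(\<lambda>\<omega>. \<lambda>j\<in>{1..p}. X i j \<omega>) \<in> measurable M ?P"
    using rows i unfolding indep_vars_def by auto
  have mY: "(\<lambda>\<omega>. \<lambda>j\<in>{1..p}. Y j \<omega>) \<in> measurable N ?P"
    by (intro measurable_restrict Y_measurable)
  have "emeasure M {\<omega> \<in> space M. \<forall>j\<in>{1..p}. X i j \<omega> \<in> A j} =
      emeasure (distr M ?P (\<lambda>\<omega>. \<lambda>j\<in>{1..p}. X i j \<omega>)) (PiE {1..p} A)"
    unfolding emeasure_distr[OF mX S] by (intro arg_cong[of _ _ "emeasure M"]) (auto simp: PiE_iff)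
  also have "\<dots> = emeasure N {\<omega> \<in> space N. \<forall>j\<in>{1..p}. Y j \<omega> \<in> A j}"
    unfolding copies[OF i] emeasure_distr[OF mY S] by (intro arg_cong[of _ _ "emeasure N"]) (auto simp: PiE_iff)
  also have "\<dots> = (\<Prod>j\<in>{1..p}. emeasure (marginal j) (A j))"
  proof (cases "p = 0")
    case True
    then show ?thesis by (simp add: N.emeasure_space_1)
  next
    case False
    have "N.prob (\<Inter>j\<in>{1..p}. Y j -` A j \<inter> space N) = (\<Prod>j\<in>{1..p}. N.prob (Y j -` A j \<inter> space N))"
      using False A by (intro N.indep_varsD[OF components]) auto
    moreover have "(\<Inter>j\<in>{1..p}. Y j -` A j \<inter> space N) = {\<omega> \<in> space N. \<forall>j\<in>{1..p}. Y j \<omega> \<in> A j}"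
      using False by auto
    ultimately have "emeasure N {\<omega> \<in> space N. \<forall>j\<in>{1..p}. Y j \<omega> \<in> A j} = (\<Prod>j\<in>{1..p}. emeasure N (Y j -` A j \<inter> space N))"
      by (simp add: N.emeasure_eq_measure prod_ennreal)
    also have "\<dots> = (\<Prod>j\<in>{1..p}. emeasure (marginal j) (A j))"
      using A Y_measurable by (intro prod.cong refl) (simp add: marginal_def emeasure_distr)
    finally show ?thesis .
  qed
  finally show ?thesis .
qed

definition array :: "'a \<Rightarrow> nat \<times> nat \<Rightarrow> real" where
  "array \<omega> = (\<lambda>(i, j)\<in>{1..n} \<times> {1..p}. X i j \<omega>)"

definition law :: "(nat \<times> nat \<Rightarrow> real) measure" where
  "law = PiM ({1..n} \<times> {1..p}) (\<lambda>(i, j). marginal j)"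

lemma sets_law: "sets law = sets (PiM ({1..n} \<times> {1..p}) (\<lambda>_. borel))"
  unfolding law_def by (intro sets_PiM_cong) auto

lemma array_measurable: "array \<in> measurable M (PiM ({1..n} \<times> {1..p}) (\<lambda>_. borel))"
  unfolding array_def[abs_def] using X_measurable by (intro measurable_restrict) auto

text \<open>Independence of the rows and of the components within a row are combined on rectangles,
  which determine a finite product measure.\<close>

lemma distr_array: "distr M (PiM ({1..n} \<times> {1..p}) (\<lambda>_. borel)) array = law"
  unfolding law_def
proof (rule measure_eqI_PiM_finite)
  interpret P: product_prob_space "\<lambda>(i::nat, j). marginal j"
    by (rule product_prob_spaceI) (auto intro: marginal_prob split: prod.split)
  show "finite ({1..n} \<times> {1..p})" by simp
  show "sets (distr M (PiM ({1..n} \<times> {1..p}) (\<lambda>_. borel)) array) = sets (PiM ({1..n} \<times> {1..p}) (\<lambda>(i, j). marginal j))"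
    unfolding sets_distr by (intro sets_PiM_cong) auto
  show "sets (PiM ({1..n} \<times> {1..p}) (\<lambda>(i, j). marginal j)) = sets (PiM ({1..n} \<times> {1..p}) (\<lambda>(i, j). marginal j))" ..
  fix A assume A: "\<And>i. i \<in> {1..n} \<times> {1..p} \<Longrightarrow> A i \<in> sets ((\<lambda>(i, j). marginal j) i)"
  have A': "A (i, j) \<in> sets borel" if "i \<in> {1..n}" "j \<in> {1..p}" for i j using A[of "(i, j)"] that by simp
  have S: "PiE ({1..n} \<times> {1..p}) A \<in> sets (PiM ({1..n} \<times> {1..p}) (\<lambda>_. borel))"
    using A by (intro sets_PiM_I_finite) (auto simp: split_beta)
  have "emeasure (distr M (PiM ({1..n} \<times> {1..p}) (\<lambda>_. borel)) array) (PiE ({1..n} \<times> {1..p}) A)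
      = emeasure M {\<omega> \<in> space M. \<forall>i\<in>{1..n}. \<forall>j\<in>{1..p}. X i j \<omega> \<in> A (i, j)}"
    unfolding emeasure_distr[OF array_measurable S]
    by (intro arg_cong[of _ _ "emeasure M"]) (auto simp: PiE_iff array_def)
  also have "\<dots> = emeasure M (\<Inter>i\<in>{1..n}. (\<lambda>\<omega>. \<lambda>j\<in>{1..p}. X i j \<omega>) -` (PiE {1..p} (\<lambda>j. A (i, j))) \<inter> space M)"
    using n by (intro arg_cong[of _ _ "emeasure M"]) (auto simp: PiE_iff)
  also have "\<dots> = (\<Prod>i\<in>{1..n}. emeasure M ((\<lambda>\<omega>. \<lambda>j\<in>{1..p}. X i j \<omega>) -` (PiE {1..p} (\<lambda>j. A (i, j))) \<inter> space M))"
  proof -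
    have "prob (\<Inter>i\<in>{1..n}. (\<lambda>\<omega>. \<lambda>j\<in>{1..p}. X i j \<omega>) -` (PiE {1..p} (\<lambda>j. A (i, j))) \<inter> space M)
        = (\<Prod>i\<in>{1..n}. prob ((\<lambda>\<omega>. \<lambda>j\<in>{1..p}. X i j \<omega>) -` (PiE {1..p} (\<lambda>j. A (i, j))) \<inter> space M))"
      using n A' by (intro indep_varsD[OF rows] sets_PiM_I_finite) auto
    then show ?thesis by (simp add: emeasure_eq_measure prod_ennreal)
  qed
  also have "\<dots> = (\<Prod>i\<in>{1..n}. \<Prod>j\<in>{1..p}. emeasure (marginal j) (A (i, j)))"
  proof (intro prod.cong refl)
    fix i assume i: "i \<in> {1..n}"
    have "(\<lambda>\<omega>. \<lambda>j\<in>{1..p}. X i j \<omega>) -` (PiE {1..p} (\<lambda>j. A (i, j))) \<inter> space M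
        = {\<omega> \<in> space M. \<forall>j\<in>{1..p}. X i j \<omega> \<in> A (i, j)}" by (auto simp: PiE_iff)
    then show "emeasure M ((\<lambda>\<omega>. \<lambda>j\<in>{1..p}. X i j \<omega>) -` (PiE {1..p} (\<lambda>j. A (i, j))) \<inter> space M)
        = (\<Prod>j\<in>{1..p}. emeasure (marginal j) (A (i, j)))"
      using row_emeasure[OF i, of "\<lambda>j. A (i, j)"] A' i by simp
  qed
  also have "\<dots> = (\<Prod>ij\<in>{1..n} \<times> {1..p}. emeasure ((\<lambda>(i, j). marginal j) ij) (A ij))"
    by (simp add: prod.cartesian_product split_beta)
  also have "\<dots> = emeasure (PiM ({1..n} \<times> {1..p}) (\<lambda>(i, j). marginal j)) (PiE ({1..n} \<times> {1..p}) A)"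
    using A by (intro P.emeasure_PiM[symmetric]) auto
  finally show "emeasure (distr M (PiM ({1..n} \<times> {1..p}) (\<lambda>_. borel)) array) (PiE ({1..n} \<times> {1..p}) A)
      = emeasure (PiM ({1..n} \<times> {1..p}) (\<lambda>(i, j). marginal j)) (PiE ({1..n} \<times> {1..p}) A)" .
next
  define U where "U = PiE ({1..n} \<times> {1..p}) (\<lambda>_. UNIV :: real set)"
  have U: "U = space (PiM ({1..n} \<times> {1..p}) (\<lambda>(i, j). marginal j))"
    unfolding U_def space_PiM by (intro PiE_cong) (auto simp: sets_eq_imp_space_eq[OF marginal_sets])
  show "range (\<lambda>_::nat. U) \<subseteq> prod_algebra ({1..n} \<times> {1..p}) (\<lambda>(i, j). marginal j)"
    unfolding U_def by (auto intro!: prod_algebraI_finite)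
  show "(\<Union>i::nat. U) = space (PiM ({1..n} \<times> {1..p}) (\<lambda>(i, j). marginal j))" by (simp add: U)
  interpret D: prob_space "distr M (PiM ({1..n} \<times> {1..p}) (\<lambda>_. borel)) array"
    by (rule prob_space_distr[OF array_measurable])
  show "emeasure (distr M (PiM ({1..n} \<times> {1..p}) (\<lambda>_. borel)) array) U \<noteq> \<infinity>" for i :: nat
    using D.emeasure_finite[of U] by simp
qed

text \<open>Within a column all factors of the product measure agree, so the rows may be permuted by
  a different permutation in every column. This invariance is what makes the rank permutations
  uniform and mutually independent.\<close>

lemma law_permute:
  assumes \<pi>: "\<And>j. j \<in> {1..p} \<Longrightarrow> \<pi> j permutes {1..n}"
  shows "distr law law (\<lambda>x. \<lambda>(i, j)\<in>{1..n} \<times> {1..p}. x (\<pi> j i, j)) = law"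
proof -
  define t where "t = (\<lambda>(i, j). (\<pi> j i, j))"
  define K where "K = {1..n} \<times> {1..p}"
  have "inj_on t K"
  proof (rule inj_onI)
    fix a b assume ab: "a \<in> K" "b \<in> K" "t a = t b"
    then have eq: "snd a = snd b" "\<pi> (snd a) (fst a) = \<pi> (snd a) (fst b)" by (auto simp: t_def split_beta)
    have "inj (\<pi> (snd a))" using ab by (intro permutes_inj[OF \<pi>]) (auto simp: K_def)
    from injD[OF this eq(2)] eq(1) show "a = b" by (rule prod_eqI)
  qed
  moreover have "t \<in> K \<rightarrow> K"
  proof
    fix k assume "k \<in> K"
    then show "t k \<in> K" using permutes_in_image[OF \<pi>, of "snd k" "fst k"] by (auto simp: t_def K_def)
  qed
  ultimately have "distr (PiM K (\<lambda>(i, j). marginal j)) (PiM K (\<lambda>k. (\<lambda>(i, j). marginal j) (t k))) (\<lambda>\<omega>. \<lambda>k\<in>K. \<omega> (t k))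
      = PiM K (\<lambda>k. (\<lambda>(i, j). marginal j) (t k))"
    using marginal_prob by (intro distr_PiM_reindex) auto
  moreover have "(\<lambda>k. (\<lambda>(i, j). marginal j) (t k)) = (\<lambda>(i, j). marginal j)"
    by (auto simp: t_def fun_eq_iff)
  moreover have "(\<lambda>\<omega>. \<lambda>k\<in>K. \<omega> (t k)) = (\<lambda>x::nat \<times> nat \<Rightarrow> real. \<lambda>(i, j)\<in>K. x (\<pi> j i, j))"
    by (auto simp: t_def fun_eq_iff restrict_def)
  ultimately have "distr (PiM K (\<lambda>(i, j). marginal j)) (PiM K (\<lambda>(i, j). marginal j)) (\<lambda>x. \<lambda>(i, j)\<in>K. x (\<pi> j i, j))
      = PiM K (\<lambda>(i, j). marginal j)"
    by (simp only:)
  then show ?thesis unfolding law_def K_def .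
qed

lemma marginal_no_atoms: "j \<in> {1..p} \<Longrightarrow> emeasure (marginal j) {a} = 0"
proof -
  assume j: "j \<in> {1..p}"
  interpret D: real_distribution "distr N borel (Y j)"
    unfolding real_distribution_def real_distribution_axioms_def
    using prob_space.prob_space_distr[OF population Y_measurable[OF j]] by simp
  have "isCont (cdf (distr N borel (Y j))) a"
    using continuous[OF j] by (simp add: continuous_on_eq_continuous_at)
  then show ?thesis using j D.isCont_cdf[of a] by (simp add: marginal_def D.emeasure_eq_measure)
qed

lemma distr_X:
  assumes "i \<in> {1..n}" "j \<in> {1..p}"
  shows "distr M borel (X i j) = marginal j"
proof -
  let ?B = "PiM ({1..n} \<times> {1..p}) (\<lambda>_. borel :: real measure)"
  have ij: "(i, j) \<in> {1..n} \<times> {1..p}" using assms by simp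
  have "distr M borel (X i j) = distr M borel (\<lambda>\<omega>. array \<omega> (i, j))"
    using assms by (intro distr_cong) (auto simp: array_def)
  also have "\<dots> = distr (distr M ?B array) borel (\<lambda>x. x (i, j))"
    by (subst distr_distr[OF measurable_component_singleton[OF ij] array_measurable]) (simp add: comp_def)
  also have "\<dots> = distr (PiM ({1..n} \<times> {1..p}) (\<lambda>(i, j). marginal j)) ((\<lambda>(i, j). marginal j) (i, j)) (\<lambda>x. x (i, j))"
    unfolding distr_array law_def by (intro distr_cong) auto
  also have "\<dots> = (\<lambda>(i, j). marginal j) (i, j)"
    by (rule distr_PiM_component[OF _ ij]) (auto intro: marginal_prob)
  finally show ?thesis by simp
qed

lemma indep_entries: "p \<ge> 1 \<Longrightarrow> indep_vars (\<lambda>_. borel) (\<lambda>(i, j). X i j) ({1..n} \<times> {1..p})"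
proof -
  assume p: "p \<ge> 1"
  have "(\<lambda>\<omega>. \<lambda>k\<in>{1..n} \<times> {1..p}. (\<lambda>(i, j). X i j) k \<omega>) = array"
    by (auto simp: array_def fun_eq_iff restrict_def)
  moreover have "PiM ({1..n} \<times> {1..p}) (\<lambda>k. distr M borel ((\<lambda>(i, j). X i j) k)) = law"
    unfolding law_def by (intro PiM_cong refl) (auto simp: distr_X)
  ultimately show ?thesis
    using n p distr_array X_measurable by (subst indep_vars_iff_distr_eq_PiM') auto
qed

text \<open>Two entries of a column are independent with the same law without atoms, and by Fubini
  such a product measure gives no mass to the diagonal.\<close>

lemma no_ties: "AE \<omega> in M. \<forall>j\<in>{1..p}. inj_on (\<lambda>i. X i j \<omega>) {1..n}"
proof -
  have "AE \<omega> in M. X i j \<omega> \<noteq> X k j \<omega>" if ik: "i \<in> {1..n}" "k \<in> {1..n}" "i \<noteq> k" and j: "j \<in> {1..p}" for i k j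
  proof -
    interpret mj: prob_space "marginal j" by (rule marginal_prob)
    have "indep_var borel (X i j) borel (X k j)"
    proof -
      have "p \<ge> 1" using j by simp
      from indep_entries[OF this]
      have "indep_var (PiM {(i, j)} (\<lambda>_. borel)) (\<lambda>\<omega>. restrict (\<lambda>ij. (\<lambda>(i, j). X i j) ij \<omega>) {(i, j)})
          (PiM {(k, j)} (\<lambda>_. borel)) (\<lambda>\<omega>. restrict (\<lambda>ij. (\<lambda>(i, j). X i j) ij \<omega>) {(k, j)})"
        by (rule indep_var_restrict) (use ik j in auto)
      from indep_var_compose[OF this, of "\<lambda>f. f (i, j)" borel "\<lambda>f. f (k, j)" borel]
      show ?thesis by (simp add: comp_def)
    qed
    then have joint: "distr M (borel \<Otimes>\<^sub>M borel) (\<lambda>\<omega>. (X i j \<omega>, X k j \<omega>)) = marginal j \<Otimes>\<^sub>M marginal j"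
      unfolding indep_var_distribution_eq using ik j by (simp add: distr_X)
    define D where "D = {x :: real \<times> real. fst x = snd x}"
    have D: "D \<in> sets (borel \<Otimes>\<^sub>M borel)"
    proof -
      have "closed D" unfolding D_def by (intro closed_Collect_eq continuous_intros)
      then show ?thesis unfolding borel_prod by (rule borel_closed)
    qed
    have D': "D \<in> sets (marginal j \<Otimes>\<^sub>M marginal j)"
      using D by (simp cong: sets_pair_measure_cong)
    have "emeasure (marginal j \<Otimes>\<^sub>M marginal j) D = (\<integral>\<^sup>+x. emeasure (marginal j) (Pair x -` D) \<partial>marginal j)"
      by (rule mj.emeasure_pair_measure_alt[OF D'])
    also have "\<dots> = (\<integral>\<^sup>+x. 0 \<partial>marginal j)"
    proof (intro nn_integral_cong)
      fix x
      have "Pair x -` D = {x}" by (auto simp: D_def)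
      then show "emeasure (marginal j) (Pair x -` D) = 0" using marginal_no_atoms[OF j] by simp
    qed
    finally have "emeasure (distr M (borel \<Otimes>\<^sub>M borel) (\<lambda>\<omega>. (X i j \<omega>, X k j \<omega>))) D = 0" by (simp add: joint)
    then have "emeasure M ((\<lambda>\<omega>. (X i j \<omega>, X k j \<omega>)) -` D \<inter> space M) = 0"
      using X_measurable ik j D by (subst (asm) emeasure_distr) auto
    moreover have "(\<lambda>\<omega>. (X i j \<omega>, X k j \<omega>)) -` D \<inter> space M \<in> sets M"
      using X_measurable ik j D by (intro measurable_sets[OF _ D]) auto
    ultimately show ?thesis
      by (intro AE_I[where N = "(\<lambda>\<omega>. (X i j \<omega>, X k j \<omega>)) -` D \<inter> space M"]) (auto simp: D_def)
  qed
  then have "AE \<omega> in M. \<forall>j\<in>{1..p}. \<forall>i\<in>{1..n}. \<forall>k\<in>{1..n}. i \<noteq> k \<longrightarrow> X i j \<omega> \<noteq> X k j \<omega>"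
    by (intro AE_finite_allI) (auto intro: AE_I2)
  then show ?thesis by eventually_elim (auto simp: inj_on_def)
qed

text \<open>Coordinates start at 0 as in the matrix, components of the sample at 1, whence
  \<open>Suc j\<close>. The restriction makes the tuple an element of a \<open>PiE\<close>
  set.\<close>

definition rank_tuple :: "'a \<Rightarrow> nat \<Rightarrow> nat \<Rightarrow> nat" where
  "rank_tuple \<omega> = (\<lambda>j\<in>{..<p}. rank_perm n (\<lambda>i j. X i j \<omega>) (Suc j))"

abbreviation "tuples \<equiv> PiE {..<p} (\<lambda>_. perms {1..n})"

definition law_event :: "(nat \<Rightarrow> nat \<Rightarrow> nat) \<Rightarrow> (nat \<times> nat \<Rightarrow> real) set" where
  "law_event q = {x \<in> space law. \<forall>j\<in>{..<p}. \<forall>k\<in>{1..n}. sample_rank n (\<lambda>i j. x (i, j)) (Suc j) k = q j k}"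

lemma law_event_sets: "law_event q \<in> sets law"
proof -
  have "{x \<in> space law. sample_rank n (\<lambda>i j. x (i, j)) (Suc j) k = q j k} \<in> sets law"
    if jk: "j \<in> {..<p}" "k \<in> {1..n}" for j k
  proof -
    have comp: "(\<lambda>x. x (i, Suc j)) \<in> borel_measurable law" if "i \<in> {1..n}" for i
      unfolding measurable_cong_sets[OF sets_law refl] using that jk
      by (intro measurable_component_singleton) auto
    have le: "{x \<in> space law. x (i, Suc j) \<le> x (k, Suc j)} \<in> sets law" if "i \<in> {1..n}" for i
      using comp[OF that] comp[OF jk(2)] by (rule borel_measurable_le)
    have "(\<lambda>x. if x (i, Suc j) \<le> x (k, Suc j) then 1 else (0::nat)) \<in> measurable law (count_space UNIV)"
      if "i \<in> {1..n}" for i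
      using le[OF that] by (intro measurable_If) auto
    then have "(\<lambda>x. sample_rank n (\<lambda>i j. x (i, j)) (Suc j) k) \<in> measurable law (count_space UNIV)"
      unfolding sample_rank_def by (intro measurable_sum_nat) auto
    from measurable_sets[OF this, of "{q j k}"]
    show ?thesis by (simp add: vimage_def Int_def conj_commute)
  qed
  then show ?thesis unfolding law_event_def by (intro sets.sets_Collect_finite_All) auto
qed

text \<open>Reordering the rows of column j by the inverse of s_j after q_j turns an array with
  ranks s_j into one with ranks q_j, and by \<open>law_permute\<close> this reordering preserves the
  law.\<close>

lemma law_event_equal:
  assumes q: "q \<in> tuples" and s: "s \<in> tuples"
  shows "emeasure law (law_event q) = emeasure law (law_event s)"
proof -
  define \<pi> where "\<pi> = (\<lambda>j. inv_into UNIV (s (j - 1)) \<circ> q (j - 1))"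
  have qs: "q j permutes {1..n}" "s j permutes {1..n}" if "j < p" for j
    using PiE_mem[OF q, of j] PiE_mem[OF s, of j] that by simp_all
  have \<pi>: "\<pi> j permutes {1..n}" if "j \<in> {1..p}" for j
    unfolding \<pi>_def using that by (intro permutes_compose permutes_inv qs) auto
  define t where "t = (\<lambda>x::nat \<times> nat \<Rightarrow> real. \<lambda>(i, j)\<in>{1..n} \<times> {1..p}. x (\<pi> j i, j))"
  have tm: "t \<in> measurable law law"
  proof -
    have "(\<lambda>x. (\<lambda>(i, j). x (\<pi> j i, j)) k) \<in> borel_measurable law" if kk: "k \<in> {1..n} \<times> {1..p}" for k
    proof -
      obtain i j where k: "k = (i, j)" "i \<in> {1..n}" "j \<in> {1..p}" using kk by (cases k) auto
      then have "(\<pi> j i, j) \<in> {1..n} \<times> {1..p}" using permutes_in_image[OF \<pi>[OF k(3)], of i] by simp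
      then show ?thesis
        unfolding measurable_cong_sets[OF sets_law refl] k(1) prod.case by (rule measurable_component_singleton)
    qed
    then have "t \<in> measurable law (PiM ({1..n} \<times> {1..p}) (\<lambda>_. borel))"
      unfolding t_def by (intro measurable_restrict)
    then show ?thesis by (simp add: measurable_cong_sets[OF refl sets_law])
  qed
  have "emeasure law (law_event q) = emeasure (distr law law t) (law_event q)"
    using law_permute[of \<pi>] \<pi> by (simp add: t_def)
  also have "\<dots> = emeasure law (t -` law_event q \<inter> space law)"
    by (rule emeasure_distr[OF tm law_event_sets])
  also have "t -` law_event q \<inter> space law = law_event s"
  proof -
    have "t x \<in> law_event q \<longleftrightarrow> x \<in> law_event s" if x: "x \<in> space law" for x
    proof -
      have "t x \<in> space law" using measurable_space[OF tm x] .
      have "(\<forall>k\<in>{1..n}. sample_rank n (\<lambda>i j. t x (i, j)) (Suc j) k = q j k) \<longleftrightarrow>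
          (\<forall>k\<in>{1..n}. sample_rank n (\<lambda>i j. x (i, j)) (Suc j) k = s j k)" if j: "j < p" for j
      proof -
        have \<pi>j: "\<pi> (Suc j) permutes {1..n}" using \<pi> j by simp
        have "sample_rank n (\<lambda>i j. t x (i, j)) (Suc j) k = sample_rank n (\<lambda>i j. x (i, j)) (Suc j) (\<pi> (Suc j) k)"
          if k: "k \<in> {1..n}" for k
        proof -
          have "sample_rank n (\<lambda>i j. t x (i, j)) (Suc j) k = sample_rank n (\<lambda>i l. x (\<pi> (Suc j) i, l)) (Suc j) k"
            unfolding sample_rank_def using k j by (intro sum.cong refl) (auto simp: t_def)
          also have "\<dots> = sample_rank n (\<lambda>i j. x (i, j)) (Suc j) (\<pi> (Suc j) k)"
            using sample_rank_permute[OF \<pi>j k, of "\<lambda>i j. x (i, j)"] .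
          finally show ?thesis .
        qed
        moreover have "q j k = s j (\<pi> (Suc j) k)" for k
          using permutes_inverses(1)[OF qs(2)[OF j]] by (simp add: \<pi>_def)
        ultimately have "(\<forall>k\<in>{1..n}. sample_rank n (\<lambda>i j. t x (i, j)) (Suc j) k = q j k) \<longleftrightarrow>
          (\<forall>k\<in>{1..n}. sample_rank n (\<lambda>i j. x (i, j)) (Suc j) (\<pi> (Suc j) k) = s j (\<pi> (Suc j) k))" by simp
        also have "\<dots> \<longleftrightarrow> (\<forall>k\<in>\<pi> (Suc j) ` {1..n}. sample_rank n (\<lambda>i j. x (i, j)) (Suc j) k = s j k)" by blast
        also have "\<pi> (Suc j) ` {1..n} = {1..n}" by (rule permutes_image[OF \<pi>j])
        finally show ?thesis .
      qed
      then show ?thesis using x \<open>t x \<in> space law\<close> unfolding law_event_def by auto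
    qed
    then show ?thesis using sets.sets_into_space[OF law_event_sets[of s]] by auto
  qed
  finally show ?thesis .
qed

definition rank_event :: "(nat \<Rightarrow> nat \<Rightarrow> nat) \<Rightarrow> 'a set" where
  "rank_event q = array -` law_event q \<inter> space M"

lemma rank_event_sets: "rank_event q \<in> events"
proof -
  have "array \<in> measurable M law" using array_measurable by (simp add: measurable_cong_sets[OF refl sets_law])
  then show ?thesis unfolding rank_event_def by (rule measurable_sets[OF _ law_event_sets])
qed

lemma rank_event_iff:
  assumes "\<omega> \<in> space M"
  shows "\<omega> \<in> rank_event q \<longleftrightarrow> (\<forall>j\<in>{..<p}. \<forall>k\<in>{1..n}. sample_rank n (\<lambda>i j. X i j \<omega>) (Suc j) k = q j k)"
proof -
  have "array \<omega> \<in> space law"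
    using measurable_space[OF array_measurable assms] sets_eq_imp_space_eq[OF sets_law] by simp
  moreover have "sample_rank n (\<lambda>i j. array \<omega> (i, j)) (Suc j) k = sample_rank n (\<lambda>i j. X i j \<omega>) (Suc j) k"
    if "j \<in> {..<p}" "k \<in> {1..n}" for j k
    unfolding sample_rank_def using that by (intro sum.cong refl) (auto simp: array_def)
  ultimately show ?thesis using assms by (auto simp: rank_event_def law_event_def)
qed

lemma rank_event_eq:
  assumes \<omega>: "\<omega> \<in> space M" and ties: "\<forall>j\<in>{1..p}. inj_on (\<lambda>i. X i j \<omega>) {1..n}" and q: "q \<in> tuples"
  shows "\<omega> \<in> rank_event q \<longleftrightarrow> rank_tuple \<omega> = q"
proof
  assume *: "\<omega> \<in> rank_event q"
  show "rank_tuple \<omega> = q"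
  proof
    fix j show "rank_tuple \<omega> j = q j"
    proof (cases "j < p")
      case True
      then have qj: "q j permutes {1..n}" using q by (auto simp: PiE_iff)
      have "rank_perm n (\<lambda>i j. X i j \<omega>) (Suc j) k = q j k" for k
        using * True qj unfolding rank_event_iff[OF \<omega>] by (auto simp: rank_perm_def permutes_def)
      then show ?thesis using True by (auto simp: rank_tuple_def)
    next
      case False
      then show ?thesis using q by (auto simp: rank_tuple_def PiE_iff extensional_def)
    qed
  qed
next
  assume "rank_tuple \<omega> = q"
  then show "\<omega> \<in> rank_event q"
    unfolding rank_event_iff[OF \<omega>] by (auto simp: rank_tuple_def rank_perm_def)
qed

lemma rank_tuple_in:
  assumes "\<forall>j\<in>{1..p}. inj_on (\<lambda>i. X i j \<omega>) {1..n}"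
  shows "rank_tuple \<omega> \<in> tuples"
  unfolding rank_tuple_def using assms by (auto intro!: rank_perm_permutes simp del: One_nat_def)

lemma finite_tuples: "finite tuples" "card tuples > 0"
proof -
  show f: "finite tuples" by (intro finite_PiE finite_permutations) auto
  show "card tuples > 0" 
  proof -
    have "(\<lambda>j\<in>{..<p}. id) \<in> tuples" using permutes_id by auto
    then show ?thesis using f card_gt_0_iff by blast
  qed
qed

text \<open>The events are disjoint, equally likely and cover all of the space up to the null set of
  ties, hence each has probability 1 over their number.\<close>

lemma prob_rank_event:
  assumes q: "q \<in> tuples"
  shows "prob (rank_event q) = 1 / real (card tuples)"
proof -
  have eq: "prob (rank_event s) = prob (rank_event q)" if s: "s \<in> tuples" for s
  proof -
    have "emeasure M (rank_event s) = emeasure law (law_event s)" for s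
    proof -
      have "array \<in> measurable M law" using array_measurable by (simp add: measurable_cong_sets[OF refl sets_law])
      moreover have "law = distr M law array"
        using distr_array by (subst distr_cong[OF refl sets_law refl]) simp_all
      ultimately show ?thesis
        using emeasure_distr[of array M law "law_event s"] law_event_sets by (simp add: rank_event_def)
    qed
    then show ?thesis using law_event_equal[OF s q] by (simp add: measure_def)
  qed
  have disj: "disjoint_family_on rank_event tuples"
    unfolding disjoint_family_on_def
  proof (intro ballI impI)
    fix s s' assume s: "s \<in> tuples" "s' \<in> tuples" "s \<noteq> s'"
    show "rank_event s \<inter> rank_event s' = {}"
    proof (rule ccontr)
      assume "rank_event s \<inter> rank_event s' \<noteq> {}"
      then obtain \<omega> where \<omega>: "\<omega> \<in> rank_event s" "\<omega> \<in> rank_event s'" by auto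
      then have sp: "\<omega> \<in> space M" by (simp add: rank_event_def)
      have "s j k = s' j k" for j k
      proof (cases "j < p")
        case True
        then have "s j permutes {1..n}" "s' j permutes {1..n}" using s by (auto simp: PiE_iff)
        then show ?thesis
          using \<omega> True unfolding rank_event_iff[OF sp] by (cases "k \<in> {1..n}") (auto simp: permutes_def)
      next
        case False
        then show ?thesis using s by (auto simp: PiE_iff extensional_def)
      qed
      then show False using s(3) by (auto simp: fun_eq_iff)
    qed
  qed
  have "1 = prob (\<Union>s\<in>tuples. rank_event s)"
  proof -
    have "AE \<omega> in M. \<omega> \<in> (\<Union>s\<in>tuples. rank_event s)"
      using no_ties AE_space
    proof eventually_elim
      case (elim \<omega>)
      then show ?case using rank_event_eq[OF elim(2,1) rank_tuple_in[OF elim(1)]] rank_tuple_in[OF elim(1)] by blast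
    qed
    moreover have "(\<Union>s\<in>tuples. rank_event s) \<in> events" using rank_event_sets finite_tuples by auto
    ultimately show ?thesis using prob_eq_1[of "\<Union>s\<in>tuples. rank_event s"] by simp
  qed
  also have "\<dots> = (\<Sum>s\<in>tuples. prob (rank_event s))"
    using rank_event_sets by (intro finite_measure_finite_Union finite_tuples disj) auto
  also have "\<dots> = (\<Sum>s\<in>tuples. prob (rank_event q))" by (intro sum.cong refl eq)
  finally have "1 = real (card tuples) * prob (rank_event q)" by simp
  then show ?thesis using finite_tuples(2) by (simp add: eq_divide_eq mult.commute)
qed

text \<open>Markov's inequality. The exceptional set is a finite union of events
  \<open>rank_event q\<close>, so it is measurable without a statement about functions of
  \<open>rank_tuple\<close>.\<close>

lemma rank_tuple_tail:
  fixes F :: "(nat \<Rightarrow> nat \<Rightarrow> nat) \<Rightarrow> real"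
  assumes F: "\<And>q. q \<in> tuples \<Longrightarrow> F q \<ge> 0" and \<epsilon>: "\<epsilon> > 0"
  obtains A where "A \<in> events" "prob A \<le> avg tuples F / \<epsilon>"
    "AE \<omega> in M. \<omega> \<notin> A \<longrightarrow> rank_tuple \<omega> \<in> tuples \<and> F (rank_tuple \<omega>) < \<epsilon>"
proof
  define B where "B = {q \<in> tuples. F q \<ge> \<epsilon>}"
  have B: "finite B" "B \<subseteq> tuples" using finite_tuples by (auto simp: B_def)
  show "(\<Union>q\<in>B. rank_event q) \<in> events" using rank_event_sets B by auto
  have "prob (\<Union>q\<in>B. rank_event q) \<le> (\<Sum>q\<in>B. prob (rank_event q))"
    using rank_event_sets B by (intro finite_measure_subadditive_finite) auto
  also have "\<dots> = (\<Sum>q\<in>B. 1 / real (card tuples))" using B by (intro sum.cong refl prob_rank_event) auto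
  also have "\<dots> \<le> (\<Sum>q\<in>B. F q / \<epsilon> / real (card tuples))"
    using \<epsilon> by (intro sum_mono divide_right_mono) (auto simp: B_def)
  also have "\<dots> \<le> (\<Sum>q\<in>tuples. F q / \<epsilon> / real (card tuples))"
    using B F \<epsilon> finite_tuples by (intro sum_mono2) auto
  also have "\<dots> = avg tuples F / \<epsilon>" by (simp add: avg_real sum_divide_distrib mult.commute)
  finally show "prob (\<Union>q\<in>B. rank_event q) \<le> avg tuples F / \<epsilon>" .
  show "AE \<omega> in M. \<omega> \<notin> (\<Union>q\<in>B. rank_event q) \<longrightarrow> rank_tuple \<omega> \<in> tuples \<and> F (rank_tuple \<omega>) < \<epsilon>"
    using no_ties AE_space
  proof eventually_elim
    case (elim \<omega>)
    note t = rank_tuple_in[OF elim(1)]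
    then show ?case using rank_event_eq[OF elim(2,1) t] by (auto simp: B_def not_le)
  qed
qed

end

section \<open>Spectra of Chatterjee matrices\<close>

text \<open>\<open>length_eigenvalues_desc\<close> says that the real roots exhaust the degree. The
  cofactor of their linear factors is therefore constant, and it is 1 because all polynomials are
  monic.\<close>

lemma symmetric_char_poly_factorization:
  fixes A :: "real mat"
  assumes A: "A \<in> carrier_mat p p" and sym: "transpose_mat A = A"
  shows "char_poly A = (\<Prod>a\<leftarrow>eigenvalues_desc A. [:- a, 1:])"
proof -
  let ?\<chi> = "char_poly A"
  have nz: "q \<noteq> 0 \<Longrightarrow> \<exists>r. q = prod_mset (image_mset (\<lambda>a. [:- a, 1:]) (proots q)) * r" for q :: "real poly"
  proof (induction "size (proots q)" arbitrary: q)
    case 0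
    then show ?case by (intro exI[of _ q]) simp
  next
    case (Suc k)
    then obtain a where a: "a \<in># proots q" by (metis nat.distinct(1) size_eq_0_iff_empty multiset_nonemptyE)
    then have "poly q a = 0" using Suc.prems by simp
    then obtain s where s: "q = [:- a, 1:] * s" by (metis dvdE poly_eq_0_iff_dvd)
    then have "s \<noteq> 0" using Suc.prems by auto
    then have pr: "proots q = add_mset a (proots s)"
      using proots_mult[of "[:- a, 1:]" s] by (simp add: s del: mult_pCons_left)
    then obtain r where "s = prod_mset (image_mset (\<lambda>a. [:- a, 1:]) (proots s)) * r"
      using Suc.hyps(1)[of s] Suc.hyps(2) \<open>s \<noteq> 0\<close> by auto
    then show ?case using pr s by (intro exI[of _ r]) (simp del: mult_pCons_left add: mult.assoc)
  qed
  have deg: "degree ?\<chi> = p" "monic ?\<chi>" using degree_monic_char_poly[OF A] by auto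
  then have \<chi>0: "?\<chi> \<noteq> 0" by auto
  from nz[OF this] obtain r where r: "?\<chi> = prod_mset (image_mset (\<lambda>a. [:- a, 1:]) (proots ?\<chi>)) * r" by auto
  have ms: "mset (eigenvalues_desc A) = proots ?\<chi>" by (simp add: eigenvalues_desc_def)
  have "prod_mset (image_mset (\<lambda>a. [:- a, 1:]) (proots ?\<chi>)) = (\<Prod>a\<leftarrow>eigenvalues_desc A. [:- a, 1:])"
    unfolding ms[symmetric] by (metis mset_map prod_mset_prod_list)
  then have fact: "?\<chi> = (\<Prod>a\<leftarrow>eigenvalues_desc A. [:- a, 1:]) * r" using r by simp
  have nz': "(\<Prod>a\<leftarrow>as. [:- a, 1:]) \<noteq> 0" for as :: "real list" by (auto simp: prod_list_zero_iff)
  have mon: "monic (\<Prod>a\<leftarrow>as. [:- a, 1:])" for as :: "real list"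
    by (induction as) (simp_all only: list.map prod_list.Cons prod_list.Nil lead_coeff_mult, simp_all)
  have "degree (\<Prod>a\<leftarrow>as. [:- a, 1:]) = length as" for as :: "real list"
    by (induction as) (simp_all add: degree_mult_eq[OF _ nz'] del: mult_pCons_left)
  then have "degree (\<Prod>a\<leftarrow>eigenvalues_desc A. [:- a, 1:]) = p" using length_eigenvalues_desc[OF A sym] by simp
  moreover have "r \<noteq> 0" "(\<Prod>a\<leftarrow>eigenvalues_desc A. [:- a, 1:]) \<noteq> 0" using fact \<chi>0 by auto
  ultimately have "degree r = 0" using deg fact by (metis add_cancel_right_right degree_mult_eq)
  then obtain c where "r = [:c:]" by (metis degree_eq_zeroE)
  moreover have "lead_coeff r = 1" using deg(2) mon[of "eigenvalues_desc A"] unfolding fact by (simp only: lead_coeff_mult)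
  ultimately show ?thesis using fact by simp
qed

lemma pderiv_linear_factors:
  fixes as :: "complex list"
  assumes "\<And>a. a \<in> set as \<Longrightarrow> z \<noteq> a"
  shows "poly (pderiv (\<Prod>a\<leftarrow>as. [:- a, 1:])) z = poly (\<Prod>a\<leftarrow>as. [:- a, 1:]) z * (\<Sum>a\<leftarrow>as. 1 / (z - a))"
  using assms
proof (induction as)
  case (Cons a as)
  then show ?case
    by (simp add: pderiv_mult pderiv_pCons field_simps del: mult_pCons_left)
qed simp

text \<open>No diagonalization is used. The resolvent is minus the adjugate of z - A over its
  determinant; the diagonal of the adjugate consists of characteristic polynomials of the principal
  minors, whose sum is the derivative of the characteristic polynomial. The logarithmic derivative
  of the factorization then gives the sum over eigenvalues.\<close>

lemma resolvent_trace_eigenvalues: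
  fixes A :: "real mat"
  assumes A: "A \<in> carrier_mat p p" and sym: "transpose_mat A = A" and z: "Im z > 0"
  shows "resolvent_trace {..<p} (\<lambda>i j. A $$ (i, j)) z = (\<Sum>e\<leftarrow>eigenvalues_desc A. 1 / (of_real e - z))"
proof -
  define C where "C = map_mat complex_of_real A"
  have C: "C \<in> carrier_mat p p" using A by (simp add: C_def)
  define B where "B = - char_matrix C z"
  have B: "B \<in> carrier_mat p p" using C by (simp add: B_def)
  have Bij: "B $$ (i, j) = (if i = j then z else 0) - of_real (A $$ (i, j))" if "i < p" "j < p" for i j
    using that A C by (simp add: B_def char_matrix_def C_def)
  interpret h: map_poly_inj_idom_hom complex_of_real ..
  have \<chi>: "char_poly C = (\<Prod>a\<leftarrow>map complex_of_real (eigenvalues_desc A). [:- a, 1:])"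
  proof -
    have "char_poly C = map_poly complex_of_real (char_poly A)"
      unfolding C_def by (rule of_real_hom.char_poly_hom[OF A])
    also have "\<dots> = map_poly complex_of_real (\<Prod>a\<leftarrow>eigenvalues_desc A. [:- a, 1:])"
      by (simp only: symmetric_char_poly_factorization[OF A sym])
    also have "\<dots> = (\<Prod>a\<leftarrow>map complex_of_real (eigenvalues_desc A). [:- a, 1:])"
      by (induction "eigenvalues_desc A") (simp_all add: h.hom_mult o_def h.hom_prod_list del: mult_pCons_left)
    finally show ?thesis .
  qed
  define d where "d = poly (char_poly C) z"
  have ne: "z \<noteq> a" if "a \<in> set (map complex_of_real (eigenvalues_desc A))" for a using that z by auto
  have det: "det B = d" unfolding d_def B_def by (rule char_poly_matrix[OF C, symmetric])
  have "poly (\<Prod>a\<leftarrow>as. [:- a, 1:]) z \<noteq> 0" if "\<And>a. a \<in> set as \<Longrightarrow> z \<noteq> a" for as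
    using that by (induction as) auto
  then have d0: "d \<noteq> 0" unfolding d_def \<chi> using ne by blast
  define G where "G = (\<lambda>i j. - (adj_mat B $$ (i, j)) / d)"
  have "resolvent_on {..<p} (\<lambda>i j. A $$ (i, j)) z G"
    unfolding resolvent_on_def
  proof (intro ballI)
    fix i k assume "i \<in> {..<p}" "k \<in> {..<p}"
    then have ik: "i < p" "k < p" by auto
    have "(B * adj_mat B) $$ (i, k) = (det B \<cdot>\<^sub>m 1\<^sub>m p) $$ (i, k)" by (simp add: adj_mat(2)[OF B])
    then have "(\<Sum>j<p. B $$ (i, j) * adj_mat B $$ (j, k)) = (if i = k then d else 0)"
      using ik B adj_mat(1)[OF B] by (simp add: scalar_prod_def det atLeast0LessThan)
    moreover have "(\<Sum>j<p. B $$ (i, j) * adj_mat B $$ (j, k))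
      = (\<Sum>j<p. (if j = i then z * adj_mat B $$ (j, k) else 0) - of_real (A $$ (i, j)) * adj_mat B $$ (j, k))"
      by (intro sum.cong refl) (auto simp: Bij ik algebra_simps)
    ultimately have e: "z * adj_mat B $$ (i, k) - (\<Sum>j<p. of_real (A $$ (i, j)) * adj_mat B $$ (j, k)) = (if i = k then d else 0)"
      using ik by (simp add: sum_subtractf)
    have "(\<Sum>j<p. of_real (A $$ (i, j)) * G j k) - z * G i k
        = (z * adj_mat B $$ (i, k) - (\<Sum>j<p. of_real (A $$ (i, j)) * adj_mat B $$ (j, k))) / d"
      by (simp add: G_def diff_divide_distrib sum_divide_distrib sum_negf)
    also have "\<dots> = (if i = k then 1 else 0)" unfolding e using d0 by simp
    finally show "(\<Sum>j<p. of_real (A $$ (i, j)) * G j k) - z * G i k = (if i = k then 1 else 0)" .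
  qed
  moreover have "A $$ (j, i) = A $$ (i, j)" if "i < p" "j < p" for i j
    using that A arg_cong[OF sym, of "\<lambda>M. M $$ (i, j)"] by auto
  then have symm: "symmetric_on {..<p} (\<lambda>i j. A $$ (i, j))"
    by (simp add: symmetric_on_def)
  ultimately have "resolvent_trace {..<p} (\<lambda>i j. A $$ (i, j)) z = (\<Sum>i<p. G i i)"
    unfolding resolvent_trace_def by (intro sum.cong refl resolvent_eqI[OF finite_lessThan _ z]) auto
  also have "\<dots> = - (\<Sum>i<p. adj_mat B $$ (i, i)) / d"
    by (simp add: G_def sum_negf sum_divide_distrib)
  also have "(\<Sum>i<p. adj_mat B $$ (i, i)) = (\<Sum>i<p. poly (char_poly (mat_delete C i i)) z)"
  proof (intro sum.cong refl)
    fix i assume "i \<in> {..<p}"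
    then have i: "i < p" by simp
    have Ci: "mat_delete C i i \<in> carrier_mat (p - 1) (p - 1)" by (rule mat_delete_carrier[OF C])
    have "adj_mat B $$ (i, i) = det (mat_delete B i i)"
      using i B by (simp add: adj_mat_def cofactor_def)
    also have "mat_delete B i i = - char_matrix (mat_delete C i i) z"
    proof (rule eq_matI)
      fix a b assume "a < dim_row (- char_matrix (mat_delete C i i) z)" "b < dim_col (- char_matrix (mat_delete C i i) z)"
      then have ab: "a < p - 1" "b < p - 1" using Ci by (auto simp: char_matrix_def)
      then show "mat_delete B i i $$ (a, b) = (- char_matrix (mat_delete C i i) z) $$ (a, b)"
        using Ci B C i by (auto simp: mat_delete_def char_matrix_def B_def)
    qed (use B C in \<open>auto simp: mat_delete_def char_matrix_def\<close>)
    also have "det \<dots> = poly (char_poly (mat_delete C i i)) z"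
      by (rule char_poly_matrix[OF Ci, symmetric])
    finally show "adj_mat B $$ (i, i) = poly (char_poly (mat_delete C i i)) z" .
  qed
  also have "\<dots> = poly (pderiv (char_poly C)) z" unfolding pderiv_char_poly[OF C] poly_sum ..
  also have "\<dots> = d * (\<Sum>a\<leftarrow>map complex_of_real (eigenvalues_desc A). 1 / (z - a))"
    unfolding d_def \<chi> by (rule pderiv_linear_factors[OF ne])
  also have "- (d * (\<Sum>a\<leftarrow>map complex_of_real (eigenvalues_desc A). 1 / (z - a))) / d
      = - (\<Sum>a\<leftarrow>map complex_of_real (eigenvalues_desc A). 1 / (z - a))" using d0 by simp
  also have "\<dots> = (\<Sum>e\<leftarrow>eigenvalues_desc A. 1 / (of_real e - z))"
  proof -
    have "- (1 / (z - complex_of_real a)) = 1 / (of_real a - z)" for a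
      by (metis minus_diff_eq minus_divide_right)
    then show ?thesis by (simp add: uminus_sum_list_map o_def)
  qed
  finally show ?thesis .
qed

lemma integral_esd:
  fixes f :: "real \<Rightarrow> complex" and A :: "real mat"
  assumes A: "A \<in> carrier_mat p p" and sym: "transpose_mat A = A" and f: "f \<in> borel_measurable borel"
  shows "(LINT x|esd A. f x) = (\<Sum>e\<leftarrow>eigenvalues_desc A. f e) / of_nat p"
proof -
  have m: "eigenvalue_desc A \<in> measurable (uniform_count_measure {1..dim_row A}) borel"
    by (simp add: measurable_def space_uniform_count_measure sets_uniform_count_measure)
  have "(LINT x|esd A. f x) = (LINT i|uniform_count_measure {1..p}. f (eigenvalue_desc A i))"
    unfolding esd_def using A by (subst integral_distr[OF m f]) simp
  also have "\<dots> = (\<Sum>i=1..p. f (eigenvalue_desc A i)) / of_nat p"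
    unfolding uniform_count_measure_def
    by (subst lebesgue_integral_point_measure_finite) (auto simp: scaleR_conv_of_real sum_divide_distrib)
  also have "(\<Sum>i=1..p. f (eigenvalue_desc A i)) = (\<Sum>i<p. f (eigenvalues_desc A ! i))"
    by (rule sum.reindex_bij_witness[of _ Suc "\<lambda>i. i - 1"]) (auto simp: eigenvalue_desc_def)
  also have "\<dots> = (\<Sum>e\<leftarrow>eigenvalues_desc A. f e)"
    unfolding sum_list_sum_nth using length_eigenvalues_desc[OF A sym] by (simp add: atLeast0LessThan)
  finally show ?thesis .
qed

lemma real_distribution_esd:
  assumes A: "A \<in> carrier_mat p p" and p: "p \<ge> 1"
  shows "real_distribution (esd A)"
proof -
  interpret U: prob_space "uniform_count_measure {1..dim_row A}"
    using A p by (intro prob_space_uniform_count_measure) auto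
  have m: "eigenvalue_desc A \<in> measurable (uniform_count_measure {1..dim_row A}) borel"
    by (simp add: measurable_def space_uniform_count_measure sets_uniform_count_measure)
  show ?thesis
    unfolding real_distribution_def real_distribution_axioms_def esd_def
    using U.prob_space_distr[OF m] by simp
qed

section \<open>Entries of the Chatterjee matrix in terms of the kernel\<close>

lemma sym_chatterjee_carrier: "sym_chatterjee_matrix n p x \<in> carrier_mat p p"
  by (simp add: sym_chatterjee_matrix_def chatterjee_matrix_def)

lemma sym_chatterjee_entry:
  "i < p \<Longrightarrow> j < p \<Longrightarrow> sym_chatterjee_matrix n p x $$ (i, j) = (chatterjee_xi n x (Suc i) (Suc j) + chatterjee_xi n x (Suc j) (Suc i)) / 2"
  by (simp add: sym_chatterjee_matrix_def chatterjee_matrix_def)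

lemma sym_chatterjee_transpose: "transpose_mat (sym_chatterjee_matrix n p x) = sym_chatterjee_matrix n p x"
  using sym_chatterjee_carrier[of n p x] by (intro eq_matI) (auto simp: sym_chatterjee_entry add.commute)

context
  fixes n :: nat
  assumes n: "n \<ge> 4"
begin

text \<open>Both centerings leave only a constant: that of the adjacency pairs to zero with the
  centered rows of the distance, and that of the distance sums to a constant since every point is
  visited once around the cycle. The constant is n times the mean distance (n+1)/3 of two distinct
  points.\<close>

lemma pairing_adjacency_distance:
  assumes p: "p permutes {1..n}" and q: "q permutes {1..n}"
  defines "\<sigma> \<equiv> q \<circ> inv_into UNIV p"
  shows "pairing {1..n} (centered_adjacency n) (centered_distance n) p q
    = (\<Sum>k=1..n. \<bar>real (\<sigma> (cyclic_next n k)) - real (\<sigma> k)\<bar>) - real n * (real n + 1) / 3"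
proof -
  define V where "V = {1..n}"
  let ?d = "centered_distance n"
  have \<sigma>: "\<sigma> permutes V" unfolding \<sigma>_def V_def by (intro permutes_compose permutes_inv p q)
  have d: "doubly_centered V ?d" unfolding V_def by (rule doubly_centered_distance[OF n])
  note D = doubly_centeredD[OF doubly_centered_permute[OF d \<sigma>]]
  have nin: "cyclic_next n k \<in> V" if "k \<in> V" for k using cyclic_next_in[OF n] that by (simp add: V_def)
  have "pairing V (centered_adjacency n) ?d p q = pairing V (centered_adjacency n) ?d id \<sigma>"
    using pairing_compose[OF permutes_inv[OF p], of "centered_adjacency n" ?d p q] permutes_inv_o(1)[OF p]
    by (simp add: \<sigma>_def V_def)
  also have "\<dots> = (\<Sum>x\<in>V. \<Sum>y\<in>V. (cyclic_adjacency n x y - 2 / (real n - 1)) * ?d (\<sigma> x) (\<sigma> y)) / 2"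
    unfolding pairing_def by (intro arg_cong2[where f = "(/)"] sum.cong refl) (auto simp: centered_adjacency_def D(2))
  also have "\<dots> = (\<Sum>x\<in>V. \<Sum>y\<in>V. cyclic_adjacency n x y * ?d (\<sigma> x) (\<sigma> y)) / 2"
    by (simp add: left_diff_distrib sum_subtractf sum_distrib_left[symmetric] sum_divide_distrib[symmetric] D(3))
  also have "(\<Sum>x\<in>V. \<Sum>y\<in>V. cyclic_adjacency n x y * ?d (\<sigma> x) (\<sigma> y))
     = (\<Sum>x\<in>V. \<Sum>y\<in>V. if y = cyclic_next n x then ?d (\<sigma> x) (\<sigma> y) else 0)
       + (\<Sum>x\<in>V. \<Sum>y\<in>V. if x = cyclic_next n y then ?d (\<sigma> x) (\<sigma> y) else 0)"
    unfolding sum.distrib[symmetric] by (intro sum.cong refl) (auto simp: cyclic_adjacency_eq[OF n])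
  also have "(\<Sum>x\<in>V. \<Sum>y\<in>V. if x = cyclic_next n y then ?d (\<sigma> x) (\<sigma> y) else 0)
     = (\<Sum>y\<in>V. \<Sum>x\<in>V. if x = cyclic_next n y then ?d (\<sigma> x) (\<sigma> y) else 0)" by (rule sum.swap)
  also have "\<dots> = (\<Sum>x\<in>V. ?d (\<sigma> x) (\<sigma> (cyclic_next n x)))"
    using nin D(1) by (intro sum.cong refl) (simp add: V_def)
  also have "(\<Sum>x\<in>V. \<Sum>y\<in>V. if y = cyclic_next n x then ?d (\<sigma> x) (\<sigma> y) else 0)
     = (\<Sum>x\<in>V. ?d (\<sigma> x) (\<sigma> (cyclic_next n x)))"
    using nin by (intro sum.cong refl) (simp add: V_def)
  finally have 1: "pairing V (centered_adjacency n) ?d p q = (\<Sum>x\<in>V. ?d (\<sigma> x) (\<sigma> (cyclic_next n x)))" by simp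
  define T where "T = (\<Sum>z\<in>V. distance_sum n z)"
  define g where "g = (\<lambda>x. distance_sum n x / (real n - 2))"
  define c where "c = T / ((real n - 1) * (real n - 2))"
  have "(\<Sum>x\<in>V. ?d (\<sigma> x) (\<sigma> (cyclic_next n x)))
      = (\<Sum>x\<in>V. \<bar>real (\<sigma> (cyclic_next n x)) - real (\<sigma> x)\<bar> - g (\<sigma> x) - g (\<sigma> (cyclic_next n x)) + c)"
  proof (intro sum.cong refl)
    fix x assume "x \<in> V"
    have "\<sigma> x \<noteq> \<sigma> (cyclic_next n x)"
      using permutes_inj[OF \<sigma>] cyclic_next_neq[OF n, of x] by (auto dest: injD)
    then show "?d (\<sigma> x) (\<sigma> (cyclic_next n x)) = \<bar>real (\<sigma> (cyclic_next n x)) - real (\<sigma> x)\<bar> - g (\<sigma> x) - g (\<sigma> (cyclic_next n x)) + c"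
      by (simp add: centered_distance_def g_def c_def T_def V_def abs_minus_commute)
  qed
  also have "\<dots> = (\<Sum>x\<in>V. \<bar>real (\<sigma> (cyclic_next n x)) - real (\<sigma> x)\<bar>) - (\<Sum>x\<in>V. g (\<sigma> x))
      - (\<Sum>x\<in>V. g (\<sigma> (cyclic_next n x))) + real n * c"
    by (simp add: sum.distrib sum_subtractf V_def)
  also have "(\<Sum>x\<in>V. g (\<sigma> (cyclic_next n x))) = (\<Sum>x\<in>V. g (\<sigma> x))"
  proof (rule sum.reindex_bij_witness[of _ "cyclic_prev n" "cyclic_next n"])
    fix x assume x: "x \<in> V"
    show "cyclic_prev n (cyclic_next n x) = x"
      using nin[OF x] x unfolding V_def by (intro sym[OF iffD1[OF eq_cyclic_next[OF n] refl]])
    show pin: "cyclic_prev n x \<in> V" using cyclic_prev_in[OF n] x by (simp add: V_def)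
    show "cyclic_next n (cyclic_prev n x) = x"
      using pin x unfolding V_def by (intro sym[OF iffD2[OF eq_cyclic_next[OF n] refl]])
  qed (use nin in auto)
  also have "(\<Sum>x\<in>V. g (\<sigma> x)) = T / (real n - 2)"
    using sum_permutes[OF \<sigma>, of g] by (simp add: g_def T_def sum_divide_distrib)
  also have "(\<Sum>x\<in>V. \<bar>real (\<sigma> (cyclic_next n x)) - real (\<sigma> x)\<bar>) - T / (real n - 2) - T / (real n - 2) + real n * c
      = (\<Sum>x\<in>V. \<bar>real (\<sigma> (cyclic_next n x)) - real (\<sigma> x)\<bar>) - T / (real n - 1)"
    using n by (simp add: c_def divide_simps) (simp add: algebra_simps)
  also have "T / (real n - 1) = real n * (real n + 1) / 3"
    using n sum_distance_sum[OF n] by (simp add: T_def V_def field_simps power2_eq_square)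
  finally show ?thesis using 1 by (simp add: V_def)
qed

text \<open>Two errors: the closing edge is at most n - 1 long and contributes at most 3/(n+1) after
  scaling, and the scaled mean of the cyclic sum is n/(n-1) instead of 1, an error of
  1/(n-1).\<close>

lemma chatterjee_xi_pairing:
  assumes ij: "i \<noteq> j" and ties: "inj_on (\<lambda>k. x k i) {1..n}" "inj_on (\<lambda>k. x k j) {1..n}"
  shows "\<bar>chatterjee_xi n x i j + 3 / ((real n)\<^sup>2 - 1) *
    pairing {1..n} (centered_adjacency n) (centered_distance n) (rank_perm n x i) (rank_perm n x j)\<bar> \<le> 4 / (real n - 1)"
proof -
  define p where "p = rank_perm n x i"
  define q where "q = rank_perm n x j"
  have p: "p permutes {1..n}" and q: "q permutes {1..n}"
    unfolding p_def q_def using rank_perm_permutes[of x i, OF ties(1)] rank_perm_permutes[of x j, OF ties(2)] .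
  define \<sigma> where "\<sigma> = q \<circ> inv_into UNIV p"
  have \<sigma>: "\<sigma> permutes {1..n}" unfolding \<sigma>_def by (intro permutes_compose permutes_inv p q)
  \<comment> \<open>\<open>chatterjee_xi\<close> inverts the ranks on \<open>{1..n}\<close>, the
    pairing inverts a permutation of the whole type; without ties the two inverses agree on
    \<open>{1..n}\<close>.\<close>
  have s: "(sample_rank n x j \<circ> inv_into {1..n} (sample_rank n x i)) k = \<sigma> k" if k: "k \<in> {1..n}" for k
  proof -
    have in1: "inv_into UNIV p k \<in> {1..n}" using permutes_in_image[OF permutes_inv[OF p]] k by simp
    have "inj_on (sample_rank n x i) {1..n}"
      using permutes_inj_on[OF p, of "{1..n}"] by (subst inj_on_cong[of _ _ p]) (auto simp: p_def rank_perm_def)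
    moreover have "sample_rank n x i (inv_into UNIV p k) = k"
      using in1 permutes_inverses(1)[OF p, of k] by (simp add: p_def rank_perm_def)
    ultimately have "inv_into {1..n} (sample_rank n x i) k = inv_into UNIV p k"
      using in1 by (metis inv_into_f_f)
    then show ?thesis using in1 by (simp add: \<sigma>_def q_def rank_perm_def)
  qed
  have "n = Suc (n - 1)" using n by simp
  then have split: "{1..n} = insert n {1..n - 1}" using atLeastAtMostSuc_conv[of 1 "n - 1"] n by simp
  define F where "F = pairing {1..n} (centered_adjacency n) (centered_distance n) p q"
  define L where "L = (\<Sum>k=1..n-1. \<bar>real (\<sigma> (k + 1)) - real (\<sigma> k)\<bar>)"
  have "(\<Sum>k=1..n. \<bar>real (\<sigma> (cyclic_next n k)) - real (\<sigma> k)\<bar>)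
      = \<bar>real (\<sigma> 1) - real (\<sigma> n)\<bar> + (\<Sum>k=1..n-1. \<bar>real (\<sigma> (cyclic_next n k)) - real (\<sigma> k)\<bar>)"
    unfolding split using n by (subst sum.insert) (auto simp: cyclic_next_def)
  also have "(\<Sum>k=1..n-1. \<bar>real (\<sigma> (cyclic_next n k)) - real (\<sigma> k)\<bar>) = L"
    unfolding L_def using n by (intro sum.cong refl) (auto simp: cyclic_next_def)
  finally have F: "F = \<bar>real (\<sigma> 1) - real (\<sigma> n)\<bar> + L - real n * (real n + 1) / 3"
    unfolding F_def pairing_adjacency_distance[OF p q] \<sigma>_def[symmetric] by simp
  have xi: "chatterjee_xi n x i j = 1 - 3 / ((real n)\<^sup>2 - 1) * L"
  proof -
    have "(\<Sum>k=1..n-1. \<bar>real ((sample_rank n x j \<circ> inv_into {1..n} (sample_rank n x i)) (k + 1))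
        - real ((sample_rank n x j \<circ> inv_into {1..n} (sample_rank n x i)) k)\<bar>) = L"
      unfolding L_def using n by (intro sum.cong refl) (subst (1 2) s, auto)
    then show ?thesis using ij by (simp add: chatterjee_xi_def Let_def)
  qed
  define b where "b = \<bar>real (\<sigma> 1) - real (\<sigma> n)\<bar>"
  define a where "a = 3 / ((real n)\<^sup>2 - 1)"
  have n2: "(real n)\<^sup>2 - 1 = (real n - 1) * (real n + 1)" by (simp add: power2_eq_square algebra_simps)
  have b: "0 \<le> b" "b \<le> real n - 1"
  proof -
    have "\<sigma> 1 \<in> {1..n}" "\<sigma> n \<in> {1..n}" 
      using n permutes_in_image[OF \<sigma>, of 1] permutes_in_image[OF \<sigma>, of n] by (simp_all del: One_nat_def)
    then show "b \<le> real n - 1" unfolding b_def by (auto simp: abs_le_iff)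
  qed (simp add: b_def)
  define K where "K = real n * (real n + 1) / 3"
  have K: "a * K = real n / (real n - 1)"
  proof -
    have "3 / (u * v) * (w * v / 3) = w / u" if "v \<noteq> 0" for u v w :: real using that by simp
    from this[of "real n + 1" "real n - 1" "real n"] show ?thesis using n by (simp add: a_def n2 K_def)
  qed
  have "chatterjee_xi n x i j + a * F = (1 - a * L) + a * (b + L - K)"
    unfolding xi F a_def b_def K_def ..
  also have "\<dots> = a * b + (1 - real n / (real n - 1))" by (simp add: K[symmetric] algebra_simps)
  also have "1 - real n / (real n - 1) = - (1 / (real n - 1))" using n by (simp add: field_simps)
  finally have e: "chatterjee_xi n x i j + a * F = a * b - 1 / (real n - 1)" by simp
  have "a \<ge> 0" using n by (simp add: a_def n2)
  then have "0 \<le> a * b" "a * b \<le> a * (real n - 1)" using b by (auto intro: mult_left_mono)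
  moreover have "a * (real n - 1) = 3 / (real n + 1)"
  proof -
    have "3 / (u * v) * u = 3 / v" if "u \<noteq> 0" for u v :: real using that by simp
    from this[of "real n - 1" "real n + 1"] show ?thesis using n by (simp add: a_def n2)
  qed
  moreover have "3 / (real n + 1) \<le> 3 / (real n - 1)" using n by (intro frac_le) auto
  moreover have "1 / (real n - 1) \<ge> 0" "3 / (real n - 1) + 1 / (real n - 1) = 4 / (real n - 1)" using n by (simp_all add: add_divide_distrib[symmetric])
  ultimately have "\<bar>chatterjee_xi n x i j + a * F\<bar> \<le> 4 / (real n - 1)" unfolding e by linarith
  then show ?thesis by (simp add: a_def F_def p_def q_def)
qed

lemma sym_chatterjee_kernel:
  assumes ties: "\<forall>j\<in>{1..p}. inj_on (\<lambda>k. x k j) {1..n}" and ij: "i < p" "j < p"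
  defines "R \<equiv> (\<lambda>j\<in>{..<p}. rank_perm n x (Suc j))"
  shows "\<bar>(sym_chatterjee_matrix n p x $$ (i, j) - (if i = j then 1 else 0)) - kernel_matrix (chatterjee_kernel n) R i j\<bar>
    \<le> 4 / (real n - 1)"
proof (cases "i = j")
  case True
  then show ?thesis using ij n by (simp add: sym_chatterjee_entry kernel_matrix_def chatterjee_xi_def)
next
  case False
  define a where "a = 3 / ((real n)\<^sup>2 - 1)"
  define F where "F = (\<lambda>i j. pairing {1..n} (centered_adjacency n) (centered_distance n) (R i) (R j))"
  have R: "R i = rank_perm n x (Suc i)" "R j = rank_perm n x (Suc j)" using ij by (simp_all add: R_def)
  have t: "inj_on (\<lambda>k. x k (Suc i)) {1..n}" "inj_on (\<lambda>k. x k (Suc j)) {1..n}" using ties ij by auto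
  have 1: "\<bar>chatterjee_xi n x (Suc i) (Suc j) + a * F i j\<bar> \<le> 4 / (real n - 1)"
    unfolding a_def F_def R using chatterjee_xi_pairing[of "Suc i" "Suc j" x, OF _ t] False by simp
  have 2: "\<bar>chatterjee_xi n x (Suc j) (Suc i) + a * F j i\<bar> \<le> 4 / (real n - 1)"
    unfolding a_def F_def R using chatterjee_xi_pairing[of "Suc j" "Suc i" x, OF _ t(2,1)] False by simp
  have "pairing {1..n} (centered_distance n) (centered_adjacency n) (R i) (R j) = F j i"
    by (simp add: F_def pairing_def mult.commute)
  moreover have "3 / (2 * ((real n)\<^sup>2 - 1)) = a / 2"
    unfolding a_def by (simp only: divide_divide_eq_left mult.commute)
  ultimately have "kernel_matrix (chatterjee_kernel n) R i j = - (a / 2) * (F i j + F j i)"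
    using False by (simp only: kernel_matrix_def chatterjee_kernel_def F_def if_False)
  then have "kernel_matrix (chatterjee_kernel n) R i j = - (a * F i j + a * F j i) / 2"
    by (simp add: algebra_simps)
  then have "(sym_chatterjee_matrix n p x $$ (i, j) - (if i = j then 1 else 0)) - kernel_matrix (chatterjee_kernel n) R i j
    = ((chatterjee_xi n x (Suc i) (Suc j) + a * F i j) + (chatterjee_xi n x (Suc j) (Suc i) + a * F j i)) / 2"
    using False by (simp add: sym_chatterjee_entry[OF ij])
  moreover have "\<bar>(u + v) / 2\<bar> \<le> e" if "\<bar>u\<bar> \<le> e" "\<bar>v\<bar> \<le> e" for u v e :: real
    using that abs_triangle_ineq[of u v] by simp
  note this[OF 1 2]
  ultimately show ?thesis by (simp only:)
qed

text \<open>The unit diagonal is removed by evaluating the resolvent at \<open>z - 1\<close>. The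
  remaining entrywise error \<open>4 / (real n - 1)\<close> enters through its Hilbert-Schmidt norm
  in \<open>resolvent_trace_HS\<close>.\<close>

lemma stieltjes_esd_chatterjee:
  assumes ties: "\<forall>j\<in>{1..p}. inj_on (\<lambda>k. x k j) {1..n}" and p: "p \<ge> 1" and z: "Im z > 0"
  defines "R \<equiv> (\<lambda>j\<in>{..<p}. rank_perm n x (Suc j))"
  shows "cmod ((LINT t|esd (sym_chatterjee_matrix n p x). 1 / (of_real t - z)) - kernel_trace n p (z - 1) R)
    \<le> sqrt (16 * real p / ((real n - 1)\<^sup>2 * (Im z) ^ 4))"
proof -
  define \<Phi> where "\<Phi> = sym_chatterjee_matrix n p x"
  define A where "A = (\<lambda>i j. \<Phi> $$ (i, j) - (if i = j then 1 else 0))"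
  define B where "B = kernel_matrix (chatterjee_kernel n) R"
  have \<Phi>: "\<Phi> \<in> carrier_mat p p" "transpose_mat \<Phi> = \<Phi>"
    unfolding \<Phi>_def by (rule sym_chatterjee_carrier sym_chatterjee_transpose)+
  have sym\<Phi>: "symmetric_on {..<p} (\<lambda>i j. \<Phi> $$ (i, j))"
    unfolding symmetric_on_def \<Phi>_def by (auto simp: sym_chatterjee_entry add.commute)
  then have symA: "symmetric_on {..<p} A" by (auto simp: symmetric_on_def A_def)
  interpret degenerate_kernel "perms {1..n}" "chatterjee_kernel n" "{1..n} \<times> {1..n}"
    "\<lambda>i q. transposition (fst i) (snd i) \<circ> q" "36 * (real n)\<^sup>2 * kernel_scale n" "kernel_var n" "kernel_kappa n"
    "1 / (2 * real n)" "288 * real n * kernel_scale n" "kernel_theta n"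
    by (rule kernel_degenerate[OF n])
  have symB: "symmetric_on {..<p} B" unfolding B_def by (rule symmetric_kernel_matrix)
  have imz: "Im (z - 1) = Im z" by simp
  then have z1: "Im (z - 1) > 0" using z by simp
  have meas: "(\<lambda>t. 1 / (complex_of_real t - z)) \<in> borel_measurable borel" by measurable
  have "(LINT t|esd \<Phi>. 1 / (of_real t - z)) = resolvent_trace {..<p} (\<lambda>i j. \<Phi> $$ (i, j)) z / of_nat p"
    unfolding integral_esd[OF \<Phi> meas] resolvent_trace_eigenvalues[OF \<Phi> z] ..
  also have "resolvent_trace {..<p} (\<lambda>i j. \<Phi> $$ (i, j)) z = resolvent_trace {..<p} A (z - 1)"
  proof -
    have "resolvent_on {..<p} (\<lambda>i j. \<Phi> $$ (i, j)) z (resolvent {..<p} A (z - 1))"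
      unfolding resolvent_on_def
    proof (intro ballI)
      fix i k assume ik: "i \<in> {..<p}" "k \<in> {..<p}"
      define G where "G = resolvent {..<p} A (z - 1)"
      have "(\<Sum>j<p. of_real (A i j) * G j k) - (z - 1) * G i k = (if i = k then 1 else 0)"
        unfolding G_def by (rule resolvent_onD[OF resolvent_on_resolvent[OF finite_lessThan symA z1] ik])
      moreover have "(\<Sum>j<p. of_real (A i j) * G j k) = (\<Sum>j<p. of_real (\<Phi> $$ (i, j)) * G j k - (if j = i then G j k else 0))"
        by (intro sum.cong refl) (auto simp: A_def algebra_simps)
      ultimately show "(\<Sum>j<p. of_real (\<Phi> $$ (i, j)) * G j k) - z * G i k = (if i = k then 1 else 0)"
        using ik by (simp add: sum_subtractf algebra_simps)
    qed
    then show ?thesis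
      unfolding resolvent_trace_def
      by (intro sum.cong refl resolvent_eqI[OF finite_lessThan sym\<Phi> z]) auto
  qed
  finally have eq: "(LINT t|esd \<Phi>. 1 / (of_real t - z)) - kernel_trace n p (z - 1) R
      = (resolvent_trace {..<p} A (z - 1) - resolvent_trace {..<p} B (z - 1)) / of_nat p"
    by (simp add: kernel_trace_def B_def diff_divide_distrib)
  have "(\<Sum>i<p. \<Sum>j<p. (A i j - B i j)\<^sup>2) \<le> (\<Sum>i<p. \<Sum>j<p. (4 / (real n - 1))\<^sup>2)"
  proof (intro sum_mono)
    fix i j assume "i \<in> {..<p}" "j \<in> {..<p}"
    then have "\<bar>A i j - B i j\<bar> \<le> 4 / (real n - 1)"
      using sym_chatterjee_kernel[OF ties, of i j] by (simp add: A_def B_def \<Phi>_def R_def)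
    then show "(A i j - B i j)\<^sup>2 \<le> (4 / (real n - 1))\<^sup>2"
      by (metis abs_ge_zero power2_abs power_mono)
  qed
  then have HS: "(\<Sum>i<p. \<Sum>j<p. (A i j - B i j)\<^sup>2) \<le> 16 * (real p)\<^sup>2 / (real n - 1)\<^sup>2"
    by (simp add: power_divide power2_eq_square mult_ac)
  have "(cmod ((LINT t|esd \<Phi>. 1 / (of_real t - z)) - kernel_trace n p (z - 1) R))\<^sup>2
      = (cmod (resolvent_trace {..<p} A (z - 1) - resolvent_trace {..<p} B (z - 1)))\<^sup>2 / (real p)\<^sup>2"
    unfolding eq by (simp add: norm_divide power_divide)
  also have "\<dots> \<le> ((\<Sum>i<p. \<Sum>j<p. (A i j - B i j)\<^sup>2) * real (card {..<p}) / (Im (z - 1)) ^ 4) / (real p)\<^sup>2"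
    by (intro divide_right_mono resolvent_trace_HS[OF finite_lessThan symA symB z1]) simp
  also have "\<dots> \<le> ((16 * (real p)\<^sup>2 / (real n - 1)\<^sup>2) * real p / (Im z) ^ 4) / (real p)\<^sup>2"
    unfolding card_lessThan imz by (intro divide_right_mono mult_right_mono HS) simp_all
  also have "\<dots> = 16 * real p / ((real n - 1)\<^sup>2 * (Im z) ^ 4)"
    using p by (simp add: field_simps)
  finally show ?thesis unfolding \<Phi>_def by (rule real_le_rsqrt)
qed

lemma kernel_trace_row_change:
  assumes z: "Im z > 0" and p: "p \<ge> 1"
  shows "cmod (kernel_trace n p z (R(i := q)) - kernel_trace n p z (R(i := q'))) \<le> 2 / (real p * Im z)"
proof -
  interpret degenerate_kernel "perms {1..n}" "chatterjee_kernel n" "{1..n} \<times> {1..n}"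
    "\<lambda>i q. transposition (fst i) (snd i) \<circ> q" "36 * (real n)\<^sup>2 * kernel_scale n" "kernel_var n" "kernel_kappa n"
    "1 / (2 * real n)" "288 * real n * kernel_scale n" "kernel_theta n"
    by (rule kernel_degenerate[OF n])
  have "cmod (resolvent_trace {..<p} (kernel_matrix (chatterjee_kernel n) (R(i := q))) z -
      resolvent_trace {..<p} (kernel_matrix (chatterjee_kernel n) (R(i := q'))) z) \<le> 2 / Im z"
    by (intro resolvent_trace_row_change[of _ _ _ _ i] symmetric_kernel_matrix z) (auto simp: kernel_matrix_def)
  then have "cmod (resolvent_trace {..<p} (kernel_matrix (chatterjee_kernel n) (R(i := q))) z -
      resolvent_trace {..<p} (kernel_matrix (chatterjee_kernel n) (R(i := q'))) z) / real p \<le> 2 / Im z / real p"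
    by (rule divide_right_mono) simp
  then show ?thesis
    by (simp add: kernel_trace_def diff_divide_distrib[symmetric] norm_divide mult.commute)
qed

lemma kernel_trace_bounds:
  assumes z: "Im z > 0" and p: "p \<ge> 1"
  shows "Im (kernel_trace n p z R) \<ge> 0" "cmod (kernel_trace n p z R) \<le> 1 / Im z"
proof -
  interpret degenerate_kernel "perms {1..n}" "chatterjee_kernel n" "{1..n} \<times> {1..n}"
    "\<lambda>i q. transposition (fst i) (snd i) \<circ> q" "36 * (real n)\<^sup>2 * kernel_scale n" "kernel_var n" "kernel_kappa n"
    "1 / (2 * real n)" "288 * real n * kernel_scale n" "kernel_theta n"
    by (rule kernel_degenerate[OF n])
  show "Im (kernel_trace n p z R) \<ge> 0"
    using Im_resolvent_trace[OF finite_lessThan symmetric_kernel_matrix z, of p R] by (simp add: kernel_trace_def)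
  show "cmod (kernel_trace n p z R) \<le> 1 / Im z"
    using norm_resolvent_trace[OF finite_lessThan symmetric_kernel_matrix z, of p R] p
    by (simp add: kernel_trace_def norm_divide field_simps)
qed

end

section \<open>Almost sure convergence\<close>

text \<open>The difference of the polynomial at \<open>T\<close> and at \<open>m\<close> factors as
  (T - m)(z + s (T + m)), and the second factor has imaginary part at least \<open>Im z\<close>
  since \<open>T\<close> and \<open>m\<close> have nonnegative imaginary parts.\<close>

lemma quadratic_root_stability:
  fixes T m z :: complex and s :: real
  assumes root: "1 + z * m + of_real s * m\<^sup>2 = 0" and Im: "Im z > 0" "Im m \<ge> 0" "Im T \<ge> 0" and s: "s \<ge> 0"
  shows "cmod (T - m) \<le> cmod (1 + z * T + of_real s * T\<^sup>2) / Im z"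
proof -
  have "1 + z * T + of_real s * T\<^sup>2 = (1 + z * T + of_real s * T\<^sup>2) - (1 + z * m + of_real s * m\<^sup>2)"
    by (simp only: root) simp
  also have "\<dots> = (T - m) * (z + of_real s * (T + m))" by (simp add: power2_eq_square algebra_simps)
  finally have e: "cmod (1 + z * T + of_real s * T\<^sup>2) = cmod (T - m) * cmod (z + of_real s * (T + m))"
    by (simp only: norm_mult)
  have "Im z \<le> Im (z + of_real s * (T + m))" using Im s by simp
  also have "\<dots> \<le> cmod (z + of_real s * (T + m))" using abs_Im_le_cmod by (rule order_trans[OF abs_ge_self])
  finally have "cmod (T - m) * Im z \<le> cmod (T - m) * cmod (z + of_real s * (T + m))" by (rule mult_left_mono) simp
  then show ?thesis unfolding e using Im by (simp add: pos_le_divide_eq)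
qed

text \<open>Here \<open>s\<close> is meant to be the limiting coefficient, while the finite equation
  has \<open>kernel_var n * real p\<close>; the bound \<open>1 / Im z\<close> on the trace controls
  the exchange. Stability is applied to each tuple before averaging, because the equation is not
  linear.\<close>

lemma kernel_trace_mean_deviation:
  assumes n: "n \<ge> 4" and p: "p \<ge> 1" and z: "Im z > 0"
    and root: "1 + z * m + of_real s * m\<^sup>2 = 0" "Im m \<ge> 0" "s \<ge> 0"
  defines "P \<equiv> PiE {..<p} (\<lambda>_. perms {1..n})"
  shows "cmod (avg P (kernel_trace n p z) - m) \<le>
    (avg P (\<lambda>R. cmod (1 + z * kernel_trace n p z R + of_real (kernel_var n * real p) * (kernel_trace n p z R)\<^sup>2))
      + \<bar>s - kernel_var n * real p\<bar> / (Im z)\<^sup>2) / Im z"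
proof -
  let ?T = "kernel_trace n p z" and ?s = "kernel_var n * real p"
  have fin: "finite P" "P \<noteq> {}"
    unfolding P_def using perms_nonempty by (auto simp: PiE_eq_empty_iff intro!: finite_PiE finite_permutations)
  have "cmod (avg P ?T - m) = cmod (avg P (\<lambda>R. ?T R - m))"
    using fin by (simp add: avg_diff avg_const)
  also have "\<dots> \<le> avg P (\<lambda>R. cmod (?T R - m))" by (rule norm_avg_le)
  also have "\<dots> \<le> avg P (\<lambda>R. (cmod (1 + z * ?T R + of_real ?s * (?T R)\<^sup>2) + \<bar>s - ?s\<bar> / (Im z)\<^sup>2) * (1 / Im z))"
  proof (rule avg_mono)
    fix R
    note b = kernel_trace_bounds[OF n z p, of R]
    have "1 + z * ?T R + of_real s * (?T R)\<^sup>2 = (1 + z * ?T R + of_real ?s * (?T R)\<^sup>2) + of_real (s - ?s) * (?T R)\<^sup>2"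
      by (simp add: algebra_simps)
    then have "cmod (1 + z * ?T R + of_real s * (?T R)\<^sup>2)
        \<le> cmod (1 + z * ?T R + of_real ?s * (?T R)\<^sup>2) + cmod (of_real (s - ?s) * (?T R)\<^sup>2)"
      by (simp only: norm_triangle_ineq)
    also have "cmod (of_real (s - ?s) * (?T R)\<^sup>2) = \<bar>s - ?s\<bar> * (cmod (?T R))\<^sup>2"
      by (simp only: norm_mult norm_of_real norm_power)
    also have "\<dots> \<le> \<bar>s - ?s\<bar> * (1 / Im z)\<^sup>2" by (intro mult_left_mono power_mono b) auto
    finally have "cmod (1 + z * ?T R + of_real s * (?T R)\<^sup>2)
        \<le> cmod (1 + z * ?T R + of_real ?s * (?T R)\<^sup>2) + \<bar>s - ?s\<bar> / (Im z)\<^sup>2" by (simp add: power_divide)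
    then have "cmod (1 + z * ?T R + of_real s * (?T R)\<^sup>2) / Im z
        \<le> (cmod (1 + z * ?T R + of_real ?s * (?T R)\<^sup>2) + \<bar>s - ?s\<bar> / (Im z)\<^sup>2) / Im z"
      using z by (intro divide_right_mono) auto
    then show "cmod (?T R - m) \<le> (cmod (1 + z * ?T R + of_real ?s * (?T R)\<^sup>2) + \<bar>s - ?s\<bar> / (Im z)\<^sup>2) * (1 / Im z)"
      using quadratic_root_stability[OF root(1) z root(2) b(1) root(3)] by simp
  qed
  also have "\<dots> = (avg P (\<lambda>R. cmod (1 + z * ?T R + of_real ?s * (?T R)\<^sup>2)) + \<bar>s - ?s\<bar> / (Im z)\<^sup>2) * (1 / Im z)"
    using fin unfolding avg_multc avg_add by (simp add: avg_const)
  finally show ?thesis by simp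
qed

lemma kernel_trace_mean_tendsto:
  fixes p :: "nat \<Rightarrow> nat"
  assumes \<gamma>: "\<gamma> > 0" and lim: "(\<lambda>n. real (p n) / real n) \<longlonglongrightarrow> \<gamma>" and z: "Im z > 0"
    and root: "1 + z * m + of_real (\<gamma> / 5) * m\<^sup>2 = 0" "Im m \<ge> 0"
  shows "(\<lambda>n. avg (PiE {..<p n} (\<lambda>_. perms {1..n})) (kernel_trace n (p n) z)) \<longlonglongrightarrow> m"
proof -
  \<comment> \<open>The error of \<open>kernel_trace_equation\<close> with \<Gamma> = \<gamma> + 1,
    which eventually dominates p n / n.\<close>
  define bound where "bound = (\<lambda>n. (sqrt ((4 * (sqrt (real n) * ((\<gamma> + 1)\<^sup>2 * 5248\<^sup>2 + (\<gamma> + 1) * (72\<^sup>2 * 5248)) / (Im z) ^ 4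
        + ((\<gamma> + 1)\<^sup>2 * 62941798400 + (\<gamma> + 1) * 576 ^ 4) * sqrt (real n)) + 2 * (\<gamma> + 1)\<^sup>2 * 576 ^ 4 / (Im z)\<^sup>2) / real n
        + 2 * ((\<gamma> + 1) ^ 3 * 220332032 / (Im z)\<^sup>2) / real n)
      + 5248 / real n / Im z) / Im z)"
  have bound: "bound \<longlonglongrightarrow> 0" unfolding bound_def by (rule kernel_trace_mean_error_tendsto)
  have "(\<lambda>n. real n * kernel_var n * (real (p n) / real n)) \<longlonglongrightarrow> 1 / 5 * \<gamma>"
    by (intro tendsto_mult kernel_var_tendsto lim)
  moreover have "eventually (\<lambda>n. real n * kernel_var n * (real (p n) / real n) = kernel_var n * real (p n)) sequentially"
    using eventually_gt_at_top[of 0] by eventually_elim simp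
  ultimately have "(\<lambda>n. kernel_var n * real (p n)) \<longlonglongrightarrow> 1 / 5 * \<gamma>"
    by (rule Lim_transform_eventually)
  from tendsto_diff[OF tendsto_const[of "\<gamma> / 5"] this]
  have var: "(\<lambda>n. \<gamma> / 5 - kernel_var n * real (p n)) \<longlonglongrightarrow> 0" by simp
  have "(\<lambda>n. (bound n + \<bar>\<gamma> / 5 - kernel_var n * real (p n)\<bar> / (Im z)\<^sup>2) / Im z) \<longlonglongrightarrow> (0 + \<bar>0\<bar> / (Im z)\<^sup>2) / Im z"
    using z by (intro tendsto_intros bound var) auto
  then have "(\<lambda>n. (bound n + \<bar>\<gamma> / 5 - kernel_var n * real (p n)\<bar> / (Im z)\<^sup>2) / Im z) \<longlonglongrightarrow> 0" by simp
  moreover have "eventually (\<lambda>n. cmod (avg (PiE {..<p n} (\<lambda>_. perms {1..n})) (kernel_trace n (p n) z) - m)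
      \<le> (bound n + \<bar>\<gamma> / 5 - kernel_var n * real (p n)\<bar> / (Im z)\<^sup>2) / Im z) sequentially"
    using order_tendstoD(2)[OF lim less_add_one] order_tendstoD(1)[OF lim \<gamma>] eventually_ge_at_top[of 4]
  proof eventually_elim
    case (elim n)
    then have n: "n \<ge> 4" by simp
    have "p n \<noteq> 0" using elim(2) by (intro notI) simp
    then have p: "p n \<ge> 1" "real (p n) \<le> (\<gamma> + 1) * real n"
      using elim(1) n by (simp_all add: pos_divide_less_eq)
    have "avg (PiE {..<p n} (\<lambda>_. perms {1..n})) (\<lambda>R. cmod (1 + z * kernel_trace n (p n) z R +
        of_real (kernel_var n * real (p n)) * (kernel_trace n (p n) z R)\<^sup>2)) \<le> bound n"
      unfolding bound_def by (rule kernel_trace_equation[OF n p z])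
    moreover have "cmod (avg (PiE {..<p n} (\<lambda>_. perms {1..n})) (kernel_trace n (p n) z) - m) \<le>
        (avg (PiE {..<p n} (\<lambda>_. perms {1..n})) (\<lambda>R. cmod (1 + z * kernel_trace n (p n) z R +
        of_real (kernel_var n * real (p n)) * (kernel_trace n (p n) z R)\<^sup>2))
        + \<bar>\<gamma> / 5 - kernel_var n * real (p n)\<bar> / (Im z)\<^sup>2) / Im z"
      using \<gamma> by (intro kernel_trace_mean_deviation n p z root) auto
    ultimately show ?case
      using z by (meson add_right_mono divide_right_mono less_imp_le order_trans)
  qed
  ultimately have "(\<lambda>n. avg (PiE {..<p n} (\<lambda>_. perms {1..n})) (kernel_trace n (p n) z) - m) \<longlonglongrightarrow> 0"
    by (rule Lim_null_comparison[rotated])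
  then show ?thesis by (simp add: LIM_zero_iff)
qed

text \<open>One permutation moves the normalized trace by at most 2/(p Im z), so p^2 times the
  fourth power of this is of order p^(-2).\<close>

lemma kernel_trace_fourth_moment:
  assumes n: "n \<ge> 4" and p: "p \<ge> 1" and z: "Im z > 0"
  defines "P \<equiv> PiE {..<p} (\<lambda>_. perms {1..n})"
  shows "avg P (\<lambda>R. cmod (kernel_trace n p z R - avg P (kernel_trace n p z)) ^ 4) \<le> 256 / ((real p)\<^sup>2 * (Im z) ^ 4)"
proof -
  have "avg P (\<lambda>R. cmod (kernel_trace n p z R - avg P (kernel_trace n p z)) ^ 4)
      \<le> 16 * (real (card {..<p}))\<^sup>2 * (2 / (real p * Im z)) ^ 4"
    unfolding P_def using z
    by (intro bounded_differences_fourth_moment finite_permutations perms_nonempty kernel_trace_row_change n p) auto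
  also have "\<dots> = 256 / ((real p)\<^sup>2 * (Im z) ^ 4)"
    using p z by (simp add: power_divide power_mult_distrib power4_eq_xxxx power2_eq_square)
  finally show ?thesis .
qed

locale chatterjee_samples = prob_space M
  for M :: "'a measure" +
  fixes p :: "nat \<Rightarrow> nat" and X :: "nat \<Rightarrow> nat \<Rightarrow> nat \<Rightarrow> 'a \<Rightarrow> real"
    and N :: "nat \<Rightarrow> 'b measure" and Y :: "nat \<Rightarrow> nat \<Rightarrow> 'b \<Rightarrow> real" and \<gamma> :: real
  assumes sample: "n \<ge> 1 \<Longrightarrow> ranked_sample M n (p n) (X n) (N n) (Y n)"
    and \<gamma>: "\<gamma> > 0" and ratio: "(\<lambda>n. real (p n) / real n) \<longlonglongrightarrow> \<gamma>"
begin

abbreviation ranks :: "nat \<Rightarrow> 'a \<Rightarrow> nat \<Rightarrow> nat \<Rightarrow> nat" where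
  "ranks n \<omega> \<equiv> (\<lambda>j\<in>{..<p n}. rank_perm n (\<lambda>i j. X n i j \<omega>) (Suc j))"

abbreviation rank_tuples :: "nat \<Rightarrow> (nat \<Rightarrow> nat \<Rightarrow> nat) set" where
  "rank_tuples n \<equiv> PiE {..<p n} (\<lambda>_. perms {1..n})"

lemma eventually_dimension: "eventually (\<lambda>n. n \<ge> 4 \<and> p n \<ge> 1 \<and> real (p n) \<ge> \<gamma> / 2 * real n) sequentially"
proof -
  have "\<gamma> / 2 < \<gamma>" using \<gamma> by simp
  from order_tendstoD(1)[OF ratio this] eventually_ge_at_top[of 4] show ?thesis
  proof eventually_elim
    case (elim n)
    then have "\<gamma> / 2 * real n < real (p n)" by (simp add: pos_less_divide_eq)
    moreover have "p n \<noteq> 0" using elim(1) \<gamma> by (intro notI) simp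
    ultimately show ?case using elim(2) by simp
  qed
qed

text \<open>Markov's inequality for the fourth power at level n^(-1/2) leaves probabilities of order
  n^(-2) n^(1/2) = n^(-3/2), which are summable. The first Borel-Cantelli lemma applies whatever the
  dependence between samples of different sizes.\<close>

lemma kernel_trace_concentration:
  assumes z: "Im z > 0"
  shows "AE \<omega> in M. (\<lambda>n. kernel_trace n (p n) z (ranks n \<omega>) - avg (rank_tuples n) (kernel_trace n (p n) z)) \<longlonglongrightarrow> 0"
proof -
  obtain n0 where n0: "\<And>n. n \<ge> n0 \<Longrightarrow> n \<ge> 4 \<and> p n \<ge> 1 \<and> real (p n) \<ge> \<gamma> / 2 * real n"
    using eventually_dimension unfolding eventually_sequentially by auto
  define F where "F = (\<lambda>n R. cmod (kernel_trace n (p n) z R - avg (rank_tuples n) (kernel_trace n (p n) z)) ^ 4)"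
  \<comment> \<open>Four times 256, because eventually p n is at least \<gamma> n / 2.\<close>
  define C where "C = 1024 / (\<gamma>\<^sup>2 * (Im z) ^ 4)"
  have "\<exists>A. A \<in> events \<and> prob A \<le> C * real n powr (- 3 / 2) \<and>
      (AE \<omega> in M. n \<ge> n0 \<longrightarrow> \<omega> \<notin> A \<longrightarrow> F n (ranks n \<omega>) < 1 / sqrt (real n))" (is "\<exists>A. ?Q n A") for n
  proof (cases "n \<ge> n0")
    case True
    then have large: "n \<ge> 4" "p n \<ge> 1" "real (p n) \<ge> \<gamma> / 2 * real n" using n0 by auto
    then have n': "real n > 0" by simp
    interpret ranked_sample M n "p n" "X n" "N n" "Y n" using large by (intro sample) simp
    obtain A where A: "A \<in> events" "prob A \<le> avg (rank_tuples n) (F n) / (1 / sqrt (real n))"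
      "AE \<omega> in M. \<omega> \<notin> A \<longrightarrow> rank_tuple \<omega> \<in> rank_tuples n \<and> F n (rank_tuple \<omega>) < 1 / sqrt (real n)"
      by (rule rank_tuple_tail[of "F n" "1 / sqrt (real n)"]) (use n' in \<open>auto simp: F_def\<close>)
    have "(\<gamma> / 2 * real n)\<^sup>2 \<le> (real (p n))\<^sup>2" using large \<gamma> by (intro power_mono) auto
    then have "256 / ((real (p n))\<^sup>2 * (Im z) ^ 4) \<le> 256 / ((\<gamma> / 2 * real n)\<^sup>2 * (Im z) ^ 4)"
      using \<gamma> n' z large(2) by (intro divide_left_mono mult_right_mono mult_pos_pos) auto
    also have "\<dots> = C / (real n)\<^sup>2" by (simp add: C_def power2_eq_square)
    finally have "avg (rank_tuples n) (F n) \<le> C / (real n)\<^sup>2"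
      unfolding F_def by (rule order_trans[OF kernel_trace_fourth_moment[OF large(1,2) z]])
    then have "avg (rank_tuples n) (F n) * sqrt (real n) \<le> C / (real n)\<^sup>2 * sqrt (real n)"
      by (rule mult_right_mono) simp
    also have "C / (real n)\<^sup>2 * sqrt (real n) = C * real n powr (- 3 / 2)"
    proof -
      have "real n powr (- 3 / 2) = real n powr (1 / 2) / real n powr 2"
        by (subst powr_diff[symmetric]) simp
      also have "\<dots> = sqrt (real n) / (real n)\<^sup>2" using n' by (simp add: powr_half_sqrt)
      finally show ?thesis by simp
    qed
    finally have "prob A \<le> C * real n powr (- 3 / 2)" using A(2) by simp
    then show ?thesis using A(1,3) by (intro exI[of _ A]) (auto simp: rank_tuple_def)
  next
    case False
    then show ?thesis by (intro exI[of _ "{}"]) (auto simp: C_def)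
  qed
  then have "\<forall>n. \<exists>A. ?Q n A" ..
  from choice[OF this] obtain A where "\<forall>n. ?Q n (A n)" ..
  then have A: "\<And>n. A n \<in> events" "\<And>n. prob (A n) \<le> C * real n powr (- 3 / 2)"
    "\<And>n. AE \<omega> in M. n \<ge> n0 \<longrightarrow> \<omega> \<notin> A n \<longrightarrow> F n (ranks n \<omega>) < 1 / sqrt (real n)" by blast+
  have "summable (\<lambda>n. C * real n powr (- 3 / 2))"
    by (intro summable_mult) (simp add: summable_real_powr_iff)
  then have "summable (\<lambda>n. prob (A n))"
    by (rule summable_comparison_test'[of _ 0]) (use A(2) in auto)
  then have "AE \<omega> in M. eventually (\<lambda>n. \<omega> \<in> space M - A n) sequentially"
    by (intro borel_cantelli_AE1 A(1)) (simp_all add: emeasure_eq_measure)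
  moreover have "AE \<omega> in M. \<forall>n. n \<ge> n0 \<longrightarrow> \<omega> \<notin> A n \<longrightarrow> F n (ranks n \<omega>) < 1 / sqrt (real n)"
    using A(3) by (subst AE_all_countable) auto
  ultimately show ?thesis
  proof eventually_elim
    case (elim \<omega>)
    define D where "D = (\<lambda>n. kernel_trace n (p n) z (ranks n \<omega>) - avg (rank_tuples n) (kernel_trace n (p n) z))"
    have "eventually (\<lambda>n. norm (cmod (D n) ^ 4) \<le> 1 / sqrt (real n)) sequentially"
      using elim(1) eventually_ge_at_top[of n0]
    proof eventually_elim
      case (elim n)
      then show ?case using \<open>\<forall>n. n \<ge> n0 \<longrightarrow> \<omega> \<notin> A n \<longrightarrow> F n (ranks n \<omega>) < 1 / sqrt (real n)\<close>
        by (auto simp: F_def D_def intro: less_imp_le)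
    qed
    moreover have "(\<lambda>n. 1 / sqrt (real n)) \<longlonglongrightarrow> 0" by real_asymp
    ultimately have "(\<lambda>n. cmod (D n) ^ 4) \<longlonglongrightarrow> 0" by (rule Lim_null_comparison)
    from tendsto_real_root[OF this, of 4] have "(\<lambda>n. cmod (D n)) \<longlonglongrightarrow> 0" by (simp add: real_root_power_cancel)
    then show ?case by (simp add: D_def tendsto_norm_zero_iff)
  qed
qed

lemma stieltjes_tendsto:
  assumes z: "Im z > 0"
  shows "AE \<omega> in M. (\<lambda>n. LINT t|esd (sym_chatterjee_matrix n (p n) (\<lambda>i j. X n i j \<omega>)). 1 / (of_real t - z))
    \<longlonglongrightarrow> (LINT t|semicircle 1 (2 * sqrt (\<gamma> / 5)). 1 / (of_real t - z))"
proof -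
  define m where "m = (LINT t|semicircle 1 (2 * sqrt (\<gamma> / 5)). 1 / (of_real t - z))"
  have r: "2 * sqrt (\<gamma> / 5) > 0" using \<gamma> by simp
  \<comment> \<open>The radius is fixed here: the coefficient r^2/4 in the semicircle equation must
    be the limit \<gamma>/5 of p times the kernel variance. The center 1 matches the shift to
    \<open>z - 1\<close>.\<close>
  have r4: "(2 * sqrt (\<gamma> / 5))\<^sup>2 / 4 = \<gamma> / 5" using \<gamma> by (simp add: power_mult_distrib)
  have root: "1 + (z - 1) * m + of_real (\<gamma> / 5) * m\<^sup>2 = 0" "Im m \<ge> 0"
    using semicircle_stieltjes[OF r z, of 1] unfolding r4 m_def by simp_all
  have z1: "Im (z - 1) > 0" using z by simp
  have mean: "(\<lambda>n. avg (rank_tuples n) (kernel_trace n (p n) (z - 1))) \<longlonglongrightarrow> m"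
    by (rule kernel_trace_mean_tendsto[OF \<gamma> ratio z1 root])
  have err: "(\<lambda>n. sqrt (16 * real (p n) / ((real n - 1)\<^sup>2 * (Im z) ^ 4))) \<longlonglongrightarrow> 0"
  proof -
    have "(\<lambda>n. real n / (real n - 1)\<^sup>2) \<longlonglongrightarrow> 0" by real_asymp
    then have "(\<lambda>n. sqrt (16 / (Im z) ^ 4 * (real (p n) / real n * (real n / (real n - 1)\<^sup>2)))) \<longlonglongrightarrow> sqrt (16 / (Im z) ^ 4 * (\<gamma> * 0))"
      by (intro tendsto_intros ratio)
    then have "(\<lambda>n. sqrt (16 / (Im z) ^ 4 * (real (p n) / real n * (real n / (real n - 1)\<^sup>2)))) \<longlonglongrightarrow> 0" by simp
    then show ?thesis
    proof (rule Lim_transform_eventually)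
      show "eventually (\<lambda>n. sqrt (16 / (Im z) ^ 4 * (real (p n) / real n * (real n / (real n - 1)\<^sup>2)))
          = sqrt (16 * real (p n) / ((real n - 1)\<^sup>2 * (Im z) ^ 4))) sequentially"
        using eventually_gt_at_top[of 1] by eventually_elim simp
    qed
  qed
  have ties: "AE \<omega> in M. \<forall>n. n \<ge> 1 \<longrightarrow> (\<forall>j\<in>{1..p n}. inj_on (\<lambda>i. X n i j \<omega>) {1..n})"
  proof (subst AE_all_countable, intro allI)
    fix n
    show "AE \<omega> in M. n \<ge> 1 \<longrightarrow> (\<forall>j\<in>{1..p n}. inj_on (\<lambda>i. X n i j \<omega>) {1..n})"
      using ranked_sample.no_ties[OF sample, of n] by (cases "n \<ge> 1") auto
  qed
  from ties kernel_trace_concentration[OF z1] show ?thesis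
  proof eventually_elim
    case (elim \<omega>)
    have "eventually (\<lambda>n. cmod ((LINT t|esd (sym_chatterjee_matrix n (p n) (\<lambda>i j. X n i j \<omega>)). 1 / (of_real t - z))
        - kernel_trace n (p n) (z - 1) (ranks n \<omega>)) \<le> sqrt (16 * real (p n) / ((real n - 1)\<^sup>2 * (Im z) ^ 4))) sequentially"
      using eventually_dimension
    proof eventually_elim
      case (elim n)
      then have "n \<ge> 4" "p n \<ge> 1" "\<forall>j\<in>{1..p n}. inj_on (\<lambda>i. X n i j \<omega>) {1..n}"
        using \<open>\<forall>n. n \<ge> 1 \<longrightarrow> (\<forall>j\<in>{1..p n}. inj_on (\<lambda>i. X n i j \<omega>) {1..n})\<close> by auto
      then show ?case by (intro stieltjes_esd_chatterjee z)
    qed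
    from Lim_null_comparison[OF this err]
    have "(\<lambda>n. ((LINT t|esd (sym_chatterjee_matrix n (p n) (\<lambda>i j. X n i j \<omega>)). 1 / (of_real t - z))
          - kernel_trace n (p n) (z - 1) (ranks n \<omega>))
        + (kernel_trace n (p n) (z - 1) (ranks n \<omega>) - avg (rank_tuples n) (kernel_trace n (p n) (z - 1)))
        + avg (rank_tuples n) (kernel_trace n (p n) (z - 1))) \<longlonglongrightarrow> 0 + 0 + m"
      by (intro tendsto_add elim(2) mean)
    then show ?case by (simp add: m_def)
  qed
qed

lemma esd_weak_limit:
  "AE \<omega> in M. weak_conv_m (\<lambda>n. esd (sym_chatterjee_matrix n (p n) (\<lambda>i j. X n i j \<omega>)))
    (semicircle 1 (2 * sqrt (\<gamma> / 5)))"
proof -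
  let ?\<nu> = "semicircle 1 (2 * sqrt (\<gamma> / 5))"
  define D where "D = {z. Re z \<in> \<rat> \<and> Im z \<in> \<rat> \<and> Im z > 0}"
  have "D \<subseteq> (\<lambda>(a, b). Complex a b) ` (\<rat> \<times> \<rat>)"
  proof
    fix z assume "z \<in> D"
    then show "z \<in> (\<lambda>(a, b). Complex a b) ` (\<rat> \<times> \<rat>)"
      by (intro image_eqI[of _ _ "(Re z, Im z)"]) (auto simp: D_def)
  qed
  then have "countable D" by (rule countable_subset) (intro countable_image countable_SIGMA countable_rat)
  then have "AE \<omega> in M. \<forall>z\<in>D. (\<lambda>n. LINT t|esd (sym_chatterjee_matrix n (p n) (\<lambda>i j. X n i j \<omega>)). 1 / (of_real t - z))
      \<longlonglongrightarrow> (LINT t|?\<nu>. 1 / (of_real t - z))"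
    by (subst AE_ball_countable) (auto simp: D_def intro!: stieltjes_tendsto)
  then show ?thesis
  proof eventually_elim
    case (elim \<omega>)
    define \<mu> where "\<mu> = (\<lambda>n. esd (sym_chatterjee_matrix n (p n) (\<lambda>i j. X n i j \<omega>)))"
    \<comment> \<open>For small \<open>n\<close> the dimension may be 0, and then \<open>esd\<close>
      is not a probability measure. Such terms are replaced by the limit law, which changes only
      finitely many of them.\<close>
    define \<mu>' where "\<mu>' = (\<lambda>n. if p n \<ge> 1 then \<mu> n else ?\<nu>)"
    have ev: "eventually (\<lambda>n. \<mu>' n = \<mu> n) sequentially"
      using eventually_dimension by eventually_elim (simp add: \<mu>'_def)
    interpret cauchy_convergence \<mu>' ?\<nu>
    proof (rule cauchy_convergence.intro)
      show "real_distribution ?\<nu>" using \<gamma> by (intro real_distribution_semicircle) simp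
      then show "real_distribution (\<mu>' n)" for n
        unfolding \<mu>'_def \<mu>_def using real_distribution_esd[OF sym_chatterjee_carrier] by simp
      fix z assume "Re z \<in> \<rat>" "Im z \<in> \<rat>" "Im z > 0"
      then have "(\<lambda>n. LINT t|\<mu> n. 1 / (of_real t - z)) \<longlonglongrightarrow> (LINT t|?\<nu>. 1 / (of_real t - z))"
        using elim by (simp add: D_def \<mu>_def)
      then show "(\<lambda>n. LINT t|\<mu>' n. 1 / (of_real t - z)) \<longlonglongrightarrow> (LINT t|?\<nu>. 1 / (of_real t - z))"
        by (rule Lim_transform_eventually) (use ev in eventually_elim, simp)
    qed
    show ?case
      unfolding weak_conv_m_def weak_conv_def \<mu>_def[symmetric]
    proof (intro allI impI)
      fix x assume "isCont (cdf ?\<nu>) x"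
      then have "(\<lambda>n. cdf (\<mu>' n) x) \<longlonglongrightarrow> cdf ?\<nu> x"
        using weak_convergence unfolding weak_conv_m_def weak_conv_def by blast
      then show "(\<lambda>n. cdf (\<mu> n) x) \<longlonglongrightarrow> cdf ?\<nu> x"
        by (rule Lim_transform_eventually) (use ev in eventually_elim, simp)
    qed
  qed
qed

end

theorem theorem1p1:
  fixes M :: "'a measure" and N :: "nat \<Rightarrow> 'b measure"
    and X :: "nat \<Rightarrow> nat \<Rightarrow> nat \<Rightarrow> 'a \<Rightarrow> real"
    and Y :: "nat \<Rightarrow> nat \<Rightarrow> 'b \<Rightarrow> real"
    and p :: "nat \<Rightarrow> nat" and \<gamma> :: real
  assumes "prob_space M"
    and "\<gamma> > 0" and "(\<lambda>n. real (p n) / real n) \<longlonglongrightarrow> \<gamma>"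
    and population_space: "\<And>n. n \<ge> 1 \<Longrightarrow> prob_space (N n)"
    and components_indep:
      "\<And>n. n \<ge> 1 \<Longrightarrow> prob_space.indep_vars (N n) (\<lambda>_. borel) (Y n) {1..p n}"
    and components_continuous:
      "\<And>n j. n \<ge> 1 \<Longrightarrow> j \<in> {1..p n} \<Longrightarrow>
        continuous_on UNIV (cdf (distr (N n) borel (Y n j)))"
    and sample_indep:
      "\<And>n. n \<ge> 1 \<Longrightarrow>
        prob_space.indep_vars M (\<lambda>_. PiM {1..p n} (\<lambda>_. borel))
          (\<lambda>i \<omega>. \<lambda>j\<in>{1..p n}. X n i j \<omega>) {1..n}"
    and sample_copies:
      "\<And>n i. n \<ge> 1 \<Longrightarrow> i \<in> {1..n} \<Longrightarrow>
        distr M (PiM {1..p n} (\<lambda>_. borel)) (\<lambda>\<omega>. \<lambda>j\<in>{1..p n}. X n i j \<omega>) =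
        distr (N n) (PiM {1..p n} (\<lambda>_. borel)) (\<lambda>\<omega>. \<lambda>j\<in>{1..p n}. Y n j \<omega>)"
  shows "AE \<omega> in M.
    weak_conv_m (\<lambda>n. esd (sym_chatterjee_matrix n (p n) (\<lambda>i j. X n i j \<omega>)))
      (semicircle 1 (2 * sqrt (\<gamma> / 5)))"
proof -
  interpret prob_space M by fact
  have sample: "ranked_sample M n (p n) (X n) (N n) (Y n)" if "n \<ge> 1" for n
    unfolding ranked_sample_def ranked_sample_axioms_def
    using assms(1) population_space[OF that] components_indep[OF that] components_continuous[OF that]
      sample_indep[OF that] sample_copies[OF that] that by blast
  interpret chatterjee_samples M p X N Y \<gamma>
    by (intro chatterjee_samples.intro chatterjee_samples_axioms.intro sample assms(1-3))
  show ?thesis by (rule esd_weak_limit)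
qed

end
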